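(* There exist $\gamma>0$ and $K>0$ such that for every family of constants $(C_\alpha)_{\alpha\in\mathbb{Z}_{\ge0}^2}$ there is a constant $C>0$ with the following property. Let $\lambda\ge1$, $R\ge1$, $A\ge1$, and let $r$ be a smooth function on $\mathbb{R}^2$ with $\operatorname{supp} r\subseteq[0,1]^2$, such that every $t=(t_1,t_2)\in\operatorname{supp} r$ satisfies $|t_1|>A^{-1}$, $|t_2|>A^{-1}$, $|t_1-t_2|>A^{-1}$ and $$\left|\det\begin{bmatrix}2t_1-\frac1R&2t_2\\ 3t_1^2&3t_2^2-\frac1{R^2}\end{bmatrix}\right|=\Big|6t_1t_2^2-6t_1^2t_2-\frac{3t_2^2}{R}-\frac{2t_1}{R^2}+\frac1{R^3}\Big|\ge A^{-1},$$ and such that $\|\partial^\alpha r\|_\infty\le C_\alpha A^{|\alpha|}$ for all $\alpha\in\mathbb{Z}_{\ge0}^2$. Then for all $f_1\in L^2(\mathbb{R}^2)$ and every $f_2\in L^2(\mathbb{R}^2)$ with $\operatorname{supp}\widehat{f_2}\subset B(0,2\lambda)\setminus B(0,\lambda)$, $$\|T(f_1,f_2)\|_{L^1([0,1]^2)}\le C A^K\lambda^{-\gamma}\|f_1\|_{L^2(\mathbb{R}^2)}\|f_2\|_{L^2(\mathbb{R}^2)} .$$ In particular $C$ is independent of $R\ge1$.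
   Context: For $t=(t_1,t_2)\in\mathbb{R}^2$: $P(t)=(t_1^2+t_2^2,\;t_1^3+t_2^3)$ and $B_Rt=\big(\tfrac{t_1}{R},\tfrac{t_2}{R^2}\big)$. The operator is $$T(f_1,f_2)(x)=\int_{\mathbb{R}^2}f_1(x+B_Rt)\,f_2(x+P(t))\,r(t)\,dt .$$ $B(a,\rho)$ is the ball with center $a$ and radius $\rho$; $\widehat{f}$ is the Fourier transform. *)

theory Defs
  imports "HOL-Analysis.Analysis"
begin

definition dirderiv :: "'a::euclidean_space \<Rightarrow> ('a \<Rightarrow> complex) \<Rightarrow> 'a \<Rightarrow> complex" where
  "dirderiv b g = (\<lambda>x. frechet_derivative g (at x) b)"

primrec C_k :: "nat \<Rightarrow> ('a::euclidean_space \<Rightarrow> complex) \<Rightarrow> bool" where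
  "C_k 0 g \<longleftrightarrow> continuous_on UNIV g"
| "C_k (Suc k) g \<longleftrightarrow> (\<forall>x. g differentiable at x) \<and> (\<forall>b\<in>Basis. C_k k (dirderiv b g))"

definition smooth :: "('a::euclidean_space \<Rightarrow> complex) \<Rightarrow> bool" where
  "smooth g \<longleftrightarrow> (\<forall>k. C_k k g)"

definition multideriv :: "nat \<times> nat \<Rightarrow> (real \<times> real \<Rightarrow> complex) \<Rightarrow> real \<times> real \<Rightarrow> complex" where
  "multideriv \<alpha> g = (dirderiv (1, 0) ^^ fst \<alpha>) ((dirderiv (0, 1) ^^ snd \<alpha>) g)"

definition support :: "('a::topological_space \<Rightarrow> complex) \<Rightarrow> 'a set" where
  "support g = closure {x. g x \<noteq> 0}"

text \<open>For functions determined only up to null sets, the support is the complement of the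
  largest open set on which the function vanishes almost everywhere.\<close>

definition ess_support :: "('a::euclidean_space \<Rightarrow> complex) \<Rightarrow> 'a set" where
  "ess_support g = - \<Union>{U. open U \<and> (AE x in lborel. x \<in> U \<longrightarrow> g x = 0)}"

text \<open>Elements of the space \<open>L\<^sup>2\<close> are represented by Borel measurable functions.\<close>

definition in_L2 :: "('a::euclidean_space \<Rightarrow> complex) \<Rightarrow> bool" where
  "in_L2 f \<longleftrightarrow> f \<in> borel_measurable lborel \<and> integrable lborel (\<lambda>x. (cmod (f x))\<^sup>2)"

definition norm_L2 :: "('a::euclidean_space \<Rightarrow> complex) \<Rightarrow> real" where
  "norm_L2 f = sqrt (LINT x|lborel. (cmod (f x))\<^sup>2)"

definition fourier_integral :: "('a::euclidean_space \<Rightarrow> complex) \<Rightarrow> 'a \<Rightarrow> complex" where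
  "fourier_integral f \<xi> = (LINT x|lborel. f x * cis (- 2 * pi * (x \<bullet> \<xi>)))"

text \<open>The Fourier(--Plancherel) transform on \<open>L\<^sup>2\<close>: \<open>g\<close> is the \<open>L\<^sup>2\<close> limit of the Fourier
  integrals of the truncations of \<open>f\<close> to balls. It exists for each \<open>f\<close> in \<open>L\<^sup>2\<close> and is unique up
  to null sets. The squared distance is taken in \<open>ennreal\<close>, so convergence to 0 does not rely on
  the convention that non-integrable functions have integral 0.\<close>

definition has_fourier_transform ::
    "('a::euclidean_space \<Rightarrow> complex) \<Rightarrow> ('a \<Rightarrow> complex) \<Rightarrow> bool"
    (infix "has'_fourier'_transform" 50) where
  "f has_fourier_transform g \<longleftrightarrow> in_L2 f \<and> in_L2 g \<and>
     (\<lambda>n::nat. \<integral>\<^sup>+ \<xi>. ennreal ((cmod (fourier_integral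
        (\<lambda>x. indicator (ball 0 (real n)) x * f x) \<xi> - g \<xi>))\<^sup>2) \<partial>lborel) \<longlonglongrightarrow> 0"

definition P :: "real \<times> real \<Rightarrow> real \<times> real" where
  "P t = (fst t ^ 2 + snd t ^ 2, fst t ^ 3 + snd t ^ 3)"

definition dil :: "real \<Rightarrow> real \<times> real \<Rightarrow> real \<times> real" where
  "dil R t = (fst t / R, snd t / R ^ 2)"

definition T :: "real \<Rightarrow> (real \<times> real \<Rightarrow> complex) \<Rightarrow> (real \<times> real \<Rightarrow> complex) \<Rightarrow>
    (real \<times> real \<Rightarrow> complex) \<Rightarrow> real \<times> real \<Rightarrow> complex" where
  "T R r f\<^sub>1 f\<^sub>2 x = (LINT t|lborel. f\<^sub>1 (x + dil R t) * f\<^sub>2 (x + P t) * r t)"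

text \<open>The Jacobian determinant of \<open>t \<mapsto> P t - dil R t\<close>.\<close>

definition jac :: "real \<Rightarrow> real \<times> real \<Rightarrow> real" where
  "jac R t = det (vector [vector [2 * fst t - 1 / R, 2 * snd t],
                          vector [3 * fst t ^ 2, 3 * snd t ^ 2 - 1 / R ^ 2]] :: real^2^2)"

lemma jac_eq:
  "jac R (t\<^sub>1, t\<^sub>2) =
     6 * t\<^sub>1 * t\<^sub>2 ^ 2 - 6 * t\<^sub>1 ^ 2 * t\<^sub>2 - 3 * t\<^sub>2 ^ 2 / R - 2 * t\<^sub>1 / R ^ 2 + 1 / R ^ 3"
  by (simp add: jac_def det_2 algebra_simps power2_eq_square power3_eq_cube)

end

theory Submission
  imports Defs "HOL-Probability.Probability" "HOL-Computational_Algebra.Fundamental_Theorem_Algebra"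
begin

text \<open>Write \<open>\<rho> = 1/R\<close>, \<open>B = Bd \<rho>\<close>, \<open>\<phi> = P - B\<close> and split \<open>f\<^sub>2\<close>, truncated at height \<open>N\<close>, by a
  Gaussian mean at scale \<open>\<lambda>\<^sup>-\<^sup>1\<^sup>/\<^sup>2\<close>: \<open>f\<^sub>2 = h + e + g * f\<^sub>2\<close> with \<open>h = u - g * u\<close>, \<open>e = w - g * w\<close>,
  where \<open>u\<close> is the bounded part and \<open>w\<close> the large part of \<open>f\<^sub>2\<close>. The term \<open>g * f\<^sub>2\<close> is exponentially
  small, since the spectrum of \<open>f\<^sub>2\<close> avoids the ball of radius \<open>\<lambda>\<close>. The term \<open>e\<close> is small in \<open>L\<^sup>1\<close> and
  is handled by the change of variables \<open>t \<mapsto> \<phi> t\<close>, which is where the Jacobian condition enters.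

  For \<open>h\<close>, substitute \<open>x = z + B y\<close>, \<open>s = y + t\<close> and apply Cauchy--Schwarz twice. This bounds
  the norm by the fourth root of a quadrilinear form in \<open>h\<close>, evaluated at four points depending on
  \<open>z, \<sigma>, s, y, y'\<close>. With the point of the second slot and \<open>\<sigma>\<close> fixed, there is a polynomial vector
  field in \<open>(s, y, y')\<close> that leaves the third and fourth points fixed and moves the first with
  velocity \<open>D e\<close>, for any prescribed \<open>e\<close> and a polynomial \<open>D\<close>. Where \<open>D\<close> is not small, integration by
  parts along this field controls increments in the first slot, and \<open>h = u - g * u\<close> is a Gaussian
  average of such increments. The set where \<open>D\<close> is small is negligible: along a suitable direction \<open>D\<close> has
  degree 15 and a leading coefficient that depends on no parameter, in particular not on \<open>R\<close>.\<close>

section \<open>Gaussian means and the Fourier transform\<close>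

text \<open>The four-point argument needs bounded functions, while \<open>f\<^sub>2\<close> is only
  in \<open>L\<^sup>2\<close>; hence the truncation height \<open>N\<close>. Let \<open>F\<close>
  bound the norm of \<open>f\<^sub>2\<close> and w = \<lambda>^(-1/1920). The bounded part costs a
  factor \<open>N\<close>, the large part has \<open>L\<^sup>1\<close> norm at most F^2/N, and N =
  F/w balances the two. With Gaussian parameter s = 1/\<lambda> and the level eps = \<lambda>^(-1/8)
  for \<open>D\<close>, the form is at most a constant times N^4 (sqrt s / eps^2 + eps^(1/30)), of
  order N^4 w^8; its fourth root N w^2 = w F is the final rate. The exponent 1/30 comes from the
  degree 15 of \<open>D\<close>. The power A^4 stems from the change of variables: about A^2 cells
  on which \<phi> is injective, and the square of a Lipschitz constant of order A of the inverse on
  each. Uniformity in \<open>R\<close> rests on compactness: all matrices are polynomial in \<rho>,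
  so \<rho> may range over [0,1], the limit 0 included, and constants are maxima over compact sets.
  The zero set of \<open>D\<close> moves with \<rho>, so small values of \<open>D\<close> are
  controlled through a leading coefficient instead of a lower bound.\<close>

lemma cis_borel_measurable [measurable]: "cis \<in> borel_measurable borel"
  unfolding cis_conv_exp by (intro borel_measurable_continuous_onI continuous_intros)

lemma cnj_borel_measurable [measurable]: "cnj \<in> borel_measurable borel"
  by (intro borel_measurable_continuous_onI continuous_intros)

lemma lborel_integral_prod_mult:
  fixes f :: "'a::euclidean_space \<Rightarrow> complex" and g :: "'b::euclidean_space \<Rightarrow> complex"
  assumes f: "integrable lborel f" and g: "integrable lborel g"
  shows "integrable lborel (\<lambda>p. f (fst p) * g (snd p))"
    and "(LINT p|lborel. f (fst p) * g (snd p)) = (LINT x|lborel. f x) * (LINT y|lborel. g y)"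
proof -
  have [measurable]: "f \<in> borel_measurable borel" "g \<in> borel_measurable borel"
    using f g by (auto dest: borel_measurable_integrable)
  have i: "integrable (lborel \<Otimes>\<^sub>M lborel) (\<lambda>p. f (fst p) * g (snd p))"
  proof (rule lborel_pair.Fubini_integrable)
    show "(\<lambda>p. f (fst p) * g (snd p)) \<in> borel_measurable (lborel \<Otimes>\<^sub>M lborel)" by simp
    show "integrable lborel (\<lambda>x. LINT y|lborel. norm (f (fst (x, y)) * g (snd (x, y))))"
      using f by (simp add: norm_mult)
    show "AE x in lborel. integrable lborel (\<lambda>y. f (fst (x, y)) * g (snd (x, y)))"
      using g by simp
  qed
  then show "integrable lborel (\<lambda>p. f (fst p) * g (snd p))" by (simp add: lborel_prod)
  from lborel_pair.integral_fst'[OF i]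
  show "(LINT p|lborel. f (fst p) * g (snd p)) = (LINT x|lborel. f x) * (LINT y|lborel. g y)"
    by (simp add: lborel_prod)
qed

text \<open>The characteristic function of the standard normal law is known. The substitution
  \<open>u = c * \<xi>\<close> with \<open>c\<^sup>2 = 2 * pi * s\<close> carries its density to the
  Gaussian factor, and \<open>t\<close> is chosen so that the frequency becomes
  \<open>x\<close>.\<close>

lemma gaussian_fourier_real:
  fixes s x :: real
  assumes s: "s > 0"
  shows "integrable lborel (\<lambda>\<xi>::real. complex_of_real (exp (- pi * s * \<xi>\<^sup>2)) * cis (2 * pi * x * \<xi>))"
    and "(LINT \<xi>|lborel. complex_of_real (exp (- pi * s * \<xi>\<^sup>2)) * cis (2 * pi * x * \<xi>))
       = of_real (exp (- pi * x\<^sup>2 / s) / sqrt s)"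
proof -
  define c where "c = sqrt (2 * pi * s)"
  define t where "t = 2 * pi * x / c"
  have c: "c > 0" "c\<^sup>2 = 2 * pi * s" using s by (auto simp: c_def)
  have i0: "integrable lborel (\<lambda>u. std_normal_density u *\<^sub>R iexp (t * u))"
    by (rule Bochner_Integration.integrable_bound[OF integrable_normal_density[of 1 0]]) auto
  have "char std_normal_distribution t = (LINT u|lborel. std_normal_density u *\<^sub>R iexp (t * u))"
    unfolding char_def by (subst integral_density) (auto simp: normal_density_nonneg)
  then have 1: "(LINT u|lborel. std_normal_density u *\<^sub>R iexp (t * u)) = of_real (exp (- (t\<^sup>2) / 2))"
    by (simp add: char_std_normal_distribution)
  have dens: "std_normal_density (0 + c * \<xi>) *\<^sub>R iexp (t * (0 + c * \<xi>))
    = (1 / sqrt (2 * pi)) *\<^sub>R (complex_of_real (exp (- pi * s * \<xi>\<^sup>2)) * cis (2 * pi * x * \<xi>))" for \<xi>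
  proof -
    have "(c * \<xi>)\<^sup>2 / 2 = pi * s * \<xi>\<^sup>2" using c by (simp add: power_mult_distrib)
    moreover have "iexp (t * (0 + c * \<xi>)) = cis (2 * pi * x * \<xi>)"
    proof -
      have "t * (0 + c * \<xi>) = 2 * pi * x * \<xi>" using c by (simp add: t_def)
      then show ?thesis by (simp only: cis_conv_exp)
    qed
    ultimately show ?thesis
      by (simp add: std_normal_density_def scaleR_conv_of_real del: of_real_mult)
  qed
  have i1: "integrable lborel (\<lambda>\<xi>. (1 / sqrt (2 * pi)) *\<^sub>R (complex_of_real (exp (- pi * s * \<xi>\<^sup>2)) * cis (2 * pi * x * \<xi>)))"
    using lborel_integrable_real_affine[OF i0, of c 0] c unfolding dens by simp
  then show "integrable lborel (\<lambda>\<xi>::real. complex_of_real (exp (- pi * s * \<xi>\<^sup>2)) * cis (2 * pi * x * \<xi>))"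
    using integrable_scaleR_right[of "sqrt (2 * pi)", OF i1] by simp
  have "of_real (exp (- (t\<^sup>2) / 2)) = c *\<^sub>R (1 / sqrt (2 * pi)) *\<^sub>R
      (LINT \<xi>|lborel. complex_of_real (exp (- pi * s * \<xi>\<^sup>2)) * cis (2 * pi * x * \<xi>))"
    using lborel_integral_real_affine[of c "\<lambda>u. std_normal_density u *\<^sub>R iexp (t * u)" 0] c 1
    unfolding dens by simp
  moreover have "c * (1 / sqrt (2 * pi)) = sqrt s" by (simp add: c_def real_sqrt_mult)
  moreover have "t\<^sup>2 / 2 = pi * x\<^sup>2 / s"
    using c s by (simp add: t_def power_divide) (simp add: field_simps power2_eq_square)
  ultimately have "of_real (exp (- pi * x\<^sup>2 / s)) = sqrt s *\<^sub>R
      (LINT \<xi>|lborel. complex_of_real (exp (- pi * s * \<xi>\<^sup>2)) * cis (2 * pi * x * \<xi>))"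
    by simp
  then show "(LINT \<xi>|lborel. complex_of_real (exp (- pi * s * \<xi>\<^sup>2)) * cis (2 * pi * x * \<xi>))
       = of_real (exp (- pi * x\<^sup>2 / s) / sqrt s)"
    using s by (simp add: scaleR_conv_of_real field_simps)
qed

definition gauss :: "real \<Rightarrow> real \<times> real \<Rightarrow> real" where
  "gauss s x = exp (- pi * s * (x \<bullet> x))"

lemma gauss_pos: "gauss s x > 0" by (simp add: gauss_def)
lemma gauss_measurable [measurable]: "gauss s \<in> borel_measurable borel"
  unfolding gauss_def by measurable
lemma gauss_le_1: "s \<ge> 0 \<Longrightarrow> gauss s x \<le> 1" by (simp add: gauss_def)
lemma gauss_minus: "gauss s (- x) = gauss s x" by (simp add: gauss_def)
lemma gauss_diff_commute: "gauss s (x - y) = gauss s (y - x)"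
  by (simp add: gauss_def inner_diff inner_commute)

lemma gauss_fourier:
  assumes s: "s > 0"
  shows "integrable lborel (\<lambda>\<xi>. complex_of_real (gauss s \<xi>) * cis (2 * pi * (x \<bullet> \<xi>)))" (is ?A)
    and "(LINT \<xi>|lborel. complex_of_real (gauss s \<xi>) * cis (2 * pi * (x \<bullet> \<xi>)))
       = of_real (gauss (1 / s) x / s)" (is ?B)
proof -
  have split: "complex_of_real (gauss s \<xi>) * cis (2 * pi * (x \<bullet> \<xi>)) =
     (complex_of_real (exp (- pi * s * (fst \<xi>)\<^sup>2)) * cis (2 * pi * fst x * fst \<xi>)) *
     (complex_of_real (exp (- pi * s * (snd \<xi>)\<^sup>2)) * cis (2 * pi * snd x * snd \<xi>))" for \<xi>
  proof -
    have "gauss s \<xi> = exp (- pi * s * (fst \<xi>)\<^sup>2) * exp (- pi * s * (snd \<xi>)\<^sup>2)"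
      by (simp add: gauss_def inner_prod_def power2_eq_square algebra_simps flip: exp_add)
    moreover have "cis (2 * pi * (x \<bullet> \<xi>)) = cis (2 * pi * fst x * fst \<xi>) * cis (2 * pi * snd x * snd \<xi>)"
      unfolding cis_mult by (simp add: inner_prod_def algebra_simps)
    ultimately show ?thesis by (simp add: mult_ac)
  qed
  note * = lborel_integral_prod_mult[OF gaussian_fourier_real(1)[OF s, of "fst x"] gaussian_fourier_real(1)[OF s, of "snd x"]]
  show ?A using *(1) by (subst split)
  have "exp (- pi * (fst x)\<^sup>2 / s) / sqrt s * (exp (- pi * (snd x)\<^sup>2 / s) / sqrt s) = gauss (1 / s) x / s"
  proof -
    have "gauss (1 / s) x = exp (- pi * (fst x)\<^sup>2 / s) * exp (- pi * (snd x)\<^sup>2 / s)"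
      unfolding exp_add [symmetric]
      by (simp add: gauss_def inner_prod_def power2_eq_square ring_distribs add_divide_distrib diff_divide_distrib)
    then show ?thesis using s by (simp add: power2_eq_square [symmetric])
  qed
  with *(2) show ?B
    by (subst split) (simp only: gaussian_fourier_real(2)[OF s] flip: of_real_mult)
qed

lemma gauss_integrable: "s > 0 \<Longrightarrow> integrable lborel (gauss s)"
  and gauss_integral: "s > 0 \<Longrightarrow> (LINT x|lborel. gauss s x) = 1 / s"
proof -
  assume s: "s > 0"
  have 1: "integrable lborel (\<lambda>x. complex_of_real (gauss s x))" using gauss_fourier(1)[OF s, of 0] by simp
  then show "integrable lborel (gauss s)" by (simp add: complex_of_real_integrable_eq)
  have "complex_of_real (LINT x|lborel. gauss s x) = of_real (1 / s)"
    using gauss_fourier(2)[OF s, of 0] by (simp add: gauss_def)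
  then show "(LINT x|lborel. gauss s x) = 1 / s" by (simp only: of_real_eq_iff)
qed

section \<open>Translations and reflections of Lebesgue integrals\<close>

lemma nn_integral_lborel_shift:
  fixes f :: "'a::euclidean_space \<Rightarrow> ennreal"
  assumes [measurable]: "f \<in> borel_measurable borel"
  shows "(\<integral>\<^sup>+ x. f (c + x) \<partial>lborel) = (\<integral>\<^sup>+ x. f x \<partial>lborel)"
  by (subst (2) lborel_distr_plus[symmetric, of c]) (simp add: nn_integral_distr)

lemma nn_integral_lborel_reflect:
  fixes f :: "'a::euclidean_space \<Rightarrow> ennreal"
  assumes [measurable]: "f \<in> borel_measurable borel"
  shows "(\<integral>\<^sup>+ x. f (c - x) \<partial>lborel) = (\<integral>\<^sup>+ x. f x \<partial>lborel)"
  by (subst (2) lborel_affine[of "-1" c]) (simp_all add: nn_integral_density nn_integral_distr)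

lemma lborel_integral_shift:
  fixes f :: "'a::euclidean_space \<Rightarrow> 'b::{banach,second_countable_topology}"
  assumes [measurable]: "f \<in> borel_measurable borel"
  shows "(LINT x|lborel. f (c + x)) = (LINT x|lborel. f x)"
  by (subst (2) lborel_distr_plus[symmetric, of c]) (simp add: integral_distr)

lemma lborel_integrable_reflect:
  fixes f :: "'a::euclidean_space \<Rightarrow> 'b::{banach,second_countable_topology}"
  assumes f: "integrable lborel f"
  shows "integrable lborel (\<lambda>x. f (c - x))"
proof -
  have [measurable]: "f \<in> borel_measurable borel" using borel_measurable_integrable[OF f] by simp
  show ?thesis using f nn_integral_lborel_reflect[of "\<lambda>x. ennreal (norm (f x))" c]
    by (simp add: integrable_iff_bounded)
qed

lemma lborel_integral_reflect:
  fixes f :: "'a::euclidean_space \<Rightarrow> 'b::{banach,second_countable_topology}"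
  assumes [measurable]: "f \<in> borel_measurable borel"
  shows "(LINT x|lborel. f (c - x)) = (LINT x|lborel. f x)"
  by (subst (2) lborel_affine[of "-1" c]) (simp_all add: integral_density integral_distr density_1)

text \<open>True without integrability: the Bochner integral of a non-integrable function is 0 by
  convention. This lets later estimates bound a Bochner integral before anything is known about its
  convergence.\<close>

lemma norm_integral_le_nn_integral:
  fixes f :: "'a \<Rightarrow> 'b::{banach,second_countable_topology}"
  shows "ennreal (norm (integral\<^sup>L M f)) \<le> (\<integral>\<^sup>+ x. ennreal (norm (f x)) \<partial>M)"
proof (cases "integrable M f")
  case True
  then show ?thesis by (rule integral_norm_bound_ennreal)
qed (simp add: not_integrable_integral_eq)

lemma fourier_integral_measurable [measurable]:
  fixes f :: "real \<times> real \<Rightarrow> complex"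
  assumes [measurable]: "f \<in> borel_measurable borel"
  shows "fourier_integral f \<in> borel_measurable borel"
proof -
  have "(\<lambda>(\<xi>, x). f x * cis (- 2 * pi * (x \<bullet> \<xi>))) \<in> borel_measurable (borel \<Otimes>\<^sub>M lborel)"
    unfolding split_beta by simp
  from lborel.borel_measurable_lebesgue_integral[OF this]
  show ?thesis unfolding fourier_integral_def by simp
qed

lemma fourier_integral_bound:
  assumes "integrable lborel f"
  shows "cmod (fourier_integral f \<xi>) \<le> (LINT x|lborel. cmod (f x))"
  unfolding fourier_integral_def
  by (rule order_trans[OF integral_norm_bound]) (simp add: norm_mult)

text \<open>This is the inverse Fourier transform of \<open>gauss s\<close>: a probability density
  concentrated at scale \<open>sqrt s\<close>. On the Fourier side, convolution with it is
  multiplication by \<open>gauss s\<close>.\<close>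

definition gker :: "real \<Rightarrow> real \<times> real \<Rightarrow> real" where
  "gker s w = gauss (1 / s) w / s"

definition gconv :: "real \<Rightarrow> (real \<times> real \<Rightarrow> complex) \<Rightarrow> real \<times> real \<Rightarrow> complex" where
  "gconv s f x = (LINT y|lborel. of_real (gker s (x - y)) * f y)"

lemma gker_measurable [measurable]: "gker s \<in> borel_measurable borel"
  unfolding gker_def by measurable

lemma gker_pos: "s > 0 \<Longrightarrow> gker s w > 0"
  by (simp add: gker_def gauss_pos)

lemma gker_le: "s > 0 \<Longrightarrow> gker s w \<le> 1 / s"
  by (simp add: gker_def gauss_le_1 divide_right_mono)

lemma gker_diff_commute: "gker s (x - y) = gker s (y - x)"
  unfolding gker_def by (simp add: gauss_diff_commute)

lemma gker_integrable: "s > 0 \<Longrightarrow> integrable lborel (gker s)"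
  and gker_integral: "s > 0 \<Longrightarrow> (LINT w|lborel. gker s w) = 1"
  unfolding gker_def using gauss_integrable[of "1 / s"] gauss_integral[of "1 / s"] by auto

lemma gker_nn_integral: "s > 0 \<Longrightarrow> (\<integral>\<^sup>+ w. ennreal (gker s w) \<partial>lborel) = 1"
  using gker_integrable[of s] gker_integral[of s] less_imp_le[OF gker_pos[of s]]
  by (subst nn_integral_eq_integral) simp_all

lemma gconv_measurable [measurable]:
  assumes [measurable]: "f \<in> borel_measurable borel"
  shows "gconv s f \<in> borel_measurable borel"
proof -
  have "(\<lambda>(x, y). of_real (gker s (x - y)) * f y) \<in> borel_measurable (borel \<Otimes>\<^sub>M lborel)"
    unfolding split_beta by simp
  from lborel.borel_measurable_lebesgue_integral[OF this]
  show ?thesis unfolding gconv_def by simp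
qed

text \<open>Fubini alone: the Gaussian factor makes the double integral over \<open>\<xi>\<close>
  and \<open>y\<close> absolutely convergent, and the integral over \<open>\<xi>\<close> is the
  Fourier transform of a Gaussian. No inversion theorem is involved.\<close>

lemma gconv_eq_fourier:
  assumes f: "integrable lborel f" and s: "s > 0"
  shows "integrable lborel (\<lambda>\<xi>. of_real (gauss s \<xi>) * cis (2 * pi * (x \<bullet> \<xi>)) * fourier_integral f \<xi>)"
    and "gconv s f x = (LINT \<xi>|lborel. of_real (gauss s \<xi>) * cis (2 * pi * (x \<bullet> \<xi>)) * fourier_integral f \<xi>)"
proof -
  have [measurable]: "f \<in> borel_measurable borel" using borel_measurable_integrable[OF f] by simp
  let ?h = "\<lambda>(\<xi>, y). (of_real (gauss s \<xi>) * cis (2 * pi * (x \<bullet> \<xi>))) * (f y * cis (- 2 * pi * (y \<bullet> \<xi>)))"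
  have g: "integrable lborel (\<lambda>\<xi>. complex_of_real (gauss s \<xi>))"
    using gauss_integrable[OF s] by simp
  have int: "integrable (lborel \<Otimes>\<^sub>M lborel) ?h"
  proof (rule Bochner_Integration.integrable_bound)
    show "integrable (lborel \<Otimes>\<^sub>M lborel) (\<lambda>p. complex_of_real (gauss s (fst p)) * f (snd p))"
      using lborel_integral_prod_mult(1)[OF g f] by (simp add: lborel_prod)
    show "?h \<in> borel_measurable (lborel \<Otimes>\<^sub>M lborel)" unfolding split_beta by simp
  qed (auto simp: norm_mult)
  have inner: "(LINT y|lborel. ?h (\<xi>, y)) = of_real (gauss s \<xi>) * cis (2 * pi * (x \<bullet> \<xi>)) * fourier_integral f \<xi>" for \<xi>
    by (simp add: fourier_integral_def mult.assoc)
  show "integrable lborel (\<lambda>\<xi>. of_real (gauss s \<xi>) * cis (2 * pi * (x \<bullet> \<xi>)) * fourier_integral f \<xi>)"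
    using lborel_pair.integrable_fst'[OF int] by (simp only: inner)
  have "(LINT \<xi>|lborel. ?h (\<xi>, y)) = of_real (gker s (x - y)) * f y" for y
  proof -
    have "?h (\<xi>, y) = f y * (of_real (gauss s \<xi>) * cis (2 * pi * ((x - y) \<bullet> \<xi>)))" for \<xi>
    proof -
      have *: "cis (2 * pi * (x \<bullet> \<xi>)) * cis (- 2 * pi * (y \<bullet> \<xi>)) = cis (2 * pi * ((x - y) \<bullet> \<xi>))"
        unfolding cis_mult by (simp add: inner_diff_left algebra_simps)
      then show ?thesis by (simp only: case_prod_conv mult_ac flip: *)
    qed
    then have "(LINT \<xi>|lborel. ?h (\<xi>, y)) = f y * (LINT \<xi>|lborel. of_real (gauss s \<xi>) * cis (2 * pi * ((x - y) \<bullet> \<xi>)))"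
      by (simp only: integral_mult_right_zero)
    then show ?thesis
      unfolding gauss_fourier(2)[OF s, of "x - y"] by (simp add: gker_def)
  qed
  then have "gconv s f x = (LINT y|lborel. LINT \<xi>|lborel. ?h (\<xi>, y))"
    by (simp add: gconv_def)
  also have "\<dots> = (LINT \<xi>|lborel. LINT y|lborel. ?h (\<xi>, y))"
    using lborel_pair.Fubini_integral[of "\<lambda>\<xi> y. ?h (\<xi>, y)"] int by simp
  finally show "gconv s f x = (LINT \<xi>|lborel. of_real (gauss s \<xi>) * cis (2 * pi * (x \<bullet> \<xi>)) * fourier_integral f \<xi>)"
    by (simp only: inner)
qed

text \<open>Schur's test for a symmetric kernel of mass 1 in each variable: 2ab \<le> a^2 + b^2
  splits the form into two pieces, each equal to the right-hand side.\<close>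

lemma nn_integral_gker_quadratic:
  fixes f :: "real \<times> real \<Rightarrow> complex"
  assumes [measurable]: "f \<in> borel_measurable borel" and s: "s > 0"
  shows "(\<integral>\<^sup>+ x. \<integral>\<^sup>+ y. ennreal (cmod (f x) * (gker s (x - y) * cmod (f y))) \<partial>lborel \<partial>lborel)
    \<le> (\<integral>\<^sup>+ x. ennreal ((cmod (f x))\<^sup>2) \<partial>lborel)"
proof -
  define Q where "Q = (\<integral>\<^sup>+ x. ennreal ((cmod (f x))\<^sup>2) \<partial>lborel)"
  have sh: "(\<integral>\<^sup>+ y. ennreal (gker s (x - y)) \<partial>lborel) = 1" for x
    using nn_integral_lborel_reflect[of "\<lambda>w. ennreal (gker s w)" x] gker_nn_integral[OF s] by simp
  have 1: "(\<integral>\<^sup>+ x. \<integral>\<^sup>+ y. ennreal ((cmod (f x))\<^sup>2) * ennreal (gker s (x - y)) \<partial>lborel \<partial>lborel) = Q"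
    by (simp add: nn_integral_cmult sh Q_def)
  have 2: "(\<integral>\<^sup>+ x. \<integral>\<^sup>+ y. ennreal ((cmod (f y))\<^sup>2) * ennreal (gker s (x - y)) \<partial>lborel \<partial>lborel) = Q"
    by (subst lborel_pair.Fubini') (simp_all add: nn_integral_cmult gker_diff_commute[of s] sh Q_def)
  have *: "2 * ennreal (cmod (f x) * (gker s (x - y) * cmod (f y)))
    \<le> ennreal ((cmod (f x))\<^sup>2) * ennreal (gker s (x - y)) + ennreal ((cmod (f y))\<^sup>2) * ennreal (gker s (x - y))" for x y
  proof -
    have "2 * (cmod (f x) * (gker s (x - y) * cmod (f y))) =  gker s (x - y) * (2 * cmod (f x) * cmod (f y))" by simp
    also have "\<dots> \<le> gker s (x - y) * ((cmod (f x))\<^sup>2 + (cmod (f y))\<^sup>2)"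
      using sum_squares_bound[of "cmod (f x)" "cmod (f y)"] gker_pos[OF s, of "x - y"]
      by (intro mult_left_mono) auto
    finally have *: "2 * (cmod (f x) * (gker s (x - y) * cmod (f y))) \<le> (cmod (f x))\<^sup>2 * gker s (x - y) + (cmod (f y))\<^sup>2 * gker s (x - y)"
      by (simp add: algebra_simps)
    have g: "0 \<le> gker s (x - y)" by (rule less_imp_le[OF gker_pos[OF s]])
    have "2 * ennreal (cmod (f x) * (gker s (x - y) * cmod (f y))) = ennreal (2 * (cmod (f x) * (gker s (x - y) * cmod (f y))))"
      using g by (subst ennreal_mult) auto
    also have "\<dots> \<le> ennreal ((cmod (f x))\<^sup>2 * gker s (x - y) + (cmod (f y))\<^sup>2 * gker s (x - y))"
      by (rule ennreal_leI) fact
    also have "\<dots> = ennreal ((cmod (f x))\<^sup>2) * ennreal (gker s (x - y)) + ennreal ((cmod (f y))\<^sup>2) * ennreal (gker s (x - y))"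
      using g by (simp add: ennreal_mult)
    finally show ?thesis .
  qed
  have "2 * (\<integral>\<^sup>+ x. \<integral>\<^sup>+ y. ennreal (cmod (f x) * (gker s (x - y) * cmod (f y))) \<partial>lborel \<partial>lborel) =
    (\<integral>\<^sup>+ x. \<integral>\<^sup>+ y. 2 * ennreal (cmod (f x) * (gker s (x - y) * cmod (f y))) \<partial>lborel \<partial>lborel)"
    by (simp add: nn_integral_cmult)
  also have "(\<integral>\<^sup>+ x. \<integral>\<^sup>+ y. 2 * ennreal (cmod (f x) * (gker s (x - y) * cmod (f y))) \<partial>lborel \<partial>lborel) \<le> 
    (\<integral>\<^sup>+ x. \<integral>\<^sup>+ y. ennreal ((cmod (f x))\<^sup>2) * ennreal (gker s (x - y)) + ennreal ((cmod (f y))\<^sup>2) * ennreal (gker s (x - y)) \<partial>lborel \<partial>lborel)"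
    by (intro nn_integral_mono *)
  also have "\<dots> = Q + Q" using 1 2 by (simp add: nn_integral_add)
  also have "Q + Q = 2 * Q" by (simp add: mult_2)
  finally show ?thesis unfolding Q_def by (subst (asm) ennreal_mult_le_mult_iff) auto
qed

text \<open>Only this half of the Plancherel theorem is needed. It follows by inserting the Gaussian
  factor \<open>exp (- pi * s * |\<xi>|\<^sup>2)\<close> and letting \<open>s\<close> tend to 0.\<close>

lemma bessel_fourier:
  fixes f :: "real \<times> real \<Rightarrow> complex"
  assumes f: "integrable lborel f"
  shows "(\<integral>\<^sup>+ \<xi>. ennreal ((cmod (fourier_integral f \<xi>))\<^sup>2) \<partial>lborel) \<le> (\<integral>\<^sup>+ x. ennreal ((cmod (f x))\<^sup>2) \<partial>lborel)"
proof -
  have [measurable]: "f \<in> borel_measurable borel" using borel_measurable_integrable[OF f] by simp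
  define Q where "Q = (\<integral>\<^sup>+ x. ennreal ((cmod (f x))\<^sup>2) \<partial>lborel)"
  define L where "L = (LINT x|lborel. cmod (f x))"
  have L: "cmod (fourier_integral f \<xi>) \<le> L" for \<xi>
    using fourier_integral_bound[OF f] by (simp add: L_def)
  have damped: "(\<integral>\<^sup>+ \<xi>. ennreal (gauss s \<xi> * (cmod (fourier_integral f \<xi>))\<^sup>2) \<partial>lborel) \<le> Q" if s: "s > 0" for s
  proof -
    let ?F = "fourier_integral f"
    \<comment> \<open>Only one factor of F * cnj F is written as an integral, which keeps the double
      integral absolutely convergent. Integrating in \<open>x\<close> first gives the damped square
      norm; integrating in \<open>\<xi>\<close> first gives the pairing of \<open>f\<close> with its
      Gaussian mean.\<close>
    let ?h = "\<lambda>(\<xi>, x). (of_real (gauss s \<xi>) * ?F \<xi>) * (cnj (f x) * cis (2 * pi * (x \<bullet> \<xi>)))"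
    have g: "integrable lborel (\<lambda>\<xi>. complex_of_real (gauss s \<xi>) * ?F \<xi>)"
      using gconv_eq_fourier(1)[OF f s, of 0] by simp
    have cf: "integrable lborel (\<lambda>x. cnj (f x))" using f by simp
    have int: "integrable (lborel \<Otimes>\<^sub>M lborel) ?h"
    proof (rule Bochner_Integration.integrable_bound)
      show "integrable (lborel \<Otimes>\<^sub>M lborel) (\<lambda>p. (complex_of_real (gauss s (fst p)) * ?F (fst p)) * cnj (f (snd p)))"
        using lborel_integral_prod_mult(1)[OF g cf] by (simp add: lborel_prod)
      show "?h \<in> borel_measurable (lborel \<Otimes>\<^sub>M lborel)" unfolding split_beta by simp
    qed (auto simp: norm_mult)
    have "(LINT x|lborel. ?h (\<xi>, x)) = of_real (gauss s \<xi> * (cmod (?F \<xi>))\<^sup>2)" for \<xi>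
    proof -
      have "(LINT x|lborel. cnj (f x) * cis (2 * pi * (x \<bullet> \<xi>))) = (LINT x|lborel. cnj (f x * cis (- 2 * pi * (x \<bullet> \<xi>))))"
        by (simp add: cis_cnj)
      also have "\<dots> = cnj (?F \<xi>)" unfolding fourier_integral_def by (rule Bochner_Integration.integral_cnj)
      finally have "(LINT x|lborel. ?h (\<xi>, x)) = of_real (gauss s \<xi>) * (?F \<xi> * cnj (?F \<xi>))" by simp
      then show ?thesis by (simp only: complex_norm_square[symmetric] of_real_mult)
    qed
    then have "of_real (LINT \<xi>|lborel. gauss s \<xi> * (cmod (?F \<xi>))\<^sup>2) = (LINT \<xi>|lborel. LINT x|lborel. ?h (\<xi>, x))"
      by (simp only: integral_complex_of_real)
    also have "\<dots> = (LINT x|lborel. LINT \<xi>|lborel. ?h (\<xi>, x))"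
      using lborel_pair.Fubini_integral[of "\<lambda>\<xi> x. ?h (\<xi>, x)"] int by simp
    also have "\<dots> = (LINT x|lborel. cnj (f x) * gconv s f x)"
    proof (rule Bochner_Integration.integral_cong[OF refl])
      fix x
      have "(LINT \<xi>|lborel. ?h (\<xi>, x)) = (LINT \<xi>|lborel. cnj (f x) * (of_real (gauss s \<xi>) * cis (2 * pi * (x \<bullet> \<xi>)) * ?F \<xi>))"
        by (rule Bochner_Integration.integral_cong[OF refl]) (simp add: mult_ac)
      then show "(LINT \<xi>|lborel. ?h (\<xi>, x)) = cnj (f x) * gconv s f x"
        by (simp add: gconv_eq_fourier(2)[OF f s])
    qed
    finally have eq: "of_real (LINT \<xi>|lborel. gauss s \<xi> * (cmod (?F \<xi>))\<^sup>2) = (LINT x|lborel. cnj (f x) * gconv s f x)" .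
    have pos: "0 \<le> gauss s \<xi> * (cmod (?F \<xi>))\<^sup>2" for \<xi> using gauss_pos[of s \<xi>] by auto
    have gi: "integrable lborel (\<lambda>\<xi>. gauss s \<xi> * (cmod (?F \<xi>))\<^sup>2)"
    proof (rule Bochner_Integration.integrable_bound)
      show "integrable lborel (\<lambda>\<xi>. gauss s \<xi> * L\<^sup>2)" using gauss_integrable[OF s] by simp
      show "AE \<xi> in lborel. norm (gauss s \<xi> * (cmod (?F \<xi>))\<^sup>2) \<le> norm (gauss s \<xi> * L\<^sup>2)"
        using L gauss_pos[of s] by (intro AE_I2) (auto simp: abs_mult intro!: mult_left_mono power_mono)
    qed measurable
    have "(\<integral>\<^sup>+ \<xi>. ennreal (gauss s \<xi> * (cmod (?F \<xi>))\<^sup>2) \<partial>lborel) = ennreal (LINT \<xi>|lborel. gauss s \<xi> * (cmod (?F \<xi>))\<^sup>2)"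
      using gi pos by (intro nn_integral_eq_integral) auto
    also have "\<dots> \<le> ennreal (cmod (LINT x|lborel. cnj (f x) * gconv s f x))"
      unfolding eq[symmetric] by (simp add: ennreal_leI)
    also have "\<dots> \<le> (\<integral>\<^sup>+ x. ennreal (cmod (cnj (f x) * gconv s f x)) \<partial>lborel)"
      by (rule norm_integral_le_nn_integral)
    also have "\<dots> \<le> (\<integral>\<^sup>+ x. \<integral>\<^sup>+ y. ennreal (cmod (f x) * (gker s (x - y) * cmod (f y))) \<partial>lborel \<partial>lborel)"
    proof (intro nn_integral_mono)
      fix x
      have "ennreal (cmod (cnj (f x) * gconv s f x)) = ennreal (cmod (LINT y|lborel. f x * (of_real (gker s (x - y)) * f y)))"
        by (simp add: gconv_def norm_mult)
      also have "\<dots> \<le> (\<integral>\<^sup>+ y. ennreal (cmod (f x * (of_real (gker s (x - y)) * f y))) \<partial>lborel)"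
        by (rule norm_integral_le_nn_integral)
      finally show "ennreal (cmod (cnj (f x) * gconv s f x)) \<le> (\<integral>\<^sup>+ y. ennreal (cmod (f x) * (gker s (x - y) * cmod (f y))) \<partial>lborel)"
        using less_imp_le[OF gker_pos[OF s]] by (simp add: norm_mult)
    qed
    also have "\<dots> \<le> Q" unfolding Q_def by (rule nn_integral_gker_quadratic) (use s in auto)
    finally show ?thesis .
  qed
  have lim: "(\<lambda>n. ennreal (gauss (1 / real (Suc n)) \<xi> * (cmod (fourier_integral f \<xi>))\<^sup>2)) \<longlonglongrightarrow> ennreal ((cmod (fourier_integral f \<xi>))\<^sup>2)" for \<xi>
  proof (rule tendsto_ennrealI)
    have "(\<lambda>n. exp (- pi * (1 / real (Suc n)) * (\<xi> \<bullet> \<xi>)) * (cmod (fourier_integral f \<xi>))\<^sup>2) \<longlonglongrightarrow> exp (- pi * 0 * (\<xi> \<bullet> \<xi>)) * (cmod (fourier_integral f \<xi>))\<^sup>2"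
      by (intro tendsto_intros LIMSEQ_Suc[OF lim_1_over_n])
    then show "(\<lambda>n. gauss (1 / real (Suc n)) \<xi> * (cmod (fourier_integral f \<xi>))\<^sup>2) \<longlonglongrightarrow> (cmod (fourier_integral f \<xi>))\<^sup>2"
      by (simp add: gauss_def)
  qed
  have "(\<integral>\<^sup>+ \<xi>. ennreal ((cmod (fourier_integral f \<xi>))\<^sup>2) \<partial>lborel) =
     (\<integral>\<^sup>+ \<xi>. liminf (\<lambda>n. ennreal (gauss (1 / real (Suc n)) \<xi> * (cmod (fourier_integral f \<xi>))\<^sup>2)) \<partial>lborel)"
    using lim_imp_Liminf[OF _ lim] by simp
  also have "\<dots> \<le> liminf (\<lambda>n. \<integral>\<^sup>+ \<xi>. ennreal (gauss (1 / real (Suc n)) \<xi> * (cmod (fourier_integral f \<xi>))\<^sup>2) \<partial>lborel)"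
    by (rule nn_integral_liminf) measurable
  also have "\<dots> \<le> Q" by (rule Liminf_le) (auto intro!: always_eventually damped)
  finally show ?thesis by (simp add: Q_def)
qed

section \<open>Norm estimates for Gaussian means\<close>

lemma nn_integral_Cauchy_Schwarz_bound:
  fixes f g :: "'a \<Rightarrow> ennreal"
  assumes [measurable]: "f \<in> borel_measurable M" "g \<in> borel_measurable M"
    and f: "(\<integral>\<^sup>+ x. (f x)\<^sup>2 \<partial>M) \<le> ennreal (a\<^sup>2)" and g: "(\<integral>\<^sup>+ x. (g x)\<^sup>2 \<partial>M) \<le> ennreal (b\<^sup>2)"
    and ab: "a \<ge> 0" "b \<ge> 0"
  shows "(\<integral>\<^sup>+ x. f x * g x \<partial>M) \<le> ennreal (a * b)"
proof -
  have "(\<integral>\<^sup>+ x. f x * g x \<partial>M)\<^sup>2 \<le> (\<integral>\<^sup>+ x. (f x)\<^sup>2 \<partial>M) * (\<integral>\<^sup>+ x. (g x)\<^sup>2 \<partial>M)"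
    by (rule Cauchy_Schwarz_nn_integral) auto
  also have "\<dots> \<le> ennreal (a\<^sup>2) * ennreal (b\<^sup>2)" by (intro mult_mono f g) auto
  also have "\<dots> = ennreal ((a * b)\<^sup>2)"
    by (simp only: power_mult_distrib ennreal_mult[OF zero_le_power2 zero_le_power2])
  finally have le: "(\<integral>\<^sup>+ x. f x * g x \<partial>M)\<^sup>2 \<le> ennreal ((a * b)\<^sup>2)" .
  then have "(\<integral>\<^sup>+ x. f x * g x \<partial>M) * (\<integral>\<^sup>+ x. f x * g x \<partial>M) < top"
    unfolding power2_eq_square by (rule le_less_trans) (rule ennreal_less_top)
  then have "(\<integral>\<^sup>+ x. f x * g x \<partial>M) < top"
    unfolding ennreal_mult_less_top by (metis ennreal_zero_less_top)
  then obtain t where t: "t \<ge> 0" "(\<integral>\<^sup>+ x. f x * g x \<partial>M) = ennreal t"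
    unfolding less_top_ennreal by blast
  have "t\<^sup>2 \<le> (a * b)\<^sup>2" using le unfolding t(2) ennreal_power[OF t(1)] by (subst (asm) ennreal_le_iff) auto
  then have "t \<le> a * b" by (rule power2_le_imp_le) (simp add: ab)
  then show ?thesis unfolding t(2) by (rule ennreal_leI)
qed

text \<open>With \<open>u = norm w / sqrt s\<close>, the factor \<open>u\<close> is at most exp (pi
  u^2 / 2) and so is absorbed by half of the Gaussian exponent. What remains is a Gaussian of
  doubled parameter, whose mass produces the factor 2. This first moment is what turns a
  Lipschitz-type bound on increments into a gain \<open>sqrt s\<close>.\<close>

lemma gker_times_norm:
  assumes s: "s > 0"
  shows "integrable lborel (\<lambda>w. gker s w * norm w)" and "(LINT w|lborel. gker s w * norm w) \<le> 2 * sqrt s"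
proof -
  have le: "gker s w * norm w \<le> sqrt s / s * gauss (1 / (2 * s)) w" for w
  proof -
    define u where "u = norm w / sqrt s"
    have u: "u \<ge> 0" "norm w = sqrt s * u" using s by (auto simp: u_def)
    have uu: "w \<bullet> w = s * u\<^sup>2" using s u by (simp add: power2_norm_eq_inner[symmetric] power_mult_distrib)
    have "u \<le> 1 + pi * u\<^sup>2 / 2"
    proof (cases "u \<le> 1")
      case False
      then have "u \<le> u\<^sup>2" by (simp add: power2_eq_square)
      also have "\<dots> \<le> pi * u\<^sup>2 / 2" using pi_ge_two mult_right_mono[of 2 pi "u\<^sup>2"] by simp
      finally show ?thesis by simp
    qed (use pi_ge_zero in \<open>auto intro: add_increasing2\<close>)
    also have "\<dots> \<le> exp (pi * u\<^sup>2 / 2)" by (rule exp_ge_add_one_self)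
    finally have "exp (- pi * u\<^sup>2) * u \<le> exp (- pi * u\<^sup>2) * exp (pi * u\<^sup>2 / 2)" by (intro mult_left_mono) auto
    also have "\<dots> = exp (- pi * u\<^sup>2 / 2)" by (simp flip: exp_add)
    finally have "sqrt s / s * (exp (- pi * u\<^sup>2) * u) \<le> sqrt s / s * exp (- pi * u\<^sup>2 / 2)" using s by (intro mult_left_mono) auto
    then show ?thesis using s by (simp add: gker_def gauss_def uu u(2) mult_ac)
  qed
  have int: "integrable lborel (\<lambda>w. sqrt s / s * gauss (1 / (2 * s)) w)"
    using gauss_integrable[of "1 / (2 * s)"] s by simp
  show 1: "integrable lborel (\<lambda>w. gker s w * norm w)"
    by (rule Bochner_Integration.integrable_bound[OF int])
       (use le less_imp_le[OF gker_pos[OF s]] s in \<open>auto simp: abs_mult less_imp_le[OF gauss_pos]\<close>)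
  have "(LINT w|lborel. gker s w * norm w) \<le> (LINT w|lborel. sqrt s / s * gauss (1 / (2 * s)) w)"
    by (rule integral_mono[OF 1 int le])
  also have "\<dots> = 2 * sqrt s" using gauss_integral[of "1 / (2 * s)"] s by simp
  finally show "(LINT w|lborel. gker s w * norm w) \<le> 2 * sqrt s" .
qed

lemma gker_shift_integrable: "s > 0 \<Longrightarrow> integrable lborel (\<lambda>y. gker s (x - y))"
  by (rule lborel_integrable_reflect[OF gker_integrable])

lemma gker_shift_nn_integral: "s > 0 \<Longrightarrow> (\<integral>\<^sup>+ y. ennreal (gker s (x - y)) \<partial>lborel) = 1"
  using nn_integral_lborel_reflect[of "\<lambda>w. ennreal (gker s w)" x] gker_nn_integral[of s] by simp

lemma gker_times_bounded_integrable:
  fixes f :: "real \<times> real \<Rightarrow> complex"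
  assumes [measurable]: "f \<in> borel_measurable borel" and s: "s > 0" and N: "\<And>y. cmod (f y) \<le> N"
  shows "integrable lborel (\<lambda>y. of_real (gker s (x - y)) * f y)"
proof (rule Bochner_Integration.integrable_bound)
  show "integrable lborel (\<lambda>y. N * gker s (x - y))" using gker_shift_integrable[OF s] by simp
  have "N \<ge> 0" using norm_ge_zero N by (rule order_trans)
  then show "AE y in lborel. norm (of_real (gker s (x - y)) * f y) \<le> norm (N * gker s (x - y))"
    using N less_imp_le[OF gker_pos[OF s]] by (auto simp: norm_mult abs_mult mult_right_mono mult.commute)
qed measurable

lemma gconv_bound:
  assumes [measurable]: "f \<in> borel_measurable borel" and s: "s > 0" and N: "\<And>y. cmod (f y) \<le> N"
  shows "cmod (gconv s f x) \<le> N"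
proof -
  have "cmod (gconv s f x) \<le> (LINT y|lborel. N * gker s (x - y))"
    unfolding gconv_def
  proof (rule order_trans[OF integral_norm_bound], rule integral_mono)
    show "integrable lborel (\<lambda>y. cmod (of_real (gker s (x - y)) * f y))"
      using gker_times_bounded_integrable[OF assms(1) s N] by (rule integrable_norm)
    show "integrable lborel (\<lambda>y. N * gker s (x - y))" using gker_shift_integrable[OF s] by simp
    show "cmod (of_real (gker s (x - y)) * f y) \<le> N * gker s (x - y)" for y
      using N[of y] less_imp_le[OF gker_pos[OF s, of "x - y"]] by (simp add: norm_mult mult_right_mono mult.commute)
  qed
  also have "\<dots> = N"
    using lborel_integral_reflect[of "gker s" x] gker_integral[OF s] by simp
  finally show ?thesis .
qed

lemma gconv_L1:
  assumes [measurable]: "f \<in> borel_measurable borel" and s: "s > 0"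
  shows "(\<integral>\<^sup>+ x. ennreal (cmod (gconv s f x)) \<partial>lborel) \<le> (\<integral>\<^sup>+ x. ennreal (cmod (f x)) \<partial>lborel)"
proof -
  have "(\<integral>\<^sup>+ x. ennreal (cmod (gconv s f x)) \<partial>lborel)
    \<le> (\<integral>\<^sup>+ x. \<integral>\<^sup>+ y. ennreal (cmod (f y)) * ennreal (gker s (x - y)) \<partial>lborel \<partial>lborel)"
    unfolding gconv_def
    by (intro nn_integral_mono order_trans[OF norm_integral_le_nn_integral])
       (use less_imp_le[OF gker_pos[OF s]] in \<open>simp add: norm_mult ennreal_mult mult.commute\<close>)
  also have "\<dots> = (\<integral>\<^sup>+ y. ennreal (cmod (f y)) \<partial>lborel)"
    by (subst lborel_pair.Fubini') (simp_all add: nn_integral_cmult gker_diff_commute[of s] gker_shift_nn_integral[OF s])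
  finally show ?thesis .
qed

text \<open>The complement of the essential support is a possibly uncountable union of open sets on
  each of which \<open>g\<close> vanishes almost everywhere. Lindelof's theorem reduces it to a
  countable union, for which the exceptional null sets can be combined.\<close>

lemma ess_support_AE:
  fixes g :: "'a::euclidean_space \<Rightarrow> complex"
  shows "AE x in lborel. x \<notin> ess_support g \<longrightarrow> g x = 0"
proof -
  let ?F = "{U. open U \<and> (AE x in lborel. x \<in> U \<longrightarrow> g x = 0)}"
  obtain F' where F': "F' \<subseteq> ?F" "countable F'" "\<Union>F' = \<Union>?F"
    using Lindelof[of ?F] by blast
  have "AE x in lborel. \<forall>U\<in>F'. x \<in> U \<longrightarrow> g x = 0"
    using F' by (subst AE_ball_countable) auto
  then show ?thesis
    by eventually_elim (use F'(3) in \<open>auto simp: ess_support_def\<close>)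
qed

lemma integrable_mult_L2:
  fixes f g :: "'a \<Rightarrow> complex"
  assumes [measurable]: "f \<in> borel_measurable M" "g \<in> borel_measurable M"
    and "integrable M (\<lambda>x. (cmod (f x))\<^sup>2)" "integrable M (\<lambda>x. (cmod (g x))\<^sup>2)"
  shows "integrable M (\<lambda>x. f x * g x)"
proof (rule Bochner_Integration.integrable_bound)
  show "integrable M (\<lambda>x. (cmod (f x))\<^sup>2 + (cmod (g x))\<^sup>2)" using assms by simp
  have "cmod (f x) * cmod (g x) \<le> (cmod (f x))\<^sup>2 + (cmod (g x))\<^sup>2" for x
  proof -
    have "0 \<le> cmod (f x) * cmod (g x)" by simp
    then show ?thesis using sum_squares_bound[of "cmod (f x)" "cmod (g x)"] by linarith
  qed
  then show "AE x in M. norm (f x * g x) \<le> norm ((cmod (f x))\<^sup>2 + (cmod (g x))\<^sup>2)"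
    by (auto simp: norm_mult)
qed measurable

lemma nn_integral_norm_L2:
  assumes "in_L2 f"
  shows "(\<integral>\<^sup>+ x. ennreal ((cmod (f x))\<^sup>2) \<partial>lborel) = ennreal ((norm_L2 f)\<^sup>2)"
  using assms by (simp add: in_L2_def norm_L2_def nn_integral_eq_integral)

lemma gker_L2:
  assumes s: "s > 0"
  shows "integrable lborel (\<lambda>y. (cmod (of_real (gker s (x - y))))\<^sup>2)"
proof (rule Bochner_Integration.integrable_bound)
  show "integrable lborel (\<lambda>y. 1 / s * gker s (x - y))" using gker_shift_integrable[OF s] by simp
  have "gker s w * gker s w \<le> 1 / s * gker s w" for w
    using gker_le[OF s] less_imp_le[OF gker_pos[OF s]] by (intro mult_right_mono)
  then show "AE y in lborel. norm ((cmod (of_real (gker s (x - y))))\<^sup>2) \<le> norm (1 / s * gker s (x - y))"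
    using s less_imp_le[OF gker_pos[OF s]] by (auto simp: power2_eq_square)
qed measurable

lemma gker_times_L2_integrable:
  assumes "in_L2 f" and s: "s > 0"
  shows "integrable lborel (\<lambda>y. of_real (gker s (x - y)) * f y)"
  using assms gker_L2[OF s] by (intro integrable_mult_L2) (auto simp: in_L2_def)

text \<open>The mean multiplies the transform by \<open>gauss s\<close>, which is tiny where the
  transform lives, and Cauchy--Schwarz in frequency gives a pointwise bound. Since a Fourier
  integral is available only for integrable functions, the argument is run on the truncations
  \<open>fn n\<close>: their transforms are close to \<open>g\<close> in \<open>L\<^sup>2\<close>,
  and their means converge to the mean of \<open>f\<close> by dominated convergence.\<close>

lemma gconv_high_frequency:
  fixes f g :: "real \<times> real \<Rightarrow> complex"
  assumes fg: "f has_fourier_transform g" and supp: "ess_support g \<inter> ball 0 lam = {}"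
    and s: "s > 0" and lam: "lam \<ge> 0"
  shows "cmod (gconv s f x) \<le> exp (- pi * s * lam\<^sup>2 / 2) / sqrt s * norm_L2 f"
proof -
  define fn where "fn = (\<lambda>(n::nat) x. indicator (ball 0 (real n)) x * f x)"
  have f: "in_L2 f" and g: "in_L2 g"
    and lim: "(\<lambda>n. \<integral>\<^sup>+ \<xi>. ennreal ((cmod (fourier_integral (fn n) \<xi> - g \<xi>))\<^sup>2) \<partial>lborel) \<longlonglongrightarrow> 0"
    using fg by (auto simp: has_fourier_transform_def fn_def)
  have [measurable]: "f \<in> borel_measurable borel" "g \<in> borel_measurable borel" using f g by (auto simp: in_L2_def)
  have [measurable]: "fn n \<in> borel_measurable borel" for n
    unfolding fn_def by (intro borel_measurable_times borel_measurable_indicator) simp_all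
  have fn_int: "integrable lborel (fn n)" for n
    unfolding fn_def
  proof (rule integrable_mult_L2)
    have "(cmod (indicator (ball 0 (real n)) x))\<^sup>2 = (indicator (ball 0 (real n)) x :: real)" for x :: "real \<times> real"
      by (auto simp: indicator_def)
    then show "integrable lborel (\<lambda>x::real \<times> real. (cmod (indicator (ball 0 (real n)) x))\<^sup>2)"
      using emeasure_lborel_ball_finite[of "0::real\<times>real" "real n"] by simp
  qed (use f in \<open>auto simp: in_L2_def intro!: borel_measurable_indicator\<close>)
  \<comment> \<open>An upper bound for the \<open>L\<^sup>2\<close> norm of \<open>gauss s\<close>
    outside the ball of radius \<open>lam\<close>.\<close>
  define \<tau> where "\<tau> = exp (- pi * s * lam\<^sup>2 / 2) / sqrt s"
  have \<tau>: "\<tau> > 0" using s by (simp add: \<tau>_def)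
  have tau2: "\<tau>\<^sup>2 = exp (- pi * s * lam\<^sup>2) / s"
    using s by (simp add: \<tau>_def power_divide flip: exp_double)
  have G1: "(\<integral>\<^sup>+ \<xi>. (ennreal (gauss s \<xi>))\<^sup>2 \<partial>lborel) \<le> ennreal ((1 / sqrt s)\<^sup>2)"
  proof -
    have "(\<integral>\<^sup>+ \<xi>. (ennreal (gauss s \<xi>))\<^sup>2 \<partial>lborel) \<le> (\<integral>\<^sup>+ \<xi>. ennreal (gauss s \<xi>) \<partial>lborel)"
      using gauss_le_1[of s] less_imp_le[OF gauss_pos] s
      by (intro nn_integral_mono) (auto simp: ennreal_power power2_eq_square intro!: ennreal_leI mult_left_le)
    also have "\<dots> = ennreal (1 / s)"
      using gauss_integrable[OF s] gauss_integral[OF s] by (simp add: nn_integral_eq_integral less_imp_le[OF gauss_pos])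
    finally show ?thesis using s by (simp add: power_divide)
  qed
  have G2: "(\<integral>\<^sup>+ \<xi>. (ennreal (gauss s \<xi>) * indicator (- ball 0 lam) \<xi>)\<^sup>2 \<partial>lborel) \<le> ennreal (\<tau>\<^sup>2)"
  proof -
    \<comment> \<open>One of the two Gaussian factors is replaced by its maximum outside the ball,
      the other is kept for integrability; this is why the exponent in \<open>\<tau>\<close> is
      halved after taking the root.\<close>
    have le: "(ennreal (gauss s \<xi>) * indicator (- ball 0 lam) \<xi>)\<^sup>2 \<le> ennreal (exp (- pi * s * lam\<^sup>2)) * ennreal (gauss s \<xi>)" for \<xi>
    proof (cases "\<xi> \<in> ball 0 lam")
      case False
      then have "lam\<^sup>2 \<le> (norm \<xi>)\<^sup>2" using lam by (intro power_mono) auto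
      then have "gauss s \<xi> \<le> exp (- pi * s * lam\<^sup>2)"
        using s unfolding gauss_def power2_norm_eq_inner by (simp add: mult_left_mono)
      then show ?thesis using False
        by (simp add: power2_eq_square indicator_def mult_right_mono less_imp_le[OF gauss_pos] ennreal_leI flip: ennreal_mult)
    qed simp
    have "(\<integral>\<^sup>+ \<xi>. (ennreal (gauss s \<xi>) * indicator (- ball 0 lam) \<xi>)\<^sup>2 \<partial>lborel)
      \<le> (\<integral>\<^sup>+ \<xi>. ennreal (exp (- pi * s * lam\<^sup>2)) * ennreal (gauss s \<xi>) \<partial>lborel)"
      by (intro nn_integral_mono le)
    also have "\<dots> = ennreal (exp (- pi * s * lam\<^sup>2)) * ennreal (1 / s)"
      using gauss_integrable[OF s] gauss_integral[OF s] by (simp add: nn_integral_cmult nn_integral_eq_integral less_imp_le[OF gauss_pos])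
    also have "\<dots> = ennreal (\<tau>\<^sup>2)" using s by (simp add: tau2 flip: ennreal_mult)
    finally show ?thesis .
  qed
  have supp0: "AE \<xi> in lborel. \<xi> \<in> ball 0 lam \<longrightarrow> g \<xi> = 0"
    using ess_support_AE[of g] by eventually_elim (use supp in auto)
  have fn_L2: "(\<integral>\<^sup>+ \<xi>. (ennreal (cmod (fourier_integral (fn n) \<xi>)))\<^sup>2 \<partial>lborel) \<le> ennreal ((norm_L2 f)\<^sup>2)" for n
  proof -
    have "(\<integral>\<^sup>+ \<xi>. (ennreal (cmod (fourier_integral (fn n) \<xi>)))\<^sup>2 \<partial>lborel) \<le> (\<integral>\<^sup>+ x. ennreal ((cmod (fn n x))\<^sup>2) \<partial>lborel)"
      using bessel_fourier[OF fn_int[of n]] by (simp add: ennreal_power)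
    also have "\<dots> \<le> (\<integral>\<^sup>+ x. ennreal ((cmod (f x))\<^sup>2) \<partial>lborel)"
      by (intro nn_integral_mono ennreal_leI) (auto simp: fn_def indicator_def)
    finally show ?thesis using nn_integral_norm_L2[OF f] by simp
  qed
  have F0: "norm_L2 f \<ge> 0" by (simp add: norm_L2_def)
  \<comment> \<open>Inside the ball \<open>g\<close> vanishes almost everywhere, so the transform
    there equals its difference from \<open>g\<close> and contributes at most \<eta> / sqrt s.
    Outside the ball the small norm \<open>\<tau>\<close> is paired with the full
    \<open>L\<^sup>2\<close> norm.\<close>
  have main: "cmod (gconv s (fn n) x) \<le> \<eta> * (1 / sqrt s) + \<tau> * norm_L2 f"
    if E: "(\<integral>\<^sup>+ \<xi>. ennreal ((cmod (fourier_integral (fn n) \<xi> - g \<xi>))\<^sup>2) \<partial>lborel) \<le> ennreal (\<eta>\<^sup>2)" and \<eta>: "\<eta> > 0" for n \<eta>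
  proof -
    let ?F = "fourier_integral (fn n)"
    have "ennreal (cmod (gconv s (fn n) x)) \<le> (\<integral>\<^sup>+ \<xi>. ennreal (cmod (of_real (gauss s \<xi>) * cis (2 * pi * (x \<bullet> \<xi>)) * ?F \<xi>)) \<partial>lborel)"
      unfolding gconv_eq_fourier(2)[OF fn_int s] by (rule norm_integral_le_nn_integral)
    also have "\<dots> = (\<integral>\<^sup>+ \<xi>. ennreal (gauss s \<xi>) * ennreal (cmod (?F \<xi>)) \<partial>lborel)"
      by (simp add: norm_mult less_imp_le[OF gauss_pos] ennreal_mult)
    also have "\<dots> \<le> (\<integral>\<^sup>+ \<xi>. ennreal (cmod (?F \<xi> - g \<xi>)) * ennreal (gauss s \<xi>)
        + (ennreal (gauss s \<xi>) * indicator (- ball 0 lam) \<xi>) * ennreal (cmod (?F \<xi>)) \<partial>lborel)"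
    proof (intro nn_integral_mono_AE)
      show "AE \<xi> in lborel. ennreal (gauss s \<xi>) * ennreal (cmod (?F \<xi>)) \<le> ennreal (cmod (?F \<xi> - g \<xi>)) * ennreal (gauss s \<xi>)
        + (ennreal (gauss s \<xi>) * indicator (- ball 0 lam) \<xi>) * ennreal (cmod (?F \<xi>))"
        using supp0 by eventually_elim (auto simp: indicator_def mult.commute)
    qed
    also have "\<dots> = (\<integral>\<^sup>+ \<xi>. ennreal (cmod (?F \<xi> - g \<xi>)) * ennreal (gauss s \<xi>) \<partial>lborel)
        + (\<integral>\<^sup>+ \<xi>. (ennreal (gauss s \<xi>) * indicator (- ball 0 lam) \<xi>) * ennreal (cmod (?F \<xi>)) \<partial>lborel)"
      by (rule nn_integral_add) auto
    also have "\<dots> \<le> ennreal (\<eta> * (1 / sqrt s)) + ennreal (\<tau> * norm_L2 f)"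
      using E G1 G2 fn_L2[of n] \<eta> \<tau> s F0
      by (intro add_mono nn_integral_Cauchy_Schwarz_bound) (auto simp: ennreal_power)
    also have "\<dots> = ennreal (\<eta> * (1 / sqrt s) + \<tau> * norm_L2 f)"
      using \<eta> \<tau> s F0 by (intro ennreal_plus[symmetric]) auto
    finally show ?thesis by (rule ennreal_le_iff[THEN iffD1, rotated]) (use \<eta> \<tau> s F0 in auto)
  qed
  have conv: "(\<lambda>n. gconv s (fn n) x) \<longlonglongrightarrow> gconv s f x"
    unfolding gconv_def
  proof (rule integral_dominated_convergence)
    show "integrable lborel (\<lambda>y. cmod (of_real (gker s (x - y)) * f y))"
      using gker_times_L2_integrable[OF f s] by (rule integrable_norm)
    show "AE y in lborel. (\<lambda>n. of_real (gker s (x - y)) * fn n y) \<longlonglongrightarrow> of_real (gker s (x - y)) * f y"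
    proof (intro AE_I2 tendsto_mult tendsto_const)
      fix y :: "real \<times> real"
      obtain m where m: "norm y < real m" using reals_Archimedean2 by blast
      have "eventually (\<lambda>n. fn n y = f y) sequentially"
        using eventually_ge_at_top[of m] by eventually_elim (use m in \<open>auto simp: fn_def indicator_def\<close>)
      then show "(\<lambda>n. fn n y) \<longlonglongrightarrow> f y" by (rule tendsto_eventually)
    qed
    show "AE y in lborel. norm (of_real (gker s (x - y)) * fn n y) \<le> cmod (of_real (gker s (x - y)) * f y)" for n
      by (auto simp: fn_def indicator_def)
  qed measurable
  have "cmod (gconv s f x) \<le> \<eta> * (1 / sqrt s) + \<tau> * norm_L2 f" if \<eta>: "\<eta> > 0" for \<eta>
  proof (rule tendsto_upperbound[OF tendsto_norm[OF conv]])
    have "eventually (\<lambda>n. (\<integral>\<^sup>+ \<xi>. ennreal ((cmod (fourier_integral (fn n) \<xi> - g \<xi>))\<^sup>2) \<partial>lborel) < ennreal (\<eta>\<^sup>2)) sequentially"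
      using lim \<eta> by (intro order_tendstoD(2)) auto
    then show "eventually (\<lambda>n. cmod (gconv s (fn n) x) \<le> \<eta> * (1 / sqrt s) + \<tau> * norm_L2 f) sequentially"
      by (rule eventually_mono) (rule main[OF less_imp_le \<eta>])
  qed simp
  note * = this
  have "cmod (gconv s f x) \<le> \<tau> * norm_L2 f + e" if "e > 0" for e
    using *[of "e * sqrt s"] that s by simp
  then show ?thesis unfolding \<tau>_def by (rule field_le_epsilon)
qed

section \<open>Sublevel sets of polynomials and the determinant of the four-point map\<close>

lemma poly_of_real_map: "poly (map_poly complex_of_real p) (complex_of_real t) = of_real (poly p t)"
proof -
  have "degree (map_poly complex_of_real p) = degree p" by (rule degree_map_poly) simp
  then show ?thesis by (simp add: poly_altdef coeff_map_poly)
qed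

text \<open>Factor over the complex numbers: if \<open>t\<close> has distance more than
  \<open>rho\<close> from every root, then each of the \<open>n\<close> linear factors exceeds
  \<open>rho\<close>. Hence the sublevel set is covered by intervals of length
  \<open>2 * rho\<close> around the real parts of the roots. Only the leading coefficient enters,
  not the position of the roots.\<close>

lemma poly_sublevel_emeasure:
  fixes p :: "real poly"
  assumes deg: "degree p \<le> n" and n: "n \<ge> 1" and k: "coeff p n = k" "k \<noteq> 0" and rho: "rho > 0"
  shows "emeasure lborel {t. \<bar>poly p t\<bar> \<le> \<bar>k\<bar> * rho ^ n} \<le> ennreal (2 * real n * rho)"
proof -
  define P where "P = map_poly complex_of_real p"
  have dp: "degree p = n" using deg k le_degree[of p n] by simp
  have dP: "degree P = n" unfolding P_def dp[symmetric] by (rule degree_map_poly) simp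
  have lc: "lead_coeff P = of_real k" unfolding dP unfolding P_def by (simp add: coeff_map_poly k)
  have "P \<noteq> 0" using dP n by auto
  then obtain A where A: "size A = n" "P = smult (of_real k) (\<Prod>x\<in>#A. [:-x, 1:])"
    using alg_closed_imp_factorization[of P] dP lc by auto
  have big: "\<bar>poly p t\<bar> > \<bar>k\<bar> * rho ^ n" if t: "\<And>x. x \<in># A \<Longrightarrow> cmod (of_real t - x) > rho" for t
  proof -
    \<comment> \<open>The strict inequality needs a nonempty multiset, since the empty product
      equals \<open>rho ^ 0\<close>. The weak one is carried along as the induction
      hypothesis.\<close>
    have *: "cmod (poly (\<Prod>x\<in>#B. [:-x, 1:]) (of_real t)) \<ge> rho ^ size B \<and> (B \<noteq> {#} \<longrightarrow> cmod (poly (\<Prod>x\<in>#B. [:-x, 1:]) (of_real t)) > rho ^ size B)"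
      if "B \<subseteq># A" for B
      using that
    proof (induction B)
      case (add x B)
      have "x \<in># A" using add.prems by (meson insert_subset_eq_iff)
      then have x: "cmod (of_real t - x) > rho" by (rule t)
      have "B \<subseteq># A" using add.prems by (meson insert_subset_eq_iff diff_subset_eq_self subset_mset.order_trans)
      with add.IH have B: "cmod (poly (\<Prod>x\<in>#B. [:-x, 1:]) (of_real t)) \<ge> rho ^ size B" by simp
      have "rho * rho ^ size B < cmod (of_real t - x) * cmod (poly (\<Prod>x\<in>#B. [:-x, 1:]) (of_real t))"
        using x B rho by (intro mult_less_le_imp_less) auto
      then show ?case by (auto simp: norm_mult[symmetric] algebra_simps)
    qed auto
    have "A \<noteq> {#}" using A n by auto
    then have "cmod (poly (\<Prod>x\<in>#A. [:-x, 1:]) (of_real t)) > rho ^ n" using *[of A] A by simp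
    then have "cmod (poly P (of_real t)) > \<bar>k\<bar> * rho ^ n" using k by (simp add: A(2) norm_mult)
    then show ?thesis by (simp add: P_def poly_of_real_map)
  qed
  have sub: "{t. \<bar>poly p t\<bar> \<le> \<bar>k\<bar> * rho ^ n} \<subseteq> (\<Union>x\<in>set_mset A. {Re x - rho .. Re x + rho})"
  proof
    fix t assume "t \<in> {t. \<bar>poly p t\<bar> \<le> \<bar>k\<bar> * rho ^ n}"
    then obtain x where x: "x \<in># A" "cmod (of_real t - x) \<le> rho" using big[of t] by force
    have "\<bar>t - Re x\<bar> \<le> rho" using abs_Re_le_cmod[of "of_real t - x"] x(2) by simp
    then show "t \<in> (\<Union>x\<in>set_mset A. {Re x - rho .. Re x + rho})" using x(1) by (intro UN_I[of x]) (auto simp: abs_le_iff)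
  qed
  have "emeasure lborel {t. \<bar>poly p t\<bar> \<le> \<bar>k\<bar> * rho ^ n} \<le> emeasure lborel (\<Union>x\<in>set_mset A. {Re x - rho .. Re x + rho})"
    by (rule emeasure_mono[OF sub]) auto
  also have "\<dots> \<le> (\<Sum>x\<in>set_mset A. emeasure lborel {Re x - rho .. Re x + rho})"
    by (rule emeasure_subadditive_finite) auto
  also have "\<dots> = of_nat (card (set_mset A)) * ennreal (2 * rho)" using rho by simp
  also have "\<dots> = ennreal (real (card (set_mset A)) * (2 * rho))"
    using rho by (simp add: ennreal_mult ennreal_of_nat_eq_real_of_nat)
  also have "\<dots> \<le> ennreal (2 * real n * rho)"
  proof (rule ennreal_leI)
    \<comment> \<open>A multiple root contributes a single interval, so the number of intervals is
      at most the number of roots counted with multiplicity.\<close>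
    have "(\<Sum>x\<in>set_mset A. 1) \<le> (\<Sum>x\<in>set_mset A. count A x)"
      by (rule sum_mono) (simp add: Suc_le_eq)
    then have "card (set_mset A) \<le> n" unfolding A(1)[symmetric] size_multiset_overloaded_eq by simp
    then show "real (card (set_mset A)) * (2 * rho) \<le> 2 * real n * rho" using rho by (simp add: mult_right_mono)
  qed
  finally show ?thesis .
qed

text \<open>The number \<open>n\<close> is only an upper bound for the degree and \<open>k\<close>
  may be 0. Sums therefore stay in the same class even when leading terms cancel, and lower-order
  terms, in particular all those containing \<rho>, never have to be computed.\<close>

definition has_top :: "nat \<Rightarrow> real \<Rightarrow> (real \<Rightarrow> real) \<Rightarrow> bool" where
  "has_top n k f \<longleftrightarrow> (\<exists>p. degree p \<le> n \<and> coeff p n = k \<and> (\<forall>t. f t = poly p t))"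

lemma has_top_add: "has_top n k f \<Longrightarrow> has_top n l g \<Longrightarrow> has_top n (k + l) (\<lambda>t. f t + g t)"
  unfolding has_top_def by (metis coeff_add degree_add_le poly_add)

lemma has_top_uminus: "has_top n k f \<Longrightarrow> has_top n (- k) (\<lambda>t. - f t)"
  unfolding has_top_def by (metis coeff_minus degree_minus poly_minus)

lemma has_top_diff: "has_top n k f \<Longrightarrow> has_top n l g \<Longrightarrow> has_top n (k - l) (\<lambda>t. f t - g t)"
  using has_top_add[OF _ has_top_uminus] by fastforce

lemma has_top_mult:
  assumes "has_top m k f" "has_top n l g"
  shows "has_top (m + n) (k * l) (\<lambda>t. f t * g t)"
proof -
  obtain p q where p: "degree p \<le> m" "coeff p m = k" "\<And>t. f t = poly p t"
    and q: "degree q \<le> n" "coeff q n = l" "\<And>t. g t = poly q t"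
    using assms unfolding has_top_def by blast
  have "coeff (p * q) (m + n) = (\<Sum>i\<le>m + n. coeff p i * coeff q (m + n - i))" by (rule coeff_mult)
  also have "\<dots> = (\<Sum>i\<in>{m}. coeff p i * coeff q (m + n - i))"
  proof (rule sum.mono_neutral_right)
    show "\<forall>i\<in>{..m + n} - {m}. coeff p i * coeff q (m + n - i) = 0"
    proof
      fix i assume i: "i \<in> {..m + n} - {m}"
      show "coeff p i * coeff q (m + n - i) = 0"
      proof (cases "i < m")
        case True
        then have "coeff q (m + n - i) = 0" using q(1) by (intro coeff_eq_0) auto
        then show ?thesis by simp
      next
        case False
        then have "coeff p i = 0" using p(1) i by (intro coeff_eq_0) auto
        then show ?thesis by simp
      qed
    qed
  qed auto
  finally have "coeff (p * q) (m + n) = k * l" using p q by simp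
  moreover have "degree (p * q) \<le> m + n" using degree_mult_le[of p q] p(1) q(1) by linarith
  ultimately show ?thesis unfolding has_top_def using p(3) q(3) by (intro exI[of _ "p * q"]) simp
qed

lemma has_top_affine: "has_top (Suc 0) k (\<lambda>t. c + t * k)"
  unfolding has_top_def by (rule exI[of _ "[:c, k:]"]) auto

lemma has_top_const: "n > 0 \<Longrightarrow> has_top n 0 (\<lambda>t. c)"
  unfolding has_top_def by (rule exI[of _ "[:c:]"]) (auto simp: coeff_pCons split: nat.split)

text \<open>The weight is at most 1 on the set where \<open>(f t)\<^sup>2\<close> is at most
  \<open>e\<close>, and at most \<open>e\<close> outside it. The first set has measure of order
  \<open>root (2 * n) e\<close>, and this also dominates \<open>e\<close> because
  \<open>e \<le> 1\<close>.\<close>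

lemma has_top_sublevel_integral:
  assumes f: "has_top n k f" and n: "n \<ge> 1" and k: "k \<noteq> 0" and e: "0 < e" "e \<le> 1"
  shows "(\<integral>\<^sup>+ t. ennreal (e\<^sup>2 / ((f t)\<^sup>2 + e\<^sup>2)) * indicator {0..1} t \<partial>lborel)
    \<le> ennreal ((1 + 2 * real n / root n \<bar>k\<bar>) * root (2 * n) e)"
proof -
  obtain p where p: "degree p \<le> n" "coeff p n = k" "\<And>t. f t = poly p t"
    using f unfolding has_top_def by blast
  \<comment> \<open>Chosen so that \<open>\<bar>k\<bar> * rho ^ n\<close> equals
    \<open>sqrt e\<close>, the level at which both bounds on the weight apply.\<close>
  define rho where "rho = root (2 * n) e / root n \<bar>k\<bar>"
  have rk: "root n \<bar>k\<bar> > 0" using k n by simp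
  have rho: "rho > 0" using e rk n by (simp add: rho_def)
  have "(root (2 * n) e) ^ (2 * n) = e" using e n by simp
  then have re: "((root (2 * n) e) ^ n)\<^sup>2 = e" by (simp add: power_mult [symmetric] mult.commute)
  have krn: "(\<bar>k\<bar> * rho ^ n)\<^sup>2 = e"
    using n k re by (simp add: rho_def power_divide power_mult_distrib)
  define S where "S = {t. \<bar>poly p t\<bar> \<le> \<bar>k\<bar> * rho ^ n}"
  have Sm [measurable]: "S \<in> sets lborel"
  proof -
    have "closed S" unfolding S_def by (intro closed_Collect_le continuous_intros)
    then show ?thesis by simp
  qed
  have le: "ennreal (e\<^sup>2 / ((f t)\<^sup>2 + e\<^sup>2)) * indicator {0..1} t \<le> indicator S t + ennreal e * indicator {0..1} t" for t
  proof (cases "t \<in> S")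
    case True
    have "e\<^sup>2 / ((f t)\<^sup>2 + e\<^sup>2) \<le> 1" using e by (simp add: divide_le_eq_1 add_nonneg_pos)
    then have "ennreal (e\<^sup>2 / ((f t)\<^sup>2 + e\<^sup>2)) \<le> 1" by (simp add: ennreal_le_1)
    then show ?thesis using True by (auto simp: indicator_def intro: add_increasing2)
  next
    case False
    then have "\<bar>k\<bar> * rho ^ n \<le> \<bar>poly p t\<bar>" by (simp add: S_def)
    then have "(\<bar>k\<bar> * rho ^ n)\<^sup>2 \<le> \<bar>poly p t\<bar>\<^sup>2" using rho by (intro power_mono) auto
    then have "e \<le> (f t)\<^sup>2" by (simp add: krn p(3))
    then have "e * e\<^sup>2 + e * e \<le> e * e\<^sup>2 + e * (f t)\<^sup>2" using e by (intro add_left_mono mult_left_mono) auto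
    moreover have "0 \<le> e * e\<^sup>2" using e by simp
    ultimately have "e\<^sup>2 \<le> e * ((f t)\<^sup>2 + e\<^sup>2)" by (simp add: power2_eq_square algebra_simps)
    then have "e\<^sup>2 / ((f t)\<^sup>2 + e\<^sup>2) \<le> e" using e by (simp add: divide_le_eq add_nonneg_pos)
    then show ?thesis by (auto simp: indicator_def False intro: ennreal_leI)
  qed
  have "(\<integral>\<^sup>+ t. ennreal (e\<^sup>2 / ((f t)\<^sup>2 + e\<^sup>2)) * indicator {0..1} t \<partial>lborel)
    \<le> (\<integral>\<^sup>+ t. indicator S t + ennreal e * indicator {0..1} t \<partial>lborel)"
    by (intro nn_integral_mono le)
  also have "\<dots> = emeasure lborel S + ennreal e"
    using nn_integral_indicator[OF Sm] by (simp add: nn_integral_add nn_integral_cmult)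
  also have "\<dots> \<le> ennreal (2 * real n * rho) + ennreal (root (2 * n) e)"
  proof (intro add_mono ennreal_leI)
    show "emeasure lborel S \<le> ennreal (2 * real n * rho)"
      unfolding S_def by (rule poly_sublevel_emeasure[OF p(1) n p(2) k rho])
    have "root 1 e \<le> root (2 * n) e" by (rule real_root_increasing) (use n e in auto)
    then show "e \<le> root (2 * n) e" by simp
  qed
  also have "\<dots> = ennreal ((1 + 2 * real n / root n \<bar>k\<bar>) * root (2 * n) e)"
    using rho e n by (simp add: rho_def algebra_simps flip: ennreal_plus)
  finally show ?thesis .
qed

section \<open>Two-by-two matrices and the degree of the determinant\<close>

type_synonym mat2 = "(real \<times> real) \<times> (real \<times> real)"

definition mdet :: "mat2 \<Rightarrow> real" where
  "mdet A = fst (fst A) * snd (snd A) - snd (fst A) * fst (snd A)"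

definition madj :: "mat2 \<Rightarrow> mat2" where
  "madj A = ((snd (snd A), - snd (fst A)), (- fst (snd A), fst (fst A)))"

definition mapp :: "mat2 \<Rightarrow> real \<times> real \<Rightarrow> real \<times> real" where
  "mapp A v = (fst (fst A) * fst v + snd (fst A) * snd v, fst (snd A) * fst v + snd (snd A) * snd v)"

definition mmul :: "mat2 \<Rightarrow> mat2 \<Rightarrow> mat2" where
  "mmul A B = ((fst (fst A) * fst (fst B) + snd (fst A) * fst (snd B), fst (fst A) * snd (fst B) + snd (fst A) * snd (snd B)),
               (fst (snd A) * fst (fst B) + snd (snd A) * fst (snd B), fst (snd A) * snd (fst B) + snd (snd A) * snd (snd B)))"

definition mdiag :: "real \<Rightarrow> real \<Rightarrow> mat2" where
  "mdiag x y = ((x, 0), (0, y))"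

definition DP :: "real \<times> real \<Rightarrow> mat2" where
  "DP t = ((2 * fst t, 2 * snd t), (3 * (fst t * fst t), 3 * (snd t * snd t)))"

text \<open>The derivative of \<open>t \<mapsto> P t - Bd \<rho> t\<close>. For \<rho> = 1/R its
  determinant is the Jacobian determinant of the hypothesis, and for \<rho> = 0 it is the derivative
  of \<open>P\<close>.\<close>

definition Dphi :: "real \<Rightarrow> real \<times> real \<Rightarrow> mat2" where
  "Dphi \<rho> t = DP t - mdiag \<rho> (\<rho> * \<rho>)"

definition msc :: "real \<Rightarrow> mat2 \<Rightarrow> mat2" where
  "msc k A = ((k * fst (fst A), k * snd (fst A)), (k * fst (snd A), k * snd (snd A)))"

text \<open>For \<open>a = b + c - d\<close>, motions \<open>db\<close>, \<open>dc\<close>, \<open>dd\<close> of \<open>b\<close>, \<open>c\<close>, \<open>d\<close> fix the third and fourth points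
  iff \<open>P'(c) dc = P'(d) dd\<close> and \<open>\<phi>'(b) db = \<phi>'(d) dd\<close>. Solving by adjugates (to avoid division)
  with \<open>dd = det P'(c) * det \<phi>'(b) * w\<close>, the first point moves by \<open>EE w\<close>.\<close>

definition EE :: "real \<Rightarrow> real \<times> real \<Rightarrow> real \<times> real \<Rightarrow> real \<times> real \<Rightarrow> mat2" where
  "EE \<rho> b c d = msc (mdet (DP c)) (mmul (DP (b + c - d) - DP b) (mmul (madj (Dphi \<rho> b)) (Dphi \<rho> d)))
     + msc (mdet (Dphi \<rho> b)) (mmul (DP (b + c - d)) (mmul (madj (DP c)) (DP d) - mdiag (mdet (DP c)) (mdet (DP c))))"

text \<open>Where this is nonzero, the first point can be moved in every direction while the third
  and the fourth stay fixed. It is the factor called \<open>D\<close> in the overview.\<close>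

definition DD :: "real \<Rightarrow> real \<times> real \<Rightarrow> real \<times> real \<Rightarrow> real \<times> real \<Rightarrow> real" where
  "DD \<rho> b c d = mdet (EE \<rho> b c d)"

text \<open>The two rows of a matrix may have different degrees, as do the rows of \<open>DP\<close>.\<close>

definition mtop :: "nat \<Rightarrow> nat \<Rightarrow> mat2 \<Rightarrow> (real \<Rightarrow> mat2) \<Rightarrow> bool" where
  "mtop m n A F \<longleftrightarrow> has_top m (fst (fst A)) (\<lambda>t. fst (fst (F t))) \<and> has_top m (snd (fst A)) (\<lambda>t. snd (fst (F t)))
     \<and> has_top n (fst (snd A)) (\<lambda>t. fst (snd (F t))) \<and> has_top n (snd (snd A)) (\<lambda>t. snd (snd (F t)))"

lemma has_top_mult': "has_top m k f \<Longrightarrow> has_top n l g \<Longrightarrow> m + n = r \<Longrightarrow> has_top r (k * l) (\<lambda>t. f t * g t)"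
  using has_top_mult by blast

lemma mtop_add: "mtop m n A F \<Longrightarrow> mtop m n B G \<Longrightarrow> mtop m n (A + B) (\<lambda>t. F t + G t)"
  unfolding mtop_def by (simp add: has_top_add)

lemma mtop_diff: "mtop m n A F \<Longrightarrow> mtop m n B G \<Longrightarrow> mtop m n (A - B) (\<lambda>t. F t - G t)"
  unfolding mtop_def by (simp add: has_top_diff)

lemma mtop_mdet: "mtop m n A F \<Longrightarrow> has_top (m + n) (mdet A) (\<lambda>t. mdet (F t))"
  unfolding mtop_def mdet_def by (auto intro!: has_top_diff has_top_mult')

lemma mtop_msc: "has_top j k f \<Longrightarrow> mtop m n A F \<Longrightarrow> mtop (j + m) (j + n) (msc k A) (\<lambda>t. msc (f t) (F t))"
  unfolding mtop_def msc_def by (auto intro!: has_top_mult')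

lemma mtop_mmul: "mtop m n A F \<Longrightarrow> mtop j j B G \<Longrightarrow> mtop (m + j) (n + j) (mmul A B) (\<lambda>t. mmul (F t) (G t))"
  unfolding mtop_def mmul_def by (auto intro!: has_top_add has_top_mult')

text \<open>Each entry of the product pairs an entry from the first row of one matrix with an entry
  from the second row of the other. The unequal row degrees thus even out to \<open>m + n\<close>,
  which makes the result admissible as second factor in \<open>mtop_mmul\<close>.\<close>

lemma mtop_madj_mmul: "mtop m n A F \<Longrightarrow> mtop m n B G \<Longrightarrow> mtop (m + n) (m + n) (mmul (madj A) B) (\<lambda>t. mmul (madj (F t)) (G t))"
  unfolding mtop_def mmul_def madj_def by (auto intro!: has_top_add has_top_diff has_top_mult')

lemma mtop_mdiag: "has_top n k f \<Longrightarrow> n > 0 \<Longrightarrow> mtop n n (mdiag k k) (\<lambda>t. mdiag (f t) (f t))"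
  unfolding mtop_def mdiag_def by (auto intro!: has_top_const)

lemma mtop_DP: "mtop 1 2 (DP v) (\<lambda>t. DP (u + t *\<^sub>R v))"
proof -
  have 1: "has_top (Suc 0) (2 * k) (\<lambda>t. 2 * (c + t * k))" for c k
    using has_top_affine[of "2 * k" "2 * c"] by (simp add: algebra_simps)
  have 3: "has_top 2 (3 * (k * k)) (\<lambda>t. 3 * ((c + t * k) * (c + t * k)))" for c k
  proof -
    have "has_top (1 + 1) ((3 * k) * k) (\<lambda>t. (3 * c + t * (3 * k)) * (c + t * k))"
      using has_top_mult[OF has_top_affine[of "3 * k" "3 * c"] has_top_affine[of k c]] by simp
    then show ?thesis by (simp add: algebra_simps numeral_2_eq_2)
  qed
  show ?thesis unfolding mtop_def DP_def using 1 3 by simp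
qed

lemma mtop_Dphi: "mtop 1 2 (DP v) (\<lambda>t. Dphi \<rho> (u + t *\<^sub>R v))"
proof -
  have "mtop 1 2 0 (\<lambda>t. mdiag \<rho> (\<rho> * \<rho>))" unfolding mtop_def mdiag_def by (simp add: has_top_const)
  from mtop_diff[OF mtop_DP this] show ?thesis by (simp add: Dphi_def)
qed

text \<open>The rows of \<open>EE\<close> have degrees 7 and 8: 3 from the scalar determinant, 3
  from the product with an adjugate, and 1 or 2 from the row of \<open>DP\<close>. The parameter
  \<rho> and the base points occur only in terms of lower degree, so the top coefficient is the
  value at \<rho> = 0 and at the directions themselves.\<close>

lemma DD_has_top:
  "has_top 15 (DD 0 v1 v2 v3) (\<lambda>t. DD \<rho> (b + t *\<^sub>R v1) (c + t *\<^sub>R v2) (d + t *\<^sub>R v3))"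
proof -
  have a: "(b + t *\<^sub>R v1) + (c + t *\<^sub>R v2) - (d + t *\<^sub>R v3) = (b + c - d) + t *\<^sub>R (v1 + v2 - v3)" for t
    by (simp add: algebra_simps)
  have z: "Dphi 0 x = DP x" for x unfolding Dphi_def mdiag_def by (simp flip: zero_prod_def)
  have dc: "has_top 3 (mdet (DP v2)) (\<lambda>t. mdet (DP (c + t *\<^sub>R v2)))"
    using mtop_mdet[OF mtop_DP, of v2 c] by (simp add: numeral_3_eq_3)
  have db: "has_top 3 (mdet (DP v1)) (\<lambda>t. mdet (Dphi \<rho> (b + t *\<^sub>R v1)))"
    using mtop_mdet[OF mtop_Dphi, of v1 \<rho> b] by (simp add: numeral_3_eq_3)
  note m1 = mtop_msc[OF dc mtop_mmul[OF mtop_diff[OF mtop_DP[of "v1 + v2 - v3" "b + c - d"] mtop_DP[of v1 b]]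
      mtop_madj_mmul[OF mtop_Dphi[of v1 \<rho> b] mtop_Dphi[of v3 \<rho> d], simplified, folded numeral_3_eq_3]]]
  have dd: "mtop 3 3 (mdiag (mdet (DP v2)) (mdet (DP v2))) (\<lambda>t. mdiag (mdet (DP (c + t *\<^sub>R v2))) (mdet (DP (c + t *\<^sub>R v2))))"
    by (rule mtop_mdiag[OF dc]) simp
  note m2 = mtop_msc[OF db mtop_mmul[OF mtop_DP[of "v1 + v2 - v3" "b + c - d"]
      mtop_diff[OF mtop_madj_mmul[OF mtop_DP[of v2 c] mtop_DP[of v3 d], simplified, folded numeral_3_eq_3] dd]]]
  show ?thesis
    using mtop_mdet[OF mtop_add[OF m1 m2]] unfolding DD_def EE_def a z by simp
qed

text \<open>With third direction 0 the first summand of \<open>EE\<close> vanishes, and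
  \<open>EE\<close> reduces to a scalar multiple of \<open>DP\<close> at 2v with v = (1,-1). The
  scalar is -(mdet (DP v))^2 = -144 and mdet (DP (2v)) = 96, so the value is 144^2 * 96.\<close>

lemma DD_top_nonzero: "DD 0 (1, -1) (1, -1) (0, 0) = 1990656"
  by (simp add: DD_def EE_def Dphi_def DP_def mdet_def madj_def mmul_def msc_def mdiag_def)

section \<open>Integration by parts along a vector field\<close>

abbreviation fd :: "('a::real_normed_vector \<Rightarrow> 'b::real_normed_vector) \<Rightarrow> 'a \<Rightarrow> 'a \<Rightarrow> 'b" where
  "fd f x \<equiv> frechet_derivative f (at x)"

text \<open>Continuity is required for each directional derivative separately, which avoids the
  topology of a space of operators. In finite dimension, expansion of the direction in a basis
  recovers joint continuity in point and direction; see
  \<open>continuous_fd_compose\<close>.\<close>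

definition C1 :: "('a::real_normed_vector \<Rightarrow> 'b::real_normed_vector) \<Rightarrow> bool" where
  "C1 f \<longleftrightarrow> (\<forall>x. f differentiable at x) \<and> (\<forall>v. continuous_on UNIV (\<lambda>x. fd f x v))"

lemma C1I:
  assumes "\<And>x. (f has_derivative f' x) (at x)" "\<And>v. continuous_on UNIV (\<lambda>x. f' x v)"
  shows "C1 f"
proof -
  have "fd f x = f' x" for x using frechet_derivative_at[OF assms(1)] by simp
  then show ?thesis unfolding C1_def using assms by (auto simp: differentiable_def)
qed

lemma C1_has_derivative: "C1 f \<Longrightarrow> (f has_derivative fd f x) (at x)"
  unfolding C1_def using frechet_derivative_works by blast

lemma C1_continuous_fd: "C1 f \<Longrightarrow> continuous_on UNIV (\<lambda>x. fd f x v)"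
  unfolding C1_def by blast

lemma C1_continuous: "C1 f \<Longrightarrow> continuous_on S f"
  by (meson C1_has_derivative continuous_at_imp_continuous_on has_derivative_continuous)

lemma C1_measurable: "C1 f \<Longrightarrow> f \<in> borel_measurable borel"
  by (intro borel_measurable_continuous_onI C1_continuous)

lemma fd_eqI: "(f has_derivative f') (at x) \<Longrightarrow> fd f x v = f' v"
  using frechet_derivative_at by fastforce

lemma C1_linear: "C1 f \<Longrightarrow> linear (fd f x)"
  using C1_has_derivative has_derivative_linear by blast

lemma fd_expand:
  fixes f :: "'a::euclidean_space \<Rightarrow> 'b::real_normed_vector"
  assumes "C1 f"
  shows "fd f x v = (\<Sum>b\<in>Basis. (v \<bullet> b) *\<^sub>R fd f x b)"
proof -
  have "fd f x v = fd f x (\<Sum>b\<in>Basis. (v \<bullet> b) *\<^sub>R b)" by (simp add: euclidean_representation)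
  also have "\<dots> = (\<Sum>b\<in>Basis. (v \<bullet> b) *\<^sub>R fd f x b)"
    using C1_linear[OF assms, of x] by (simp add: linear_sum linear_scale)
  finally show ?thesis .
qed

lemma continuous_fd_compose:
  fixes f :: "'a::euclidean_space \<Rightarrow> 'b::real_normed_vector" and g h :: "'c::topological_space \<Rightarrow> 'a"
  assumes f: "C1 f" and g: "continuous_on UNIV g" and h: "continuous_on UNIV h"
  shows "continuous_on UNIV (\<lambda>x. fd f (g x) (h x))"
proof -
  have "continuous_on UNIV (\<lambda>x. fd f (g x) b)" for b
    using continuous_on_compose2[OF C1_continuous_fd[OF f] g] by simp
  then show ?thesis
    by (subst fd_expand[OF f]) (intro continuous_intros h)
qed

lemma C1_const: "C1 (\<lambda>x. c)"
  by (rule C1I[where f' = "\<lambda>x v. 0"]) auto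

lemma C1_bounded_linear: "bounded_linear f \<Longrightarrow> C1 f"
  by (rule C1I[where f' = "\<lambda>x. f"]) (auto simp: bounded_linear_imp_has_derivative)

lemma C1_compose:
  fixes f :: "'a::euclidean_space \<Rightarrow> 'b::euclidean_space" and g :: "'b \<Rightarrow> 'c::real_normed_vector"
  assumes g: "C1 g" and f: "C1 f"
  shows "C1 (\<lambda>x. g (f x))" and fd_compose: "fd (\<lambda>x. g (f x)) x v = fd g (f x) (fd f x v)"
proof -
  have d: "((\<lambda>x. g (f x)) has_derivative (\<lambda>v. fd g (f x) (fd f x v))) (at x)" for x
    by (rule has_derivative_compose[OF C1_has_derivative[OF f] C1_has_derivative[OF g]])
  show "C1 (\<lambda>x. g (f x))"
    by (rule C1I[OF d]) (intro continuous_fd_compose g C1_continuous f C1_continuous_fd)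
  show "fd (\<lambda>x. g (f x)) x v = fd g (f x) (fd f x v)" by (rule fd_eqI[OF d])
qed

lemma C1_linear_compose:
  assumes L: "bounded_linear L" and f: "C1 f"
  shows "C1 (\<lambda>x. L (f x))" and fd_linear_compose: "fd (\<lambda>x. L (f x)) x v = L (fd f x v)"
proof -
  have d: "((\<lambda>x. L (f x)) has_derivative (\<lambda>v. L (fd f x v))) (at x)" for x
    by (rule bounded_linear.has_derivative[OF L C1_has_derivative[OF f]])
  show "C1 (\<lambda>x. L (f x))"
    by (rule C1I[OF d]) (intro bounded_linear.continuous_on[OF L] C1_continuous_fd f)
  show "fd (\<lambda>x. L (f x)) x v = L (fd f x v)" by (rule fd_eqI[OF d])
qed

lemma C1_add:
  assumes "C1 f" "C1 g"
  shows "C1 (\<lambda>x. f x + g x)" and fd_add: "fd (\<lambda>x. f x + g x) x v = fd f x v + fd g x v"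
proof -
  have d: "((\<lambda>x. f x + g x) has_derivative (\<lambda>v. fd f x v + fd g x v)) (at x)" for x
    by (intro has_derivative_add C1_has_derivative assms)
  show "C1 (\<lambda>x. f x + g x)" by (rule C1I[OF d]) (intro continuous_intros C1_continuous_fd assms)
  show "fd (\<lambda>x. f x + g x) x v = fd f x v + fd g x v" by (rule fd_eqI[OF d])
qed

lemma C1_diff:
  assumes "C1 f" "C1 g"
  shows "C1 (\<lambda>x. f x - g x)" and fd_diff: "fd (\<lambda>x. f x - g x) x v = fd f x v - fd g x v"
proof -
  have d: "((\<lambda>x. f x - g x) has_derivative (\<lambda>v. fd f x v - fd g x v)) (at x)" for x
    by (intro has_derivative_diff C1_has_derivative assms)
  show "C1 (\<lambda>x. f x - g x)" by (rule C1I[OF d]) (intro continuous_intros C1_continuous_fd assms)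
  show "fd (\<lambda>x. f x - g x) x v = fd f x v - fd g x v" by (rule fd_eqI[OF d])
qed

lemma C1_uminus: "C1 f \<Longrightarrow> C1 (\<lambda>x. - f x)"
  using C1_diff(1)[OF C1_const[of 0]] by simp

lemma C1_mult:
  fixes f g :: "'a::real_normed_vector \<Rightarrow> 'b::real_normed_algebra"
  assumes "C1 f" "C1 g"
  shows "C1 (\<lambda>x. f x * g x)" and fd_mult: "fd (\<lambda>x. f x * g x) x v = f x * fd g x v + fd f x v * g x"
proof -
  have d: "((\<lambda>x. f x * g x) has_derivative (\<lambda>v. f x * fd g x v + fd f x v * g x)) (at x)" for x
    by (intro has_derivative_mult C1_has_derivative assms)
  show "C1 (\<lambda>x. f x * g x)" by (rule C1I[OF d]) (intro continuous_intros C1_continuous_fd C1_continuous assms)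
  show "fd (\<lambda>x. f x * g x) x v = f x * fd g x v + fd f x v * g x" by (rule fd_eqI[OF d])
qed

lemma C1_scaleR:
  assumes "C1 f" "C1 g"
  shows "C1 (\<lambda>x. f x *\<^sub>R g x)" and fd_scaleR: "fd (\<lambda>x. f x *\<^sub>R g x) x v = f x *\<^sub>R fd g x v + fd f x v *\<^sub>R g x"
proof -
  have d: "((\<lambda>x. f x *\<^sub>R g x) has_derivative (\<lambda>v. f x *\<^sub>R fd g x v + fd f x v *\<^sub>R g x)) (at x)" for x
    by (intro has_derivative_scaleR C1_has_derivative assms)
  show "C1 (\<lambda>x. f x *\<^sub>R g x)" by (rule C1I[OF d]) (intro continuous_intros C1_continuous_fd C1_continuous assms)
  show "fd (\<lambda>x. f x *\<^sub>R g x) x v = f x *\<^sub>R fd g x v + fd f x v *\<^sub>R g x" by (rule fd_eqI[OF d])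
qed

lemma C1_power: "C1 f \<Longrightarrow> C1 (\<lambda>x. (f x :: 'b::{real_normed_algebra_1}) ^ n)"
  by (induction n) (simp_all add: C1_const C1_mult)

lemma C1_Pair:
  assumes "C1 f" "C1 g"
  shows "C1 (\<lambda>x. (f x, g x))" and fd_Pair: "fd (\<lambda>x. (f x, g x)) x v = (fd f x v, fd g x v)"
proof -
  have d: "((\<lambda>x. (f x, g x)) has_derivative (\<lambda>v. (fd f x v, fd g x v))) (at x)" for x
    by (intro has_derivative_Pair C1_has_derivative assms)
  show "C1 (\<lambda>x. (f x, g x))" by (rule C1I[OF d]) (intro continuous_intros C1_continuous_fd assms)
  show "fd (\<lambda>x. (f x, g x)) x v = (fd f x v, fd g x v)" by (rule fd_eqI[OF d])
qed

lemmas C1_fst = C1_linear_compose(1)[OF bounded_linear_fst]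
lemmas C1_snd = C1_linear_compose(1)[OF bounded_linear_snd]
lemmas C1_cnj = C1_linear_compose(1)[OF bounded_linear_cnj]
lemmas C1_of_real = C1_linear_compose(1)[OF bounded_linear_of_real]
lemmas C1_Re = C1_linear_compose(1)[OF bounded_linear_Re]
lemmas C1_Im = C1_linear_compose(1)[OF bounded_linear_Im]
lemma C1_id: "C1 (\<lambda>x. x)" by (rule C1_bounded_linear[OF bounded_linear_ident])
lemmas C1_intros = C1_id C1_const C1_fst C1_snd C1_cnj C1_of_real C1_Re C1_Im C1_add C1_diff C1_uminus
  C1_mult C1_scaleR C1_power C1_Pair

section \<open>Integrals of compactly supported derivatives\<close>

lemma integrable_continuous_support:
  fixes f :: "'a::euclidean_space \<Rightarrow> 'b::{banach,second_countable_topology}"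
  assumes "continuous_on UNIV f" "\<And>x. norm x > M \<Longrightarrow> f x = 0"
  shows "integrable lborel f"
proof -
  have "integrable lborel (\<lambda>x. indicator (cball 0 M) x *\<^sub>R f x)"
    by (rule borel_integrable_compact) (auto intro: continuous_on_subset[OF assms(1)])
  moreover have "(\<lambda>x. indicator (cball 0 M) x *\<^sub>R f x) = f"
    using assms(2) by (auto simp: indicator_def fun_eq_iff)
  ultimately show ?thesis by simp
qed

lemma fd_outside_support:
  assumes z: "\<And>x. norm x > M \<Longrightarrow> f x = 0" and x: "norm x > M"
  shows "fd f x v = 0"
proof (rule fd_eqI)
  show "(f has_derivative (\<lambda>v. 0)) (at x)"
  proof (rule has_derivative_transform_within_open[OF has_derivative_const])
    show "open {y. norm y > M}" by (intro open_Collect_less continuous_intros)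
  qed (use x z in auto)
qed

text \<open>The derivative is the limit of difference quotients, and each quotient has integral 0 by
  translation invariance. The mean value inequality bounds the quotients by \<open>K\<close>, and
  they vanish outside the ball of radius \<open>M + norm v\<close>, so dominated convergence
  applies.\<close>

lemma integral_fd_eq_0:
  fixes F :: "'a::euclidean_space \<Rightarrow> 'b::{banach,second_countable_topology}"
  assumes F: "C1 F" and M: "\<And>x. norm x > M \<Longrightarrow> F x = 0"
  shows "(LINT x|lborel. fd F x v) = 0"
proof -
  have cont: "continuous_on UNIV (\<lambda>x. fd F x v)" by (rule C1_continuous_fd[OF F])
  obtain K where K: "\<And>x. norm (fd F x v) \<le> K"
  proof -
    have "compact ((\<lambda>x. fd F x v) ` cball 0 M)"
      by (intro compact_continuous_image continuous_on_subset[OF cont]) auto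
    then obtain B where B: "B > 0" "\<And>x. x \<in> cball 0 M \<Longrightarrow> norm (fd F x v) \<le> B"
      by (auto simp: bounded_pos dest!: compact_imp_bounded)
    have "norm (fd F x v) \<le> B" for x
      using B(1) B(2)[of x] fd_outside_support[where f = F and M = M and x = x and v = v] M
      by (cases "norm x \<le> M") auto
    then show ?thesis by (rule that)
  qed
  have K0: "K \<ge> 0" using norm_ge_zero K by (rule order_trans)
  have [measurable]: "F \<in> borel_measurable borel" by (rule C1_measurable[OF F])
  define D where "D = (\<lambda>n x. real (Suc n) *\<^sub>R (F ((1 / real (Suc n)) *\<^sub>R v + x) - F x))"
  have Fi: "integrable lborel F" by (rule integrable_continuous_support[OF C1_continuous[OF F] M])
  have lim: "(\<lambda>n. LINT x|lborel. D n x) \<longlonglongrightarrow> (LINT x|lborel. fd F x v)"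
  proof (rule integral_dominated_convergence[where w = "\<lambda>x. K * indicator (cball 0 (M + norm v)) x"])
    show "(\<lambda>x. fd F x v) \<in> borel_measurable lborel" using borel_measurable_continuous_onI[OF cont] by simp
    show "D n \<in> borel_measurable lborel" for n unfolding D_def by measurable
    show "integrable lborel (\<lambda>x::'a. K * indicator (cball 0 (M + norm v)) x)"
      using emeasure_lborel_cball_finite[of "0::'a" "M + norm v"] by simp
    show "AE x in lborel. (\<lambda>n. D n x) \<longlonglongrightarrow> fd F x v"
    proof (rule AE_I2)
      fix x
      have "((\<lambda>t. t *\<^sub>R v + x) has_derivative (\<lambda>t. t *\<^sub>R v)) (at 0)"
        by (auto intro!: derivative_eq_intros)
      moreover have "(F has_derivative fd F x) (at (0 *\<^sub>R v + x))" using C1_has_derivative[OF F] by simp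
      ultimately have "((\<lambda>t. F (t *\<^sub>R v + x)) has_derivative (\<lambda>t. fd F x (t *\<^sub>R v))) (at 0)"
        by (rule has_derivative_compose)
      then have "((\<lambda>y. (1 / norm (y - 0)) *\<^sub>R (F (y *\<^sub>R v + x) - (F (0 *\<^sub>R v + x) + fd F x ((y - 0) *\<^sub>R v)))) \<longlongrightarrow> 0) (at (0::real))"
        unfolding has_derivative_within by blast
      moreover have "filterlim (\<lambda>n. 1 / real (Suc n)) (at (0::real)) sequentially"
        by (rule filterlim_atI[OF LIMSEQ_Suc[OF lim_1_over_n]]) simp
      ultimately have "(\<lambda>n. (1 / norm (1 / real (Suc n) - 0)) *\<^sub>R (F ((1 / real (Suc n)) *\<^sub>R v + x) -
          (F (0 *\<^sub>R v + x) + fd F x ((1 / real (Suc n) - 0) *\<^sub>R v)))) \<longlonglongrightarrow> 0"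
        by (rule filterlim_compose)
      moreover have "(1 / norm (1 / real (Suc n) - 0)) *\<^sub>R (F ((1 / real (Suc n)) *\<^sub>R v + x) -
          (F (0 *\<^sub>R v + x) + fd F x ((1 / real (Suc n) - 0) *\<^sub>R v))) = D n x - fd F x v" for n
        by (simp add: D_def linear_scale[OF C1_linear[OF F]] scaleR_diff_right diff_diff_eq[symmetric])
      ultimately have "(\<lambda>n. D n x - fd F x v) \<longlonglongrightarrow> 0" by simp
      then show "(\<lambda>n. D n x) \<longlonglongrightarrow> fd F x v" by (rule LIM_zero_cancel)
    qed
    show "AE x in lborel. norm (D n x) \<le> K * indicator (cball 0 (M + norm v)) x" for n
    proof (rule AE_I2)
      fix x
      let ?h = "1 / real (Suc n)"
      show "norm (D n x) \<le> K * indicator (cball 0 (M + norm v)) x"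
      proof (cases "norm x \<le> M + norm v")
        case True
        have "norm (F (?h *\<^sub>R v + x) - F x) \<le> norm (?h - 0) * K"
        proof -
          let ?g = "\<lambda>t. F (t *\<^sub>R v + x)"
          have "(?g has_derivative (\<lambda>t. t *\<^sub>R fd F (s *\<^sub>R v + x) v)) (at s within {0..?h})" for s
          proof -
            have "((\<lambda>t. t *\<^sub>R v + x) has_derivative (\<lambda>t. t *\<^sub>R v)) (at s within {0..?h})"
              by (auto intro!: derivative_eq_intros)
            from has_derivative_compose[OF this C1_has_derivative[OF F]]
            show ?thesis by (simp add: linear_scale[OF C1_linear[OF F]])
          qed
          then have "norm (?g ?h - ?g 0) \<le> K * norm (?h - 0)"
          proof (rule differentiable_bound[rotated 1])
            show "onorm (\<lambda>t. t *\<^sub>R fd F (s *\<^sub>R v + x) v) \<le> K" for s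
            proof (rule onorm_le)
              fix t :: real
              show "norm (t *\<^sub>R fd F (s *\<^sub>R v + x) v) \<le> K * norm t"
                using mult_right_mono[OF K[of "s *\<^sub>R v + x"], of "\<bar>t\<bar>"] by (simp add: mult.commute)
            qed
          qed auto
          then show ?thesis by (simp add: mult.commute)
        qed
        then have "real (Suc n) * norm (F (?h *\<^sub>R v + x) - F x) \<le> K"
          by (simp add: field_simps)
        then show ?thesis using True by (simp add: D_def)
      next
        case False
        have h: "norm (?h *\<^sub>R v) \<le> norm v" by (simp add: divide_le_eq mult_le_cancel_left1)
        have "norm x \<le> norm (?h *\<^sub>R v + x) + norm (?h *\<^sub>R v)"
          using norm_triangle_ineq4[of "?h *\<^sub>R v + x" "?h *\<^sub>R v"] by simp
        then have "norm (?h *\<^sub>R v + x) > M" using False h by linarith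
        moreover have "norm x > M" using False norm_ge_zero[of v] by linarith
        ultimately show ?thesis using False by (simp add: D_def M del: norm_scaleR)
      qed
    qed
  qed
  have "(LINT x|lborel. D n x) = 0" for n
  proof -
    let ?c = "(1 / real (Suc n)) *\<^sub>R v"
    have "integrable lborel (\<lambda>x. F (?c + x))"
    proof (rule integrable_continuous_support)
      show "continuous_on UNIV (\<lambda>x. F (?c + x))"
        by (rule continuous_on_compose2[OF C1_continuous[OF F, of UNIV]]) (auto intro!: continuous_intros)
      show "F (?c + x) = 0" if "norm x > M + norm ?c" for x
        using that norm_triangle_ineq4[of "?c + x" ?c] by (intro M) (simp del: norm_scaleR)
    qed
    then have "(LINT x|lborel. F (?c + x) - F x) = 0"
      using Fi lborel_integral_shift[of F ?c] by simp
    then show ?thesis by (simp add: D_def)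
  qed
  then show ?thesis using lim by (simp add: LIMSEQ_const_iff)
qed

definition divg :: "('a::euclidean_space \<Rightarrow> 'a) \<Rightarrow> 'a \<Rightarrow> real" where
  "divg Z x = (\<Sum>b\<in>Basis. fd Z x b \<bullet> b)"

text \<open>For each basis vector \<open>b\<close> the derivative in direction \<open>b\<close> of
  the component \<open>Z x \<bullet> b\<close> times \<open>H\<close> integrates to 0. The sum over
  \<open>b\<close>, with the product rule, is the claim.\<close>

lemma divergence_theorem:
  fixes H :: "'a::euclidean_space \<Rightarrow> complex"
  assumes H: "C1 H" and M: "\<And>x. norm x > M \<Longrightarrow> H x = 0" and Z: "C1 Z"
  shows "(LINT x|lborel. fd H x (Z x)) = - (LINT x|lborel. divg Z x *\<^sub>R H x)"
proof -
  have Zb: "C1 (\<lambda>x. Z x \<bullet> b)" and fdZb: "fd (\<lambda>x. Z x \<bullet> b) x v = fd Z x v \<bullet> b" for b x v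
    using C1_linear_compose[OF bounded_linear_inner_left Z] by auto
  have F: "C1 (\<lambda>x. (Z x \<bullet> b) *\<^sub>R H x)" for b by (intro C1_scaleR Zb H)
  have 1: "(LINT x|lborel. (Z x \<bullet> b) *\<^sub>R fd H x b + (fd Z x b \<bullet> b) *\<^sub>R H x) = 0" for b
    using integral_fd_eq_0[OF F[of b], of M b] M by (simp add: fd_scaleR[OF Zb H] fdZb)
  have i1: "integrable lborel (\<lambda>x. (Z x \<bullet> b) *\<^sub>R fd H x b)" for b
  proof (rule integrable_continuous_support)
    show "continuous_on UNIV (\<lambda>x. (Z x \<bullet> b) *\<^sub>R fd H x b)"
      by (intro continuous_on_scaleR continuous_on_inner continuous_on_const C1_continuous[OF Z] C1_continuous_fd[OF H])
    show "(Z x \<bullet> b) *\<^sub>R fd H x b = 0" if "norm x > M" for x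
      using fd_outside_support[OF M that] by simp
  qed
  have i2: "integrable lborel (\<lambda>x. (fd Z x b \<bullet> b) *\<^sub>R H x)" for b
  proof (rule integrable_continuous_support)
    show "continuous_on UNIV (\<lambda>x. (fd Z x b \<bullet> b) *\<^sub>R H x)"
      by (intro continuous_on_scaleR continuous_on_inner continuous_on_const C1_continuous[OF H] C1_continuous_fd[OF Z])
    show "(fd Z x b \<bullet> b) *\<^sub>R H x = 0" if "norm x > M" for x
      using M[OF that] by simp
  qed
  have "(LINT x|lborel. fd H x (Z x)) = (\<Sum>b\<in>Basis. LINT x|lborel. (Z x \<bullet> b) *\<^sub>R fd H x b)"
    unfolding fd_expand[OF H, of _ "Z _"] by (rule Bochner_Integration.integral_sum) (rule i1)
  also have "\<dots> = (\<Sum>b\<in>Basis. - (LINT x|lborel. (fd Z x b \<bullet> b) *\<^sub>R H x))"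
  proof (rule sum.cong[OF refl])
    fix b show "(LINT x|lborel. (Z x \<bullet> b) *\<^sub>R fd H x b) = - (LINT x|lborel. (fd Z x b \<bullet> b) *\<^sub>R H x)"
      using 1[of b] i1[of b] i2[of b] by (simp add: eq_neg_iff_add_eq_0)
  qed
  also have "\<dots> = - (LINT x|lborel. divg Z x *\<^sub>R H x)"
    unfolding divg_def scaleR_sum_left sum_negf
    by (subst Bochner_Integration.integral_sum) (use i2 in auto)
  finally show ?thesis .
qed

lemma C1_regularised_inverse:
  fixes D :: "'a::euclidean_space \<Rightarrow> real"
  assumes D: "C1 D" and e: "e > 0"
  shows "C1 (\<lambda>x. D x / ((D x)\<^sup>2 + e\<^sup>2))"
    and "fd (\<lambda>x. D x / ((D x)\<^sup>2 + e\<^sup>2)) x v = fd D x v * (e\<^sup>2 - (D x)\<^sup>2) / ((D x)\<^sup>2 + e\<^sup>2)\<^sup>2"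
proof -
  have pos: "t\<^sup>2 + e\<^sup>2 \<noteq> 0" for t :: real
  proof -
    have "t\<^sup>2 + e\<^sup>2 > 0" using e by (simp add: add_nonneg_pos)
    then show ?thesis by (rule less_imp_neq[symmetric])
  qed
  have d: "((\<lambda>x. D x / ((D x)\<^sup>2 + e\<^sup>2)) has_derivative (\<lambda>v. fd D x v * (e\<^sup>2 - (D x)\<^sup>2) / ((D x)\<^sup>2 + e\<^sup>2)\<^sup>2)) (at x)" for x
  proof (rule has_derivative_eq_rhs)
    show "((\<lambda>x. D x / ((D x)\<^sup>2 + e\<^sup>2)) has_derivative (\<lambda>h. (fd D x h * ((D x)\<^sup>2 + e\<^sup>2) - D x * (2 * D x * fd D x h)) / (((D x)\<^sup>2 + e\<^sup>2) * ((D x)\<^sup>2 + e\<^sup>2)))) (at x)"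
      by (rule has_derivative_divide') (use pos e in \<open>auto intro!: derivative_eq_intros C1_has_derivative[OF D]\<close>)
  qed (auto simp: fun_eq_iff power2_eq_square algebra_simps)
  show "C1 (\<lambda>x. D x / ((D x)\<^sup>2 + e\<^sup>2))"
    by (rule C1I[OF d]) (use pos e in \<open>auto intro!: continuous_intros C1_continuous_fd[OF D] C1_continuous[OF D]\<close>)
  show "fd (\<lambda>x. D x / ((D x)\<^sup>2 + e\<^sup>2)) x v = fd D x v * (e\<^sup>2 - (D x)\<^sup>2) / ((D x)\<^sup>2 + e\<^sup>2)\<^sup>2"
    by (rule fd_eqI[OF d])
qed

text \<open>The integrand is \<open>Z(G) * om * D / (D\<^sup>2 + e\<^sup>2)\<close>, so that integration by parts never divides
  by \<open>D\<close> itself.\<close>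

lemma vector_field_oscillation:
  fixes G om g :: "'a::euclidean_space \<Rightarrow> complex" and D :: "'a \<Rightarrow> real"
  assumes G: "C1 G" and om: "C1 om" and D: "C1 D" and Z: "C1 Z" and e: "0 < e" "e \<le> 1"
    and M: "\<And>x. norm x > M \<Longrightarrow> om x = 0"
    and transport: "\<And>x. fd G x (Z x) = of_real (D x) * g x"
    and bG: "\<And>x. norm x \<le> M \<Longrightarrow> cmod (G x) \<le> gam"
    and bom: "\<And>x. norm x \<le> M \<Longrightarrow> cmod (om x) \<le> m0" "\<And>x. norm x \<le> M \<Longrightarrow> cmod (fd om x (Z x)) \<le> m1"
    and bD: "\<And>x. norm x \<le> M \<Longrightarrow> \<bar>fd D x (Z x)\<bar> \<le> d1" and bZ: "\<And>x. norm x \<le> M \<Longrightarrow> \<bar>divg Z x\<bar> \<le> d2"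
  shows "cmod (LINT x|lborel. g x * om x * of_real ((D x)\<^sup>2 / ((D x)\<^sup>2 + e\<^sup>2)))
    \<le> gam * (m1 + m0 * d1 + m0 * d2) / e\<^sup>2 * measure lborel (cball 0 M :: 'a set)"
proof -
  define Q where "Q = (\<lambda>x. D x / ((D x)\<^sup>2 + e\<^sup>2))"
  have Q: "C1 Q" and Q': "fd Q x v = fd D x v * (e\<^sup>2 - (D x)\<^sup>2) / ((D x)\<^sup>2 + e\<^sup>2)\<^sup>2" for x v
    unfolding Q_def using C1_regularised_inverse[OF D e(1)] by auto
  define H where "H = (\<lambda>x. (G x * om x) * complex_of_real (Q x))"
  have cQ: "C1 (\<lambda>x. complex_of_real (Q x))" and fdcQ: "fd (\<lambda>x. complex_of_real (Q x)) x v = of_real (fd Q x v)" for x v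
    using C1_linear_compose[OF bounded_linear_of_real Q] by auto
  have Go: "C1 (\<lambda>x. G x * om x)" by (intro C1_mult G om)
  have H: "C1 H" unfolding H_def by (intro C1_mult Go cQ)
  have HM: "H x = 0" if "norm x > M" for x using M[OF that] by (simp add: H_def)
  have pos: "(D x)\<^sup>2 + e\<^sup>2 > 0" for x using e by (simp add: add_nonneg_pos)
  \<comment> \<open>The terms in which the field differentiates \<open>Q\<close> or
    \<open>om\<close>. The term in which it differentiates \<open>G\<close> is the integrand to be
    estimated: transport gives \<open>D * g\<close>, and \<open>D * Q\<close> is the weight
    \<open>D\<^sup>2 / (D\<^sup>2 + e\<^sup>2)\<close>.\<close>
  define E where "E = (\<lambda>x. G x * om x * of_real (fd Q x (Z x)) + G x * fd om x (Z x) * of_real (Q x))"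
  have fdH: "fd H x (Z x) = g x * om x * of_real ((D x)\<^sup>2 / ((D x)\<^sup>2 + e\<^sup>2)) + E x" for x
  proof -
    have "fd H x (Z x) = G x * om x * of_real (fd Q x (Z x)) + (G x * fd om x (Z x) + fd G x (Z x) * om x) * of_real (Q x)"
      unfolding H_def by (simp add: fd_mult[OF Go cQ] fd_mult[OF G om] fdcQ)
    moreover have "fd G x (Z x) * om x * of_real (Q x) = g x * om x * of_real ((D x)\<^sup>2 / ((D x)\<^sup>2 + e\<^sup>2))"
      by (simp add: transport Q_def power2_eq_square)
    ultimately show ?thesis by (simp add: E_def algebra_simps)
  qed
  have cE: "continuous_on UNIV E"
    unfolding E_def
    by (intro continuous_intros C1_continuous[OF G] C1_continuous[OF om] C1_continuous[OF Q]
        continuous_fd_compose[OF Q _ C1_continuous[OF Z]] continuous_fd_compose[OF om _ C1_continuous[OF Z]])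
  have EM: "E x = 0" if "norm x > M" for x
    using M[OF that] fd_outside_support[where f = om and M = M and x = x and v = "Z x"] M that by (simp add: E_def)
  have cdiv: "continuous_on UNIV (\<lambda>x. divg Z x *\<^sub>R H x)"
    unfolding divg_def by (intro continuous_intros C1_continuous_fd[OF Z] C1_continuous[OF H])
  have iE: "integrable lborel E" by (rule integrable_continuous_support[OF cE EM])
  have iH: "integrable lborel (\<lambda>x. fd H x (Z x))"
    by (rule integrable_continuous_support[OF continuous_fd_compose[OF H continuous_on_id C1_continuous[OF Z]]])
       (rule fd_outside_support[OF HM])
  have idiv: "integrable lborel (\<lambda>x. divg Z x *\<^sub>R H x)"
    by (rule integrable_continuous_support[OF cdiv, where M = M]) (simp add: HM)
  have "(LINT x|lborel. g x * om x * of_real ((D x)\<^sup>2 / ((D x)\<^sup>2 + e\<^sup>2))) = (LINT x|lborel. fd H x (Z x) - E x)"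
    by (simp add: fdH)
  also have "\<dots> = (LINT x|lborel. fd H x (Z x)) - (LINT x|lborel. E x)" by (rule Bochner_Integration.integral_diff[OF iH iE])
  also have "\<dots> = - (LINT x|lborel. divg Z x *\<^sub>R H x + E x)"
    using divergence_theorem[OF H HM Z] Bochner_Integration.integral_add[OF idiv iE] by simp
  finally have eq: "cmod (LINT x|lborel. g x * om x * of_real ((D x)\<^sup>2 / ((D x)\<^sup>2 + e\<^sup>2)))
      = cmod (LINT x|lborel. divg Z x *\<^sub>R H x + E x)" by simp
  \<comment> \<open>The sharp bound is 1/(2e). The weaker one, valid since \<open>e \<le> 1\<close>,
    gives all error terms the same denominator as the derivative of \<open>Q\<close>.\<close>
  have bQ: "\<bar>Q x\<bar> \<le> 1 / e\<^sup>2" for x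
  proof -
    have "e\<^sup>2 * \<bar>D x\<bar> \<le> e * \<bar>D x\<bar>"
      using e by (intro mult_right_mono) (auto simp: power2_eq_square mult_left_le)
    also have "\<dots> \<le> 2 * e * \<bar>D x\<bar>" using e by simp
    also have "\<dots> \<le> (D x)\<^sup>2 + e\<^sup>2" using sum_squares_bound[of e "\<bar>D x\<bar>"] by simp
    finally show ?thesis using e pos[of x] by (simp add: Q_def abs_divide divide_simps mult.commute)
  qed
  have bQ': "\<bar>fd Q x v\<bar> \<le> \<bar>fd D x v\<bar> / e\<^sup>2" for x v
  proof -
    have 1: "\<bar>e\<^sup>2 - (D x)\<^sup>2\<bar> \<le> (D x)\<^sup>2 + e\<^sup>2" by (simp add: abs_le_iff)
    have "\<bar>fd Q x v\<bar> = \<bar>fd D x v\<bar> * (\<bar>e\<^sup>2 - (D x)\<^sup>2\<bar> / ((D x)\<^sup>2 + e\<^sup>2)\<^sup>2)"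
      by (simp add: Q' abs_mult abs_divide)
    also have "\<dots> \<le> \<bar>fd D x v\<bar> * (((D x)\<^sup>2 + e\<^sup>2) / ((D x)\<^sup>2 + e\<^sup>2)\<^sup>2)"
      by (intro mult_left_mono divide_right_mono 1) auto
    also have "\<dots> = \<bar>fd D x v\<bar> / ((D x)\<^sup>2 + e\<^sup>2)" using pos[of x] by (simp add: power2_eq_square)
    also have "\<dots> \<le> \<bar>fd D x v\<bar> / e\<^sup>2" using e by (intro divide_left_mono) (auto intro!: mult_pos_pos pos)
    finally show ?thesis .
  qed
  have bound: "cmod (divg Z x *\<^sub>R H x + E x) \<le> gam * (m1 + m0 * d1 + m0 * d2) / e\<^sup>2 * indicator (cball 0 M) x" for x
  proof (cases "norm x \<le> M")
    case True
    note b = bG[OF True] bom[OF True] bD[OF True] bZ[OF True]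
    have g0: "gam \<ge> 0" "m0 \<ge> 0" "m1 \<ge> 0" "d1 \<ge> 0" "d2 \<ge> 0" using b by (auto intro: order_trans[OF norm_ge_zero] order_trans[OF abs_ge_zero])
    have "cmod (divg Z x *\<^sub>R H x) = \<bar>divg Z x\<bar> * (cmod (G x) * cmod (om x) * \<bar>Q x\<bar>)" by (simp add: H_def norm_mult)
    also have "\<dots> \<le> d2 * (gam * m0 * (1 / e\<^sup>2))" using b bQ[of x] g0 by (intro mult_mono) auto
    finally have 1: "cmod (divg Z x *\<^sub>R H x) \<le> d2 * (gam * m0 * (1 / e\<^sup>2))" .
    have "cmod (G x * om x * of_real (fd Q x (Z x))) = cmod (G x) * cmod (om x) * \<bar>fd Q x (Z x)\<bar>" by (simp add: norm_mult)
    also have "\<dots> \<le> gam * m0 * (d1 / e\<^sup>2)"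
      using b g0 order_trans[OF bQ' divide_right_mono[OF b(4)]] by (intro mult_mono) auto
    finally have 2: "cmod (G x * om x * of_real (fd Q x (Z x))) \<le> gam * m0 * (d1 / e\<^sup>2)" .
    have "cmod (G x * fd om x (Z x) * of_real (Q x)) = cmod (G x) * cmod (fd om x (Z x)) * \<bar>Q x\<bar>" by (simp add: norm_mult)
    also have "\<dots> \<le> gam * m1 * (1 / e\<^sup>2)" using b g0 bQ[of x] by (intro mult_mono) auto
    finally have 3: "cmod (G x * fd om x (Z x) * of_real (Q x)) \<le> gam * m1 * (1 / e\<^sup>2)" .
    have "cmod (divg Z x *\<^sub>R H x + E x) \<le> d2 * (gam * m0 * (1 / e\<^sup>2)) + (gam * m0 * (d1 / e\<^sup>2) + gam * m1 * (1 / e\<^sup>2))"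
      unfolding E_def by (intro norm_triangle_le add_mono 1 order_trans[OF norm_triangle_ineq add_mono[OF 2 3]])
    then show ?thesis using True by (simp add: algebra_simps add_divide_distrib)
  next
    case False
    then show ?thesis using HM[of x] EM[of x] by simp
  qed
  have "cmod (LINT x|lborel. divg Z x *\<^sub>R H x + E x) \<le> (LINT x|lborel. gam * (m1 + m0 * d1 + m0 * d2) / e\<^sup>2 * indicator (cball 0 M) (x::'a))"
  proof (rule order_trans[OF integral_norm_bound], rule integral_mono)
    show "integrable lborel (\<lambda>x. cmod (divg Z x *\<^sub>R H x + E x))" using idiv iE by auto
    show "integrable lborel (\<lambda>x::'a. gam * (m1 + m0 * d1 + m0 * d2) / e\<^sup>2 * indicator (cball 0 M) x)"
      using emeasure_lborel_cball_finite[of "0::'a" M] by (intro integrable_mult_right) simp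
  qed (rule bound)
  also have "\<dots> = gam * (m1 + m0 * d1 + m0 * d2) / e\<^sup>2 * measure lborel (cball 0 M :: 'a set)"
    by simp
  finally show ?thesis unfolding eq .
qed

section \<open>The vector field that moves only the first point\<close>

lemma mapp_linear_simps:
  "mapp A (u + v) = mapp A u + mapp A v" "mapp A (u - v) = mapp A u - mapp A v"
  "mapp A (k *\<^sub>R u) = k *\<^sub>R mapp A u" "mapp A (- u) = - mapp A u"
  "mapp (A + B) u = mapp A u + mapp B u" "mapp (A - B) u = mapp A u - mapp B u"
  "mapp (msc k A) u = k *\<^sub>R mapp A u" "mapp (mmul A B) u = mapp A (mapp B u)"
  "mapp (mdiag k k) u = k *\<^sub>R u" "mapp A (mapp (madj A) u) = mdet A *\<^sub>R u"
  by (simp_all add: mapp_def msc_def mmul_def mdiag_def madj_def mdet_def prod_eq_iff algebra_simps)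

text \<open>The vector field along which only the first of the four points moves. The argument \<open>e\<close> is
  the direction of its motion.\<close>

definition Zw :: "real \<Rightarrow> real \<times> real \<Rightarrow> real \<times> real \<Rightarrow> real \<times> real \<Rightarrow> real \<times> real \<Rightarrow> real \<times> real" where
  "Zw \<rho> b c d e = mapp (madj (EE \<rho> b c d)) e"

definition Zb :: "real \<Rightarrow> real \<times> real \<Rightarrow> real \<times> real \<Rightarrow> real \<times> real \<Rightarrow> real \<times> real \<Rightarrow> real \<times> real" where
  "Zb \<rho> b c d e = mdet (DP c) *\<^sub>R mapp (madj (Dphi \<rho> b)) (mapp (Dphi \<rho> d) (Zw \<rho> b c d e))"

definition Zc :: "real \<Rightarrow> real \<times> real \<Rightarrow> real \<times> real \<Rightarrow> real \<times> real \<Rightarrow> real \<times> real \<Rightarrow> real \<times> real" where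
  "Zc \<rho> b c d e = mdet (Dphi \<rho> b) *\<^sub>R mapp (madj (DP c)) (mapp (DP d) (Zw \<rho> b c d e))"

definition Zd :: "real \<Rightarrow> real \<times> real \<Rightarrow> real \<times> real \<Rightarrow> real \<times> real \<Rightarrow> real \<times> real \<Rightarrow> real \<times> real" where
  "Zd \<rho> b c d e = (mdet (DP c) * mdet (Dphi \<rho> b)) *\<^sub>R Zw \<rho> b c d e"

text \<open>\<open>Zb\<close>, \<open>Zc\<close>, \<open>Zd\<close> are the velocities of
  \<open>b\<close>, \<open>c\<close>, \<open>d\<close>, all driven by \<open>Zw\<close>. The first
  two identities are the constraints that fix the last two points, solved by A * adj A = det A. In
  the third, the velocity of the first point is \<open>EE\<close> applied to \<open>Zw\<close>;
  since \<open>Zw\<close> is the adjugate of \<open>EE\<close> applied to \<open>e\<close>, the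
  result is the determinant times \<open>e\<close>.\<close>

lemma Z_identities:
  "mapp (DP c) (Zc \<rho> b c d e) = mapp (DP d) (Zd \<rho> b c d e)"
  "mapp (Dphi \<rho> b) (Zb \<rho> b c d e) = mapp (Dphi \<rho> d) (Zd \<rho> b c d e)"
  "mapp (DP (b + c - d)) (Zb \<rho> b c d e + Zc \<rho> b c d e - Zd \<rho> b c d e) - mapp (DP b) (Zb \<rho> b c d e) = DD \<rho> b c d *\<^sub>R e"
proof -
  show "mapp (DP c) (Zc \<rho> b c d e) = mapp (DP d) (Zd \<rho> b c d e)"
    by (simp add: Zc_def Zd_def mapp_linear_simps mult.commute)
  show "mapp (Dphi \<rho> b) (Zb \<rho> b c d e) = mapp (Dphi \<rho> d) (Zd \<rho> b c d e)"
    by (simp add: Zb_def Zd_def mapp_linear_simps)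
  have "DD \<rho> b c d *\<^sub>R e = mapp (EE \<rho> b c d) (Zw \<rho> b c d e)"
    by (simp add: DD_def Zw_def mapp_linear_simps)
  also have "\<dots> = mapp (DP (b + c - d)) (Zb \<rho> b c d e + Zc \<rho> b c d e - Zd \<rho> b c d e) - mapp (DP b) (Zb \<rho> b c d e)"
    unfolding EE_def mapp_linear_simps Zb_def Zc_def Zd_def by (simp add: mapp_linear_simps algebra_simps)
  finally show "mapp (DP (b + c - d)) (Zb \<rho> b c d e + Zc \<rho> b c d e - Zd \<rho> b c d e) - mapp (DP b) (Zb \<rho> b c d e) = DD \<rho> b c d *\<^sub>R e" ..
qed

section \<open>Regularity of the field, the curve map and the cutoffs\<close>

type_synonym vec = "real \<times> real"
type_synonym vec3 = "vec \<times> vec \<times> vec"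

text \<open>The encoding of matrices as nested pairs pays off here: regularity of every matrix
  expression follows from the rules for projections, pairs, sums and products.\<close>

lemma C1_mdet: "C1 F \<Longrightarrow> C1 (\<lambda>x. mdet (F x))" for F :: "'a::euclidean_space \<Rightarrow> mat2"
  unfolding mdet_def by (intro C1_intros)
lemma C1_madj: "C1 F \<Longrightarrow> C1 (\<lambda>x. madj (F x))" for F :: "'a::euclidean_space \<Rightarrow> mat2"
  unfolding madj_def by (intro C1_intros)
lemma C1_mapp: "C1 F \<Longrightarrow> C1 u \<Longrightarrow> C1 (\<lambda>x. mapp (F x) (u x))" for F :: "'a::euclidean_space \<Rightarrow> mat2"
  unfolding mapp_def by (intro C1_intros)
lemma C1_mmul: "C1 F \<Longrightarrow> C1 G \<Longrightarrow> C1 (\<lambda>x. mmul (F x) (G x))" for F :: "'a::euclidean_space \<Rightarrow> mat2"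
  unfolding mmul_def by (intro C1_intros)
lemma C1_msc: "C1 f \<Longrightarrow> C1 F \<Longrightarrow> C1 (\<lambda>x. msc (f x) (F x))" for F :: "'a::euclidean_space \<Rightarrow> mat2"
  unfolding msc_def by (intro C1_intros)
lemma C1_mdiag: "C1 f \<Longrightarrow> C1 (\<lambda>x. mdiag (f x) (f x))" for f :: "'a::euclidean_space \<Rightarrow> real"
  unfolding mdiag_def by (intro C1_intros)
lemma C1_DP: "C1 u \<Longrightarrow> C1 (\<lambda>x. DP (u x))" for u :: "'a::euclidean_space \<Rightarrow> vec"
  unfolding DP_def by (intro C1_intros)
lemma C1_Dphi: "C1 f \<Longrightarrow> C1 u \<Longrightarrow> C1 (\<lambda>x. Dphi (f x) (u x))" for u :: "'a::euclidean_space \<Rightarrow> vec"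
  unfolding Dphi_def DP_def mdiag_def by (intro C1_intros)

text \<open>The parameter \<rho> is allowed to vary with \<open>x\<close> as well. The bounds for
  the field are later obtained by compactness in all variables at once, \<rho> included, which is
  how they become independent of \<open>R\<close>.\<close>

lemma C1_EE: "C1 f \<Longrightarrow> C1 u \<Longrightarrow> C1 v \<Longrightarrow> C1 w \<Longrightarrow> C1 (\<lambda>x. EE (f x) (u x) (v x) (w x))" for f :: "'a::euclidean_space \<Rightarrow> real"
  unfolding EE_def by (intro C1_add C1_diff C1_msc C1_mmul C1_mdet C1_madj C1_mdiag C1_DP C1_Dphi)
lemma C1_DD: "C1 f \<Longrightarrow> C1 u \<Longrightarrow> C1 v \<Longrightarrow> C1 w \<Longrightarrow> C1 (\<lambda>x. DD (f x) (u x) (v x) (w x))" for f :: "'a::euclidean_space \<Rightarrow> real"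
  unfolding DD_def by (intro C1_mdet C1_EE)
lemma C1_Zw: "C1 f \<Longrightarrow> C1 u \<Longrightarrow> C1 v \<Longrightarrow> C1 w \<Longrightarrow> C1 z \<Longrightarrow> C1 (\<lambda>x. Zw (f x) (u x) (v x) (w x) (z x))" for f :: "'a::euclidean_space \<Rightarrow> real"
  unfolding Zw_def by (intro C1_mapp C1_madj C1_EE)
lemma C1_Zb: "C1 f \<Longrightarrow> C1 u \<Longrightarrow> C1 v \<Longrightarrow> C1 w \<Longrightarrow> C1 z \<Longrightarrow> C1 (\<lambda>x. Zb (f x) (u x) (v x) (w x) (z x))" for f :: "'a::euclidean_space \<Rightarrow> real"
  unfolding Zb_def by (intro C1_scaleR C1_mdet C1_mapp C1_madj C1_DP C1_Dphi C1_Zw)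
lemma C1_Zc: "C1 f \<Longrightarrow> C1 u \<Longrightarrow> C1 v \<Longrightarrow> C1 w \<Longrightarrow> C1 z \<Longrightarrow> C1 (\<lambda>x. Zc (f x) (u x) (v x) (w x) (z x))" for f :: "'a::euclidean_space \<Rightarrow> real"
  unfolding Zc_def by (intro C1_scaleR C1_mdet C1_mapp C1_madj C1_DP C1_Dphi C1_Zw)
lemma C1_Zd: "C1 f \<Longrightarrow> C1 u \<Longrightarrow> C1 v \<Longrightarrow> C1 w \<Longrightarrow> C1 z \<Longrightarrow> C1 (\<lambda>x. Zd (f x) (u x) (v x) (w x) (z x))" for f :: "'a::euclidean_space \<Rightarrow> real"
  unfolding Zd_def by (intro C1_scaleR C1_mult C1_mdet C1_DP C1_Dphi C1_Zw)

text \<open>The dilation written in \<rho> = 1/R. It is polynomial in \<rho>, so \<rho> = 0 is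
  admissible and R \<ge> 1 corresponds to a subset of the compact interval [0,1].\<close>

definition Bd :: "real \<Rightarrow> vec \<Rightarrow> vec" where "Bd \<rho> t = (\<rho> * fst t, \<rho> * \<rho> * snd t)"

lemma dil_eq_Bd: "dil R = Bd (1 / R)"
  by (auto simp: dil_def Bd_def power2_eq_square)

lemma C1_P: "C1 P" unfolding P_def by (intro C1_intros)
lemma C1_Bd: "C1 u \<Longrightarrow> C1 (\<lambda>x. Bd \<rho> (u x))" for u :: "'a::real_normed_vector \<Rightarrow> vec"
  unfolding Bd_def by (intro C1_intros)

lemma fd_P: "fd P t v = mapp (DP t) v"
proof (rule fd_eqI)
  show "(P has_derivative (\<lambda>v. mapp (DP t) v)) (at t)"
    unfolding P_def mapp_def DP_def
    by (auto intro!: derivative_eq_intros simp: fun_eq_iff power2_eq_square)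
qed

lemma Bd_linear: "bounded_linear (Bd \<rho>)"
  unfolding Bd_def by (intro bounded_linear_Pair bounded_linear_const_mult bounded_linear_fst bounded_linear_snd)

text \<open>An explicit cutoff of class C1, as the square of a positive part. It is not normalised:
  it is at least 1 for arguments up to 4 in absolute value, vanishes from 5 on, and is bounded by
  25^2 = 625, so that \<open>bump\<close> is bounded by 625^2 = 390625.\<close>

definition bumpr :: "real \<Rightarrow> real" where "bumpr t = (max 0 (25 - t\<^sup>2))\<^sup>2"
definition bump :: "vec \<Rightarrow> real" where "bump x = bumpr (fst x) * bumpr (snd x)"

lemma C1_bumpr: "C1 bumpr"
proof -
  have d: "((\<lambda>t::real. (max 0 t)\<^sup>2) has_derivative (\<lambda>v. 2 * max 0 t * v)) (at t)" for t
  proof -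
    consider "t > 0" | "t < 0" | "t = 0" by linarith
    then show ?thesis
    proof cases
      case 1
      show ?thesis
      proof (rule has_derivative_transform_within_open[where f = "\<lambda>t. t\<^sup>2"])
        show "((\<lambda>t::real. t\<^sup>2) has_derivative (\<lambda>v. 2 * max 0 t * v)) (at t)"
          using 1 by (auto intro!: derivative_eq_intros simp: fun_eq_iff)
      qed (use 1 in \<open>auto intro: open_greaterThan[of 0]\<close>)
    next
      case 2
      show ?thesis
      proof (rule has_derivative_transform_within_open[where f = "\<lambda>t. 0"])
        show "((\<lambda>t::real. 0::real) has_derivative (\<lambda>v. 2 * max 0 t * v)) (at t)"
          using 2 by (auto intro!: derivative_eq_intros simp: fun_eq_iff)
      qed (use 2 in \<open>auto intro: open_lessThan[of 0]\<close>)
    next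
      case 3
      have "((\<lambda>h::real. (max 0 h)\<^sup>2 / h) \<longlongrightarrow> 0) (at 0)"
      proof (rule tendsto_rabs_zero_cancel, rule tendsto_sandwich[where f = "\<lambda>_. 0" and h = "\<lambda>h. \<bar>h\<bar>"])
        show "\<forall>\<^sub>F h::real in at 0. \<bar>(max 0 h)\<^sup>2 / h\<bar> \<le> \<bar>h\<bar>"
          by (rule eventually_at_topological[THEN iffD2]) (auto simp: max_def power2_eq_square)
        show "((\<lambda>h::real. \<bar>h\<bar>) \<longlongrightarrow> 0) (at 0)" by (rule tendsto_rabs_zero) (rule tendsto_ident_at)
      qed auto
      then have "((\<lambda>t::real. (max 0 t)\<^sup>2) has_field_derivative 0) (at 0)"
        unfolding DERIV_def by simp
      then have "((\<lambda>t::real. (max 0 t)\<^sup>2) has_derivative (\<lambda>v. 2 * max 0 0 * v)) (at 0)"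
        unfolding has_field_derivative_def by (rule has_derivative_eq_rhs) (simp add: fun_eq_iff)
      then show ?thesis unfolding 3 .
    qed
  qed
  have m: "C1 (\<lambda>t::real. (max 0 t)\<^sup>2)"
    by (rule C1I[OF d]) (intro continuous_intros)
  show ?thesis unfolding bumpr_def
    by (rule C1_compose(1)[OF m]) (intro C1_intros)
qed

lemma C1_bump: "C1 bump"
  unfolding bump_def by (intro C1_mult C1_compose(1)[OF C1_bumpr] C1_fst C1_snd C1_id)

lemma bumpr_bounds: "bumpr t \<ge> 0" "bumpr t \<le> 625" "\<bar>t\<bar> \<le> 4 \<Longrightarrow> bumpr t \<ge> 1" "\<bar>t\<bar> \<ge> 5 \<Longrightarrow> bumpr t = 0"
proof -
  show "bumpr t \<ge> 0" by (simp add: bumpr_def)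
  have "(max 0 (25 - t\<^sup>2))\<^sup>2 \<le> 25\<^sup>2" by (rule power_mono) auto
  then show "bumpr t \<le> 625" by (simp add: bumpr_def)
  show "bumpr t \<ge> 1" if "\<bar>t\<bar> \<le> 4"
  proof -
    have "\<bar>t\<bar>\<^sup>2 \<le> 4\<^sup>2" using that by (rule power_mono) auto
    then have "1 \<le> max 0 (25 - t\<^sup>2)" by simp
    then show ?thesis unfolding bumpr_def by (rule one_le_power)
  qed
  show "bumpr t = 0" if "\<bar>t\<bar> \<ge> 5"
  proof -
    have "5\<^sup>2 \<le> \<bar>t\<bar>\<^sup>2" using that by (rule power_mono) auto
    then show ?thesis by (simp add: bumpr_def)
  qed
qed

lemma bump_bounds: "bump x \<ge> 0" "bump x \<le> 390625"
  "\<bar>fst x\<bar> \<le> 4 \<Longrightarrow> \<bar>snd x\<bar> \<le> 4 \<Longrightarrow> bump x \<ge> 1" "bump x \<noteq> 0 \<Longrightarrow> \<bar>fst x\<bar> < 5 \<and> \<bar>snd x\<bar> < 5"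
proof -
  show "bump x \<ge> 0" by (simp add: bump_def bumpr_bounds)
  show "bump x \<le> 390625"
    using mult_mono[OF bumpr_bounds(2)[of "fst x"] bumpr_bounds(2)[of "snd x"]] bumpr_bounds(1) by (simp add: bump_def)
  show "bump x \<ge> 1" if "\<bar>fst x\<bar> \<le> 4" "\<bar>snd x\<bar> \<le> 4"
    using mult_mono[of 1 "bumpr (fst x)" 1 "bumpr (snd x)"] bumpr_bounds that by (simp add: bump_def)
  show "bump x \<noteq> 0 \<Longrightarrow> \<bar>fst x\<bar> < 5 \<and> \<bar>snd x\<bar> < 5"
    using bumpr_bounds(4)[of "fst x"] bumpr_bounds(4)[of "snd x"] by (auto simp: bump_def not_le[symmetric])
qed

lemma norm_vec_le: "norm (x :: vec) \<le> \<bar>fst x\<bar> + \<bar>snd x\<bar>"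
  using norm_Pair_le[of "fst x" "snd x"] by simp

lemma bump_support: "norm x > 10 \<Longrightarrow> bump x = 0"
  using bump_bounds(4)[of x] norm_vec_le[of x] by fastforce

lemma bump_fd_bound: "\<exists>B\<ge>1. \<forall>x v. \<bar>fd bump x v\<bar> \<le> B * norm v"
proof -
  have "\<exists>K. \<forall>x. \<bar>fd bump x b\<bar> \<le> K" for b
  proof -
    have "compact ((\<lambda>x. fd bump x b) ` cball 0 10)"
      by (intro compact_continuous_image continuous_on_subset[OF C1_continuous_fd[OF C1_bump]]) auto
    then obtain K where K: "K > 0" "\<And>x. x \<in> cball 0 10 \<Longrightarrow> \<bar>fd bump x b\<bar> \<le> K"
      by (auto simp: bounded_pos dest!: compact_imp_bounded)
    have "\<bar>fd bump x b\<bar> \<le> K" for x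
      using K(1) K(2)[of x] fd_outside_support[where f = bump and M = 10 and x = x and v = b] bump_support
      by (cases "norm x \<le> 10") auto
    then show ?thesis by blast
  qed
  then obtain K where K: "\<And>b x. \<bar>fd bump x b\<bar> \<le> K b" by metis
  have "\<bar>fd bump x v\<bar> \<le> (1 + (\<Sum>b\<in>Basis. K b)) * norm v" for x v
  proof -
    have "\<bar>fd bump x v\<bar> \<le> (\<Sum>b\<in>Basis. \<bar>(v \<bullet> b) *\<^sub>R fd bump x b\<bar>)"
      unfolding fd_expand[OF C1_bump, of x v] by (rule sum_abs)
    also have "\<dots> \<le> (\<Sum>b\<in>Basis. norm v * K b)"
    proof (rule sum_mono)
      fix b :: vec assume b: "b \<in> Basis"
      have "\<bar>(v \<bullet> b) *\<^sub>R fd bump x b\<bar> = \<bar>v \<bullet> b\<bar> * \<bar>fd bump x b\<bar>" by (simp add: abs_mult)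
      also have "\<dots> \<le> norm v * K b" by (intro mult_mono Basis_le_norm[OF b] K) auto
      finally show "\<bar>(v \<bullet> b) *\<^sub>R fd bump x b\<bar> \<le> norm v * K b" .
    qed
    also have "\<dots> = (\<Sum>b\<in>Basis. K b) * norm v" by (subst mult.commute) (rule sum_distrib_left[symmetric])
    also have "\<dots> \<le> (1 + (\<Sum>b\<in>Basis. K b)) * norm v" by (simp add: mult_right_mono)
    finally show ?thesis .
  qed
  moreover have "1 + (\<Sum>b\<in>Basis. K b) \<ge> 1"
    using order_trans[OF abs_ge_zero K] by (simp add: sum_nonneg)
  ultimately show ?thesis by blast
qed

section \<open>The four-point form\<close>

text \<open>Here \<open>q = (s, y, y')\<close> and \<open>pt0\<close> is the base point \<open>z\<close>. The second of the four points is \<open>V\<close> itself.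
  In terms of \<open>z\<close> they are \<open>z + B y + P (s - y)\<close>, \<open>z + B y + P (\<sigma> - y)\<close>, \<open>z + B y' + P (s - y')\<close>
  and \<open>z + B y' + P (\<sigma> - y')\<close>.\<close>

definition pt1 :: "vec \<Rightarrow> vec \<Rightarrow> vec3 \<Rightarrow> vec" where
  "pt1 V \<sigma> = (\<lambda>q. V - P (\<sigma> - fst (snd q)) + P (fst q - fst (snd q)))"
definition pt3 :: "real \<Rightarrow> vec \<Rightarrow> vec \<Rightarrow> vec3 \<Rightarrow> vec" where
  "pt3 \<rho> V \<sigma> = (\<lambda>q. V - P (\<sigma> - fst (snd q)) + Bd \<rho> (snd (snd q) - fst (snd q)) + P (fst q - snd (snd q)))"
definition pt4 :: "real \<Rightarrow> vec \<Rightarrow> vec \<Rightarrow> vec3 \<Rightarrow> vec" where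
  "pt4 \<rho> V \<sigma> = (\<lambda>q. V - P (\<sigma> - fst (snd q)) + Bd \<rho> (snd (snd q) - fst (snd q)) + P (\<sigma> - snd (snd q)))"
definition pt0 :: "real \<Rightarrow> vec \<Rightarrow> vec \<Rightarrow> vec3 \<Rightarrow> vec" where
  "pt0 \<rho> V \<sigma> = (\<lambda>q. V - Bd \<rho> (fst (snd q)) - P (\<sigma> - fst (snd q)))"
text \<open>The three cutoffs localise \<open>z\<close>, \<open>y\<close> and \<open>y'\<close>. The
  conjugates sit on the amplitudes that belong to the second and third points, in accordance with
  the expansion of the square of a Gram kernel.\<close>

definition wt :: "real \<Rightarrow> (vec \<Rightarrow> complex) \<Rightarrow> vec \<Rightarrow> vec \<Rightarrow> vec3 \<Rightarrow> complex" where
  "wt \<rho> r V \<sigma> = (\<lambda>q. of_real (bump (pt0 \<rho> V \<sigma> q)) * of_real (bump (fst (snd q))) * of_real (bump (snd (snd q)))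
     * r (fst q - fst (snd q)) * cnj (r (\<sigma> - fst (snd q))) * cnj (r (fst q - snd (snd q))) * r (\<sigma> - snd (snd q)))"
text \<open>Translation of the motions of \<open>b = \<sigma> - y\<close>,
  \<open>c = s - y'\<close>, \<open>d = \<sigma> - y'\<close> into the coordinates
  \<open>(s, y, y')\<close>. As \<sigma> is fixed, \<open>y\<close> moves with minus the velocity of
  \<open>b\<close>, \<open>y'\<close> with minus that of \<open>d\<close>, and
  \<open>s = c + y'\<close> with the velocity of \<open>c\<close> minus that of
  \<open>d\<close>.\<close>

definition ZF :: "real \<Rightarrow> vec \<Rightarrow> vec \<Rightarrow> vec3 \<Rightarrow> vec3" where
  "ZF \<rho> \<sigma> e = (\<lambda>q.
     (Zc \<rho> (\<sigma> - fst (snd q)) (fst q - snd (snd q)) (\<sigma> - snd (snd q)) e - Zd \<rho> (\<sigma> - fst (snd q)) (fst q - snd (snd q)) (\<sigma> - snd (snd q)) e,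
      - Zb \<rho> (\<sigma> - fst (snd q)) (fst q - snd (snd q)) (\<sigma> - snd (snd q)) e, - Zd \<rho> (\<sigma> - fst (snd q)) (fst q - snd (snd q)) (\<sigma> - snd (snd q)) e))"
definition DF :: "real \<Rightarrow> vec \<Rightarrow> vec3 \<Rightarrow> real" where
  "DF \<rho> \<sigma> = (\<lambda>q. DD \<rho> (\<sigma> - fst (snd q)) (fst q - snd (snd q)) (\<sigma> - snd (snd q)))"

lemmas vec3_C1 = C1_id C1_const C1_fst C1_snd C1_add C1_diff C1_uminus C1_Bd C1_compose(1)[OF C1_P]

lemma C1_pt: "C1 (pt1 V \<sigma>)" "C1 (pt3 \<rho> V \<sigma>)" "C1 (pt4 \<rho> V \<sigma>)" "C1 (pt0 \<rho> V \<sigma>)"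
  unfolding pt1_def pt3_def pt4_def pt0_def by (intro vec3_C1)+

lemma P_has_derivative: "(g has_derivative g') (at x) \<Longrightarrow> ((\<lambda>x. P (g x)) has_derivative (\<lambda>h. mapp (DP (g x)) (g' h))) (at x)"
  using has_derivative_compose[of g g' x UNIV P "mapp (DP (g x))"] C1_has_derivative[OF C1_P] fd_P
  by (metis (no_types, lifting) ext)

lemma fd_pt:
  "fd (pt1 V \<sigma>) (s, y, y') (hs, hy, hy') = mapp (DP (\<sigma> - y)) hy + mapp (DP (s - y)) (hs - hy)"
  "fd (pt3 \<rho> V \<sigma>) (s, y, y') (hs, hy, hy') = mapp (DP (\<sigma> - y)) hy + Bd \<rho> (hy' - hy) + mapp (DP (s - y')) (hs - hy')"
  "fd (pt4 \<rho> V \<sigma>) (s, y, y') (hs, hy, hy') = mapp (DP (\<sigma> - y)) hy + Bd \<rho> (hy' - hy) - mapp (DP (\<sigma> - y')) hy'"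
  "fd (pt0 \<rho> V \<sigma>) (s, y, y') (hs, hy, hy') = - Bd \<rho> hy + mapp (DP (\<sigma> - y)) hy"
proof -
  have b: "((\<lambda>x. Bd \<rho> (g x)) has_derivative (\<lambda>h. Bd \<rho> (g' h))) (at x)" if "(g has_derivative g') (at x)"
    for g g' and x :: vec3 using bounded_linear.has_derivative[OF Bd_linear that] .
  note i = derivative_eq_intros P_has_derivative b refl
  let ?q = "(s, y, y')" and ?h = "(hs, hy, hy')"
  have "((\<lambda>q. V - P (\<sigma> - fst (snd q)) + P (fst q - fst (snd q))) has_derivative
     (\<lambda>h. - mapp (DP (\<sigma> - fst (snd ?q))) (- fst (snd h)) + mapp (DP (fst ?q - fst (snd ?q))) (fst h - fst (snd h)))) (at ?q)"
    by (rule i P_has_derivative | simp)+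
  from fd_eqI[OF this, of ?h] show "fd (pt1 V \<sigma>) ?q ?h = mapp (DP (\<sigma> - y)) hy + mapp (DP (s - y)) (hs - hy)"
    by (simp add: pt1_def mapp_linear_simps)
  have "((\<lambda>q. V - P (\<sigma> - fst (snd q)) + Bd \<rho> (snd (snd q) - fst (snd q)) + P (fst q - snd (snd q))) has_derivative
     (\<lambda>h. - mapp (DP (\<sigma> - fst (snd ?q))) (- fst (snd h)) + Bd \<rho> (snd (snd h) - fst (snd h)) + mapp (DP (fst ?q - snd (snd ?q))) (fst h - snd (snd h)))) (at ?q)"
    by (rule i | simp)+
  from fd_eqI[OF this, of ?h] show "fd (pt3 \<rho> V \<sigma>) ?q ?h = mapp (DP (\<sigma> - y)) hy + Bd \<rho> (hy' - hy) + mapp (DP (s - y')) (hs - hy')"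
    by (simp add: pt3_def mapp_linear_simps)
  have "((\<lambda>q. V - P (\<sigma> - fst (snd q)) + Bd \<rho> (snd (snd q) - fst (snd q)) + P (\<sigma> - snd (snd q))) has_derivative
     (\<lambda>h. - mapp (DP (\<sigma> - fst (snd ?q))) (- fst (snd h)) + Bd \<rho> (snd (snd h) - fst (snd h)) + mapp (DP (\<sigma> - snd (snd ?q))) (- snd (snd h)))) (at ?q)"
    by (rule i | simp)+
  from fd_eqI[OF this, of ?h] show "fd (pt4 \<rho> V \<sigma>) ?q ?h = mapp (DP (\<sigma> - y)) hy + Bd \<rho> (hy' - hy) - mapp (DP (\<sigma> - y')) hy'"
    by (simp add: pt4_def mapp_linear_simps)
  have "((\<lambda>q. V - Bd \<rho> (fst (snd q)) - P (\<sigma> - fst (snd q))) has_derivative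
     (\<lambda>h. - Bd \<rho> (fst (snd h)) - mapp (DP (\<sigma> - fst (snd ?q))) (- fst (snd h)))) (at ?q)"
    by (rule i | simp)+
  from fd_eqI[OF this, of ?h] show "fd (pt0 \<rho> V \<sigma>) ?q ?h = - Bd \<rho> hy + mapp (DP (\<sigma> - y)) hy"
    by (simp add: pt0_def mapp_linear_simps)
qed

lemma mapp_Dphi: "mapp (Dphi \<rho> t) v = mapp (DP t) v - Bd \<rho> v"
  unfolding Dphi_def mapp_linear_simps by (simp add: mapp_def mdiag_def Bd_def)

text \<open>In the coordinates \<open>b\<close>, \<open>c\<close>, \<open>d\<close> one has
  \<open>s - y = b + c - d\<close>, and the claims become \<open>Z_identities\<close>. The fourth
  point is V - \<phi>(b) + \<phi>(d) and the third differs from it by P(c) - P(d). So the second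
  identity stops the fourth point, and then the first identity stops the third.\<close>

lemma pt_transport:
  "fd (pt1 V \<sigma>) q (ZF \<rho> \<sigma> e q) = DF \<rho> \<sigma> q *\<^sub>R e"
  "fd (pt3 \<rho> V \<sigma>) q (ZF \<rho> \<sigma> e q) = 0"
  "fd (pt4 \<rho> V \<sigma>) q (ZF \<rho> \<sigma> e q) = 0"
proof -
  obtain s y y' where q: "q = (s, y, y')" by (cases q)
  define b c d where bcd: "b = \<sigma> - y" "c = s - y'" "d = \<sigma> - y'"
  have a: "s - y = b + c - d" by (simp add: bcd)
  note [simp] = mapp_linear_simps(1-4) linear_diff[OF bounded_linear.linear[OF Bd_linear]] linear_neg[OF bounded_linear.linear[OF Bd_linear]]
  note Z = Z_identities[where \<rho> = \<rho> and b = b and c = c and d = d and e = e]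
  show "fd (pt1 V \<sigma>) q (ZF \<rho> \<sigma> e q) = DF \<rho> \<sigma> q *\<^sub>R e"
    using Z(3) by (simp add: q ZF_def DF_def fd_pt a flip: bcd) (simp add: algebra_simps)
  show "fd (pt4 \<rho> V \<sigma>) q (ZF \<rho> \<sigma> e q) = 0"
    using Z(2) by (simp add: q ZF_def fd_pt mapp_Dphi flip: bcd) (simp add: algebra_simps)
  then show "fd (pt3 \<rho> V \<sigma>) q (ZF \<rho> \<sigma> e q) = 0"
    using Z(1) by (simp add: q ZF_def fd_pt flip: bcd)
qed

lemma C1_section:
  fixes F :: "'a::euclidean_space \<times> 'b::euclidean_space \<Rightarrow> 'c::real_normed_vector"
  assumes "C1 F"
  shows "C1 (\<lambda>q. F (q, p))" and fd_section: "fd (\<lambda>q. F (q, p)) q v = fd F (q, p) (v, 0)"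
proof -
  have d: "((\<lambda>q. (q, p)) has_derivative (\<lambda>v. (v, 0))) (at q)" for q
    by (auto intro!: derivative_eq_intros)
  have d': "((\<lambda>q. F (q, p)) has_derivative (\<lambda>v. fd F (q, p) (v, 0))) (at q)" for q
    by (rule has_derivative_compose[OF d C1_has_derivative[OF assms]])
  show "C1 (\<lambda>q. F (q, p))"
    by (rule C1I[OF d']) (intro continuous_fd_compose assms continuous_intros)
  show "fd (\<lambda>q. F (q, p)) q v = fd F (q, p) (v, 0)" by (rule fd_eqI[OF d'])
qed

lemma continuous_bounded_on_compact:
  fixes f :: "'a::euclidean_space \<Rightarrow> real"
  assumes "continuous_on UNIV f" "compact S"
  obtains K where "K \<ge> 1" "\<And>x. x \<in> S \<Longrightarrow> f x \<le> K"
proof -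
  have "compact (f ` S)" using assms by (intro compact_continuous_image continuous_on_subset[OF assms(1)]) auto
  then obtain K where K: "K > 0" "\<And>x. x \<in> S \<Longrightarrow> \<bar>f x\<bar> \<le> K" by (auto simp: bounded_pos dest!: compact_imp_bounded)
  show ?thesis by (rule that[of "max 1 K"]) (use K in \<open>force simp: abs_le_iff\<close>)+
qed

text \<open>Each quantity is continuous in \<open>(q, \<sigma>, \<rho>, e)\<close> jointly and is
  bounded on the compact product of balls with the interval [0,1] for \<rho>. The point
  \<open>V\<close> enters \<open>pt0\<close> only as a translation and drops out of the derivative,
  so it need not be confined to a compact set.\<close>

lemma field_bounds:
  "\<exists>\<kappa>\<ge>1. \<forall>\<rho> \<sigma> e V q. 0 \<le> \<rho> \<and> \<rho> \<le> 1 \<and> norm \<sigma> \<le> 20 \<and> norm e \<le> 1 \<and> norm q \<le> 40 \<longrightarrow>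
     norm (ZF \<rho> \<sigma> e q) \<le> \<kappa> \<and> norm (fd (pt0 \<rho> V \<sigma>) q (ZF \<rho> \<sigma> e q)) \<le> \<kappa> \<and>
     \<bar>fd (DF \<rho> \<sigma>) q (ZF \<rho> \<sigma> e q)\<bar> \<le> \<kappa> \<and> \<bar>divg (ZF \<rho> \<sigma> e) q\<bar> \<le> \<kappa>"
proof -
  define S :: "(vec3 \<times> vec \<times> real \<times> vec) set" where "S = cball 0 40 \<times> cball 0 20 \<times> {0..1} \<times> cball 0 1"
  have S: "compact S" unfolding S_def by (intro compact_Times compact_cball) auto
  define ZX where "ZX = (\<lambda>x::vec3 \<times> vec \<times> real \<times> vec. ZF (fst (snd (snd x))) (fst (snd x)) (snd (snd (snd x))) (fst x))"
  define DX where "DX = (\<lambda>x::vec3 \<times> vec \<times> real \<times> vec. DF (fst (snd (snd x))) (fst (snd x)) (fst x))"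
  have ZX: "C1 ZX" unfolding ZX_def ZF_def
    by (intro C1_Pair C1_Zb C1_Zc C1_Zd vec3_C1)
  have DX: "C1 DX" unfolding DX_def DF_def
    by (intro C1_DD vec3_C1)
  have cZ: "continuous_on UNIV ZX" by (rule C1_continuous[OF ZX])
  define f1 where "f1 = (\<lambda>x. norm (ZX x))"
  \<comment> \<open>The derivative of \<open>pt0\<close> along the field, with the dilation written
    out: \<rho> is a variable here and continuity in it is needed.\<close>
  define f2 where "f2 = (\<lambda>x. norm (- (fst (snd (snd x)) * fst (fst (snd (ZX x))), fst (snd (snd x)) * fst (snd (snd x)) * snd (fst (snd (ZX x))))
      + mapp (DP (fst (snd x) - fst (snd (fst x)))) (fst (snd (ZX x)))))"
  define f3 where "f3 = (\<lambda>x. \<bar>fd DX x (ZX x, 0)\<bar>)"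
  define f4 where "f4 = (\<lambda>x. \<bar>\<Sum>b\<in>Basis. fd ZX x (b, 0) \<bullet> b\<bar>)"
  have "continuous_on UNIV f1" unfolding f1_def by (intro continuous_intros cZ)
  from continuous_bounded_on_compact[OF this S] obtain K1 where K1: "K1 \<ge> 1" "\<And>x. x \<in> S \<Longrightarrow> f1 x \<le> K1" by auto
  have "continuous_on UNIV f2" unfolding f2_def mapp_def DP_def fst_conv snd_conv by (intro continuous_intros cZ)
  from continuous_bounded_on_compact[OF this S] obtain K2 where K2: "K2 \<ge> 1" "\<And>x. x \<in> S \<Longrightarrow> f2 x \<le> K2" by auto
  have "continuous_on UNIV f3" unfolding f3_def by (intro continuous_intros continuous_fd_compose DX cZ)
  from continuous_bounded_on_compact[OF this S] obtain K3 where K3: "K3 \<ge> 1" "\<And>x. x \<in> S \<Longrightarrow> f3 x \<le> K3" by auto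
  have "continuous_on UNIV f4" unfolding f4_def by (intro continuous_intros C1_continuous_fd[OF ZX])
  from continuous_bounded_on_compact[OF this S] obtain K4 where K4: "K4 \<ge> 1" "\<And>x. x \<in> S \<Longrightarrow> f4 x \<le> K4" by auto
  define \<kappa> where "\<kappa> = K1 + K2 + K3 + K4"
  show ?thesis
  proof (intro exI[of _ \<kappa>] conjI allI impI)
    show "\<kappa> \<ge> 1" using K1 K2 K3 K4 by (simp add: \<kappa>_def)
    fix \<rho> :: real and \<sigma> e V :: vec and q :: vec3
    assume A: "0 \<le> \<rho> \<and> \<rho> \<le> 1 \<and> norm \<sigma> \<le> 20 \<and> norm e \<le> 1 \<and> norm q \<le> 40"
    define x where "x = (q, \<sigma>, \<rho>, e)"
    have x: "x \<in> S" using A by (simp add: x_def S_def)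
    have Zq: "ZF \<rho> \<sigma> e = (\<lambda>q. ZX (q, \<sigma>, \<rho>, e))" and Dq: "DF \<rho> \<sigma> = (\<lambda>q. DX (q, \<sigma>, \<rho>, e))"
      by (simp_all add: ZX_def DX_def)
    note b = K1(2)[OF x] K2(2)[OF x] K3(2)[OF x] K4(2)[OF x]
    show "norm (ZF \<rho> \<sigma> e q) \<le> \<kappa>"
      using b K1(1) K2(1) K3(1) K4(1) by (simp add: f1_def x_def Zq \<kappa>_def)
    have "fd (pt0 \<rho> V \<sigma>) q (ZF \<rho> \<sigma> e q) = - Bd \<rho> (fst (snd (ZX x))) + mapp (DP (\<sigma> - fst (snd q))) (fst (snd (ZX x)))"
      using fd_pt(4)[of \<rho> V \<sigma> "fst q" "fst (snd q)" "snd (snd q)" "fst (ZX x)" "fst (snd (ZX x))" "snd (snd (ZX x))"]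
      by (simp add: Zq x_def)
    then have "norm (fd (pt0 \<rho> V \<sigma>) q (ZF \<rho> \<sigma> e q)) = f2 x" by (simp add: f2_def x_def Bd_def)
    then show "norm (fd (pt0 \<rho> V \<sigma>) q (ZF \<rho> \<sigma> e q)) \<le> \<kappa>" using b K1(1) K2(1) K3(1) K4(1) by (simp add: \<kappa>_def)
    show "\<bar>fd (DF \<rho> \<sigma>) q (ZF \<rho> \<sigma> e q)\<bar> \<le> \<kappa>"
      using b K1(1) K2(1) K3(1) K4(1) by (simp add: Dq Zq fd_section[OF DX] f3_def x_def \<kappa>_def)
    show "\<bar>divg (ZF \<rho> \<sigma> e) q\<bar> \<le> \<kappa>"
      using b K1(1) K2(1) K3(1) K4(1) by (simp add: divg_def Zq fd_section[OF ZX] f4_def x_def \<kappa>_def)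
  qed
qed

lemma C1_ZF: "C1 (ZF \<rho> \<sigma> e)" unfolding ZF_def
  by (intro C1_Pair C1_Zb C1_Zc C1_Zd vec3_C1)

lemma C1_DF: "C1 (DF \<rho> \<sigma>)" unfolding DF_def
  by (intro C1_DD vec3_C1)

text \<open>Bookkeeping for products: \<open>m\<close> bounds the size and \<open>j\<close> counts
  factors. Under multiplication \<open>m\<close> multiplies and \<open>j\<close> adds, while
  \<open>k\<close> is the common cost of one derivative along the field.\<close>

definition field_bounded :: "'a::real_normed_vector set \<Rightarrow> ('a \<Rightarrow> 'a) \<Rightarrow> real \<Rightarrow> real \<Rightarrow> real \<Rightarrow> ('a \<Rightarrow> complex) \<Rightarrow> bool" where
  "field_bounded S Z k m j f \<longleftrightarrow> C1 f \<and> 0 \<le> m \<and> 0 \<le> j \<and> (\<forall>x\<in>S. cmod (f x) \<le> m \<and> cmod (fd f x (Z x)) \<le> j * m * k)"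

lemma field_bounded_mult:
  assumes f: "field_bounded S Z k m j f" and g: "field_bounded S Z k m' j' g" and k: "k \<ge> 0"
  shows "field_bounded S Z k (m * m') (j + j') (\<lambda>x. f x * g x)"
  unfolding field_bounded_def
proof (intro conjI ballI)
  have cf: "C1 f" and cg: "C1 g" and m: "0 \<le> m" "0 \<le> m'" "0 \<le> j" "0 \<le> j'" using f g by (auto simp: field_bounded_def)
  show "C1 (\<lambda>x. f x * g x)" by (rule C1_mult[OF cf cg])
  show "0 \<le> m * m'" "0 \<le> j + j'" using m by auto
  fix x assume x: "x \<in> S"
  have b: "cmod (f x) \<le> m" "cmod (g x) \<le> m'" "cmod (fd f x (Z x)) \<le> j * m * k" "cmod (fd g x (Z x)) \<le> j' * m' * k"
    using f g x by (auto simp: field_bounded_def)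
  show "cmod (f x * g x) \<le> m * m'" unfolding norm_mult using b m by (intro mult_mono) auto
  have "cmod (fd (\<lambda>x. f x * g x) x (Z x)) \<le> cmod (f x) * cmod (fd g x (Z x)) + cmod (fd f x (Z x)) * cmod (g x)"
    unfolding fd_mult[OF cf cg] norm_mult[symmetric] by (rule norm_triangle_ineq)
  also have "\<dots> \<le> m * (j' * m' * k) + (j * m * k) * m'"
    using b m k by (intro add_mono mult_mono) auto
  finally show "cmod (fd (\<lambda>x. f x * g x) x (Z x)) \<le> (j + j') * (m * m') * k" by (simp add: algebra_simps)
qed

lemma field_bounded_compose:
  fixes g :: "vec \<Rightarrow> complex" and L :: "'a::euclidean_space \<Rightarrow> vec"
  assumes g: "C1 g" and L: "C1 L" and m: "m \<ge> 0" "k \<ge> 0"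
    and bg: "\<And>v. cmod (g v) \<le> m" "\<And>v w. cmod (fd g v w) \<le> m * k * norm w"
    and bL: "\<And>x. x \<in> S \<Longrightarrow> norm (fd L x (Z x)) \<le> kap"
  shows "field_bounded S Z (k * kap) m 1 (\<lambda>x. g (L x))"
  unfolding field_bounded_def
proof (intro conjI ballI)
  show "C1 (\<lambda>x. g (L x))" by (rule C1_compose[OF g L])
  fix x assume x: "x \<in> S"
  have "cmod (fd (\<lambda>x. g (L x)) x (Z x)) \<le> m * k * norm (fd L x (Z x))"
    unfolding fd_compose[OF g L] by (rule bg)
  also have "\<dots> \<le> m * k * kap" using m by (intro mult_left_mono bL x) auto
  finally show "cmod (fd (\<lambda>x. g (L x)) x (Z x)) \<le> 1 * m * (k * kap)" by simp
qed (use m bg in auto)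

text \<open>The quantitative form in which the amplitude enters the estimates: one derivative costs
  one factor \<open>A\<close>, and all constants are collected in \<open>c\<close>. The support is
  described pointwise by coordinates, which suits linear arithmetic.\<close>

definition cutoff :: "real \<Rightarrow> real \<Rightarrow> (vec \<Rightarrow> complex) \<Rightarrow> bool" where
  "cutoff c A r \<longleftrightarrow> C1 r \<and> 1 \<le> c \<and> 1 \<le> A \<and> (\<forall>t. cmod (r t) \<le> c) \<and> (\<forall>t v. cmod (fd r t v) \<le> c * A * norm v)
     \<and> (\<forall>t. r t \<noteq> 0 \<longrightarrow> 0 \<le> fst t \<and> fst t \<le> 1 \<and> 0 \<le> snd t \<and> snd t \<le> 1)"

lemma norm_fst_le_norm: "norm (fst z) \<le> norm z"
  using norm_fst_le[of "fst z" "snd z"] by simp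

lemma norm_snd_le_norm: "norm (snd z) \<le> norm z"
  using norm_snd_le[of "snd z" "fst z"] by simp

lemma cutoffD:
  assumes "cutoff c A r"
  shows "C1 r" "1 \<le> c" "1 \<le> A" "cmod (r t) \<le> c" "cmod (fd r t v) \<le> c * A * norm v"
    "r t \<noteq> 0 \<Longrightarrow> 0 \<le> fst t \<and> fst t \<le> 1 \<and> 0 \<le> snd t \<and> snd t \<le> 1"
  using assms unfolding cutoff_def by blast+

text \<open>The cutoffs bound the coordinates of \<open>z\<close>, \<open>y\<close>,
  \<open>y'\<close> by 5, and the amplitudes keep \<open>s - y\<close> and
  \<open>\<sigma> - y\<close> in the unit square. Then
  \<open>V = z + Bd \<rho> y + P (\<sigma> - y)\<close> has coordinates at most 5 + 5 + 2 = 12. The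
  stated radii are rounded up.\<close>

lemma wt_support:
  assumes r: "cutoff c A r" and rho: "0 \<le> \<rho>" "\<rho> \<le> 1" and nz: "wt \<rho> r V \<sigma> q \<noteq> 0"
  shows "norm q \<le> 40" "norm \<sigma> \<le> 20" "norm V \<le> 40"
proof -
  obtain s y y' where q: "q = (s, y, y')" by (cases q)
  have nz': "bump (pt0 \<rho> V \<sigma> q) \<noteq> 0" "bump y \<noteq> 0" "bump y' \<noteq> 0" "r (s - y) \<noteq> 0" "r (\<sigma> - y) \<noteq> 0"
    using nz by (auto simp: wt_def q)
  note b = bump_bounds(4)[OF nz'(1)] bump_bounds(4)[OF nz'(2)] bump_bounds(4)[OF nz'(3)]
  have rs: "0 \<le> fst t \<and> fst t \<le> 1 \<and> 0 \<le> snd t \<and> snd t \<le> 1" if "r t \<noteq> 0" for t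
    using cutoffD(6)[OF r that] .
  note rs1 = rs[OF nz'(4)] rs[OF nz'(5)]
  have "\<bar>fst s\<bar> \<le> 6" "\<bar>snd s\<bar> \<le> 6" "\<bar>fst \<sigma>\<bar> \<le> 6" "\<bar>snd \<sigma>\<bar> \<le> 6"
    using b(2) rs1 unfolding fst_diff snd_diff by linarith+
  then have "norm y \<le> 10" "norm y' \<le> 10" "norm s \<le> 12" "norm \<sigma> \<le> 12"
    using norm_vec_le[of y] norm_vec_le[of y'] norm_vec_le[of s] norm_vec_le[of \<sigma>] b(2,3) by linarith+
  then show "norm \<sigma> \<le> 20" by simp
  have "norm q \<le> norm s + (norm y + norm y')"
    unfolding q by (intro order_trans[OF norm_Pair_le] add_left_mono norm_Pair_le)
  then show "norm q \<le> 40" using \<open>norm y \<le> 10\<close> \<open>norm y' \<le> 10\<close> \<open>norm s \<le> 12\<close> by linarith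
  define t where "t = \<sigma> - y"
  have t: "0 \<le> fst t" "fst t \<le> 1" "0 \<le> snd t" "snd t \<le> 1" using rs1 by (auto simp: t_def)
  have pw: "0 \<le> x ^ n \<and> x ^ n \<le> 1" if "0 \<le> x" "x \<le> 1" for x :: real and n using that by (auto intro: power_le_one)
  have P: "\<bar>fst (P t)\<bar> \<le> 2" "\<bar>snd (P t)\<bar> \<le> 2"
    using pw[of "fst t" 2] pw[of "snd t" 2] pw[of "fst t" 3] pw[of "snd t" 3] t by (auto simp: P_def)
  have "\<bar>\<rho> * fst y\<bar> \<le> 1 * 5" "\<bar>\<rho> * \<rho> * snd y\<bar> \<le> 1 * 1 * 5"
    unfolding abs_mult using rho b(2) by (intro mult_mono; auto)+
  then have B: "\<bar>fst (Bd \<rho> y)\<bar> \<le> 5" "\<bar>snd (Bd \<rho> y)\<bar> \<le> 5" by (simp_all add: Bd_def)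
  have "V = pt0 \<rho> V \<sigma> q + Bd \<rho> y + P t" by (simp add: pt0_def q t_def)
  then have "fst V = fst (pt0 \<rho> V \<sigma> q) + fst (Bd \<rho> y) + fst (P t)" "snd V = snd (pt0 \<rho> V \<sigma> q) + snd (Bd \<rho> y) + snd (P t)"
    by (metis fst_add, metis snd_add)
  then have "\<bar>fst V\<bar> \<le> 12" "\<bar>snd V\<bar> \<le> 12" using b(1) B P by linarith+
  then show "norm V \<le> 40" using norm_vec_le[of V] by linarith
qed

lemma C1_wt:
  assumes "cutoff c A r"
  shows "C1 (wt \<rho> r V \<sigma>)"
proof -
  have comp: "C1 (\<lambda>q. r (L q))" if "C1 L" for L :: "vec3 \<Rightarrow> vec"
    by (rule C1_compose(1)[OF cutoffD(1)[OF assms] that])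
  show ?thesis
    unfolding wt_def
    by (intro C1_mult C1_of_real C1_compose(1)[OF C1_bump] C1_pt C1_cnj comp vec3_C1)
qed

text \<open>The weight has seven factors, three cutoffs of size \<open>\<beta>\<close> and four
  amplitudes of size \<open>c\<close>. Their arguments move with speed at most
  \<open>2 * \<kappa>\<close>, a difference of two components of the field being the worst case, and
  a derivative costs \<open>A\<close>. The product rule gives 7 * 2\<kappa> * \<beta>^3 c^4
  A.\<close>

lemma wt_bounds:
  "\<exists>K\<ge>1. \<forall>\<rho> c A r V \<sigma> q. cutoff c A r \<and> 0 \<le> \<rho> \<and> \<rho> \<le> 1 \<longrightarrow> cmod (wt \<rho> r V \<sigma> q) \<le> K * c ^ 4 \<and>
    (\<forall>e. norm \<sigma> \<le> 20 \<and> norm e \<le> 1 \<and> norm q \<le> 40 \<longrightarrow> cmod (fd (wt \<rho> r V \<sigma>) q (ZF \<rho> \<sigma> e q)) \<le> K * c ^ 4 * A)"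
proof -
  obtain \<kappa> where k1: "\<kappa> \<ge> 1" and k': "\<forall>\<rho> \<sigma> e V q. 0 \<le> \<rho> \<and> \<rho> \<le> 1 \<and> norm \<sigma> \<le> 20 \<and> norm e \<le> 1 \<and> norm q \<le> 40 \<longrightarrow>
     norm (ZF \<rho> \<sigma> e q) \<le> \<kappa> \<and> norm (fd (pt0 \<rho> V \<sigma>) q (ZF \<rho> \<sigma> e q)) \<le> \<kappa> \<and>
     \<bar>fd (DF \<rho> \<sigma>) q (ZF \<rho> \<sigma> e q)\<bar> \<le> \<kappa> \<and> \<bar>divg (ZF \<rho> \<sigma> e) q\<bar> \<le> \<kappa>"
    using field_bounds by (elim exE conjE) (rule that)
  note k = k'[rule_format]
  obtain B where B1: "B \<ge> 1" and B2: "\<forall>x v. \<bar>fd bump x v\<bar> \<le> B * norm v"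
    using bump_fd_bound by (elim exE conjE) (rule that)
  note B = B1 B2[rule_format]
  define \<beta> where "\<beta> = 390625 * B"
  have \<beta>: "\<beta> \<ge> 1" "\<And>x. \<bar>bump x\<bar> \<le> \<beta>" "\<And>x v. \<bar>fd bump x v\<bar> \<le> \<beta> * norm v"
  proof -
    show "\<beta> \<ge> 1" using B by (simp add: \<beta>_def)
    show "\<bar>bump x\<bar> \<le> \<beta>" for x using bump_bounds(1,2)[of x] B by (simp add: \<beta>_def)
    show "\<bar>fd bump x v\<bar> \<le> \<beta> * norm v" for x v
    proof -
      have "0 \<le> B * norm v" using B(1) by simp
      then show ?thesis using B(2)[of x v] unfolding \<beta>_def mult.assoc by linarith
    qed
  qed
  have cb: "C1 (\<lambda>x. complex_of_real (bump x))" and fdcb: "fd (\<lambda>x. complex_of_real (bump x)) x v = of_real (fd bump x v)" for x v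
    by (rule C1_linear_compose[OF bounded_linear_of_real C1_bump])+
  have main: "field_bounded S (ZF \<rho> \<sigma> e) (A * (2 * \<kappa>)) (\<beta> * \<beta> * \<beta> * c * c * c * c) (1 + 1 + 1 + 1 + 1 + 1 + 1) (wt \<rho> r V \<sigma>)"
    if r: "cutoff c A r" and S: "\<And>q. q \<in> S \<Longrightarrow> 0 \<le> \<rho> \<and> \<rho> \<le> 1 \<and> norm \<sigma> \<le> 20 \<and> norm e \<le> 1 \<and> norm q \<le> 40" for \<rho> c A r V \<sigma> e S
  proof -
    have r': "C1 r" "1 \<le> c" "1 \<le> A" "\<And>t. cmod (r t) \<le> c" "\<And>t v. cmod (fd r t v) \<le> c * A * norm v"
      using cutoffD[OF r] by blast+
    have cr: "C1 (\<lambda>x. cnj (r x))" and fdcr: "fd (\<lambda>x. cnj (r x)) x v = cnj (fd r x v)" for x v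
      by (rule C1_linear_compose[OF bounded_linear_cnj r'(1)])+
    have fb: "field_bounded S (ZF \<rho> \<sigma> e) (A * (2 * \<kappa>)) \<beta> 1 (\<lambda>q. of_real (bump (L q)))"
      if "C1 L" "\<And>q. q \<in> S \<Longrightarrow> norm (fd L q (ZF \<rho> \<sigma> e q)) \<le> 2 * \<kappa>" for L
    proof (rule field_bounded_compose[OF cb that(1) _ _ _ _ that(2)])
      have "\<beta> * norm w \<le> \<beta> * A * norm w" for w :: vec
        using \<beta>(1) r'(3) by (intro mult_right_mono) auto
      then show "cmod (fd (\<lambda>x. complex_of_real (bump x)) v w) \<le> \<beta> * A * norm w" for v w
        unfolding fdcb norm_of_real by (rule order_trans[OF \<beta>(3)])
    qed (use \<beta> r' in auto)
    have fr: "field_bounded S (ZF \<rho> \<sigma> e) (A * (2 * \<kappa>)) c 1 (\<lambda>q. r (L q))"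
      if "C1 L" "\<And>q. q \<in> S \<Longrightarrow> norm (fd L q (ZF \<rho> \<sigma> e q)) \<le> 2 * \<kappa>" for L
      by (rule field_bounded_compose[OF r'(1) that(1) _ _ r'(4,5) that(2)]) (use r' in auto)
    have frc: "field_bounded S (ZF \<rho> \<sigma> e) (A * (2 * \<kappa>)) c 1 (\<lambda>q. cnj (r (L q)))"
      if "C1 L" "\<And>q. q \<in> S \<Longrightarrow> norm (fd L q (ZF \<rho> \<sigma> e q)) \<le> 2 * \<kappa>" for L
      by (rule field_bounded_compose[OF cr that(1) _ _ _ _ that(2)]) (use r' in \<open>auto simp: fdcr\<close>)
    have lin: "C1 (\<lambda>q::vec3. fst (snd q))" "C1 (\<lambda>q::vec3. snd (snd q))" "C1 (\<lambda>q::vec3. fst q - fst (snd q))"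
      "C1 (\<lambda>q::vec3. \<sigma> - fst (snd q))" "C1 (\<lambda>q::vec3. fst q - snd (snd q))" "C1 (\<lambda>q::vec3. \<sigma> - snd (snd q))"
      by (intro vec3_C1)+
    have fl: "fd (\<lambda>q::vec3. fst (snd q)) q h = fst (snd h)" "fd (\<lambda>q::vec3. snd (snd q)) q h = snd (snd h)"
      "fd (\<lambda>q::vec3. fst q - fst (snd q)) q h = fst h - fst (snd h)" "fd (\<lambda>q::vec3. \<sigma> - fst (snd q)) q h = 0 - fst (snd h)"
      "fd (\<lambda>q::vec3. fst q - snd (snd q)) q h = fst h - snd (snd h)" "fd (\<lambda>q::vec3. \<sigma> - snd (snd q)) q h = 0 - snd (snd h)" for q h
      by (rule fd_eqI[where f' = "\<lambda>h. fst (snd h)"], intro derivative_intros)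
         (rule fd_eqI[where f' = "\<lambda>h. snd (snd h)"] fd_eqI[where f' = "\<lambda>h. fst h - fst (snd h)"]
           fd_eqI[where f' = "\<lambda>h. 0 - fst (snd h)"] fd_eqI[where f' = "\<lambda>h. fst h - snd (snd h)"]
           fd_eqI[where f' = "\<lambda>h. 0 - snd (snd h)"], intro derivative_intros)+
    have n: "norm (fst h) \<le> norm h" "norm (fst (snd h)) \<le> norm h" "norm (snd (snd h)) \<le> norm h" for h :: vec3
      by (rule norm_fst_le_norm order_trans[OF norm_fst_le_norm norm_snd_le_norm] order_trans[OF norm_snd_le_norm norm_snd_le_norm])+
    have bl: "norm (fd (\<lambda>q. fst (snd q)) q (ZF \<rho> \<sigma> e q)) \<le> 2 * \<kappa>" "norm (fd (\<lambda>q. snd (snd q)) q (ZF \<rho> \<sigma> e q)) \<le> 2 * \<kappa>"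
      "norm (fd (\<lambda>q. fst q - fst (snd q)) q (ZF \<rho> \<sigma> e q)) \<le> 2 * \<kappa>" "norm (fd (\<lambda>q. \<sigma> - fst (snd q)) q (ZF \<rho> \<sigma> e q)) \<le> 2 * \<kappa>"
      "norm (fd (\<lambda>q. fst q - snd (snd q)) q (ZF \<rho> \<sigma> e q)) \<le> 2 * \<kappa>" "norm (fd (\<lambda>q. \<sigma> - snd (snd q)) q (ZF \<rho> \<sigma> e q)) \<le> 2 * \<kappa>"
      "norm (fd (pt0 \<rho> V \<sigma>) q (ZF \<rho> \<sigma> e q)) \<le> 2 * \<kappa>"
      if q: "q \<in> S" for q
    proof -
      let ?h = "ZF \<rho> \<sigma> e q"
      have kq: "norm ?h \<le> \<kappa>" "norm (fd (pt0 \<rho> V \<sigma>) q ?h) \<le> \<kappa>" using k[OF S[OF q], of V] by blast+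
      note nn = n[of ?h] kq k1 norm_triangle_ineq4[of "fst ?h" "fst (snd ?h)"] norm_triangle_ineq4[of "fst ?h" "snd (snd ?h)"]
      show "norm (fd (\<lambda>q. fst (snd q)) q ?h) \<le> 2 * \<kappa>" "norm (fd (\<lambda>q. snd (snd q)) q ?h) \<le> 2 * \<kappa>"
        "norm (fd (\<lambda>q. \<sigma> - fst (snd q)) q ?h) \<le> 2 * \<kappa>" "norm (fd (\<lambda>q. \<sigma> - snd (snd q)) q ?h) \<le> 2 * \<kappa>"
        "norm (fd (pt0 \<rho> V \<sigma>) q ?h) \<le> 2 * \<kappa>"
        "norm (fd (\<lambda>q. fst q - fst (snd q)) q ?h) \<le> 2 * \<kappa>" "norm (fd (\<lambda>q. fst q - snd (snd q)) q ?h) \<le> 2 * \<kappa>"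
        unfolding fl diff_0 norm_minus_cancel using nn by linarith+
    qed
    have k0: "0 \<le> A * (2 * \<kappa>)" using r'(3) k1 by simp
    show ?thesis
      unfolding wt_def
      by (intro field_bounded_mult fb fr frc C1_pt lin bl k0)
  qed
  have arith: "(1 + 1 + 1 + 1 + 1 + 1 + 1) * (x * y) * (z * (2 * w)) = 14 * x * w * y * z" for x y z w :: real
    by simp
  define K where "K = 14 * \<beta> ^ 3 * \<kappa>"
  show ?thesis
  proof (intro exI[of _ K] conjI allI impI)
    have b3: "\<beta> ^ 3 \<ge> 1" using \<beta>(1) by (rule one_le_power)
    have "1 * 1 \<le> \<beta> ^ 3 * \<kappa>" using b3 k1 by (intro mult_mono) linarith+
    then show K1: "K \<ge> 1" by (simp add: K_def)
    fix \<rho> :: real and c A r and V \<sigma> :: vec and q :: vec3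
    assume *: "cutoff c A r \<and> 0 \<le> \<rho> \<and> \<rho> \<le> 1"
    then have c: "c \<ge> 1" "A \<ge> 1" using cutoffD(2,3) by blast+
    have m_eq: "\<beta> * \<beta> * \<beta> * c * c * c * c = \<beta> ^ 3 * c ^ 4" by (simp add: power3_eq_cube power4_eq_xxxx)
    have c4: "c ^ 4 \<ge> 0" using c by simp
    show "cmod (wt \<rho> r V \<sigma> q) \<le> K * c ^ 4"
    proof (cases "wt \<rho> r V \<sigma> q = 0")
      case True
      then show ?thesis using K1 c4 by simp
    next
      case False
      note sp = wt_support[OF conjunct1[OF *] conjunct1[OF conjunct2[OF *]] conjunct2[OF conjunct2[OF *]] False]
      \<comment> \<open>For the size of the weight the direction of motion is irrelevant, and the
        zero direction is an admissible choice.\<close>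
      have "field_bounded {q} (ZF \<rho> \<sigma> 0) (A * (2 * \<kappa>)) (\<beta> * \<beta> * \<beta> * c * c * c * c) (1 + 1 + 1 + 1 + 1 + 1 + 1) (wt \<rho> r V \<sigma>)"
      proof (rule main[OF conjunct1[OF *]])
        have "norm (0::vec) \<le> 1" by simp
        then show "0 \<le> \<rho> \<and> \<rho> \<le> 1 \<and> norm \<sigma> \<le> 20 \<and> norm (0::vec) \<le> 1 \<and> norm q' \<le> 40" if "q' \<in> {q}" for q'
          using * sp(1,2) that by blast
      qed
      then have "cmod (wt \<rho> r V \<sigma> q) \<le> \<beta> ^ 3 * c ^ 4" unfolding field_bounded_def m_eq by blast
      also have "\<dots> \<le> K * c ^ 4"
      proof (rule mult_right_mono[OF _ c4])
        have "\<beta> ^ 3 * 1 \<le> \<beta> ^ 3 * (14 * \<kappa>)" using b3 k1 \<beta>(1) by (intro mult_left_mono) auto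
        then show "\<beta> ^ 3 \<le> K" by (simp add: K_def)
      qed
      finally show ?thesis .
    qed
    fix e :: vec assume e: "norm \<sigma> \<le> 20 \<and> norm e \<le> 1 \<and> norm q \<le> 40"
    have "field_bounded {q} (ZF \<rho> \<sigma> e) (A * (2 * \<kappa>)) (\<beta> * \<beta> * \<beta> * c * c * c * c) (1 + 1 + 1 + 1 + 1 + 1 + 1) (wt \<rho> r V \<sigma>)"
    proof (rule main[OF conjunct1[OF *]])
      show "0 \<le> \<rho> \<and> \<rho> \<le> 1 \<and> norm \<sigma> \<le> 20 \<and> norm e \<le> 1 \<and> norm q' \<le> 40" if "q' \<in> {q}" for q'
        using * e that by blast
    qed
    then have "cmod (fd (wt \<rho> r V \<sigma>) q (ZF \<rho> \<sigma> e q)) \<le> (1 + 1 + 1 + 1 + 1 + 1 + 1) * (\<beta> ^ 3 * c ^ 4) * (A * (2 * \<kappa>))"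
      unfolding field_bounded_def m_eq by blast
    also have "\<dots> = K * c ^ 4 * A" unfolding K_def by (rule arith)
    finally show "cmod (fd (wt \<rho> r V \<sigma>) q (ZF \<rho> \<sigma> e q)) \<le> K * c ^ 4 * A" .
  qed
qed

text \<open>Along the field only the first factor changes, so differentiating the product of the
  three functions yields \<open>DF\<close> times the derivative of \<open>\<phi>1\<close> in
  direction \<open>e\<close>. Integration by parts then bounds an integral containing a derivative
  of \<open>\<phi>1\<close> by the supremum of \<open>\<phi>1\<close> alone. This is the source of
  all decay in the bounded part.\<close>

lemma four_point_bound:
  "\<exists>K\<ge>1. \<forall>\<rho> c A r V \<sigma> e N eps \<phi>1 \<phi>3 \<phi>4. cutoff c A r \<and> 0 \<le> \<rho> \<and> \<rho> \<le> 1 \<and> norm e \<le> 1 \<and> 0 < eps \<and> eps \<le> 1 \<and>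
     C1 \<phi>1 \<and> C1 \<phi>3 \<and> C1 \<phi>4 \<and> (\<forall>v. cmod (\<phi>1 v) \<le> N) \<and> (\<forall>v. cmod (\<phi>3 v) \<le> N) \<and> (\<forall>v. cmod (\<phi>4 v) \<le> N) \<longrightarrow>
     cmod (LINT q|lborel. (fd \<phi>1 (pt1 V \<sigma> q) e * \<phi>3 (pt3 \<rho> V \<sigma> q) * \<phi>4 (pt4 \<rho> V \<sigma> q)) * wt \<rho> r V \<sigma> q
        * of_real ((DF \<rho> \<sigma> q)\<^sup>2 / ((DF \<rho> \<sigma> q)\<^sup>2 + eps\<^sup>2))) \<le> K * c ^ 4 * A * N ^ 3 / eps\<^sup>2"
proof -
  obtain \<kappa> where k1: "\<kappa> \<ge> 1" and k': "\<forall>\<rho> \<sigma> e V q. 0 \<le> \<rho> \<and> \<rho> \<le> 1 \<and> norm \<sigma> \<le> 20 \<and> norm e \<le> 1 \<and> norm q \<le> 40 \<longrightarrow>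
     norm (ZF \<rho> \<sigma> e q) \<le> \<kappa> \<and> norm (fd (pt0 \<rho> V \<sigma>) q (ZF \<rho> \<sigma> e q)) \<le> \<kappa> \<and>
     \<bar>fd (DF \<rho> \<sigma>) q (ZF \<rho> \<sigma> e q)\<bar> \<le> \<kappa> \<and> \<bar>divg (ZF \<rho> \<sigma> e) q\<bar> \<le> \<kappa>"
    using field_bounds by (elim exE conjE) (rule that)
  note k = k'[rule_format]
  obtain B where B1: "B \<ge> 1" and B': "\<forall>\<rho> c A r V \<sigma> q. cutoff c A r \<and> 0 \<le> \<rho> \<and> \<rho> \<le> 1 \<longrightarrow> cmod (wt \<rho> r V \<sigma> q) \<le> B * c ^ 4 \<and>
    (\<forall>e. norm \<sigma> \<le> 20 \<and> norm e \<le> 1 \<and> norm q \<le> 40 \<longrightarrow> cmod (fd (wt \<rho> r V \<sigma>) q (ZF \<rho> \<sigma> e q)) \<le> B * c ^ 4 * A)"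
    using wt_bounds by (elim exE conjE) (rule that)
  define mu where "mu = measure lborel (cball 0 40 :: vec3 set)"
  have mu: "mu \<ge> 0" by (simp add: mu_def)
  define K where "K = 1 + 3 * B * \<kappa> * mu"
  have "0 \<le> 3 * B * \<kappa> * mu" using B1 k1 mu by (intro mult_nonneg_nonneg) linarith+
  then have K1: "K \<ge> 1" unfolding K_def by linarith
  have "cmod (LINT q|lborel. (fd \<phi>1 (pt1 V \<sigma> q) e * \<phi>3 (pt3 \<rho> V \<sigma> q) * \<phi>4 (pt4 \<rho> V \<sigma> q)) * wt \<rho> r V \<sigma> q
        * of_real ((DF \<rho> \<sigma> q)\<^sup>2 / ((DF \<rho> \<sigma> q)\<^sup>2 + eps\<^sup>2))) \<le> K * c ^ 4 * A * N ^ 3 / eps\<^sup>2"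
    if r: "cutoff c A r" and rho: "0 \<le> \<rho>" "\<rho> \<le> 1" and e: "norm e \<le> 1" and eps: "0 < eps" "eps \<le> 1"
      and \<phi>: "C1 \<phi>1" "C1 \<phi>3" "C1 \<phi>4" and N: "\<And>v. cmod (\<phi>1 v) \<le> N" "\<And>v. cmod (\<phi>3 v) \<le> N" "\<And>v. cmod (\<phi>4 v) \<le> N"
    for \<rho> c A r V \<sigma> e N eps \<phi>1 \<phi>3 \<phi>4
  proof -
    have cA: "c \<ge> 1" "A \<ge> 1" using cutoffD(2,3)[OF r] by blast+
    have N0: "N \<ge> 0" using norm_ge_zero N(1) by (rule order_trans)
    have rhs0: "0 \<le> K * c ^ 4 * A * N ^ 3 / eps\<^sup>2" 
      using K1 cA N0 eps by (intro divide_nonneg_nonneg mult_nonneg_nonneg zero_le_power) linarith+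
    show ?thesis
    proof (cases "norm \<sigma> \<le> 20")
      case False
      have w0: "wt \<rho> r V \<sigma> q = 0" for q using wt_support(2)[OF r rho] False by blast
      show ?thesis using rhs0 by (simp add: w0)
    next
      case True
      define G where "G = (\<lambda>q. \<phi>1 (pt1 V \<sigma> q) * \<phi>3 (pt3 \<rho> V \<sigma> q) * \<phi>4 (pt4 \<rho> V \<sigma> q))"
      have c1: "C1 (\<lambda>q. \<phi>1 (pt1 V \<sigma> q))" "C1 (\<lambda>q. \<phi>3 (pt3 \<rho> V \<sigma> q))" "C1 (\<lambda>q. \<phi>4 (pt4 \<rho> V \<sigma> q))"
        by (rule C1_compose(1)[OF \<phi>(1) C1_pt(1)] C1_compose(1)[OF \<phi>(2) C1_pt(2)] C1_compose(1)[OF \<phi>(3) C1_pt(3)])+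
      have c13: "C1 (\<lambda>q. \<phi>1 (pt1 V \<sigma> q) * \<phi>3 (pt3 \<rho> V \<sigma> q))" by (intro C1_mult c1)
      have G: "C1 G" unfolding G_def by (intro C1_mult c1)
      have z: "fd g x 0 = 0" if "C1 g" for g :: "vec \<Rightarrow> complex" and x using C1_linear[OF that] by (rule linear_0)
      have tr: "fd G q (ZF \<rho> \<sigma> e q) = of_real (DF \<rho> \<sigma> q) * (fd \<phi>1 (pt1 V \<sigma> q) e * \<phi>3 (pt3 \<rho> V \<sigma> q) * \<phi>4 (pt4 \<rho> V \<sigma> q))" for q
        unfolding G_def fd_mult[OF c13 c1(3)] fd_mult[OF c1(1,2)] fd_compose[OF \<phi>(1) C1_pt(1)] fd_compose[OF \<phi>(2) C1_pt(2)]
          fd_compose[OF \<phi>(3) C1_pt(3)] pt_transport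
        by (simp add: z \<phi> linear_scale[OF C1_linear[OF \<phi>(1)]] scaleR_conv_of_real)
      have "cmod (LINT q|lborel. (fd \<phi>1 (pt1 V \<sigma> q) e * \<phi>3 (pt3 \<rho> V \<sigma> q) * \<phi>4 (pt4 \<rho> V \<sigma> q)) * wt \<rho> r V \<sigma> q
        * of_real ((DF \<rho> \<sigma> q)\<^sup>2 / ((DF \<rho> \<sigma> q)\<^sup>2 + eps\<^sup>2)))
        \<le> N ^ 3 * (B * c ^ 4 * A + B * c ^ 4 * \<kappa> + B * c ^ 4 * \<kappa>) / eps\<^sup>2 * measure lborel (cball 0 40 :: vec3 set)"
      proof (rule vector_field_oscillation[OF G C1_wt[OF r] C1_DF C1_ZF eps _ tr])
        show "wt \<rho> r V \<sigma> q = 0" if "norm q > 40" for q using wt_support(1)[OF r rho] that by (meson not_le)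
        fix q :: vec3 assume q: "norm q \<le> 40"
        have *: "0 \<le> \<rho> \<and> \<rho> \<le> 1 \<and> norm \<sigma> \<le> 20 \<and> norm e \<le> 1 \<and> norm q \<le> 40" using rho True e q by simp
        show "\<bar>fd (DF \<rho> \<sigma>) q (ZF \<rho> \<sigma> e q)\<bar> \<le> \<kappa>" "\<bar>divg (ZF \<rho> \<sigma> e) q\<bar> \<le> \<kappa>" using k[OF *, of V] by blast+
        show "cmod (wt \<rho> r V \<sigma> q) \<le> B * c ^ 4" "cmod (fd (wt \<rho> r V \<sigma>) q (ZF \<rho> \<sigma> e q)) \<le> B * c ^ 4 * A"
          using B'[rule_format, OF conjI[OF r conjI[OF rho]], of V \<sigma> q] True e q by blast+
        show "cmod (G q) \<le> N ^ 3"
          unfolding G_def norm_mult power3_eq_cube using N N0 by (intro mult_mono) auto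
      qed
      also have "\<dots> = (B * c ^ 4 * (A + 2 * \<kappa>)) * mu * (N ^ 3 / eps\<^sup>2)" by (simp add: mu_def algebra_simps add_divide_distrib)
      also have "\<dots> \<le> (K * c ^ 4 * A) * (N ^ 3 / eps\<^sup>2)"
      proof (rule mult_right_mono)
        have "A + 2 * \<kappa> \<le> 3 * (\<kappa> * A)"
          using mult_left_mono[OF cA(2), of \<kappa>] mult_right_mono[OF k1, of A] k1 cA by linarith
        then have "B * c ^ 4 * (A + 2 * \<kappa>) * mu \<le> B * c ^ 4 * (3 * (\<kappa> * A)) * mu"
          using B1 mu cA by (intro mult_right_mono mult_left_mono mult_nonneg_nonneg zero_le_power) linarith+
        also have "\<dots> = (3 * B * \<kappa> * mu) * c ^ 4 * A" by simp
        also have "\<dots> \<le> K * c ^ 4 * A" 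
          using cA unfolding K_def by (intro mult_right_mono zero_le_power) linarith+
        finally show "B * c ^ 4 * (A + 2 * \<kappa>) * mu \<le> K * c ^ 4 * A" .
        show "0 \<le> N ^ 3 / eps\<^sup>2" using N0 by simp
      qed
      finally show ?thesis by simp
    qed
  qed
  then show ?thesis using K1 by blast
qed

section \<open>Bounded measurable functions in the four-point form\<close>

lemma shear_measurable:
  fixes g :: "'b::euclidean_space \<Rightarrow> 'a::euclidean_space"
  assumes g: "g \<in> borel_measurable borel"
  shows "(\<lambda>X. (fst X + g (snd X), snd X)) \<in> borel_measurable borel"
proof -
  have 1: "(\<lambda>X::'a \<times> 'b. fst X) \<in> borel_measurable borel" "(\<lambda>X::'a \<times> 'b. snd X) \<in> borel_measurable borel"
    by (intro borel_measurable_continuous_onI continuous_intros)+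
  show ?thesis
    by (intro borel_measurable_Pair borel_measurable_add 1 measurable_compose[OF 1(2) g])
qed

lemma nn_integral_shear:
  fixes F :: "'a::euclidean_space \<times> 'b::euclidean_space \<Rightarrow> ennreal"
  assumes [measurable]: "F \<in> borel_measurable borel" "g \<in> borel_measurable borel"
  shows "(\<integral>\<^sup>+ X. F (fst X + g (snd X), snd X) \<partial>lborel) = (\<integral>\<^sup>+ X. F X \<partial>lborel)"
proof -
  have Fm: "F \<in> borel_measurable (lborel \<Otimes>\<^sub>M lborel)" by (simp add: lborel_prod)
  have Gm: "(\<lambda>X. F (fst X + g (snd X), snd X)) \<in> borel_measurable (lborel \<Otimes>\<^sub>M lborel)"
    unfolding lborel_prod using measurable_compose[OF shear_measurable[OF assms(2)] assms(1)] by simp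
  have "(\<integral>\<^sup>+ V. F (V + g p, p) \<partial>lborel) = (\<integral>\<^sup>+ V. F (V, p) \<partial>lborel)" for p
    using nn_integral_lborel_shift[of "\<lambda>V. F (V, p)" "g p"] by (simp add: add.commute)
  then show ?thesis
    using lborel_pair.nn_integral_snd[OF Fm] lborel_pair.nn_integral_snd[OF Gm] by (simp add: lborel_prod)
qed

lemma lborel_distr_shear:
  fixes g :: "'b::euclidean_space \<Rightarrow> 'a::euclidean_space"
  assumes g [measurable]: "g \<in> borel_measurable borel"
  shows "distr lborel borel (\<lambda>X. (fst X + g (snd X), snd X)) = lborel"
proof (rule measure_eqI)
  fix A :: "('a \<times> 'b) set" assume "A \<in> sets (distr lborel borel (\<lambda>X. (fst X + g (snd X), snd X)))"
  then have A [measurable]: "A \<in> sets borel" by simp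
  have "emeasure (distr lborel borel (\<lambda>X. (fst X + g (snd X), snd X))) A = (\<integral>\<^sup>+ X. indicator A X \<partial>distr lborel borel (\<lambda>X. (fst X + g (snd X), snd X)))"
    by simp
  also have "\<dots> = (\<integral>\<^sup>+ X. indicator A (fst X + g (snd X), snd X) \<partial>lborel)"
    using shear_measurable[OF g] by (subst nn_integral_distr) simp_all
  also have "\<dots> = (\<integral>\<^sup>+ X. indicator A X \<partial>lborel)" by (rule nn_integral_shear) auto
  finally show "emeasure (distr lborel borel (\<lambda>X. (fst X + g (snd X), snd X))) A = emeasure lborel A" by simp
qed simp

text \<open>Each of the four points is \<open>V\<close> plus a function of the remaining variables,
  that is, the first component of a measure-preserving shear. Null sets of the plane therefore pull
  back to null sets, and almost everywhere convergence of approximants survives insertion of the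
  points.\<close>

lemma AE_shear:
  fixes g :: "'b::euclidean_space \<Rightarrow> 'a::euclidean_space"
  assumes g [measurable]: "g \<in> borel_measurable borel" and Q: "AE v in lborel. Q v"
  shows "AE X in lborel. Q (fst X + g (snd X))"
proof -
  obtain N where N2: "\<And>v. v \<in> space lborel - N \<Longrightarrow> Q v" and N1: "N \<in> null_sets lborel"
    by (rule AE_E3[OF Q]) (rule that)
  note N = N1 N2
  have Nb: "N \<in> sets borel" using N(1) by (auto simp: null_sets_def)
  have Ni: "(\<lambda>X::'a \<times> 'b. indicator N (fst X) :: ennreal) \<in> borel_measurable borel"
    by (rule measurable_compose[OF borel_measurable_continuous_onI borel_measurable_indicator[OF Nb]]) (intro continuous_intros)
  have "(\<integral>\<^sup>+ X. indicator N (fst X + g (snd X)) \<partial>lborel) = (\<integral>\<^sup>+ X. indicator N (fst X) \<partial>(lborel :: ('a \<times> 'b) measure))"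
    using nn_integral_shear[OF Ni g] by simp
  also have "\<dots> = (\<integral>\<^sup>+ y. \<integral>\<^sup>+ x. indicator N x \<partial>lborel \<partial>(lborel :: 'b measure))"
    using lborel_pair.nn_integral_snd[of "\<lambda>X::'a\<times>'b. indicator N (fst X)"] Ni by (simp add: lborel_prod)
  also have "\<dots> = 0" using N(1) Nb by (auto simp: null_sets_def)
  finally have "(\<integral>\<^sup>+ X. indicator N (fst X + g (snd X)) \<partial>lborel) = 0" .
  moreover have "(\<lambda>X. indicator N (fst X + g (snd X)) :: ennreal) \<in> borel_measurable lborel"
    using measurable_compose[OF shear_measurable[OF g] Ni] by simp
  ultimately have "AE X in lborel. (indicator N (fst X + g (snd X)) :: ennreal) = 0"
    by (simp add: nn_integral_0_iff_AE)
  then show ?thesis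
  proof eventually_elim
    case (elim X)
    then have "fst X + g (snd X) \<notin> N" by (auto simp: indicator_def split: if_splits)
    then show ?case using N(2)[of "fst X + g (snd X)"] by simp
  qed
qed

lemma integrable_bounded_support:
  fixes f :: "'a::euclidean_space \<Rightarrow> 'b::{banach,second_countable_topology}"
  assumes [measurable]: "f \<in> borel_measurable borel" and B: "\<And>x. norm (f x) \<le> B" and M: "\<And>x. norm x > M \<Longrightarrow> f x = 0"
  shows "integrable lborel f"
proof (rule Bochner_Integration.integrable_bound)
  show "integrable lborel (\<lambda>x. B * indicator (cball (0::'a) M) x)"
    using emeasure_lborel_cball_finite[of "0::'a" M] by (intro integrable_mult_right) simp
  show "AE x in lborel. norm (f x) \<le> norm (B * indicator (cball 0 M) x)"
  proof (rule AE_I2)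
    fix x show "norm (f x) \<le> norm (B * indicator (cball 0 M) x)"
      using B[of x] M[of x] order_trans[OF norm_ge_zero B[of x]] by (cases "norm x \<le> M") (auto simp: indicator_def)
  qed
qed simp

lemma C1_real_polynomial_function: "real_polynomial_function p \<Longrightarrow> C1 p"
  by (induction rule: real_polynomial_function.induct) (auto intro: C1_bounded_linear C1_const C1_add C1_mult)

lemma C1_complex_polynomial_function:
  fixes p :: "vec \<Rightarrow> complex"
  assumes "polynomial_function p"
  shows "C1 p"
proof -
  have "real_polynomial_function (\<lambda>x. p x \<bullet> 1)" "real_polynomial_function (\<lambda>x. p x \<bullet> \<i>)"
    using assms unfolding polynomial_function_iff_Basis_inner by (auto simp: Basis_complex_def)
  then have "C1 (\<lambda>x. (p x \<bullet> 1) *\<^sub>R 1 + (p x \<bullet> \<i>) *\<^sub>R \<i>)"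
    by (intro C1_add C1_scaleR C1_const C1_real_polynomial_function)
  moreover have "(\<lambda>x. (p x \<bullet> 1) *\<^sub>R 1 + (p x \<bullet> \<i>) *\<^sub>R \<i>) = p"
    by (auto simp: fun_eq_iff complex_eq_iff inner_complex_def)
  ultimately show ?thesis by simp
qed

lemma C1_inverse:
  fixes f :: "'a::euclidean_space \<Rightarrow> real"
  assumes f: "C1 f" and nz: "\<And>x. f x \<noteq> 0"
  shows "C1 (\<lambda>x. inverse (f x))"
proof (rule C1I)
  show "((\<lambda>x. inverse (f x)) has_derivative (\<lambda>v. - (inverse (f x) * fd f x v * inverse (f x)))) (at x)" for x
    by (rule Deriv.has_derivative_inverse[OF nz C1_has_derivative[OF f]])
  show "continuous_on UNIV (\<lambda>x. - (inverse (f x) * fd f x v * inverse (f x)))" for v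
    using nz by (intro continuous_intros C1_continuous[OF f] C1_continuous_fd[OF f]) auto
qed

text \<open>A bounded function is first written as the image under a smooth bounded function, so that
  the polynomial approximations can be kept bounded.\<close>

lemma C1_approximation:
  fixes f :: "vec \<Rightarrow> complex"
  assumes f: "f \<in> borel_measurable borel" and N: "\<And>x. cmod (f x) \<le> N" "N > 0"
  shows "\<exists>g. (\<forall>n::nat. C1 (g n)) \<and> (\<forall>n x. cmod (g n x) \<le> 2 * N) \<and> (AE x in lborel. (\<lambda>n. g n x) \<longlonglongrightarrow> f x)"
proof -
  \<comment> \<open>The map z \<mapsto> 4N z / (1 + |z|^2) has values of modulus at most 2N. The
    function \<open>h\<close> is the bounded branch of its inverse along \<open>f\<close>: with w =
    f/(4N), the equation |w| = |h| / (1 + |h|^2) is quadratic in |h|, and |w| \<le> 1/4 keeps its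
    discriminant positive.\<close>
  define \<psi> where "\<psi> = (\<lambda>z::complex. (4 * N * inverse (1 + (Re z * Re z + Im z * Im z))) *\<^sub>R z)"
  define w where "w = (\<lambda>x. f x /\<^sub>R (4 * N))"
  define h where "h = (\<lambda>x. (2 / (1 + sqrt (1 - 4 * (cmod (w x))\<^sup>2))) *\<^sub>R w x)"
  have w: "cmod (w x) \<le> 1 / 4" for x
    using N by (simp add: w_def divide_simps)
  have \<psi>h: "\<psi> (h x) = f x" for x
  proof -
    define s where "s = sqrt (1 - 4 * (cmod (w x))\<^sup>2)"
    have "(cmod (w x))\<^sup>2 \<le> (1 / 4)\<^sup>2" using w by (intro power_mono) auto
    then have s: "s \<ge> 0" "s\<^sup>2 = 1 - 4 * (cmod (w x))\<^sup>2" by (auto simp: s_def power_divide)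
    have hx: "h x = (2 / (1 + s)) *\<^sub>R w x" by (simp add: h_def s_def)
    have "Re (h x) * Re (h x) + Im (h x) * Im (h x) = (cmod (h x))\<^sup>2" unfolding cmod_power2 by (simp add: power2_eq_square)
    also have "\<dots> = (2 / (1 + s))\<^sup>2 * (cmod (w x))\<^sup>2" unfolding hx norm_scaleR power_mult_distrib using s by simp
    also have "\<dots> = (1 - s\<^sup>2) / (1 + s)\<^sup>2" using s(2) by (simp add: power_divide)
    also have "\<dots> = (1 - s) / (1 + s)"
    proof -
      have "1 - s\<^sup>2 = (1 - s) * (1 + s)" by (simp add: power2_eq_square algebra_simps)
      then show ?thesis using s(1) by (simp add: power2_eq_square)
    qed
    finally have "1 + (Re (h x) * Re (h x) + Im (h x) * Im (h x)) = 2 / (1 + s)" using s(1) by (simp add: field_simps)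
    then have "\<psi> (h x) = (4 * N * inverse (2 / (1 + s)) * (2 / (1 + s))) *\<^sub>R w x" by (simp add: \<psi>_def hx)
    also have "\<dots> = (4 * N) *\<^sub>R w x" using s(1) by simp
    finally show ?thesis using N by (simp add: w_def)
  qed
  have \<psi>_bound: "cmod (\<psi> z) \<le> 2 * N" for z
  proof -
    have "2 * (cmod z) \<le> 1 + (cmod z)\<^sup>2" using sum_squares_bound[of "1" "cmod z"] by simp
    then have "cmod z * inverse (1 + (cmod z)\<^sup>2) \<le> 1 / 2" by (simp add: divide_simps add_pos_nonneg)
    then have "(4 * N) * (cmod z * inverse (1 + (cmod z)\<^sup>2)) \<le> (4 * N) * (1 / 2)" using N by (intro mult_left_mono) auto
    moreover have "cmod (\<psi> z) = (4 * N) * (cmod z * inverse (1 + (cmod z)\<^sup>2))"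
    proof -
      have "(cmod z)\<^sup>2 = Re z * Re z + Im z * Im z" unfolding cmod_power2 by (simp add: power2_eq_square)
      moreover have "0 \<le> inverse (1 + (cmod z)\<^sup>2)" by simp
      ultimately show ?thesis using N unfolding \<psi>_def by (simp add: abs_mult)
    qed
    ultimately show ?thesis by simp
  qed
  have C\<psi>: "C1 (\<lambda>x. \<psi> (p x))" if p: "C1 p" for p :: "vec \<Rightarrow> complex"
  proof -
    have "C1 (\<lambda>x. inverse (1 + (Re (p x) * Re (p x) + Im (p x) * Im (p x))))"
    proof (rule C1_inverse)
      show "C1 (\<lambda>x. 1 + (Re (p x) * Re (p x) + Im (p x) * Im (p x)))"
        by (intro C1_add C1_mult C1_const C1_Re C1_Im p)
      show "1 + (Re (p x) * Re (p x) + Im (p x) * Im (p x)) \<noteq> 0" for x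
        using add_pos_nonneg[of 1 "Re (p x) * Re (p x) + Im (p x) * Im (p x)"] by simp
    qed
    then show ?thesis unfolding \<psi>_def by (intro C1_scaleR C1_mult C1_const p)
  qed
  have \<psi>_cont: "isCont \<psi> z" for z
  proof -
    have "1 + (Re z * Re z + Im z * Im z) \<noteq> 0"
      using add_pos_nonneg[of 1 "Re z * Re z + Im z * Im z"] by simp
    then show ?thesis unfolding \<psi>_def by (intro continuous_intros) auto
  qed
  have "h \<in> borel_measurable borel" unfolding h_def w_def using f by measurable
  then have "h \<in> borel_measurable lebesgue" by (intro measurable_completion) simp
  then have "h measurable_on UNIV" by (rule lebesgue_measurable_imp_measurable_on) simp
  then obtain Z g where Z: "negligible Z" and g: "\<And>n::nat. continuous_on UNIV (g n)" and lim: "\<And>x. x \<notin> Z \<Longrightarrow> (\<lambda>n. g n x) \<longlonglongrightarrow> h x"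
    unfolding measurable_on_def by auto
  \<comment> \<open>The continuous approximants are replaced by polynomials within 1/(n+1) on the
    ball of radius n. Every point lies in these balls from some n on, so pointwise convergence is
    kept.\<close>
  have "\<exists>p. polynomial_function p \<and> (\<forall>x\<in>cball 0 (real n). norm (g n x - p x) < 1 / real (Suc n))" for n
    by (rule Stone_Weierstrass_polynomial_function) (auto intro: continuous_on_subset[OF g])
  then obtain p where p: "\<And>n. polynomial_function (p n)" "\<And>n x. x \<in> cball 0 (real n) \<Longrightarrow> norm (g n x - p n x) < 1 / real (Suc n)"
    by metis
  show ?thesis
  proof (intro exI[of _ "\<lambda>n x. \<psi> (p n x)"] conjI allI)
    show "C1 (\<lambda>x. \<psi> (p n x))" for n by (rule C\<psi>[OF C1_complex_polynomial_function[OF p(1)]])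
    show "cmod (\<psi> (p n x)) \<le> 2 * N" for n x by (rule \<psi>_bound)
    have "AE x in lebesgue. x \<notin> Z" using Z by (intro AE_not_in) (simp add: negligible_iff_null_sets)
    then have "AE x in lborel. x \<notin> Z" by (simp add: AE_completion_iff)
    then show "AE x in lborel. (\<lambda>n. \<psi> (p n x)) \<longlonglongrightarrow> f x"
    proof eventually_elim
      case (elim x)
      obtain m where m: "norm x \<le> real m" using real_arch_simple by blast
      have "(\<lambda>n. g n x - p n x) \<longlonglongrightarrow> 0"
      proof (rule Lim_null_comparison)
        show "(\<lambda>n. 1 / real (Suc n)) \<longlonglongrightarrow> 0" by (rule LIMSEQ_Suc[OF lim_1_over_n])
        show "\<forall>\<^sub>F n in sequentially. norm (g n x - p n x) \<le> 1 / real (Suc n)"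
          using eventually_ge_at_top[of m]
        proof eventually_elim
          case (elim n)
          then have "x \<in> cball 0 (real n)" using m by simp
          then show ?case using p(2)[of x n] by simp
        qed
      qed
      from tendsto_diff[OF lim[OF elim] this] have "(\<lambda>n. p n x) \<longlonglongrightarrow> h x" by simp
      from isCont_tendsto_compose[OF \<psi>_cont this] show ?case by (simp add: \<psi>h)
    qed
  qed
qed

section \<open>Differences in the first slot\<close>

abbreviation rat :: "real \<Rightarrow> real \<Rightarrow> vec \<Rightarrow> vec3 \<Rightarrow> complex" where
  "rat \<rho> eps \<sigma> q \<equiv> of_real ((DF \<rho> \<sigma> q)\<^sup>2 / ((DF \<rho> \<sigma> q)\<^sup>2 + eps\<^sup>2))"

lemma continuous_joint:
  "continuous_on UNIV (\<lambda>X. pt1 (fst X) (fst (snd X)) (snd (snd X)))"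
  "continuous_on UNIV (\<lambda>X. pt3 \<rho> (fst X) (fst (snd X)) (snd (snd X)))"
  "continuous_on UNIV (\<lambda>X. pt4 \<rho> (fst X) (fst (snd X)) (snd (snd X)))"
  "continuous_on UNIV (\<lambda>X. pt0 \<rho> (fst X) (fst (snd X)) (snd (snd X)))"
  "continuous_on UNIV (\<lambda>X::vec \<times> vec \<times> vec3. DF \<rho> (fst (snd X)) (snd (snd X)))"
proof -
  show "continuous_on UNIV (\<lambda>X. pt1 (fst X) (fst (snd X)) (snd (snd X)))"
    "continuous_on UNIV (\<lambda>X. pt3 \<rho> (fst X) (fst (snd X)) (snd (snd X)))"
    "continuous_on UNIV (\<lambda>X. pt4 \<rho> (fst X) (fst (snd X)) (snd (snd X)))"
    "continuous_on UNIV (\<lambda>X. pt0 \<rho> (fst X) (fst (snd X)) (snd (snd X)))"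
    unfolding pt1_def pt3_def pt4_def pt0_def P_def Bd_def by (intro continuous_intros)+
  have "C1 (\<lambda>X::vec \<times> vec \<times> vec3. DF \<rho> (fst (snd X)) (snd (snd X)))"
    unfolding DF_def by (intro C1_DD vec3_C1)
  then show "continuous_on UNIV (\<lambda>X::vec \<times> vec \<times> vec3. DF \<rho> (fst (snd X)) (snd (snd X)))" by (rule C1_continuous)
qed

lemma continuous_wt:
  assumes r: "cutoff c A r"
  shows "continuous_on UNIV (\<lambda>X. wt \<rho> r (fst X) (fst (snd X)) (snd (snd X)))"
proof -
  have b: "continuous_on UNIV (\<lambda>x. bump (f x))" if "continuous_on UNIV f" for f :: "vec \<times> vec \<times> vec3 \<Rightarrow> vec"
    using continuous_on_compose2[OF C1_continuous[OF C1_bump, of UNIV] that] by simp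
  have rr: "continuous_on UNIV (\<lambda>x. r (f x))" if "continuous_on UNIV f" for f :: "vec \<times> vec \<times> vec3 \<Rightarrow> vec"
    using continuous_on_compose2[OF C1_continuous[OF cutoffD(1)[OF r], of UNIV] that] by simp
  show ?thesis
    unfolding wt_def
    by (intro continuous_on_mult continuous_on_of_real b rr continuous_on_cnj continuous_joint continuous_intros)
qed

lemma continuous_rat:
  assumes "eps > 0" and D: "continuous_on UNIV D"
  shows "continuous_on UNIV (\<lambda>x. complex_of_real ((D x)\<^sup>2 / ((D x)\<^sup>2 + eps\<^sup>2)))"
proof -
  have "(D x)\<^sup>2 + eps\<^sup>2 \<noteq> 0" for x
    using assms(1) add_nonneg_pos[of "(D x)\<^sup>2" "eps\<^sup>2"] by simp
  then show ?thesis by (intro continuous_intros D) auto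
qed

lemma rat_le_1: "eps > 0 \<Longrightarrow> cmod (complex_of_real (D\<^sup>2 / (D\<^sup>2 + eps\<^sup>2))) \<le> 1"
  using add_nonneg_pos[of "D\<^sup>2" "eps\<^sup>2"] unfolding norm_of_real by (simp add: divide_le_eq_1)

text \<open>The increment is the integral of the directional derivative over the segment of length
  \<open>norm w\<close>, and Fubini moves that integral outside. Each translate
  \<open>v \<mapsto> \<phi>1 (v + \<theta> *\<^sub>R e)\<close> has the same supremum bound, so
  \<open>four_point_bound\<close> applies for every \<theta> with one constant. The result contains
  no derivative of the functions and hence extends to bounded measurable ones.\<close>

lemma four_point_difference:
  "\<exists>K\<ge>1. \<forall>\<rho> c A r V \<sigma> w N eps \<phi>1 \<phi>3 \<phi>4. cutoff c A r \<and> 0 \<le> \<rho> \<and> \<rho> \<le> 1 \<and> 0 < eps \<and> eps \<le> 1 \<and>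
     C1 \<phi>1 \<and> C1 \<phi>3 \<and> C1 \<phi>4 \<and> (\<forall>v. cmod (\<phi>1 v) \<le> N) \<and> (\<forall>v. cmod (\<phi>3 v) \<le> N) \<and> (\<forall>v. cmod (\<phi>4 v) \<le> N) \<longrightarrow>
     cmod (LINT q|lborel. ((\<phi>1 (pt1 V \<sigma> q + w) - \<phi>1 (pt1 V \<sigma> q)) * \<phi>3 (pt3 \<rho> V \<sigma> q) * \<phi>4 (pt4 \<rho> V \<sigma> q)) * wt \<rho> r V \<sigma> q
        * rat \<rho> eps \<sigma> q) \<le> K * c ^ 4 * A * N ^ 3 / eps\<^sup>2 * norm w"
proof -
  obtain K where K1: "K \<ge> 1" and K': "\<forall>\<rho> c A r V \<sigma> e N eps \<phi>1 \<phi>3 \<phi>4. cutoff c A r \<and> 0 \<le> \<rho> \<and> \<rho> \<le> 1 \<and> norm e \<le> 1 \<and> 0 < eps \<and> eps \<le> 1 \<and>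
     C1 \<phi>1 \<and> C1 \<phi>3 \<and> C1 \<phi>4 \<and> (\<forall>v. cmod (\<phi>1 v) \<le> N) \<and> (\<forall>v. cmod (\<phi>3 v) \<le> N) \<and> (\<forall>v. cmod (\<phi>4 v) \<le> N) \<longrightarrow>
     cmod (LINT q|lborel. (fd \<phi>1 (pt1 V \<sigma> q) e * \<phi>3 (pt3 \<rho> V \<sigma> q) * \<phi>4 (pt4 \<rho> V \<sigma> q)) * wt \<rho> r V \<sigma> q
        * rat \<rho> eps \<sigma> q) \<le> K * c ^ 4 * A * N ^ 3 / eps\<^sup>2"
    using four_point_bound by (elim exE conjE) (rule that)
  have "cmod (LINT q|lborel. ((\<phi>1 (pt1 V \<sigma> q + w) - \<phi>1 (pt1 V \<sigma> q)) * \<phi>3 (pt3 \<rho> V \<sigma> q) * \<phi>4 (pt4 \<rho> V \<sigma> q)) * wt \<rho> r V \<sigma> q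
        * rat \<rho> eps \<sigma> q) \<le> K * c ^ 4 * A * N ^ 3 / eps\<^sup>2 * norm w"
    if r: "cutoff c A r" and rho: "0 \<le> \<rho>" "\<rho> \<le> 1" and eps: "0 < eps" "eps \<le> 1"
      and \<phi>: "C1 \<phi>1" "C1 \<phi>3" "C1 \<phi>4" and N: "\<forall>v. cmod (\<phi>1 v) \<le> N" "\<forall>v. cmod (\<phi>3 v) \<le> N" "\<forall>v. cmod (\<phi>4 v) \<le> N"
    for \<rho> c A r V \<sigma> w N eps \<phi>1 \<phi>3 \<phi>4
  proof (cases "w = 0")
    case True
    then show ?thesis by simp
  next
    case False
    define L where "L = norm w"
    define e where "e = w /\<^sub>R L"
    have L: "L > 0" using False by (simp add: L_def)
    have e1: "norm e \<le> 1" and Le: "L *\<^sub>R e = w" using L by (auto simp: e_def L_def)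
    define \<Psi> where "\<Psi> = (\<lambda>q. \<phi>3 (pt3 \<rho> V \<sigma> q) * \<phi>4 (pt4 \<rho> V \<sigma> q) * wt \<rho> r V \<sigma> q * rat \<rho> eps \<sigma> q)"
    define h where "h = (\<lambda>\<theta> q. fd \<phi>1 (pt1 V \<sigma> q + \<theta> *\<^sub>R e) e * \<Psi> q)"
    have c\<Psi>: "continuous_on UNIV \<Psi>"
      unfolding \<Psi>_def
      by (intro continuous_on_mult C1_continuous[OF C1_compose(1)[OF \<phi>(2) C1_pt(2)]] C1_continuous[OF C1_compose(1)[OF \<phi>(3) C1_pt(3)]]
          C1_continuous[OF C1_wt[OF r]] continuous_rat[OF eps(1)] C1_continuous[OF C1_DF])
    have \<Psi>0: "\<Psi> q = 0" if "norm q > 40" for q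
    proof -
      have "wt \<rho> r V \<sigma> q = 0" using wt_support(1)[OF r rho] that by (meson not_le)
      then show ?thesis by (simp add: \<Psi>_def)
    qed
    have ch: "continuous_on UNIV (\<lambda>x. h (fst x) (snd x))"
    proof -
      have "continuous_on UNIV (\<lambda>x::real \<times> vec3. pt1 V \<sigma> (snd x))"
        by (rule continuous_on_compose2[OF C1_continuous[OF C1_pt(1), of UNIV]]) (auto intro!: continuous_intros)
      moreover have "continuous_on UNIV (\<lambda>x::real \<times> vec3. \<Psi> (snd x))"
        by (rule continuous_on_compose2[OF c\<Psi>]) (auto intro!: continuous_intros)
      ultimately show ?thesis unfolding h_def
        by (intro continuous_on_mult continuous_fd_compose[OF \<phi>(1)] continuous_intros)
    qed
    have int: "integrable (lborel \<Otimes>\<^sub>M lborel) (\<lambda>(\<theta>, q). indicator {0..L} \<theta> *\<^sub>R h \<theta> q)"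
    proof -
      have "integrable lborel (\<lambda>x. indicator ({0..L} \<times> cball 0 40) x *\<^sub>R h (fst x) (snd x))"
        by (rule borel_integrable_compact) (auto intro!: compact_Times continuous_on_subset[OF ch])
      moreover have "indicator ({0..L} \<times> cball 0 40) x *\<^sub>R h (fst x) (snd x) = indicator {0..L} (fst x) *\<^sub>R h (fst x) (snd x)" for x
        using \<Psi>0[of "snd x"] by (cases x) (auto simp: indicator_def h_def)
      ultimately show ?thesis by (simp add: lborel_prod case_prod_unfold)
    qed
    have FTC: "(LINT \<theta>|lborel. indicator {0..L} \<theta> *\<^sub>R h \<theta> q) = (\<phi>1 (pt1 V \<sigma> q + w) - \<phi>1 (pt1 V \<sigma> q)) * \<Psi> q" for q
    proof -
      have "(LINT \<theta>|lborel. indicator {0..L} \<theta> *\<^sub>R fd \<phi>1 (pt1 V \<sigma> q + \<theta> *\<^sub>R e) e) = \<phi>1 (pt1 V \<sigma> q + L *\<^sub>R e) - \<phi>1 (pt1 V \<sigma> q + 0 *\<^sub>R e)"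
      proof (rule integral_FTC_atLeastAtMost)
        show "0 \<le> L" using L by simp
        fix \<theta> :: real
        have "((\<lambda>\<theta>. pt1 V \<sigma> q + \<theta> *\<^sub>R e) has_derivative (\<lambda>t. t *\<^sub>R e)) (at \<theta> within {0..L})"
          by (auto intro!: derivative_eq_intros)
        from has_derivative_compose[OF this C1_has_derivative[OF \<phi>(1)]]
        show "((\<lambda>\<theta>. \<phi>1 (pt1 V \<sigma> q + \<theta> *\<^sub>R e)) has_vector_derivative fd \<phi>1 (pt1 V \<sigma> q + \<theta> *\<^sub>R e) e) (at \<theta> within {0..L})"
          unfolding has_vector_derivative_def by (simp add: linear_scale[OF C1_linear[OF \<phi>(1)]])
      next
        have "continuous_on UNIV (\<lambda>\<theta>. fd \<phi>1 (pt1 V \<sigma> q + \<theta> *\<^sub>R e) e)"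
          by (intro continuous_fd_compose[OF \<phi>(1)] continuous_intros)
        then show "continuous_on {0..L} (\<lambda>\<theta>. fd \<phi>1 (pt1 V \<sigma> q + \<theta> *\<^sub>R e) e)" by (rule continuous_on_subset) simp
      qed
      then show ?thesis
        unfolding h_def mult_scaleR_left[symmetric] integral_mult_left_zero by (simp add: Le)
    qed
    have inner: "cmod (LINT q|lborel. h \<theta> q) \<le> K * c ^ 4 * A * N ^ 3 / eps\<^sup>2" for \<theta>
    proof -
      define \<phi> where "\<phi> = (\<lambda>v. \<phi>1 (v + \<theta> *\<^sub>R e))"
      have cf: "C1 (\<lambda>v::vec. v + \<theta> *\<^sub>R e)" by (intro C1_add C1_id C1_const)
      have fdv: "fd (\<lambda>v::vec. v + \<theta> *\<^sub>R e) v u = u" for v u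
        by (rule fd_eqI[where f' = "\<lambda>u. u"]) (auto intro!: derivative_eq_intros)
      have C\<phi>: "C1 \<phi>" unfolding \<phi>_def by (rule C1_compose(1)[OF \<open>C1 \<phi>1\<close> cf])
      have fd\<phi>: "fd \<phi> v e = fd \<phi>1 (v + \<theta> *\<^sub>R e) e" for v unfolding \<phi>_def fd_compose[OF \<open>C1 \<phi>1\<close> cf] fdv ..
      have b: "\<forall>v. cmod (\<phi> v) \<le> N" unfolding \<phi>_def using N(1) by blast
      have "cmod (LINT q|lborel. (fd \<phi> (pt1 V \<sigma> q) e * \<phi>3 (pt3 \<rho> V \<sigma> q) * \<phi>4 (pt4 \<rho> V \<sigma> q)) * wt \<rho> r V \<sigma> q
        * rat \<rho> eps \<sigma> q) \<le> K * c ^ 4 * A * N ^ 3 / eps\<^sup>2"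
        by (rule K'[rule_format]) (intro conjI r rho e1 eps C\<phi> \<open>C1 \<phi>3\<close> \<open>C1 \<phi>4\<close> b N(2,3))
      then show ?thesis by (simp add: h_def \<Psi>_def fd\<phi> mult.assoc)
    qed
    define B where "B = K * c ^ 4 * A * N ^ 3 / eps\<^sup>2"
    have "(LINT q|lborel. ((\<phi>1 (pt1 V \<sigma> q + w) - \<phi>1 (pt1 V \<sigma> q)) * \<phi>3 (pt3 \<rho> V \<sigma> q) * \<phi>4 (pt4 \<rho> V \<sigma> q)) * wt \<rho> r V \<sigma> q
        * rat \<rho> eps \<sigma> q) = (LINT q|lborel. LINT \<theta>|lborel. indicator {0..L} \<theta> *\<^sub>R h \<theta> q)"
      by (simp add: FTC \<Psi>_def mult.assoc)
    also have "\<dots> = (LINT \<theta>|lborel. LINT q|lborel. indicator {0..L} \<theta> *\<^sub>R h \<theta> q)"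
      by (rule lborel_pair.Fubini_integral[OF int])
    finally have "cmod (LINT q|lborel. ((\<phi>1 (pt1 V \<sigma> q + w) - \<phi>1 (pt1 V \<sigma> q)) * \<phi>3 (pt3 \<rho> V \<sigma> q) * \<phi>4 (pt4 \<rho> V \<sigma> q)) * wt \<rho> r V \<sigma> q
        * rat \<rho> eps \<sigma> q) = cmod (LINT \<theta>|lborel. indicator {0..L} \<theta> *\<^sub>R (LINT q|lborel. h \<theta> q))" by simp
    also have "\<dots> \<le> (LINT \<theta>|lborel. B * indicator {0..L} \<theta>)"
    proof (rule order_trans[OF integral_norm_bound], rule integral_mono)
      have "integrable lborel (\<lambda>\<theta>. indicator {0..L} \<theta> *\<^sub>R (LINT q|lborel. h \<theta> q))"
        using lborel_pair.integrable_fst[OF int] by simp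
      then show "integrable lborel (\<lambda>\<theta>. norm (indicator {0..L} \<theta> *\<^sub>R (LINT q|lborel. h \<theta> q)))" by (rule integrable_norm)
      show "integrable lborel (\<lambda>\<theta>. B * indicator {0..L} \<theta>)" using L by (intro integrable_mult_right) simp
      show "norm (indicator {0..L} \<theta> *\<^sub>R (LINT q|lborel. h \<theta> q)) \<le> B * indicator {0..L} \<theta>" for \<theta>
        using inner[of \<theta>] by (auto simp: indicator_def B_def)
    qed
    also have "\<dots> = B * norm w" using L by (simp add: L_def)
    finally show ?thesis by (simp add: B_def)
  qed
  then show ?thesis using K1 by blast
qed

section \<open>The form on the joint space of all variables\<close>

definition pX1 :: "vec \<times> vec \<times> vec3 \<Rightarrow> vec" where "pX1 X = pt1 (fst X) (fst (snd X)) (snd (snd X))"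
definition pX3 :: "real \<Rightarrow> vec \<times> vec \<times> vec3 \<Rightarrow> vec" where "pX3 \<rho> X = pt3 \<rho> (fst X) (fst (snd X)) (snd (snd X))"
definition pX4 :: "real \<Rightarrow> vec \<times> vec \<times> vec3 \<Rightarrow> vec" where "pX4 \<rho> X = pt4 \<rho> (fst X) (fst (snd X)) (snd (snd X))"
definition wX :: "real \<Rightarrow> (vec \<Rightarrow> complex) \<Rightarrow> vec \<times> vec \<times> vec3 \<Rightarrow> complex" where
  "wX \<rho> r X = wt \<rho> r (fst X) (fst (snd X)) (snd (snd X))"
definition DX :: "real \<Rightarrow> vec \<times> vec \<times> vec3 \<Rightarrow> real" where "DX \<rho> X = DF \<rho> (fst (snd X)) (snd (snd X))"

lemma continuous_X:
  "continuous_on UNIV pX1" "continuous_on UNIV (pX3 \<rho>)" "continuous_on UNIV (pX4 \<rho>)" "continuous_on UNIV (DX \<rho>)"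
  unfolding pX1_def pX3_def pX4_def DX_def by (rule continuous_joint)+

lemma continuous_wX: "cutoff c A r \<Longrightarrow> continuous_on UNIV (wX \<rho> r)"
  unfolding wX_def by (rule continuous_wt)

lemma AE_pX:
  assumes "AE v in lborel. Q v"
  shows "AE X in lborel. Q (pX1 X + w)" "AE X in lborel. Q (pX3 \<rho> X)" "AE X in lborel. Q (pX4 \<rho> X)" "AE X::vec \<times> vec \<times> vec3 in lborel. Q (fst X)"
proof -
  have 1: "(\<lambda>p. pt1 0 (fst p) (snd p) + w) \<in> borel_measurable borel"
    "(\<lambda>p. pt3 \<rho> 0 (fst p) (snd p)) \<in> borel_measurable borel"
    "(\<lambda>p. pt4 \<rho> 0 (fst p) (snd p)) \<in> borel_measurable borel"
    unfolding pt1_def pt3_def pt4_def P_def Bd_def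
    by (intro borel_measurable_continuous_onI continuous_intros)+
  have eq1: "fst X + (pt1 0 (fst (snd X)) (snd (snd X)) + w) = pX1 X + w" for X
    by (simp add: pX1_def pt1_def algebra_simps)
  show "AE X in lborel. Q (pX1 X + w)" using AE_shear[OF 1(1) assms] unfolding eq1 .
  have "fst X + pt3 \<rho> 0 (fst (snd X)) (snd (snd X)) = pX3 \<rho> X" for X
    by (simp add: pX3_def pt3_def algebra_simps)
  then show "AE X in lborel. Q (pX3 \<rho> X)" using AE_shear[OF 1(2) assms] by simp
  have "fst X + pt4 \<rho> 0 (fst (snd X)) (snd (snd X)) = pX4 \<rho> X" for X
    by (simp add: pX4_def pt4_def algebra_simps)
  then show "AE X in lborel. Q (pX4 \<rho> X)" using AE_shear[OF 1(3) assms] by simp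
  show "AE X::vec \<times> vec \<times> vec3 in lborel. Q (fst X)" using AE_shear[of "\<lambda>p. 0", OF _ assms] by simp
qed

lemma wX_support:
  assumes r: "cutoff c A r" and rho: "0 \<le> \<rho>" "\<rho> \<le> 1" and nz: "wX \<rho> r X \<noteq> 0"
  shows "norm X \<le> 100"
proof -
  have "norm X \<le> norm (fst X) + (norm (fst (snd X)) + norm (snd (snd X)))"
    using norm_Pair_le[of "fst X" "snd X"] norm_Pair_le[of "fst (snd X)" "snd (snd X)"] by simp
  then show ?thesis using wt_support[OF r rho nz[unfolded wX_def]] by linarith
qed

lemma iterated_integral_bound:
  fixes F :: "'a::euclidean_space \<times> 'b::euclidean_space \<Rightarrow> complex"
  assumes F: "integrable lborel F" and B: "\<And>x. cmod (LINT y|lborel. F (x, y)) \<le> B * indicator (cball 0 M) x"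
  shows "cmod (LINT X|lborel. F X) \<le> B * measure lborel (cball 0 M :: 'a set)"
proof -
  have F': "integrable (lborel \<Otimes>\<^sub>M lborel) F" using F by (simp add: lborel_prod)
  have "cmod (LINT X|lborel. F X) = cmod (LINT x|lborel. LINT y|lborel. F (x, y))"
    using lborel_pair.integral_fst'[OF F'] by (simp add: lborel_prod)
  also have "\<dots> \<le> (LINT x|lborel. B * indicator (cball 0 M) (x::'a))"
  proof (rule order_trans[OF integral_norm_bound], rule integral_mono)
    show "integrable lborel (\<lambda>x. norm (LINT y|lborel. F (x, y)))"
      using lborel_pair.integrable_fst'[OF F'] by (rule integrable_norm)
    show "integrable lborel (\<lambda>x. B * indicator (cball (0::'a) M) x)"
      using emeasure_lborel_cball_finite[of "0::'a" M] by (intro integrable_mult_right) simp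
  qed (rule B)
  also have "\<dots> = B * measure lborel (cball 0 M :: 'a set)" by simp
  finally show ?thesis .
qed

text \<open>The first slot is a function of the whole variable \<open>X\<close>, so that weights in
  \<open>DX\<close> and increments can be absorbed into it. The other slots are functions of their
  points only.\<close>

definition quad :: "real \<Rightarrow> (vec \<Rightarrow> complex) \<Rightarrow> (vec \<times> vec \<times> vec3 \<Rightarrow> complex) \<Rightarrow> (vec \<Rightarrow> complex) \<Rightarrow> (vec \<Rightarrow> complex) \<Rightarrow> (vec \<Rightarrow> complex)
    \<Rightarrow> vec \<times> vec \<times> vec3 \<Rightarrow> complex" where
  "quad \<rho> r f1 f2 f3 f4 X = f1 X * f2 (fst X) * f3 (pX3 \<rho> X) * f4 (pX4 \<rho> X) * wX \<rho> r X"

lemma quad_properties: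
  assumes r: "cutoff c A r" and rho: "0 \<le> \<rho>" "\<rho> \<le> 1"
    and m: "f1 \<in> borel_measurable borel" "f2 \<in> borel_measurable borel" "f3 \<in> borel_measurable borel" "f4 \<in> borel_measurable borel"
    and b: "\<And>x. cmod (f1 x) \<le> N1" "\<And>x. cmod (f2 x) \<le> N2" "\<And>x. cmod (f3 x) \<le> N3" "\<And>x. cmod (f4 x) \<le> N4"
    and K: "\<And>X. cmod (wX \<rho> r X) \<le> K"
  shows "quad \<rho> r f1 f2 f3 f4 \<in> borel_measurable borel"
    and "cmod (quad \<rho> r f1 f2 f3 f4 X) \<le> N1 * N2 * N3 * N4 * K"
    and "norm X > 100 \<Longrightarrow> quad \<rho> r f1 f2 f3 f4 X = 0"
    and "integrable lborel (quad \<rho> r f1 f2 f3 f4)"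
proof -
  have N: "0 \<le> N1" "0 \<le> N2" "0 \<le> N3" "0 \<le> N4" using b by (meson norm_ge_zero order_trans)+
  have c: "(\<lambda>X. f3 (pX3 \<rho> X)) \<in> borel_measurable borel" "(\<lambda>X. f4 (pX4 \<rho> X)) \<in> borel_measurable borel"
    "(\<lambda>X::vec \<times> vec \<times> vec3. f2 (fst X)) \<in> borel_measurable borel"
    by (rule measurable_compose[OF borel_measurable_continuous_onI[OF continuous_X(2)] m(3)]
        measurable_compose[OF borel_measurable_continuous_onI[OF continuous_X(3)] m(4)]
        measurable_compose[OF borel_measurable_continuous_onI[OF continuous_on_fst[OF continuous_on_id]] m(2)])+
  show 1: "quad \<rho> r f1 f2 f3 f4 \<in> borel_measurable borel"
    unfolding quad_def
    by (intro borel_measurable_times c m(1) borel_measurable_continuous_onI[OF continuous_wX[OF r]])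
  show 2: "cmod (quad \<rho> r f1 f2 f3 f4 X) \<le> N1 * N2 * N3 * N4 * K" for X
    unfolding quad_def norm_mult by (intro mult_mono b K mult_nonneg_nonneg N norm_ge_zero)
  show 3: "quad \<rho> r f1 f2 f3 f4 X = 0" if "norm X > 100" for X
  proof -
    have "wX \<rho> r X = 0" using wX_support[OF r rho] that by (meson not_le)
    then show ?thesis by (simp add: quad_def)
  qed
  show "integrable lborel (quad \<rho> r f1 f2 f3 f4)"
    by (rule integrable_bounded_support[OF 1 2 3])
qed

text \<open>The second point is \<open>V\<close> itself, constant in the inner integral over
  \<open>q\<close>; hence \<open>\<phi>2\<close> needs only to be bounded and measurable. The bound
  for the inner integral is then integrated over the balls of radius 20 for \<sigma> and 40 for
  \<open>V\<close> outside which the weight vanishes.\<close>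

lemma quad_difference_C1:
  "\<exists>K\<ge>1. \<forall>\<rho> c A r w N eps \<phi>1 \<phi>2 \<phi>3 \<phi>4. cutoff c A r \<and> 0 \<le> \<rho> \<and> \<rho> \<le> 1 \<and> 0 < eps \<and> eps \<le> 1 \<and>
     C1 \<phi>1 \<and> \<phi>2 \<in> borel_measurable borel \<and> C1 \<phi>3 \<and> C1 \<phi>4 \<and>
     (\<forall>v. cmod (\<phi>1 v) \<le> N) \<and> (\<forall>v. cmod (\<phi>2 v) \<le> N) \<and> (\<forall>v. cmod (\<phi>3 v) \<le> N) \<and> (\<forall>v. cmod (\<phi>4 v) \<le> N) \<longrightarrow>
     cmod (LINT X|lborel. quad \<rho> r (\<lambda>X. (\<phi>1 (pX1 X + w) - \<phi>1 (pX1 X)) * of_real ((DX \<rho> X)\<^sup>2 / ((DX \<rho> X)\<^sup>2 + eps\<^sup>2))) \<phi>2 \<phi>3 \<phi>4 X)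
       \<le> K * c ^ 4 * A * N ^ 4 / eps\<^sup>2 * norm w"
proof -
  obtain K where K1: "K \<ge> 1" and K': "\<forall>\<rho> c A r V \<sigma> w N eps \<phi>1 \<phi>3 \<phi>4. cutoff c A r \<and> 0 \<le> \<rho> \<and> \<rho> \<le> 1 \<and> 0 < eps \<and> eps \<le> 1 \<and>
     C1 \<phi>1 \<and> C1 \<phi>3 \<and> C1 \<phi>4 \<and> (\<forall>v. cmod (\<phi>1 v) \<le> N) \<and> (\<forall>v. cmod (\<phi>3 v) \<le> N) \<and> (\<forall>v. cmod (\<phi>4 v) \<le> N) \<longrightarrow>
     cmod (LINT q|lborel. ((\<phi>1 (pt1 V \<sigma> q + w) - \<phi>1 (pt1 V \<sigma> q)) * \<phi>3 (pt3 \<rho> V \<sigma> q) * \<phi>4 (pt4 \<rho> V \<sigma> q)) * wt \<rho> r V \<sigma> q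
        * rat \<rho> eps \<sigma> q) \<le> K * c ^ 4 * A * N ^ 3 / eps\<^sup>2 * norm w"
    using four_point_difference by (elim exE conjE) (rule that)
  obtain W where W1: "W \<ge> 1" and W': "\<forall>\<rho> c A r V \<sigma> q. cutoff c A r \<and> 0 \<le> \<rho> \<and> \<rho> \<le> 1 \<longrightarrow> cmod (wt \<rho> r V \<sigma> q) \<le> W * c ^ 4 \<and>
    (\<forall>e. norm \<sigma> \<le> 20 \<and> norm e \<le> 1 \<and> norm q \<le> 40 \<longrightarrow> cmod (fd (wt \<rho> r V \<sigma>) q (ZF \<rho> \<sigma> e q)) \<le> W * c ^ 4 * A)"
    using wt_bounds by (elim exE conjE) (rule that)
  define m20 where "m20 = measure lborel (cball 0 20 :: vec set)"
  define m40 where "m40 = measure lborel (cball 0 40 :: vec set)"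
  have m0: "0 \<le> m20 * m40" by (simp add: m20_def m40_def)
  define K2 where "K2 = K * (1 + m20 * m40)"
  have "1 * 1 \<le> K * (1 + m20 * m40)" using K1 m0 by (intro mult_mono) linarith+
  then have K2: "K2 \<ge> 1" by (simp add: K2_def)
  have "cmod (LINT X|lborel. quad \<rho> r (\<lambda>X. (\<phi>1 (pX1 X + w) - \<phi>1 (pX1 X)) * of_real ((DX \<rho> X)\<^sup>2 / ((DX \<rho> X)\<^sup>2 + eps\<^sup>2))) \<phi>2 \<phi>3 \<phi>4 X)
       \<le> K2 * c ^ 4 * A * N ^ 4 / eps\<^sup>2 * norm w"
    if r: "cutoff c A r" and rho: "0 \<le> \<rho>" "\<rho> \<le> 1" and eps: "0 < eps" "eps \<le> 1"
      and \<phi>: "C1 \<phi>1" "\<phi>2 \<in> borel_measurable borel" "C1 \<phi>3" "C1 \<phi>4"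
      and N: "\<forall>v. cmod (\<phi>1 v) \<le> N" "\<forall>v. cmod (\<phi>2 v) \<le> N" "\<forall>v. cmod (\<phi>3 v) \<le> N" "\<forall>v. cmod (\<phi>4 v) \<le> N"
    for \<rho> c A r w N eps \<phi>1 \<phi>2 \<phi>3 \<phi>4
  proof -
    define f1 where "f1 = (\<lambda>X. (\<phi>1 (pX1 X + w) - \<phi>1 (pX1 X)) * complex_of_real ((DX \<rho> X)\<^sup>2 / ((DX \<rho> X)\<^sup>2 + eps\<^sup>2)))"
    define F where "F = quad \<rho> r f1 \<phi>2 \<phi>3 \<phi>4"
    have N0: "N \<ge> 0" using N(1) by (meson norm_ge_zero order_trans)
    have cA: "c \<ge> 1" "A \<ge> 1" using cutoffD(2,3)[OF r] by blast+
    define B where "B = K * c ^ 4 * A * N ^ 3 / eps\<^sup>2 * norm w"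
    have B0: "0 \<le> B" unfolding B_def
      using K1 cA N0 by (intro mult_nonneg_nonneg divide_nonneg_nonneg zero_le_power norm_ge_zero zero_le_power2) linarith+
    have "continuous_on UNIV (\<lambda>X. \<phi>1 (pX1 X + w))"
      by (rule continuous_on_compose2[OF C1_continuous[OF \<phi>(1), of UNIV]]) (auto intro!: continuous_intros continuous_X)
    moreover have "continuous_on UNIV (\<lambda>X. \<phi>1 (pX1 X))"
      by (rule continuous_on_compose2[OF C1_continuous[OF \<phi>(1), of UNIV] continuous_X(1)]) simp
    ultimately have f1c: "continuous_on UNIV f1"
      unfolding f1_def by (intro continuous_on_mult continuous_on_diff continuous_rat[OF eps(1)] continuous_X)
    have f1b: "cmod (f1 X) \<le> 2 * N" for X
    proof -
      have "cmod (\<phi>1 (pX1 X + w) - \<phi>1 (pX1 X)) \<le> N + N"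
        by (rule order_trans[OF norm_triangle_ineq4]) (use N(1) in \<open>intro add_mono; blast\<close>)
      then have "cmod (f1 X) \<le> (N + N) * 1" unfolding f1_def norm_mult
        using N0 by (intro mult_mono rat_le_1 eps) simp_all
      then show ?thesis by simp
    qed
    have wb: "cmod (wX \<rho> r X) \<le> W * c ^ 4" for X
      unfolding wX_def using W'[rule_format, OF conjI[OF r conjI[OF rho]]] by blast
    note q = quad_properties[OF r rho borel_measurable_continuous_onI[OF f1c] \<phi>(2) C1_measurable[OF \<phi>(3)] C1_measurable[OF \<phi>(4)]
       f1b N(2)[rule_format] N(3)[rule_format] N(4)[rule_format] wb, folded F_def]
    have inner: "cmod (LINT q|lborel. F (V, \<sigma>, q)) \<le> (N * B) * (indicator (cball 0 40) V * indicator (cball 0 20) \<sigma>)" for V \<sigma>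
    proof (cases "norm V \<le> 40 \<and> norm \<sigma> \<le> 20")
      case False
      have "wX \<rho> r (V, \<sigma>, q) = 0" for q
        using wt_support(2,3)[OF r rho, of V \<sigma> q] False unfolding wX_def fst_conv snd_conv by blast
      then have "F (V, \<sigma>, q) = 0" for q by (simp add: F_def quad_def)
      then show ?thesis using B0 N0 by simp
    next
      case True
      have eq: "F (V, \<sigma>, q) = \<phi>2 V * (((\<phi>1 (pt1 V \<sigma> q + w) - \<phi>1 (pt1 V \<sigma> q)) * \<phi>3 (pt3 \<rho> V \<sigma> q) * \<phi>4 (pt4 \<rho> V \<sigma> q)) * wt \<rho> r V \<sigma> q
        * rat \<rho> eps \<sigma> q)" for q
        by (simp add: F_def quad_def f1_def pX1_def pX3_def pX4_def wX_def DX_def mult_ac)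
      have "cmod (LINT q|lborel. ((\<phi>1 (pt1 V \<sigma> q + w) - \<phi>1 (pt1 V \<sigma> q)) * \<phi>3 (pt3 \<rho> V \<sigma> q) * \<phi>4 (pt4 \<rho> V \<sigma> q)) * wt \<rho> r V \<sigma> q
        * rat \<rho> eps \<sigma> q) \<le> B"
        unfolding B_def by (rule K'[rule_format]) (intro conjI r rho eps \<phi> N)
      then have "cmod (\<phi>2 V) * cmod (LINT q|lborel. ((\<phi>1 (pt1 V \<sigma> q + w) - \<phi>1 (pt1 V \<sigma> q)) * \<phi>3 (pt3 \<rho> V \<sigma> q) * \<phi>4 (pt4 \<rho> V \<sigma> q)) * wt \<rho> r V \<sigma> q
        * rat \<rho> eps \<sigma> q) \<le> N * B"
        by (rule mult_mono[OF N(2)[rule_format] _ N0 norm_ge_zero])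
      then show ?thesis unfolding eq integral_mult_right_zero norm_mult using True by simp
    qed
    have mid: "cmod (LINT p|lborel. F (V, p)) \<le> (N * B * m20) * indicator (cball 0 40) V" for V
    proof -
      have m: "(\<lambda>p. F (V, p)) \<in> borel_measurable borel"
        by (rule measurable_compose[OF _ q(1)]) (intro borel_measurable_continuous_onI continuous_intros)
      have i: "integrable lborel (\<lambda>p. F (V, p))"
      proof (rule integrable_bounded_support[OF m q(2)])
        fix p :: "vec \<times> vec3" assume "norm p > 100"
        moreover have "norm p \<le> norm (V, p)" by (rule norm_snd_le)
        ultimately show "F (V, p) = 0" by (intro q(3)) linarith
      qed
      have "cmod (LINT p|lborel. F (V, p)) \<le> (N * B * indicator (cball 0 40) V) * measure lborel (cball 0 20 :: vec set)"
        by (rule iterated_integral_bound[OF i]) (use inner[of V] in \<open>simp add: mult.assoc\<close>)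
      then show ?thesis by (simp add: m20_def mult_ac)
    qed
    have "cmod (LINT X|lborel. F X) \<le> (N * B * m20) * measure lborel (cball 0 40 :: vec set)"
      by (rule iterated_integral_bound[OF q(4) mid])
    also have "\<dots> = (m20 * m40) * (N * B)" by (simp add: m40_def)
    also have "\<dots> \<le> (1 + m20 * m40) * (N * B)" using N0 B0 by (intro mult_right_mono) auto
    also have "\<dots> = K2 * c ^ 4 * A * N ^ 4 / eps\<^sup>2 * norm w" by (simp add: K2_def B_def power3_eq_cube power4_eq_xxxx)
    finally show ?thesis by (simp add: F_def f1_def)
  qed
  then show ?thesis using K2 by blast
qed

text \<open>Dominated convergence along bounded approximants of class C1 in the first, third and
  fourth slots. These are bounded by 2N instead of N, whence the factor 16 = 2^4.\<close>

lemma quad_difference: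
  "\<exists>K\<ge>1. \<forall>\<rho> c A r w N eps \<phi>1 \<phi>2 \<phi>3 \<phi>4. cutoff c A r \<and> 0 \<le> \<rho> \<and> \<rho> \<le> 1 \<and> 0 < eps \<and> eps \<le> 1 \<and> 0 < N \<and>
     \<phi>1 \<in> borel_measurable borel \<and> \<phi>2 \<in> borel_measurable borel \<and> \<phi>3 \<in> borel_measurable borel \<and> \<phi>4 \<in> borel_measurable borel \<and>
     (\<forall>v. cmod (\<phi>1 v) \<le> N) \<and> (\<forall>v. cmod (\<phi>2 v) \<le> N) \<and> (\<forall>v. cmod (\<phi>3 v) \<le> N) \<and> (\<forall>v. cmod (\<phi>4 v) \<le> N) \<longrightarrow>
     cmod (LINT X|lborel. quad \<rho> r (\<lambda>X. (\<phi>1 (pX1 X + w) - \<phi>1 (pX1 X)) * of_real ((DX \<rho> X)\<^sup>2 / ((DX \<rho> X)\<^sup>2 + eps\<^sup>2))) \<phi>2 \<phi>3 \<phi>4 X)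
       \<le> K * c ^ 4 * A * N ^ 4 / eps\<^sup>2 * norm w"
proof -
  obtain K where K1: "K \<ge> 1" and K': "\<forall>\<rho> c A r w N eps \<phi>1 \<phi>2 \<phi>3 \<phi>4. cutoff c A r \<and> 0 \<le> \<rho> \<and> \<rho> \<le> 1 \<and> 0 < eps \<and> eps \<le> 1 \<and>
     C1 \<phi>1 \<and> \<phi>2 \<in> borel_measurable borel \<and> C1 \<phi>3 \<and> C1 \<phi>4 \<and>
     (\<forall>v. cmod (\<phi>1 v) \<le> N) \<and> (\<forall>v. cmod (\<phi>2 v) \<le> N) \<and> (\<forall>v. cmod (\<phi>3 v) \<le> N) \<and> (\<forall>v. cmod (\<phi>4 v) \<le> N) \<longrightarrow>
     cmod (LINT X|lborel. quad \<rho> r (\<lambda>X. (\<phi>1 (pX1 X + w) - \<phi>1 (pX1 X)) * of_real ((DX \<rho> X)\<^sup>2 / ((DX \<rho> X)\<^sup>2 + eps\<^sup>2))) \<phi>2 \<phi>3 \<phi>4 X)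
       \<le> K * c ^ 4 * A * N ^ 4 / eps\<^sup>2 * norm w"
    using quad_difference_C1 by (elim exE conjE) (rule that)
  obtain W where W1: "W \<ge> 1" and W': "\<forall>\<rho> c A r V \<sigma> q. cutoff c A r \<and> 0 \<le> \<rho> \<and> \<rho> \<le> 1 \<longrightarrow> cmod (wt \<rho> r V \<sigma> q) \<le> W * c ^ 4 \<and>
    (\<forall>e. norm \<sigma> \<le> 20 \<and> norm e \<le> 1 \<and> norm q \<le> 40 \<longrightarrow> cmod (fd (wt \<rho> r V \<sigma>) q (ZF \<rho> \<sigma> e q)) \<le> W * c ^ 4 * A)"
    using wt_bounds by (elim exE conjE) (rule that)
  have "cmod (LINT X|lborel. quad \<rho> r (\<lambda>X. (\<phi>1 (pX1 X + w) - \<phi>1 (pX1 X)) * of_real ((DX \<rho> X)\<^sup>2 / ((DX \<rho> X)\<^sup>2 + eps\<^sup>2))) \<phi>2 \<phi>3 \<phi>4 X)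
       \<le> (16 * K) * c ^ 4 * A * N ^ 4 / eps\<^sup>2 * norm w"
    if r: "cutoff c A r" and rho: "0 \<le> \<rho>" "\<rho> \<le> 1" and eps: "0 < eps" "eps \<le> 1" and N0: "0 < N"
      and m: "\<phi>1 \<in> borel_measurable borel" "\<phi>2 \<in> borel_measurable borel" "\<phi>3 \<in> borel_measurable borel" "\<phi>4 \<in> borel_measurable borel"
      and N: "\<forall>v. cmod (\<phi>1 v) \<le> N" "\<forall>v. cmod (\<phi>2 v) \<le> N" "\<forall>v. cmod (\<phi>3 v) \<le> N" "\<forall>v. cmod (\<phi>4 v) \<le> N"
    for \<rho> c A r w N eps \<phi>1 \<phi>2 \<phi>3 \<phi>4
  proof -
    obtain g1 where a1: "\<forall>n::nat. C1 (g1 n)" and b1: "\<forall>n x. cmod (g1 n x) \<le> 2 * N" and c1: "AE x in lborel. (\<lambda>n. g1 n x) \<longlonglongrightarrow> \<phi>1 x"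
      using C1_approximation[OF m(1) N(1)[rule_format] N0] by (elim exE conjE) (rule that)
    note g1 = a1[rule_format] b1[rule_format] c1
    obtain g3 where a3: "\<forall>n::nat. C1 (g3 n)" and b3: "\<forall>n x. cmod (g3 n x) \<le> 2 * N" and c3: "AE x in lborel. (\<lambda>n. g3 n x) \<longlonglongrightarrow> \<phi>3 x"
      using C1_approximation[OF m(3) N(3)[rule_format] N0] by (elim exE conjE) (rule that)
    note g3 = a3[rule_format] b3[rule_format] c3
    obtain g4 where a4: "\<forall>n::nat. C1 (g4 n)" and b4: "\<forall>n x. cmod (g4 n x) \<le> 2 * N" and c4: "AE x in lborel. (\<lambda>n. g4 n x) \<longlonglongrightarrow> \<phi>4 x"
      using C1_approximation[OF m(4) N(4)[rule_format] N0] by (elim exE conjE) (rule that)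
    note g4 = a4[rule_format] b4[rule_format] c4
    have N2: "\<forall>v. cmod (\<phi>2 v) \<le> 2 * N" using N0 by (intro allI order_trans[OF N(2)[rule_format]]) simp
    define R where "R = (\<lambda>X. complex_of_real ((DX \<rho> X)\<^sup>2 / ((DX \<rho> X)\<^sup>2 + eps\<^sup>2)))"
    define f where "f = (\<lambda>\<phi> X. (\<phi> (pX1 X + w) - \<phi> (pX1 X)) * R X)"
    have fm: "f \<phi> \<in> borel_measurable borel" if p: "\<phi> \<in> borel_measurable borel" for \<phi> :: "vec \<Rightarrow> complex"
    proof -
      have "(\<lambda>X. pX1 X + w) \<in> borel_measurable borel"
        by (intro borel_measurable_continuous_onI continuous_intros continuous_X)
      from measurable_compose[OF this p] measurable_compose[OF borel_measurable_continuous_onI[OF continuous_X(1)] p]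
      show ?thesis unfolding f_def R_def
        by (intro borel_measurable_times borel_measurable_diff borel_measurable_continuous_onI[OF continuous_rat[OF eps(1) continuous_X(4)]])
    qed
    have fb: "cmod (f \<phi> X) \<le> 2 * M" if p: "\<And>x. cmod (\<phi> x) \<le> M" for \<phi> :: "vec \<Rightarrow> complex" and X M
    proof -
      have M0: "0 \<le> M" using p by (meson norm_ge_zero order_trans)
      have "cmod (\<phi> (pX1 X + w) - \<phi> (pX1 X)) \<le> M + M"
        by (rule order_trans[OF norm_triangle_ineq4]) (intro add_mono p)
      then have "cmod (f \<phi> X) \<le> (M + M) * 1" unfolding f_def norm_mult R_def
        using M0 by (intro mult_mono rat_le_1 eps) simp_all
      then show ?thesis by simp
    qed
    have wb: "cmod (wX \<rho> r X) \<le> W * c ^ 4" for X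
      unfolding wX_def using W'[rule_format, OF conjI[OF r conjI[OF rho]]] by blast
    define F where "F = (\<lambda>n. quad \<rho> r (f (g1 n)) \<phi>2 (g3 n) (g4 n))"
    define F0 where "F0 = quad \<rho> r (f \<phi>1) \<phi>2 \<phi>3 \<phi>4"
    define B where "B = 2 * (2 * N) * (2 * N) * (2 * N) * (2 * N) * (W * c ^ 4)"
    have qF: "F n \<in> borel_measurable borel" "cmod (F n X) \<le> B" "norm X > 100 \<Longrightarrow> F n X = 0" for n X
      unfolding F_def B_def
      by (rule quad_properties(1-3)[OF r rho fm[OF C1_measurable[OF g1(1)]] m(2) C1_measurable[OF g3(1)] C1_measurable[OF g4(1)]
          fb[OF g1(2)] N2[rule_format] g3(2) g4(2) wb]; assumption?)+
    have qF0: "F0 \<in> borel_measurable borel"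
      unfolding F0_def by (rule quad_properties(1)[OF r rho fm[OF m(1)] m(2,3,4) fb[OF N(1)[rule_format]] N(2)[rule_format] N(3)[rule_format] N(4)[rule_format] wb])
    have lim: "(\<lambda>n. LINT X|lborel. F n X) \<longlonglongrightarrow> (LINT X|lborel. F0 X)"
    proof (rule integral_dominated_convergence[where w = "\<lambda>X. B * indicator (cball 0 100) X"])
      show "F0 \<in> borel_measurable lborel" "F n \<in> borel_measurable lborel" for n using qF(1) qF0 by simp_all
      show "integrable lborel (\<lambda>X. B * indicator (cball (0 :: vec \<times> vec \<times> vec3) 100) X)"
        using emeasure_lborel_cball_finite[of "0 :: vec \<times> vec \<times> vec3" 100] by (intro integrable_mult_right) simp
      show "AE X in lborel. norm (F n X) \<le> B * indicator (cball 0 100) X" for n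
      proof (rule AE_I2)
        fix X show "norm (F n X) \<le> B * indicator (cball 0 100) X"
          using qF(2)[of n X] qF(3)[of X n] by (cases "norm X \<le> 100") simp_all
      qed
      show "AE X in lborel. (\<lambda>n. F n X) \<longlonglongrightarrow> F0 X"
        using AE_pX(1)[OF g1(3), of w] AE_pX(1)[OF g1(3), of 0] AE_pX(2)[OF g3(3), of \<rho>] AE_pX(3)[OF g4(3), of \<rho>]
      proof eventually_elim
        case (elim X)
        then show ?case unfolding F_def F0_def quad_def f_def
          by (intro tendsto_mult tendsto_diff tendsto_const) simp_all
      qed
    qed
    have "cmod (LINT X|lborel. F n X) \<le> K * c ^ 4 * A * (2 * N) ^ 4 / eps\<^sup>2 * norm w" for n
      unfolding F_def f_def R_def
      by (rule K'[rule_format]) (intro conjI r rho eps g1(1) m(2) g3(1) g4(1) allI g1(2) N2[rule_format] g3(2) g4(2))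
    then have le: "cmod (LINT X|lborel. F0 X) \<le> K * c ^ 4 * A * (2 * N) ^ 4 / eps\<^sup>2 * norm w"
      by (intro tendsto_upperbound[OF tendsto_norm[OF lim]]) simp_all
    have eq: "K * c ^ 4 * A * (2 * N) ^ 4 / eps\<^sup>2 * norm w = (16 * K) * c ^ 4 * A * N ^ 4 / eps\<^sup>2 * norm w"
      by (simp add: power_mult_distrib)
    show ?thesis using le unfolding eq F0_def f_def R_def .
  qed
  moreover have "16 * K \<ge> 1" using K1 by simp
  ultimately show ?thesis by blast
qed

text \<open>The exponent 30 is twice the degree of \<open>DD\<close> along the direction \<open>E\<close>.\<close>

lemma DX_sublevel:
  "\<exists>K\<ge>1. \<forall>\<rho> eps. 0 < eps \<and> eps \<le> 1 \<longrightarrow>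
    (\<integral>\<^sup>+ X. ennreal (eps\<^sup>2 / ((DX \<rho> X)\<^sup>2 + eps\<^sup>2)) * indicator (cball 0 100) X \<partial>lborel) \<le> ennreal (K * root 30 eps)"
proof -
  define k where "k = 1 + 2 * real 15 / root 15 \<bar>1990656\<bar>"
  have k: "k \<ge> 1" by (simp add: k_def)
  define m where "m = measure lborel (cball 0 110 :: (vec \<times> vec \<times> vec3) set)"
  \<comment> \<open>Moving \<open>s\<close> by (1,-1) and \<open>y\<close> by (-1,1) moves both
    \<open>\<sigma> - y\<close> and \<open>s - y'\<close> by (1,-1) and leaves
    \<open>\<sigma> - y'\<close> fixed. These are the directions of
    \<open>DD_top_nonzero\<close>.\<close>
  define E :: "vec \<times> vec \<times> vec3" where "E = ((0, 0), (0, 0), (1, -1), (-1, 1), 0, 0)"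
  have nE: "norm E \<le> 10"
  proof -
    have "norm (1 :: real, -1 :: real) \<le> 2" "norm (-1 :: real, 1 :: real) \<le> 2"
      using norm_vec_le[of "(1, -1)"] norm_vec_le[of "(-1, 1)"] by simp_all
    moreover have "norm E \<le> norm (0 :: real, 0 :: real) + (norm (0 :: real, 0 :: real) + (norm (1 :: real, -1 :: real) + (norm (-1 :: real, 1 :: real) + norm (0 :: real, 0 :: real))))"
      unfolding E_def by (intro order_trans[OF norm_Pair_le] add_left_mono order_refl)
    ultimately show ?thesis by (simp del: norm_Pair)
  qed
  have "(\<integral>\<^sup>+ X. ennreal (eps\<^sup>2 / ((DX \<rho> X)\<^sup>2 + eps\<^sup>2)) * indicator (cball 0 100) X \<partial>lborel) \<le> ennreal ((k * (1 + m)) * root 30 eps)"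
    if eps: "0 < eps" "eps \<le> 1" for \<rho> eps
  proof -
    define \<Xi> where "\<Xi> = (\<lambda>X. ennreal (eps\<^sup>2 / ((DX \<rho> X)\<^sup>2 + eps\<^sup>2)))"
    have [measurable]: "DX \<rho> \<in> borel_measurable borel" by (rule borel_measurable_continuous_onI[OF continuous_X(4)])
    have \<Xi>m [measurable]: "\<Xi> \<in> borel_measurable borel" unfolding \<Xi>_def by measurable
    have cm [measurable]: "cball 0 M \<in> sets borel" for M and x :: 'a by simp
    have top: "has_top 15 1990656 (\<lambda>t. DX \<rho> (X + t *\<^sub>R E))" for X
    proof -
      obtain V \<sigma> s y y' where X: "X = (V, \<sigma>, s, y, y')" by (metis prod.exhaust)
      have "DX \<rho> (X + t *\<^sub>R E) = DD \<rho> ((\<sigma> - y) + t *\<^sub>R (1, -1)) ((s - y') + t *\<^sub>R (1, -1)) ((\<sigma> - y') + t *\<^sub>R (0, 0))" for t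
      proof -
        have 1: "(\<sigma> + t *\<^sub>R (0, 0)) - (y + t *\<^sub>R (- 1, 1)) = (\<sigma> - y) + t *\<^sub>R (1, - 1)"
          "(s + t *\<^sub>R (1, - 1)) - (y' + t *\<^sub>R (0, 0)) = (s - y') + t *\<^sub>R (1, - 1)"
          "(\<sigma> + t *\<^sub>R (0, 0)) - (y' + t *\<^sub>R (0, 0)) = (\<sigma> - y') + t *\<^sub>R (0, 0)"
          by (simp_all add: prod_eq_iff)
        show ?thesis
          unfolding DX_def DF_def X E_def scaleR_Pair add_Pair fst_conv snd_conv
          unfolding scaleR_Pair[symmetric] 1 ..
      qed
      then show ?thesis using DD_has_top[of "(1, -1)" "(1, -1)" "(0, 0)" \<rho> "\<sigma> - y" "s - y'" "\<sigma> - y'"]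
        by (simp only: DD_top_nonzero)
    qed
    have inner: "(\<integral>\<^sup>+ t. \<Xi> (X + t *\<^sub>R E) * indicator {0..1} t \<partial>lborel) \<le> ennreal (k * root 30 eps)" for X
      using has_top_sublevel_integral[OF top[of X] _ _ eps] unfolding \<Xi>_def k_def by simp
    define J where "J = (\<integral>\<^sup>+ X. \<Xi> X * indicator (cball 0 100) X \<partial>lborel)"
    \<comment> \<open>Averaging over the translations by \<open>t *\<^sub>R E\<close> with
      \<open>t\<close> in [0,1] brings in the one-variable sublevel estimate. The ball grows from
      radius 100 to 110 because \<open>norm E \<le> 10\<close>.\<close>
    have J_le: "J \<le> (\<integral>\<^sup>+ X. \<Xi> (X + t *\<^sub>R E) * indicator (cball 0 110) X \<partial>lborel)" if t: "t \<in> {0..1}" for t :: real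
    proof -
      have "J = (\<integral>\<^sup>+ X. \<Xi> (t *\<^sub>R E + X) * indicator (cball 0 100) (t *\<^sub>R E + X) \<partial>lborel)"
        unfolding J_def
        by (rule nn_integral_lborel_shift[symmetric]) (intro borel_measurable_times_ennreal \<Xi>m borel_measurable_indicator borel_closed closed_cball)
      also have "\<dots> \<le> (\<integral>\<^sup>+ X. \<Xi> (X + t *\<^sub>R E) * indicator (cball 0 110) X \<partial>lborel)"
      proof (intro nn_integral_mono)
        fix X
        have "norm X \<le> norm (t *\<^sub>R E + X) + norm (t *\<^sub>R E)" using norm_triangle_ineq4[of "t *\<^sub>R E + X" "t *\<^sub>R E"] by simp
        moreover have "norm (t *\<^sub>R E) \<le> 1 * 10" unfolding norm_scaleR using t nE by (intro mult_mono) auto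
        ultimately have "norm (t *\<^sub>R E + X) \<le> 100 \<Longrightarrow> norm X \<le> 110" by linarith
        then show "\<Xi> (t *\<^sub>R E + X) * indicator (cball 0 100) (t *\<^sub>R E + X) \<le> \<Xi> (X + t *\<^sub>R E) * indicator (cball 0 110) X"
          by (simp add: add.commute indicator_def)
      qed
      finally show ?thesis .
    qed
    have joint: "(\<lambda>p. \<Xi> (snd p + fst p *\<^sub>R E) * indicator (cball 0 110) (snd p) * indicator {0..1} (fst p)) \<in> borel_measurable (lborel \<Otimes>\<^sub>M lborel)"
    proof -
      have 1: "(\<lambda>p::real \<times> vec \<times> vec \<times> vec3. snd p + fst p *\<^sub>R E) \<in> borel_measurable borel"
        "(\<lambda>p::real \<times> vec \<times> vec \<times> vec3. snd p) \<in> borel_measurable borel" "(\<lambda>p::real \<times> vec \<times> vec \<times> vec3. fst p) \<in> borel_measurable borel"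
        by (intro borel_measurable_continuous_onI continuous_intros)+
      show ?thesis unfolding lborel_prod measurable_lborel2
        by (intro borel_measurable_times_ennreal measurable_compose[OF 1(1) \<Xi>m] measurable_compose[OF 1(2) borel_measurable_indicator]
            measurable_compose[OF 1(3) borel_measurable_indicator]) simp_all
    qed
    have "J = (\<integral>\<^sup>+ t. J * indicator {0..1} t \<partial>(lborel :: real measure))" by (simp add: nn_integral_cmult_indicator)
    also have "\<dots> \<le> (\<integral>\<^sup>+ t. \<integral>\<^sup>+ X. \<Xi> (X + t *\<^sub>R E) * indicator (cball 0 110) X * indicator {0..1} t \<partial>lborel \<partial>lborel)"
    proof (intro nn_integral_mono)
      fix t :: real
      show "J * indicator {0..1} t \<le> (\<integral>\<^sup>+ X. \<Xi> (X + t *\<^sub>R E) * indicator (cball 0 110) X * indicator {0..1} t \<partial>lborel)"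
        using J_le[of t] by (cases "t \<in> {0..1}") simp_all
    qed
    also have "\<dots> = (\<integral>\<^sup>+ X. \<integral>\<^sup>+ t. \<Xi> (X + t *\<^sub>R E) * indicator (cball 0 110) X * indicator {0..1} t \<partial>lborel \<partial>lborel)"
      using lborel_pair.Fubini'[of "\<lambda>t X. \<Xi> (X + t *\<^sub>R E) * indicator (cball 0 110) X * indicator {0..1} t"] joint
      by (simp add: case_prod_unfold)
    also have "\<dots> \<le> (\<integral>\<^sup>+ X. ennreal (k * root 30 eps) * indicator (cball 0 110 :: (vec \<times> vec \<times> vec3) set) X \<partial>lborel)"
    proof (intro nn_integral_mono)
      fix X :: "vec \<times> vec \<times> vec3"
      show "(\<integral>\<^sup>+ t. \<Xi> (X + t *\<^sub>R E) * indicator (cball 0 110) X * indicator {0..1} t \<partial>lborel) \<le> ennreal (k * root 30 eps) * indicator (cball 0 110) X"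
        using inner[of X] by (cases "X \<in> cball 0 110") simp_all
    qed
    also have "\<dots> = ennreal (k * root 30 eps) * emeasure lborel (cball 0 110 :: (vec \<times> vec \<times> vec3) set)"
      by (subst nn_integral_cmult_indicator) simp_all
    also have "\<dots> = ennreal (k * root 30 eps * m)"
    proof -
      have "emeasure lborel (cball 0 110 :: (vec \<times> vec \<times> vec3) set) = ennreal m"
        unfolding m_def by (rule emeasure_eq_ennreal_measure) (use emeasure_lborel_cball_finite in \<open>simp add: less_top[symmetric]\<close>)
      then show ?thesis using k eps by (simp add: ennreal_mult m_def)
    qed
    also have "\<dots> \<le> ennreal ((k * (1 + m)) * root 30 eps)"
    proof (rule ennreal_leI)
      have "0 \<le> k * root 30 eps" using k eps by simp
      then show "k * root 30 eps * m \<le> k * (1 + m) * root 30 eps" by (simp add: algebra_simps)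
    qed
    finally show ?thesis unfolding J_def \<Xi>_def .
  qed
  moreover have "1 * 1 \<le> k * (1 + m)" using k by (intro mult_mono) (simp_all add: m_def)
  ultimately show ?thesis by (intro exI[of _ "k * (1 + m)"]) simp
qed

text \<open>The complementary weight is estimated by absolute values only: it is concentrated where
  \<open>DX\<close> is small, and there its integral is small by \<open>DX_sublevel\<close>.\<close>

lemma quad_degenerate:
  "\<exists>K\<ge>1. \<forall>\<rho> c A r N eps f1 f2 f3 f4. cutoff c A r \<and> 0 \<le> \<rho> \<and> \<rho> \<le> 1 \<and> 0 < eps \<and> eps \<le> 1 \<and> 0 \<le> N \<and>
     f1 \<in> borel_measurable borel \<and> f2 \<in> borel_measurable borel \<and> f3 \<in> borel_measurable borel \<and> f4 \<in> borel_measurable borel \<and>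
     (\<forall>X. cmod (f1 X) \<le> N) \<and> (\<forall>v. cmod (f2 v) \<le> N) \<and> (\<forall>v. cmod (f3 v) \<le> N) \<and> (\<forall>v. cmod (f4 v) \<le> N) \<longrightarrow>
     cmod (LINT X|lborel. quad \<rho> r (\<lambda>X. f1 X * of_real (eps\<^sup>2 / ((DX \<rho> X)\<^sup>2 + eps\<^sup>2))) f2 f3 f4 X)
       \<le> K * c ^ 4 * N ^ 4 * root 30 eps"
proof -
  obtain S where S1: "S \<ge> 1" and S': "\<forall>\<rho> eps. 0 < eps \<and> eps \<le> 1 \<longrightarrow>
    (\<integral>\<^sup>+ X. ennreal (eps\<^sup>2 / ((DX \<rho> X)\<^sup>2 + eps\<^sup>2)) * indicator (cball 0 100) X \<partial>lborel) \<le> ennreal (S * root 30 eps)"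
    using DX_sublevel by (elim exE conjE) (rule that)
  obtain W where W1: "W \<ge> 1" and W': "\<forall>\<rho> c A r V \<sigma> q. cutoff c A r \<and> 0 \<le> \<rho> \<and> \<rho> \<le> 1 \<longrightarrow> cmod (wt \<rho> r V \<sigma> q) \<le> W * c ^ 4 \<and>
    (\<forall>e. norm \<sigma> \<le> 20 \<and> norm e \<le> 1 \<and> norm q \<le> 40 \<longrightarrow> cmod (fd (wt \<rho> r V \<sigma>) q (ZF \<rho> \<sigma> e q)) \<le> W * c ^ 4 * A)"
    using wt_bounds by (elim exE conjE) (rule that)
  have "cmod (LINT X|lborel. quad \<rho> r (\<lambda>X. f1 X * of_real (eps\<^sup>2 / ((DX \<rho> X)\<^sup>2 + eps\<^sup>2))) f2 f3 f4 X)
       \<le> (W * S) * c ^ 4 * N ^ 4 * root 30 eps"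
    if r: "cutoff c A r" and rho: "0 \<le> \<rho>" "\<rho> \<le> 1" and eps: "0 < eps" "eps \<le> 1" and N0: "0 \<le> N"
      and m: "f1 \<in> borel_measurable borel" "f2 \<in> borel_measurable borel" "f3 \<in> borel_measurable borel" "f4 \<in> borel_measurable borel"
      and N: "\<forall>X. cmod (f1 X) \<le> N" "\<forall>v. cmod (f2 v) \<le> N" "\<forall>v. cmod (f3 v) \<le> N" "\<forall>v. cmod (f4 v) \<le> N"
    for \<rho> c A r N eps f1 f2 f3 f4
  proof -
    define B where "B = N * N * N * N * (W * c ^ 4)"
    have c1: "c \<ge> 1" using cutoffD(2)[OF r] .
    have B0: "B \<ge> 0" unfolding B_def using N0 W1 c1 by (intro mult_nonneg_nonneg zero_le_power) linarith+
    have wb: "cmod (wX \<rho> r X) \<le> W * c ^ 4" for X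
      unfolding wX_def using W'[rule_format, OF conjI[OF r conjI[OF rho]]] by blast
    define g where "g = quad \<rho> r f1 f2 f3 f4"
    note q = quad_properties[OF r rho m N(1)[rule_format] N(2)[rule_format] N(3)[rule_format] N(4)[rule_format] wb, folded g_def B_def]
    have eq: "quad \<rho> r (\<lambda>X. f1 X * of_real (eps\<^sup>2 / ((DX \<rho> X)\<^sup>2 + eps\<^sup>2))) f2 f3 f4 X = g X * of_real (eps\<^sup>2 / ((DX \<rho> X)\<^sup>2 + eps\<^sup>2))" for X
      by (simp add: g_def quad_def)
    have [measurable]: "DX \<rho> \<in> borel_measurable borel" by (rule borel_measurable_continuous_onI[OF continuous_X(4)])
    have pos: "0 \<le> eps\<^sup>2 / ((DX \<rho> X)\<^sup>2 + eps\<^sup>2)" for X by simp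
    have im: "(\<lambda>X. ennreal (eps\<^sup>2 / ((DX \<rho> X)\<^sup>2 + eps\<^sup>2)) * indicator (cball 0 100) X) \<in> borel_measurable lborel"
    proof -
      have "(\<lambda>X. ennreal (eps\<^sup>2 / ((DX \<rho> X)\<^sup>2 + eps\<^sup>2))) \<in> borel_measurable borel" by measurable
      then show ?thesis unfolding measurable_lborel2
        by (intro borel_measurable_times_ennreal borel_measurable_indicator borel_closed closed_cball)
    qed
    have "ennreal (cmod (LINT X|lborel. g X * of_real (eps\<^sup>2 / ((DX \<rho> X)\<^sup>2 + eps\<^sup>2))))
       \<le> (\<integral>\<^sup>+ X. ennreal (cmod (g X * of_real (eps\<^sup>2 / ((DX \<rho> X)\<^sup>2 + eps\<^sup>2)))) \<partial>lborel)"
      by (rule norm_integral_le_nn_integral)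
    also have "\<dots> \<le> (\<integral>\<^sup>+ X. ennreal B * (ennreal (eps\<^sup>2 / ((DX \<rho> X)\<^sup>2 + eps\<^sup>2)) * indicator (cball 0 100) X) \<partial>lborel)"
    proof (intro nn_integral_mono)
      fix X
      show "ennreal (cmod (g X * of_real (eps\<^sup>2 / ((DX \<rho> X)\<^sup>2 + eps\<^sup>2)))) \<le> ennreal B * (ennreal (eps\<^sup>2 / ((DX \<rho> X)\<^sup>2 + eps\<^sup>2)) * indicator (cball 0 100) X)"
      proof (cases "norm X \<le> 100")
        case True
        have "ennreal (cmod (g X * of_real (eps\<^sup>2 / ((DX \<rho> X)\<^sup>2 + eps\<^sup>2)))) \<le> ennreal (B * (eps\<^sup>2 / ((DX \<rho> X)\<^sup>2 + eps\<^sup>2)))"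
          unfolding norm_mult norm_of_real abs_of_nonneg[OF pos] by (intro ennreal_leI mult_right_mono q(2) pos)
        then show ?thesis unfolding ennreal_mult[OF B0 pos] using True by simp
      qed (simp add: q(3))
    qed
    also have "\<dots> = ennreal B * (\<integral>\<^sup>+ X. ennreal (eps\<^sup>2 / ((DX \<rho> X)\<^sup>2 + eps\<^sup>2)) * indicator (cball 0 100) X \<partial>lborel)"
      by (rule nn_integral_cmult[OF im])
    also have "\<dots> \<le> ennreal B * ennreal (S * root 30 eps)"
      by (intro mult_left_mono S'[rule_format] conjI eps) simp
    also have "\<dots> = ennreal (B * (S * root 30 eps))" using B0 S1 eps by (intro ennreal_mult[symmetric]) auto
    finally have "cmod (LINT X|lborel. g X * of_real (eps\<^sup>2 / ((DX \<rho> X)\<^sup>2 + eps\<^sup>2))) \<le> B * (S * root 30 eps)"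
      using B0 S1 eps by (subst (asm) ennreal_le_iff) auto
    also have "\<dots> = (W * S) * c ^ 4 * N ^ 4 * root 30 eps" by (simp add: B_def power4_eq_xxxx)
    finally show ?thesis unfolding eq .
  qed
  moreover have "W * S \<ge> 1" using mult_mono[of 1 W 1 S] W1 S1 by simp
  ultimately show ?thesis by blast
qed

lemma gconv_shift:
  assumes m: "f \<in> borel_measurable borel"
  shows "gconv s f v = (LINT w|lborel. of_real (gker s w) * f (v + w))"
proof -
  have "(\<lambda>y. of_real (gker s (v - y)) * f y) \<in> borel_measurable borel"
    by (intro borel_measurable_times m borel_measurable_of_real measurable_compose[OF _ gker_measurable]
        borel_measurable_diff borel_measurable_const) simp
  from lborel_integral_shift[OF this, of v]
  have "gconv s f v = (LINT w|lborel. of_real (gker s (v - (v + w))) * f (v + w))" by (simp add: gconv_def)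
  moreover have "gker s (v - (v + w)) = gker s w" for w by (simp add: gker_def gauss_minus)
  ultimately show ?thesis by simp
qed

text \<open>The weights D^2/(D^2+eps^2) and eps^2/(D^2+eps^2) add up to 1. With the second, the form
  is small by \<open>quad_degenerate\<close>. With the first, the function in the first slot is
  written as minus a Gaussian average of increments of \<open>f\<close>; each increment by
  \<open>w\<close> costs a constant times |w| / eps^2, and the first moment of the Gaussian is at
  most \<open>2 * sqrt s\<close>. All slots are bounded by 2N, which gives 16 and 2 * 16 in the
  constant.\<close>

lemma box_bound:
  "\<exists>K\<ge>1. \<forall>\<rho> c A r N eps s f. cutoff c A r \<and> 0 \<le> \<rho> \<and> \<rho> \<le> 1 \<and> 0 < eps \<and> eps \<le> 1 \<and> 0 < N \<and> 0 < s \<and>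
     f \<in> borel_measurable borel \<and> (\<forall>v. cmod (f v) \<le> N) \<longrightarrow>
     cmod (LINT X|lborel. quad \<rho> r (\<lambda>X. f (pX1 X) - gconv s f (pX1 X)) (\<lambda>v. cnj (f v - gconv s f v)) (\<lambda>v. cnj (f v - gconv s f v)) (\<lambda>v. f v - gconv s f v) X)
       \<le> K * c ^ 4 * A * N ^ 4 * (sqrt s / eps\<^sup>2 + root 30 eps)"
proof -
  obtain K where K1: "K \<ge> 1" and K': "\<forall>\<rho> c A r w N eps \<phi>1 \<phi>2 \<phi>3 \<phi>4. cutoff c A r \<and> 0 \<le> \<rho> \<and> \<rho> \<le> 1 \<and> 0 < eps \<and> eps \<le> 1 \<and> 0 < N \<and>
     \<phi>1 \<in> borel_measurable borel \<and> \<phi>2 \<in> borel_measurable borel \<and> \<phi>3 \<in> borel_measurable borel \<and> \<phi>4 \<in> borel_measurable borel \<and>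
     (\<forall>v. cmod (\<phi>1 v) \<le> N) \<and> (\<forall>v. cmod (\<phi>2 v) \<le> N) \<and> (\<forall>v. cmod (\<phi>3 v) \<le> N) \<and> (\<forall>v. cmod (\<phi>4 v) \<le> N) \<longrightarrow>
     cmod (LINT X|lborel. quad \<rho> r (\<lambda>X. (\<phi>1 (pX1 X + w) - \<phi>1 (pX1 X)) * of_real ((DX \<rho> X)\<^sup>2 / ((DX \<rho> X)\<^sup>2 + eps\<^sup>2))) \<phi>2 \<phi>3 \<phi>4 X)
       \<le> K * c ^ 4 * A * N ^ 4 / eps\<^sup>2 * norm w"
    using quad_difference by (elim exE conjE) (rule that)
  obtain D where D1: "D \<ge> 1" and D': "\<forall>\<rho> c A r N eps f1 f2 f3 f4. cutoff c A r \<and> 0 \<le> \<rho> \<and> \<rho> \<le> 1 \<and> 0 < eps \<and> eps \<le> 1 \<and> 0 \<le> N \<and>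
     f1 \<in> borel_measurable borel \<and> f2 \<in> borel_measurable borel \<and> f3 \<in> borel_measurable borel \<and> f4 \<in> borel_measurable borel \<and>
     (\<forall>X. cmod (f1 X) \<le> N) \<and> (\<forall>v. cmod (f2 v) \<le> N) \<and> (\<forall>v. cmod (f3 v) \<le> N) \<and> (\<forall>v. cmod (f4 v) \<le> N) \<longrightarrow>
     cmod (LINT X|lborel. quad \<rho> r (\<lambda>X. f1 X * of_real (eps\<^sup>2 / ((DX \<rho> X)\<^sup>2 + eps\<^sup>2))) f2 f3 f4 X)
       \<le> D * c ^ 4 * N ^ 4 * root 30 eps"
    using quad_degenerate by (elim exE conjE) (rule that)
  obtain W where W1: "W \<ge> 1" and W': "\<forall>\<rho> c A r V \<sigma> q. cutoff c A r \<and> 0 \<le> \<rho> \<and> \<rho> \<le> 1 \<longrightarrow> cmod (wt \<rho> r V \<sigma> q) \<le> W * c ^ 4 \<and>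
    (\<forall>e. norm \<sigma> \<le> 20 \<and> norm e \<le> 1 \<and> norm q \<le> 40 \<longrightarrow> cmod (fd (wt \<rho> r V \<sigma>) q (ZF \<rho> \<sigma> e q)) \<le> W * c ^ 4 * A)"
    using wt_bounds by (elim exE conjE) (rule that)
  have "cmod (LINT X|lborel. quad \<rho> r (\<lambda>X. f (pX1 X) - gconv s f (pX1 X)) (\<lambda>v. cnj (f v - gconv s f v)) (\<lambda>v. cnj (f v - gconv s f v)) (\<lambda>v. f v - gconv s f v) X)
       \<le> (32 * K + 16 * D) * c ^ 4 * A * N ^ 4 * (sqrt s / eps\<^sup>2 + root 30 eps)"
    if r: "cutoff c A r" and rho: "0 \<le> \<rho>" "\<rho> \<le> 1" and eps: "0 < eps" "eps \<le> 1" and N0: "0 < N" and s: "0 < s"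
      and fm: "f \<in> borel_measurable borel" and fN: "\<forall>v. cmod (f v) \<le> N"
    for \<rho> c A r N eps s f
  proof -
    have cA: "c \<ge> 1" "A \<ge> 1" using cutoffD(2,3)[OF r] by blast+
    define h where "h = (\<lambda>v. f v - gconv s f v)"
    have hm: "h \<in> borel_measurable borel" unfolding h_def by (intro borel_measurable_diff fm gconv_measurable)
    have chm: "(\<lambda>v. cnj (h v)) \<in> borel_measurable borel" by (rule measurable_compose[OF hm cnj_borel_measurable])
    have hN: "cmod (h v) \<le> 2 * N" for v
    proof -
      have "cmod (h v) \<le> N + N" unfolding h_def
        by (rule order_trans[OF norm_triangle_ineq4]) (intro add_mono fN[rule_format] gconv_bound[OF fm s])
      then show ?thesis by simp
    qed
    have chN: "cmod (cnj (h v)) \<le> 2 * N" for v using hN by simp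
    have f2N: "cmod (f v) \<le> 2 * N" for v using order_trans[OF fN[rule_format], of "2 * N" v] N0 by simp
    have N20: "0 < 2 * N" "0 \<le> 2 * N" using N0 by simp_all
    have wb: "cmod (wX \<rho> r X) \<le> W * c ^ 4" for X
      unfolding wX_def using W'[rule_format, OF conjI[OF r conjI[OF rho]]] by blast
    define R where "R = (\<lambda>X. complex_of_real ((DX \<rho> X)\<^sup>2 / ((DX \<rho> X)\<^sup>2 + eps\<^sup>2)))"
    define R' where "R' = (\<lambda>X. complex_of_real (eps\<^sup>2 / ((DX \<rho> X)\<^sup>2 + eps\<^sup>2)))"
    have RR: "R X + R' X = 1" for X
    proof -
      have "(DX \<rho> X)\<^sup>2 + eps\<^sup>2 \<noteq> 0" using add_nonneg_pos[of "(DX \<rho> X)\<^sup>2" "eps\<^sup>2"] eps by simp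
      then show ?thesis unfolding R_def R'_def of_real_add[symmetric] add_divide_distrib[symmetric] by simp
    qed
    have Rc: "continuous_on UNIV R" unfolding R_def by (rule continuous_rat[OF eps(1) continuous_X(4)])
    have R1: "cmod (R X) \<le> 1" for X unfolding R_def by (rule rat_le_1[OF eps(1)])
    have Rm: "R \<in> borel_measurable borel" by (rule borel_measurable_continuous_onI[OF Rc])
    have R'm: "R' \<in> borel_measurable borel"
    proof -
      have "R' = (\<lambda>X. 1 - R X)" using RR by (auto simp: fun_eq_iff algebra_simps)
      then show ?thesis using Rm by simp
    qed
    have R'1: "cmod (R' X) \<le> 1" for X
      unfolding R'_def norm_of_real using add_nonneg_pos[of "(DX \<rho> X)\<^sup>2" "eps\<^sup>2"] eps by (simp add: divide_le_eq_1)
    have p1m: "(\<lambda>X. g (pX1 X + w)) \<in> borel_measurable borel" if "g \<in> borel_measurable borel" for g :: "vec \<Rightarrow> complex" and w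
      by (rule measurable_compose[OF borel_measurable_continuous_onI that]) (intro continuous_intros continuous_X)
    define hX where "hX = (\<lambda>X. h (pX1 X))"
    have hXm: "hX \<in> borel_measurable borel" unfolding hX_def using p1m[OF hm, of 0] by simp
    have hXN: "cmod (hX X) \<le> 2 * N" for X unfolding hX_def by (rule hN)
    have hRb: "cmod (hX X * R X) \<le> 2 * N" "cmod (hX X * R' X) \<le> 2 * N" for X
      using mult_mono[OF hXN R1, of X X] mult_mono[OF hXN R'1, of X X] N0 by (simp_all add: norm_mult)
    let ?q = "\<lambda>g. quad \<rho> r g (\<lambda>v. cnj (h v)) (\<lambda>v. cnj (h v)) h"
    note qp = quad_properties[OF r rho _ chm chm hm _ chN chN hN wb]
    have I1: "integrable lborel (?q (\<lambda>X. hX X * R X))" by (rule qp(4)[OF borel_measurable_times[OF hXm Rm] hRb(1)])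
    have I2: "integrable lborel (?q (\<lambda>X. hX X * R' X))" by (rule qp(4)[OF borel_measurable_times[OF hXm R'm] hRb(2)])
    have split: "?q hX X = ?q (\<lambda>X. hX X * R X) X + ?q (\<lambda>X. hX X * R' X) X" for X
    proof -
      have "hX X = hX X * R X + hX X * R' X" unfolding distrib_left[symmetric] RR by simp
      then show ?thesis unfolding quad_def distrib_right[symmetric] by simp
    qed
    have deg: "cmod (LINT X|lborel. ?q (\<lambda>X. hX X * R' X) X) \<le> D * c ^ 4 * (2 * N) ^ 4 * root 30 eps"
      unfolding R'_def
      by (rule D'[rule_format, where A = A]) (intro conjI r rho eps hXm chm hm allI hXN chN hN N20)
    \<comment> \<open>Integrated in \<open>w\<close> first, this returns minus the function in the
      first slot; integrated in \<open>X\<close> first, it is a form of increments. The exchange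
      needs joint integrability, supplied by the Gaussian in \<open>w\<close> and the bounded
      support in \<open>X\<close>.\<close>
    define G where "G = (\<lambda>(w, X). of_real (gker s w) * ?q (\<lambda>X. (f (pX1 X + w) - f (pX1 X)) * R X) X)"
    have fdm: "(\<lambda>X. (f (pX1 X + w) - f (pX1 X)) * R X) \<in> borel_measurable borel" for w
      using p1m[OF fm, of w] p1m[OF fm, of 0] Rm by simp
    have fdb: "cmod ((f (pX1 X + w) - f (pX1 X)) * R X) \<le> 2 * N" for w X
    proof -
      have "cmod (f (pX1 X + w) - f (pX1 X)) \<le> N + N"
        by (rule order_trans[OF norm_triangle_ineq4]) (intro add_mono fN[rule_format])
      then have "cmod ((f (pX1 X + w) - f (pX1 X)) * R X) \<le> (N + N) * 1" unfolding norm_mult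
        using N0 by (intro mult_mono R1) simp_all
      then show ?thesis by simp
    qed
    define B where "B = 2 * N * (2 * N) * (2 * N) * (2 * N) * (W * c ^ 4)"
    have Gint: "integrable (lborel \<Otimes>\<^sub>M lborel) G"
    proof (rule Bochner_Integration.integrable_bound)
      have "integrable lborel (\<lambda>X. complex_of_real (B * indicator (cball (0 :: vec \<times> vec \<times> vec3) 100) X))"
        using emeasure_lborel_cball_finite[of "0 :: vec \<times> vec \<times> vec3" 100] by (intro integrable_of_real integrable_mult_right) simp
      from lborel_integral_prod_mult(1)[OF integrable_of_real[OF gker_integrable[OF s]] this]
      show "integrable (lborel \<Otimes>\<^sub>M lborel) (\<lambda>p. complex_of_real (gker s (fst p)) * complex_of_real (B * indicator (cball (0 :: vec \<times> vec \<times> vec3) 100) (snd p)))"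
        by (simp add: lborel_prod)
      have s1: "(\<lambda>p::vec \<times> vec \<times> vec \<times> vec3. pX1 (snd p) + fst p) \<in> borel_measurable borel"
        by (intro borel_measurable_continuous_onI continuous_on_add continuous_on_compose2[OF continuous_X(1)] continuous_intros) auto
      have s2: "(\<lambda>p::vec \<times> vec \<times> vec \<times> vec3. snd p) \<in> borel_measurable borel" "(\<lambda>p::vec \<times> vec \<times> vec \<times> vec3. fst p) \<in> borel_measurable borel"
        by (intro borel_measurable_continuous_onI continuous_intros)+
      have "(\<lambda>X. ?q (\<lambda>X. 1) X) \<in> borel_measurable borel"
        using qp(1)[of "\<lambda>X. 1" 1] by simp
      note s3 = measurable_compose[OF s2(1) this]
      have "(\<lambda>p::vec \<times> vec \<times> vec \<times> vec3. gker s (fst p)) \<in> borel_measurable borel"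
        by (rule measurable_compose[OF s2(2) gker_measurable])
      then have s4: "(\<lambda>p::vec \<times> vec \<times> vec \<times> vec3. complex_of_real (gker s (fst p))) \<in> borel_measurable borel"
        by measurable
      have geq: "G p = of_real (gker s (fst p)) * ((f (pX1 (snd p) + fst p) - f (pX1 (snd p) + 0)) * R (snd p)) * ?q (\<lambda>X. 1) (snd p)" for p
        by (simp add: G_def case_prod_unfold quad_def)
      show "G \<in> borel_measurable (lborel \<Otimes>\<^sub>M lborel)"
        unfolding lborel_prod measurable_lborel2 geq[abs_def]
        by (intro borel_measurable_times borel_measurable_diff s3 s4 measurable_compose[OF s1 fm]
            measurable_compose[OF s2(1) p1m[OF fm]] measurable_compose[OF s2(1) Rm])
      show "AE p in lborel \<Otimes>\<^sub>M lborel. norm (G p) \<le> norm (complex_of_real (gker s (fst p)) * complex_of_real (B * indicator (cball (0 :: vec \<times> vec \<times> vec3) 100) (snd p)))"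
      proof (rule AE_I2)
        fix p :: "vec \<times> vec \<times> vec \<times> vec3"
        have b: "cmod (?q (\<lambda>X. (f (pX1 X + fst p) - f (pX1 X)) * R X) (snd p)) \<le> B * indicator (cball 0 100) (snd p)"
          using qp(2)[OF fdm fdb, of "fst p" "snd p", folded B_def] qp(3)[OF fdm fdb, of "snd p" "fst p"]
          by (cases "norm (snd p) \<le> 100") simp_all
        have b': "x \<le> norm (complex_of_real x)" for x unfolding norm_of_real by (rule abs_ge_self)
        show "norm (G p) \<le> norm (complex_of_real (gker s (fst p)) * complex_of_real (B * indicator (cball (0 :: vec \<times> vec \<times> vec3) 100) (snd p)))"
          unfolding G_def case_prod_unfold norm_mult[of "complex_of_real (gker s (fst p))"]
          by (rule mult_left_mono[OF order_trans[OF b b'] norm_ge_zero])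
      qed
    qed
    have inner: "(LINT w|lborel. G (w, X)) = - ?q (\<lambda>X. hX X * R X) X" for X
    proof -
      have i1: "integrable lborel (\<lambda>w. of_real (gker s w) * f (pX1 X + w))"
      proof (rule Bochner_Integration.integrable_bound)
        show "integrable lborel (\<lambda>w. N * gker s w)" using gker_integrable[OF s] by simp
        have "(\<lambda>w. f (pX1 X + w)) \<in> borel_measurable borel"
          by (rule measurable_compose[OF _ fm]) (intro borel_measurable_continuous_onI continuous_intros)
        moreover have "(\<lambda>w. complex_of_real (gker s w)) \<in> borel_measurable borel" by measurable
        ultimately show "(\<lambda>w. of_real (gker s w) * f (pX1 X + w)) \<in> borel_measurable lborel"
          unfolding measurable_lborel2 by (rule borel_measurable_times[rotated])
        show "AE w in lborel. norm (complex_of_real (gker s w) * f (pX1 X + w)) \<le> norm (N * gker s w)"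
        proof (rule AE_I2)
          fix w
          have "gker s w * cmod (f (pX1 X + w)) \<le> gker s w * N"
            by (rule mult_left_mono[OF fN[rule_format] less_imp_le[OF gker_pos[OF s]]])
          then show "norm (complex_of_real (gker s w) * f (pX1 X + w)) \<le> norm (N * gker s w)"
            using less_imp_le[OF gker_pos[OF s], of w] N0 by (simp add: norm_mult abs_mult mult.commute)
        qed
      qed
      have i2: "integrable lborel (\<lambda>w. of_real (gker s w) * f (pX1 X))"
        by (intro integrable_mult_left integrable_of_real gker_integrable[OF s])
      have "(LINT w|lborel. of_real (gker s w) * (f (pX1 X + w) - f (pX1 X))) = gconv s f (pX1 X) - f (pX1 X)"
        unfolding right_diff_distrib Bochner_Integration.integral_diff[OF i1 i2] gconv_shift[OF fm]
        by (simp add: gker_integral[OF s])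
      also have "\<dots> = - hX X" by (simp add: hX_def h_def)
      finally have e: "(LINT w|lborel. of_real (gker s w) * (f (pX1 X + w) - f (pX1 X))) = - hX X" .
      have "G (w, X) = (of_real (gker s w) * (f (pX1 X + w) - f (pX1 X))) * ?q R X" for w
        by (simp add: G_def quad_def mult_ac)
      then have "(LINT w|lborel. G (w, X)) = - hX X * ?q R X" by (simp add: e)
      then show ?thesis by (simp add: quad_def mult_ac)
    qed
    have "(LINT X|lborel. ?q (\<lambda>X. hX X * R X) X) = - (LINT X|lborel. LINT w|lborel. G (w, X))"
      by (simp add: inner)
    also have "(LINT X|lborel. LINT w|lborel. G (w, X)) = (LINT w|lborel. LINT X|lborel. G (w, X))"
      using lborel_pair.Fubini_integral[of "\<lambda>w X. G (w, X)"] Gint by simp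
    finally have eqG: "cmod (LINT X|lborel. ?q (\<lambda>X. hX X * R X) X) = cmod (LINT w|lborel. LINT X|lborel. G (w, X))"
      by simp
    \<comment> \<open>A local constant, hiding the dilation of the same name.\<close>
    define Bd where "Bd = K * c ^ 4 * A * (2 * N) ^ 4 / eps\<^sup>2"
    have Bd0: "0 \<le> Bd" unfolding Bd_def
      using K1 cA N0 by (intro mult_nonneg_nonneg divide_nonneg_nonneg zero_le_power zero_le_power2) linarith+
    have "cmod (LINT w|lborel. LINT X|lborel. G (w, X)) \<le> (LINT w|lborel. Bd * (gker s w * norm w))"
    proof (rule order_trans[OF integral_norm_bound], rule integral_mono)
      show "integrable lborel (\<lambda>w. cmod (LINT X|lborel. G (w, X)))"
        by (rule integrable_norm[OF lborel_pair.integrable_fst'[OF Gint]])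
      show "integrable lborel (\<lambda>w. Bd * (gker s w * norm w))" using gker_times_norm(1)[OF s] by (rule integrable_mult_right)
      fix w
      have "cmod (LINT X|lborel. ?q (\<lambda>X. (f (pX1 X + w) - f (pX1 X)) * R X) X) \<le> Bd * norm w"
        unfolding R_def Bd_def
        by (rule K'[rule_format]) (intro conjI r rho eps fm chm hm allI f2N chN hN N20)
      then have "gker s w * cmod (LINT X|lborel. ?q (\<lambda>X. (f (pX1 X + w) - f (pX1 X)) * R X) X) \<le> gker s w * (Bd * norm w)"
        using less_imp_le[OF gker_pos[OF s]] by (rule mult_left_mono)
      then show "cmod (LINT X|lborel. G (w, X)) \<le> Bd * (gker s w * norm w)"
        unfolding G_def prod.case integral_mult_right_zero norm_mult norm_of_real abs_of_nonneg[OF less_imp_le[OF gker_pos[OF s]]]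
        by (simp only: mult_ac)
    qed
    also have "\<dots> = Bd * (LINT w|lborel. gker s w * norm w)" by simp
    also have "\<dots> \<le> Bd * (2 * sqrt s)" using gker_times_norm(2)[OF s] Bd0 by (rule mult_left_mono)
    finally have main: "cmod (LINT X|lborel. ?q (\<lambda>X. hX X * R X) X) \<le> Bd * (2 * sqrt s)" unfolding eqG .
    have qs: "(LINT X|lborel. ?q hX X) = (LINT X|lborel. ?q (\<lambda>X. hX X * R X) X) + (LINT X|lborel. ?q (\<lambda>X. hX X * R' X) X)"
      unfolding split by (rule Bochner_Integration.integral_add[OF I1 I2])
    have "cmod (LINT X|lborel. ?q hX X) \<le> Bd * (2 * sqrt s) + D * c ^ 4 * (2 * N) ^ 4 * root 30 eps"
      unfolding qs by (rule order_trans[OF norm_triangle_ineq add_mono[OF main deg]])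
    also have "\<dots> = (32 * K) * (c ^ 4 * A * N ^ 4 * (sqrt s / eps\<^sup>2)) + (16 * D) * (c ^ 4 * 1 * N ^ 4 * root 30 eps)"
      by (simp add: Bd_def power_mult_distrib)
    also have "\<dots> \<le> (32 * K + 16 * D) * (c ^ 4 * A * N ^ 4 * (sqrt s / eps\<^sup>2)) + (32 * K + 16 * D) * (c ^ 4 * A * N ^ 4 * root 30 eps)"
      using K1 D1 cA N0 s eps
      by (intro add_mono mult_mono mult_nonneg_nonneg zero_le_power divide_nonneg_nonneg real_root_ge_zero real_sqrt_ge_zero zero_le_power2 order_refl) linarith+
    also have "\<dots> = (32 * K + 16 * D) * c ^ 4 * A * N ^ 4 * (sqrt s / eps\<^sup>2 + root 30 eps)"
      by (simp only: distrib_left mult.assoc)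
    finally show ?thesis unfolding hX_def h_def .
  qed
  moreover have "32 * K + 16 * D \<ge> 1" using K1 D1 by linarith
  ultimately show ?thesis by blast
qed

section \<open>Reduction to the four-point form by Cauchy--Schwarz\<close>

text \<open>Passage from a complex integral to an iterated nonnegative integral when the inner
  integral is known to be real and nonnegative. The conclusions have the shape of the hypotheses, so
  the lemma can be applied repeatedly, one variable at a time.\<close>

lemma nn_integral_slice:
  fixes F :: "'a::euclidean_space \<times> 'b::euclidean_space \<Rightarrow> complex"
  assumes F: "integrable lborel F" and g: "\<And>x. (LINT y|lborel. F (x, y)) = of_real (\<gamma> x)" "\<And>x. \<gamma> x \<ge> 0"
  shows "(LINT X|lborel. F X) = of_real (LINT x|lborel. \<gamma> x)" "(LINT x|lborel. \<gamma> x) \<ge> 0"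
    "(\<integral>\<^sup>+ x. ennreal (\<gamma> x) \<partial>lborel) = ennreal (LINT x|lborel. \<gamma> x)"
proof -
  have F': "integrable (lborel \<Otimes>\<^sub>M lborel) F" using F by (simp add: lborel_prod)
  have i: "integrable lborel (\<lambda>x. complex_of_real (\<gamma> x))"
    using lborel_pair.integrable_fst'[OF F'] unfolding g(1) .
  then have i': "integrable lborel \<gamma>" by (simp add: complex_of_real_integrable_eq)
  show "(LINT X|lborel. F X) = of_real (LINT x|lborel. \<gamma> x)"
    using lborel_pair.integral_fst'[OF F'] unfolding g(1) lborel_prod by simp
  show "(LINT x|lborel. \<gamma> x) \<ge> 0" by (rule Bochner_Integration.integral_nonneg) (rule g(2))
  show "(\<integral>\<^sup>+ x. ennreal (\<gamma> x) \<partial>lborel) = ennreal (LINT x|lborel. \<gamma> x)"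
    by (rule nn_integral_eq_integral[OF i']) (simp add: g(2))
qed

lemma integrable_of_L2_support:
  fixes F :: "'a::euclidean_space \<Rightarrow> complex"
  assumes m: "F \<in> borel_measurable borel" and fin: "(\<integral>\<^sup>+ x. ennreal ((cmod (F x))\<^sup>2) \<partial>lborel) < \<infinity>"
    and M: "\<And>x. norm x > M \<Longrightarrow> F x = 0"
  shows "integrable lborel F"
proof (rule Bochner_Integration.integrable_bound)
  have m2: "(\<lambda>x. (cmod (F x))\<^sup>2) \<in> borel_measurable lborel" using m by measurable
  have "integrable lborel (\<lambda>x. (cmod (F x))\<^sup>2)"
    using fin m2 by (intro integrableI_bounded) simp_all
  moreover have "integrable lborel (indicator (cball (0::'a) M) :: 'a \<Rightarrow> real)"
    using emeasure_lborel_cball_finite[of "0::'a" M] by simp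
  ultimately show "integrable lborel (\<lambda>x. (cmod (F x))\<^sup>2 + indicator (cball (0::'a) M) x)"
    by (rule Bochner_Integration.integrable_add)
  show "AE x in lborel. norm (F x) \<le> norm ((cmod (F x))\<^sup>2 + indicator (cball 0 M) x)"
  proof (rule AE_I2)
    fix x
    have "2 * cmod (F x) \<le> (cmod (F x))\<^sup>2 + 1" using sum_squares_bound[of "cmod (F x)" 1] by simp
    then have "cmod (F x) \<le> (cmod (F x))\<^sup>2 + 1" using norm_ge_zero[of "F x"] by linarith
    then show "norm (F x) \<le> norm ((cmod (F x))\<^sup>2 + indicator (cball 0 M) x)"
      using M[of x] by (cases "norm x \<le> M") simp_all
  qed
qed (use m in simp)

text \<open>The weighted square norm of the image of \<open>F\<close> is expanded as a quadratic
  form in \<open>F\<close> with the Gram kernel \<open>k\<close> of the operator. Cauchy--Schwarz in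
  both variables then separates \<open>F\<close> from the Hilbert--Schmidt norm of \<open>k\<close>.
  The function \<open>F\<close> is in \<open>L\<^sup>2\<close> with bounded support, hence
  integrable, which justifies Fubini.\<close>

lemma box_Cauchy_Schwarz:
  fixes F :: "vec \<Rightarrow> complex" and K :: "vec \<times> vec \<Rightarrow> complex" and ch :: "vec \<Rightarrow> real"
  assumes Fm: "F \<in> borel_measurable borel" and Ffin: "(\<integral>\<^sup>+ s. ennreal ((cmod (F s))\<^sup>2) \<partial>lborel) < \<infinity>"
    and FM: "\<And>s. norm s > M \<Longrightarrow> F s = 0"
    and Km: "K \<in> borel_measurable borel" and KB: "\<And>p. cmod (K p) \<le> B"
    and chm: "ch \<in> borel_measurable borel" and ch: "\<And>y. 0 \<le> ch y" "\<And>y. ch y \<le> C" "\<And>y. norm y > M \<Longrightarrow> ch y = 0"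
  defines "k \<equiv> \<lambda>\<sigma> s. LINT y|lborel. of_real (ch y) * K (y, s) * cnj (K (y, \<sigma>))"
  shows "(\<integral>\<^sup>+ y. ennreal (ch y) * ennreal ((cmod (LINT s|lborel. F s * K (y, s)))\<^sup>2) \<partial>lborel)\<^sup>2
    \<le> (\<integral>\<^sup>+ s. ennreal ((cmod (F s))\<^sup>2) \<partial>lborel)\<^sup>2 * (\<integral>\<^sup>+ \<sigma>. \<integral>\<^sup>+ s. ennreal ((cmod (k \<sigma> s))\<^sup>2) \<partial>lborel \<partial>lborel)"
proof -
  have Fi: "integrable lborel F" by (rule integrable_of_L2_support[OF Fm Ffin FM])
  have B0: "0 \<le> B" using KB norm_ge_zero order_trans by blast
  have C0: "0 \<le> C" using ch(1,2) order_trans by blast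
  have pr: "(\<lambda>Y::vec \<times> vec \<times> vec. (fst Y, fst (snd Y))) \<in> borel_measurable borel"
    "(\<lambda>Y::vec \<times> vec \<times> vec. (fst Y, snd (snd Y))) \<in> borel_measurable borel"
    "(\<lambda>Y::vec \<times> vec \<times> vec. fst Y) \<in> borel_measurable borel"
    "(\<lambda>Y::vec \<times> vec \<times> vec. fst (snd Y)) \<in> borel_measurable borel"
    "(\<lambda>Y::vec \<times> vec \<times> vec. snd (snd Y)) \<in> borel_measurable borel"
    by (intro borel_measurable_continuous_onI continuous_intros)+
  have sl: "(\<lambda>s. K (y, s)) \<in> borel_measurable borel" "(\<lambda>y. K (y, s)) \<in> borel_measurable borel" for y s
    by (rule measurable_compose[OF _ Km], intro borel_measurable_continuous_onI continuous_intros)+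
  define H where "H = (\<lambda>y. LINT s|lborel. F s * K (y, s))"
  have HI: "integrable lborel (\<lambda>s. F s * K (y, s))" for y
  proof (rule Bochner_Integration.integrable_bound)
    show "integrable lborel (\<lambda>s. F s * of_real B)" using Fi by (rule integrable_mult_left)
    show "(\<lambda>s. F s * K (y, s)) \<in> borel_measurable lborel" using Fm sl by simp
    show "AE s in lborel. norm (F s * K (y, s)) \<le> norm (F s * complex_of_real B)"
      using KB B0 by (intro AE_I2) (simp add: norm_mult mult_left_mono)
  qed
  \<comment> \<open>The components of \<open>Y\<close> are y, \<sigma>, s. Integrating over the last
    two first gives the left-hand side, integrating over the first one gives the Gram
    kernel.\<close>
  define G where "G = (\<lambda>Y::vec \<times> vec \<times> vec. of_real (ch (fst Y)) * (cnj (F (fst (snd Y)) * K (fst Y, fst (snd Y))) * (F (snd (snd Y)) * K (fst Y, snd (snd Y)))))"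
  have cm: "(\<lambda>Y::vec \<times> vec \<times> vec. complex_of_real (ch (fst Y))) \<in> borel_measurable borel"
    by (intro measurable_compose[OF measurable_compose[OF pr(3) chm] borel_measurable_continuous_onI]) (intro continuous_intros)
  have Gm: "G \<in> borel_measurable borel"
    unfolding G_def
    by (intro borel_measurable_times cm measurable_compose[OF _ cnj_borel_measurable]
        measurable_compose[OF pr(4) Fm] measurable_compose[OF pr(5) Fm] measurable_compose[OF pr(1) Km] measurable_compose[OF pr(2) Km])
  have FF: "integrable lborel (\<lambda>p. F (fst p) * F (snd p))" by (rule lborel_integral_prod_mult(1)[OF Fi Fi])
  have Gi: "integrable (lborel \<Otimes>\<^sub>M lborel) G"
  proof (rule Bochner_Integration.integrable_bound)
    have "integrable lborel (\<lambda>y. complex_of_real (C * B * B * indicator (cball (0::vec) M) y))"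
      using emeasure_lborel_cball_finite[of "0::vec" M] by (intro integrable_of_real integrable_mult_right) simp
    from lborel_integral_prod_mult(1)[OF this FF]
    show "integrable (lborel \<Otimes>\<^sub>M lborel) (\<lambda>Y. complex_of_real (C * B * B * indicator (cball (0::vec) M) (fst Y)) * (F (fst (snd Y)) * F (snd (snd Y))))"
      by (simp add: lborel_prod)
    show "G \<in> borel_measurable (lborel \<Otimes>\<^sub>M lborel)" using Gm by (simp add: lborel_prod)
    show "AE Y in lborel \<Otimes>\<^sub>M lborel. norm (G Y) \<le> norm (complex_of_real (C * B * B * indicator (cball (0::vec) M) (fst Y)) * (F (fst (snd Y)) * F (snd (snd Y))))"
    proof (rule AE_I2)
      fix Y :: "vec \<times> vec \<times> vec"
      have n: "norm (G Y) = ch (fst Y) * cmod (K (fst Y, fst (snd Y))) * cmod (K (fst Y, snd (snd Y))) * (cmod (F (fst (snd Y))) * cmod (F (snd (snd Y))))"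
        unfolding G_def norm_mult complex_mod_cnj norm_of_real abs_of_nonneg[OF ch(1)] by simp
      have "ch (fst Y) * cmod (K (fst Y, fst (snd Y))) * cmod (K (fst Y, snd (snd Y))) \<le> C * B * B"
        using ch(1,2) KB B0 C0 by (intro mult_mono mult_nonneg_nonneg norm_ge_zero)
      moreover have "norm (fst Y) > M \<Longrightarrow> ch (fst Y) = 0" by (rule ch(3))
      ultimately have "ch (fst Y) * cmod (K (fst Y, fst (snd Y))) * cmod (K (fst Y, snd (snd Y))) \<le> C * B * B * indicator (cball 0 M) (fst Y)"
        by (cases "norm (fst Y) \<le> M") simp_all
      then have "norm (G Y) \<le> (C * B * B * indicator (cball 0 M) (fst Y)) * (cmod (F (fst (snd Y))) * cmod (F (snd (snd Y))))"
        unfolding n by (rule mult_right_mono) simp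
      also have "\<dots> = norm (complex_of_real (C * B * B * indicator (cball (0::vec) M) (fst Y)) * (F (fst (snd Y)) * F (snd (snd Y))))"
        unfolding norm_mult[of "complex_of_real _"] norm_of_real norm_mult[of "F _"] using C0 B0 by simp
      finally show "norm (G Y) \<le> norm (complex_of_real (C * B * B * indicator (cball (0::vec) M) (fst Y)) * (F (fst (snd Y)) * F (snd (snd Y))))" .
    qed
  qed
  have slice: "(LINT p|lborel. G (y, p)) = of_real (ch y * (cmod (H y))\<^sup>2)" for y
  proof -
    have ci: "integrable lborel (\<lambda>s. cnj (F s * K (y, s)))" using HI by (rule integrable_cnj)
    have "(LINT p|lborel. cnj (F (fst p) * K (y, fst p)) * (F (snd p) * K (y, snd p))) = cnj (H y) * H y"
      unfolding lborel_integral_prod_mult(2)[OF ci HI] H_def Bochner_Integration.integral_cnj ..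
    then have "(LINT p|lborel. G (y, p)) = of_real (ch y) * (cnj (H y) * H y)" by (simp add: G_def)
    also have "cnj (H y) * H y = of_real ((cmod (H y))\<^sup>2)" using complex_norm_square[of "H y"] by (simp add: mult.commute)
    finally show ?thesis by simp
  qed
  have Gi': "integrable lborel G" using Gi by (simp add: lborel_prod)
  have pos: "0 \<le> ch y * (cmod (H y))\<^sup>2" for y using ch(1) by simp
  note sl1 = nn_integral_slice[OF Gi' slice pos]
  have lhs: "(\<integral>\<^sup>+ y. ennreal (ch y) * ennreal ((cmod (H y))\<^sup>2) \<partial>lborel) = ennreal (cmod (LINT Y|lborel. G Y))"
  proof -
    have "cmod (LINT Y|lborel. G Y) = (LINT y|lborel. ch y * (cmod (H y))\<^sup>2)" unfolding sl1(1) norm_of_real using sl1(2) by simp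
    then show ?thesis using sl1(3) by (simp add: ennreal_mult ch(1))
  qed
  have "(LINT y|lborel. G (y, p)) = cnj (F (fst p)) * F (snd p) * k (fst p) (snd p)" for p
  proof -
    have "G (y, p) = (cnj (F (fst p)) * F (snd p)) * (of_real (ch y) * K (y, snd p) * cnj (K (y, fst p)))" for y
      by (simp add: G_def mult_ac)
    then show ?thesis by (simp add: k_def)
  qed
  then have "(LINT Y|lborel. G Y) = (LINT p|lborel. cnj (F (fst p)) * F (snd p) * k (fst p) (snd p))"
    using lborel_pair.integral_snd[of "\<lambda>y p. G (y, p)"] Gi by (simp add: lborel_prod)
  then have "ennreal (cmod (LINT Y|lborel. G Y)) \<le> (\<integral>\<^sup>+ p. ennreal (cmod (cnj (F (fst p)) * F (snd p) * k (fst p) (snd p))) \<partial>lborel)"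
    by (simp only: norm_integral_le_nn_integral)
  also have "\<dots> = (\<integral>\<^sup>+ p. ennreal (cmod (F (fst p)) * cmod (F (snd p))) * ennreal (cmod (k (fst p) (snd p))) \<partial>lborel)"
    by (simp add: norm_mult ennreal_mult)
  finally have 1: "ennreal (cmod (LINT Y|lborel. G Y)) \<le> (\<integral>\<^sup>+ p. ennreal (cmod (F (fst p)) * cmod (F (snd p))) * ennreal (cmod (k (fst p) (snd p))) \<partial>lborel)" .
  have km: "(\<lambda>p. k (fst p) (snd p)) \<in> borel_measurable borel"
  proof -
    have q: "(\<lambda>Y::(vec \<times> vec) \<times> vec. snd Y) \<in> borel_measurable borel" "(\<lambda>Y::(vec \<times> vec) \<times> vec. (snd Y, snd (fst Y))) \<in> borel_measurable borel"
      "(\<lambda>Y::(vec \<times> vec) \<times> vec. (snd Y, fst (fst Y))) \<in> borel_measurable borel"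
      by (intro borel_measurable_continuous_onI continuous_intros)+
    have "(\<lambda>Y::(vec \<times> vec) \<times> vec. of_real (ch (snd Y)) * K (snd Y, snd (fst Y)) * cnj (K (snd Y, fst (fst Y)))) \<in> borel_measurable borel"
      by (intro borel_measurable_times measurable_compose[OF q(2) Km] measurable_compose[OF measurable_compose[OF q(3) Km] cnj_borel_measurable]
          measurable_compose[OF measurable_compose[OF q(1) chm] borel_measurable_continuous_onI] continuous_intros)
    then have "(\<lambda>(p, y). of_real (ch y) * K (y, snd p) * cnj (K (y, fst p))) \<in> borel_measurable (lborel \<Otimes>\<^sub>M lborel)"
      unfolding lborel_prod case_prod_unfold by simp
    from lborel.borel_measurable_lebesgue_integral[OF this] show ?thesis unfolding k_def by simp
  qed
  have FFm: "(\<lambda>p. ennreal (cmod (F (fst p)) * cmod (F (snd p)))) \<in> borel_measurable lborel"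
  proof -
    have "(\<lambda>p::vec \<times> vec. F (fst p)) \<in> borel_measurable borel" "(\<lambda>p::vec \<times> vec. F (snd p)) \<in> borel_measurable borel"
      by (rule measurable_compose[OF _ Fm], intro borel_measurable_continuous_onI continuous_intros)+
    then show ?thesis by simp
  qed
  have "(\<integral>\<^sup>+ p. ennreal (cmod (F (fst p)) * cmod (F (snd p))) * ennreal (cmod (k (fst p) (snd p))) \<partial>lborel)\<^sup>2
    \<le> (\<integral>\<^sup>+ p. (ennreal (cmod (F (fst p)) * cmod (F (snd p))))\<^sup>2 \<partial>lborel) * (\<integral>\<^sup>+ p. (ennreal (cmod (k (fst p) (snd p))))\<^sup>2 \<partial>lborel)"
    by (rule Cauchy_Schwarz_nn_integral[OF FFm]) (use km in simp)
  also have "(\<integral>\<^sup>+ p. (ennreal (cmod (F (fst p)) * cmod (F (snd p))))\<^sup>2 \<partial>lborel) = (\<integral>\<^sup>+ s. ennreal ((cmod (F s))\<^sup>2) \<partial>lborel)\<^sup>2"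
  proof -
    have e: "(ennreal (cmod (F (fst p)) * cmod (F (snd p))))\<^sup>2 = ennreal ((cmod (F (fst p)))\<^sup>2) * ennreal ((cmod (F (snd p)))\<^sup>2)" for p :: "vec \<times> vec"
      by (simp add: ennreal_power power_mult_distrib ennreal_mult)
    have m: "(\<lambda>p. (ennreal (cmod (F (fst p)) * cmod (F (snd p))))\<^sup>2) \<in> borel_measurable (lborel \<Otimes>\<^sub>M lborel)"
      using FFm by (simp add: lborel_prod)
    have Fm2: "(\<lambda>s. ennreal ((cmod (F s))\<^sup>2)) \<in> borel_measurable lborel" using Fm by simp
    show ?thesis
      using lborel.nn_integral_fst[OF m] unfolding lborel_prod e
      by (simp add: nn_integral_cmult[OF Fm2] nn_integral_multc[OF Fm2] power2_eq_square[of "integral\<^sup>N _ _"])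
  qed
  also have "(\<integral>\<^sup>+ p. (ennreal (cmod (k (fst p) (snd p))))\<^sup>2 \<partial>lborel) = (\<integral>\<^sup>+ \<sigma>. \<integral>\<^sup>+ s. ennreal ((cmod (k \<sigma> s))\<^sup>2) \<partial>lborel \<partial>lborel)"
  proof -
    have m: "(\<lambda>p. ennreal ((cmod (k (fst p) (snd p)))\<^sup>2)) \<in> borel_measurable (lborel \<Otimes>\<^sub>M lborel)"
      using km by (simp add: lborel_prod)
    show ?thesis using lborel.nn_integral_fst[OF m] by (simp add: lborel_prod ennreal_power)
  qed
  finally have 2: "(\<integral>\<^sup>+ p. ennreal (cmod (F (fst p)) * cmod (F (snd p))) * ennreal (cmod (k (fst p) (snd p))) \<partial>lborel)\<^sup>2
    \<le> (\<integral>\<^sup>+ s. ennreal ((cmod (F s))\<^sup>2) \<partial>lborel)\<^sup>2 * (\<integral>\<^sup>+ \<sigma>. \<integral>\<^sup>+ s. ennreal ((cmod (k \<sigma> s))\<^sup>2) \<partial>lborel \<partial>lborel)" .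
  show ?thesis
    unfolding lhs[unfolded H_def] by (rule order_trans[OF power_mono[OF 1 zero_le] 2])
qed

text \<open>A linearised form of a \<le> p^(1/2) b^(1/4), from two uses of the arithmetic-geometric
  mean inequality with weights \<open>\<mu>\<close> and \<open>\<nu>\<close>. Being linear in
  \<open>p\<close> and \<open>b\<close>, it can be integrated over a parameter term by term, in
  place of Hoelder's inequality, and it is trivial for infinite values.\<close>

lemma ennreal_weighted_AM_GM:
  fixes a p b :: ennreal
  assumes le: "a ^ 4 \<le> p\<^sup>2 * b" and pos: "\<mu> > 0" "\<nu> > 0"
  shows "a \<le> ennreal (\<mu> / 2) * p + ennreal (\<nu> / (4 * \<mu>)) + ennreal (1 / (4 * \<mu> * \<nu>)) * b"
proof (cases "p = \<infinity> \<or> b = \<infinity>")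
  case True
  then show ?thesis using pos by (auto simp: ennreal_mult_top)
next
  case False
  then obtain p' b' where p': "p = ennreal p'" "p' \<ge> 0" and b': "b = ennreal b'" "b' \<ge> 0"
    by (metis ennreal_cases infinity_ennreal_def)
  have fin: "p\<^sup>2 * b = ennreal (p'\<^sup>2 * b')" unfolding p'(1) b'(1) using p' b' by (simp add: ennreal_mult ennreal_power)
  have "a < top"
  proof (rule ccontr)
    assume "\<not> a < top"
    then have "a = top" by (simp add: less_top[symmetric])
    then have "a ^ 4 = top" by (simp add: eval_nat_numeral)
    then show False using le unfolding fin by (simp add: top_unique)
  qed
  then obtain a' where a': "a = ennreal a'" "a' \<ge> 0" unfolding less_top_ennreal by blast
  have le': "a' ^ 4 \<le> p'\<^sup>2 * b'" using le unfolding fin unfolding a'(1) ennreal_power[OF a'(2)] by (subst (asm) ennreal_le_iff) (use b' in auto)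
  define X where "X = \<mu> / 2 * p'"
  define Y where "Y = \<nu> / (4 * \<mu>) + 1 / (4 * \<mu> * \<nu>) * b'"
  have X0: "0 \<le> X" and Y0: "0 \<le> Y" using pos p' b' by (auto simp: X_def Y_def)
  have 1: "p' * (\<nu> + b' / \<nu>) / 2 \<le> (X + Y)\<^sup>2"
  proof -
    have "p' * (\<nu> + b' / \<nu>) / 2 = 4 * (X * Y)" using pos by (simp add: X_def Y_def field_simps)
    also have "\<dots> \<le> (X + Y)\<^sup>2" using zero_le_power2[of "X - Y"] by (simp add: power2_eq_square algebra_simps)
    finally show ?thesis .
  qed
  have 2: "4 * b' \<le> (\<nu> + b' / \<nu>)\<^sup>2"
  proof -
    have "(\<nu> + b' / \<nu>)\<^sup>2 = (\<nu> - b' / \<nu>)\<^sup>2 + 4 * b'" using pos by (simp add: power2_eq_square field_simps)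
    then show ?thesis using zero_le_power2[of "\<nu> - b' / \<nu>"] by linarith
  qed
  have "p'\<^sup>2 * b' \<le> p'\<^sup>2 * ((\<nu> + b' / \<nu>)\<^sup>2 / 4)" using 2 by (intro mult_left_mono) auto
  also have "\<dots> = (p' * (\<nu> + b' / \<nu>) / 2)\<^sup>2" by (simp add: power_mult_distrib power_divide)
  also have "\<dots> \<le> ((X + Y)\<^sup>2)\<^sup>2" using 1 pos p' b' by (intro power_mono) auto
  finally have "a' ^ 4 \<le> (X + Y) ^ 4" using le' by (simp add: power_mult [symmetric])
  then have "a' \<le> X + Y" using X0 Y0 by (intro power_le_imp_le_base[of a' 3 "X + Y"]) auto
  then have "ennreal a' \<le> ennreal (X + Y)" by (rule ennreal_leI)
  also have "\<dots> = ennreal (\<mu> / 2) * p + ennreal (\<nu> / (4 * \<mu>)) + ennreal (1 / (4 * \<mu> * \<nu>)) * b"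
    using X0 Y0 pos p' b' by (simp add: X_def Y_def ennreal_mult[symmetric] ennreal_plus[symmetric] add.assoc del: ennreal_plus)
  finally show ?thesis unfolding a'(1) .
qed

text \<open>After the substitution x = z + B y, s = y + t the argument of the first function is z +
  B s, by linearity of B, and no longer contains y. For fixed \<open>z\<close> the operator is thus
  an integral operator from functions of s to functions of y, and this is its kernel.\<close>

definition slice_ker :: "real \<Rightarrow> (vec \<Rightarrow> complex) \<Rightarrow> (vec \<Rightarrow> complex) \<Rightarrow> vec \<Rightarrow> vec \<times> vec \<Rightarrow> complex" where
  "slice_ker \<rho> r h z p = h (z + Bd \<rho> (fst p) + P (snd p - fst p)) * r (snd p - fst p)"

text \<open>The Gram kernel of that integral operator, with the cutoff in y as weight. It depends on
  the second function and on the amplitude only; the first function has been separated off.\<close>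

definition gram_ker :: "real \<Rightarrow> (vec \<Rightarrow> complex) \<Rightarrow> (vec \<Rightarrow> complex) \<Rightarrow> vec \<Rightarrow> vec \<Rightarrow> vec \<Rightarrow> complex" where
  "gram_ker \<rho> r h z \<sigma> s = (LINT y|lborel. of_real (bump y) * slice_ker \<rho> r h z (y, s) * cnj (slice_ker \<rho> r h z (y, \<sigma>)))"

lemma bump_measurable: "bump \<in> borel_measurable borel" by (rule C1_measurable[OF C1_bump])

lemma slice_ker_measurable:
  assumes hm: "h \<in> borel_measurable borel" and r: "cutoff c A r"
  shows "(\<lambda>Y. slice_ker \<rho> r h (fst Y) (snd Y)) \<in> borel_measurable borel" "slice_ker \<rho> r h z \<in> borel_measurable borel"
proof -
  have rm: "r \<in> borel_measurable borel" by (rule C1_measurable[OF cutoffD(1)[OF r]])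
  have c: "(\<lambda>Y::vec \<times> vec \<times> vec. fst Y + Bd \<rho> (fst (snd Y)) + P (snd (snd Y) - fst (snd Y))) \<in> borel_measurable borel"
    "(\<lambda>Y::vec \<times> vec \<times> vec. snd (snd Y) - fst (snd Y)) \<in> borel_measurable borel"
    unfolding P_def Bd_def by (intro borel_measurable_continuous_onI continuous_intros)+
  show 1: "(\<lambda>Y. slice_ker \<rho> r h (fst Y) (snd Y)) \<in> borel_measurable borel"
    unfolding slice_ker_def by (intro borel_measurable_times measurable_compose[OF c(1) hm] measurable_compose[OF c(2) rm])
  have "(\<lambda>p::vec \<times> vec. (z, p)) \<in> borel_measurable borel" by (intro borel_measurable_continuous_onI continuous_intros)
  from measurable_compose[OF this 1] show "slice_ker \<rho> r h z \<in> borel_measurable borel" by simp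
qed

lemma slice_ker_bound:
  assumes r: "cutoff c A r" and N: "\<And>v. cmod (h v) \<le> N"
  shows "cmod (slice_ker \<rho> r h z p) \<le> N * c"
  unfolding slice_ker_def norm_mult using N cutoffD(4)[OF r] order_trans[OF norm_ge_zero N]
  by (intro mult_mono) auto

lemma gram_ker_measurable:
  assumes hm: "h \<in> borel_measurable borel" and r: "cutoff c A r"
  shows "(\<lambda>Y::vec \<times> vec \<times> vec. gram_ker \<rho> r h (fst Y) (fst (snd Y)) (snd (snd Y))) \<in> borel_measurable borel"
proof -
  have c: "(\<lambda>T::(vec \<times> vec \<times> vec) \<times> vec. (fst (fst T), snd T, snd (snd (fst T)))) \<in> borel_measurable borel"
    "(\<lambda>T::(vec \<times> vec \<times> vec) \<times> vec. (fst (fst T), snd T, fst (snd (fst T)))) \<in> borel_measurable borel"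
    "(\<lambda>T::(vec \<times> vec \<times> vec) \<times> vec. snd T) \<in> borel_measurable borel"
    by (intro borel_measurable_continuous_onI continuous_intros)+
  note K1 = measurable_compose[OF c(1) slice_ker_measurable(1)[OF hm r]] measurable_compose[OF measurable_compose[OF c(2) slice_ker_measurable(1)[OF hm r]] cnj_borel_measurable]
  have "(\<lambda>T::(vec \<times> vec \<times> vec) \<times> vec. of_real (bump (snd T)) * slice_ker \<rho> r h (fst (fst T)) (snd T, snd (snd (fst T))) * cnj (slice_ker \<rho> r h (fst (fst T)) (snd T, fst (snd (fst T))))) \<in> borel_measurable borel"
    using K1 unfolding fst_conv snd_conv
    by (intro borel_measurable_times measurable_compose[OF measurable_compose[OF c(3) bump_measurable] borel_measurable_continuous_onI] continuous_intros)
  then have "(\<lambda>(Y, y). of_real (bump y) * slice_ker \<rho> r h (fst Y) (y, snd (snd Y)) * cnj (slice_ker \<rho> r h (fst Y) (y, fst (snd Y)))) \<in> borel_measurable ((lborel :: (vec \<times> vec \<times> vec) measure) \<Otimes>\<^sub>M lborel)"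
    unfolding lborel_prod case_prod_unfold by simp
  from lborel.borel_measurable_lebesgue_integral[OF this] show ?thesis unfolding gram_ker_def by simp
qed

lemma gram_ker_nn_integral_measurable:
  assumes hm: "h \<in> borel_measurable borel" and r: "cutoff c A r"
  shows "(\<lambda>z. \<integral>\<^sup>+ \<sigma>. \<integral>\<^sup>+ s. ennreal ((cmod (gram_ker \<rho> r h z \<sigma> s))\<^sup>2) \<partial>lborel \<partial>lborel) \<in> borel_measurable borel"
proof -
  have c: "(\<lambda>T::(vec \<times> vec) \<times> vec. (fst (fst T), snd (fst T), snd T)) \<in> borel_measurable borel"
    by (intro borel_measurable_continuous_onI continuous_intros)
  have "(\<lambda>(q, s). ennreal ((cmod (gram_ker \<rho> r h (fst q) (snd q) s))\<^sup>2)) \<in> borel_measurable ((lborel :: (vec \<times> vec) measure) \<Otimes>\<^sub>M lborel)"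
    using measurable_compose[OF c gram_ker_measurable[OF hm r]] unfolding lborel_prod case_prod_unfold fst_conv snd_conv by simp
  from lborel.borel_measurable_nn_integral[OF this]
  have "(\<lambda>(z, \<sigma>). \<integral>\<^sup>+ s. ennreal ((cmod (gram_ker \<rho> r h z \<sigma> s))\<^sup>2) \<partial>lborel) \<in> borel_measurable (lborel \<Otimes>\<^sub>M lborel)"
    unfolding lborel_prod case_prod_unfold by simp
  from lborel.borel_measurable_nn_integral[OF this] show ?thesis by simp
qed

text \<open>The square of the Gram kernel is a product of two integrals, one over \<open>y\<close>
  and one over a second copy \<open>y'\<close>. Multiplied by the cutoff in \<open>z\<close>, the
  joint integrand is that of \<open>quad\<close>, once the variable \<open>z\<close> is replaced by
  the second point. This replacement is a shear and preserves Lebesgue measure.\<close>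

lemma box_le_quad:
  assumes r: "cutoff c A r" and rho: "0 \<le> \<rho>" "\<rho> \<le> 1" and hm: "h \<in> borel_measurable borel" and N: "\<And>v. cmod (h v) \<le> N"
  shows "(\<integral>\<^sup>+ z. ennreal (bump z) * (\<integral>\<^sup>+ \<sigma>. \<integral>\<^sup>+ s. ennreal ((cmod (gram_ker \<rho> r h z \<sigma> s))\<^sup>2) \<partial>lborel \<partial>lborel) \<partial>lborel)
    \<le> ennreal (cmod (LINT X|lborel. quad \<rho> r (\<lambda>X. h (pX1 X)) (\<lambda>v. cnj (h v)) (\<lambda>v. cnj (h v)) h X))"
proof -
  define q where "q = quad \<rho> r (\<lambda>X. h (pX1 X)) (\<lambda>v. cnj (h v)) (\<lambda>v. cnj (h v)) h"
  \<comment> \<open>The second point is z + g(\<sigma>, s, y, y'), with g = B y + P(\<sigma> -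
    y).\<close>
  define g where "g = (\<lambda>p::vec \<times> vec3. Bd \<rho> (fst (snd (snd p))) + P (fst p - fst (snd (snd p))))"
  define Om where "Om = (\<lambda>Y. q (fst Y + g (snd Y), snd Y))"
  obtain W where W1: "W \<ge> 1" and W': "\<forall>\<rho> c A r V \<sigma> q. cutoff c A r \<and> 0 \<le> \<rho> \<and> \<rho> \<le> 1 \<longrightarrow> cmod (wt \<rho> r V \<sigma> q) \<le> W * c ^ 4 \<and>
    (\<forall>e. norm \<sigma> \<le> 20 \<and> norm e \<le> 1 \<and> norm q \<le> 40 \<longrightarrow> cmod (fd (wt \<rho> r V \<sigma>) q (ZF \<rho> \<sigma> e q)) \<le> W * c ^ 4 * A)"
    using wt_bounds by (elim exE conjE) (rule that)
  have wb: "cmod (wX \<rho> r X) \<le> W * c ^ 4" for X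
    unfolding wX_def using W'[rule_format, OF conjI[OF r conjI[OF rho]]] by blast
  have chm: "(\<lambda>v. cnj (h v)) \<in> borel_measurable borel" by (rule measurable_compose[OF hm cnj_borel_measurable])
  have chN: "cmod (cnj (h v)) \<le> N" for v using N by simp
  have hXm: "(\<lambda>X. h (pX1 X)) \<in> borel_measurable borel"
    by (rule measurable_compose[OF borel_measurable_continuous_onI[OF continuous_X(1)] hm])
  note qp = quad_properties[OF r rho hXm chm chm hm N chN chN N wb, folded q_def]
  have gm: "g \<in> borel_measurable borel"
    unfolding g_def Bd_def P_def by (intro borel_measurable_continuous_onI continuous_intros)
  have Om_eq: "Om (z, \<sigma>, s, y, y') = of_real (bump z) * ((of_real (bump y) * slice_ker \<rho> r h z (y, s) * cnj (slice_ker \<rho> r h z (y, \<sigma>)))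
      * cnj (of_real (bump y') * slice_ker \<rho> r h z (y', s) * cnj (slice_ker \<rho> r h z (y', \<sigma>))))" for z \<sigma> s y y'
  proof -
    have a: "pt1 (z + g (\<sigma>, s, y, y')) \<sigma> (s, y, y') = z + Bd \<rho> y + P (s - y)"
      "z + g (\<sigma>, s, y, y') = z + Bd \<rho> y + P (\<sigma> - y)"
      "pt0 \<rho> (z + g (\<sigma>, s, y, y')) \<sigma> (s, y, y') = z"
      by (simp_all add: pt1_def pt0_def g_def)
    have "Bd \<rho> y + Bd \<rho> (y' - y) = Bd \<rho> y'" by (simp add: Bd_def algebra_simps)
    then have b: "pt3 \<rho> (z + g (\<sigma>, s, y, y')) \<sigma> (s, y, y') = z + Bd \<rho> y' + P (s - y')"
      "pt4 \<rho> (z + g (\<sigma>, s, y, y')) \<sigma> (s, y, y') = z + Bd \<rho> y' + P (\<sigma> - y')"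
      by (simp_all add: pt3_def pt4_def g_def algebra_simps)
    have "Om (z, \<sigma>, s, y, y') = h (z + Bd \<rho> y + P (s - y)) * cnj (h (z + Bd \<rho> y + P (\<sigma> - y))) * cnj (h (z + Bd \<rho> y' + P (s - y'))) * h (z + Bd \<rho> y' + P (\<sigma> - y'))
      * (of_real (bump z) * of_real (bump y) * of_real (bump y') * r (s - y) * cnj (r (\<sigma> - y)) * cnj (r (s - y')) * r (\<sigma> - y'))"
      unfolding Om_def q_def quad_def pX1_def pX3_def pX4_def wX_def wt_def fst_conv snd_conv a(1) a(3) b unfolding a(2) ..
    then show ?thesis by (simp add: slice_ker_def mult_ac)
  qed
  have Om_m: "Om \<in> borel_measurable borel" unfolding Om_def by (rule measurable_compose[OF shear_measurable[OF gm] qp(1)])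
  define B where "B = N * N * N * N * (W * c ^ 4)"
  have Om_b: "cmod (Om Y) \<le> B" for Y unfolding Om_def B_def by (rule qp(2))
  have Om_s: "Om Y = 0" if Y: "norm Y > 200" for Y
  proof (rule ccontr)
    assume nz: "Om Y \<noteq> 0"
    obtain z \<sigma> s y y' where Yeq: "Y = (z, \<sigma>, s, y, y')" by (cases Y) auto
    have "bump z \<noteq> 0" using nz unfolding Yeq Om_eq by auto
    then have z: "norm z \<le> 10" using bump_support[of z] by (meson not_le)
    have w: "wX \<rho> r (z + g (\<sigma>, s, y, y'), \<sigma>, s, y, y') \<noteq> 0" using nz unfolding Yeq Om_def q_def quad_def by auto
    have "norm (\<sigma>, s, y, y') \<le> norm (z + g (\<sigma>, s, y, y'), \<sigma>, s, y, y')" by (rule norm_snd_le)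
    then have p: "norm (\<sigma>, s, y, y') \<le> 100" using wX_support[OF r rho w] by linarith
    have "norm Y \<le> norm z + norm (\<sigma>, s, y, y')" unfolding Yeq by (rule norm_Pair_le)
    then show False using Y z p by linarith
  qed
  have Pm: "(\<lambda>p. (z, p)) \<in> borel_measurable borel" for z :: vec
    by (intro borel_measurable_continuous_onI continuous_intros)
  have Pm2: "(\<lambda>p. (z, \<sigma>, p)) \<in> borel_measurable borel" for z \<sigma> :: vec
    by (intro borel_measurable_continuous_onI continuous_intros)
  have I0: "integrable lborel Om" by (rule integrable_bounded_support[OF Om_m Om_b Om_s])
  have I1: "integrable lborel (\<lambda>p. Om (z, p))" for z
  proof (rule integrable_bounded_support[OF measurable_compose[OF Pm Om_m] Om_b])
    fix p :: "vec \<times> vec3" assume "norm p > 200"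
    then show "Om (z, p) = 0" using norm_snd_le[of p z] by (intro Om_s) linarith
  qed
  have I2: "integrable lborel (\<lambda>p. Om (z, \<sigma>, p))" for z \<sigma>
  proof (rule integrable_bounded_support[OF measurable_compose[OF Pm2 Om_m] Om_b])
    fix p :: vec3 assume "norm p > 200"
    then show "Om (z, \<sigma>, p) = 0" using norm_snd_le[of p \<sigma>] norm_snd_le[of "(\<sigma>, p)" z] by (intro Om_s) linarith
  qed
  have inner: "(LINT p|lborel. Om (z, \<sigma>, s, p)) = of_real (bump z * (cmod (gram_ker \<rho> r h z \<sigma> s))\<^sup>2)" for z \<sigma> s
  proof -
    define u where "u = (\<lambda>y. of_real (bump y) * slice_ker \<rho> r h z (y, s) * cnj (slice_ker \<rho> r h z (y, \<sigma>)))"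
    have ui: "integrable lborel u"
    proof (rule integrable_bounded_support)
      have m: "(\<lambda>y. slice_ker \<rho> r h z (y, s)) \<in> borel_measurable borel" for s
        by (rule measurable_compose[OF _ slice_ker_measurable(2)[OF hm r]]) (intro borel_measurable_continuous_onI continuous_intros)
      show "u \<in> borel_measurable borel" unfolding u_def
        by (intro borel_measurable_times m measurable_compose[OF m cnj_borel_measurable] measurable_compose[OF bump_measurable borel_measurable_continuous_onI] continuous_intros)
      show "norm (u y) \<le> 390625 * (N * c) * (N * c)" for y
        unfolding u_def norm_mult complex_mod_cnj norm_of_real abs_of_nonneg[OF bump_bounds(1)]
        using order_trans[OF norm_ge_zero N] cutoffD(2)[OF r]
        by (intro mult_mono bump_bounds slice_ker_bound[OF r N] mult_nonneg_nonneg norm_ge_zero) simp_all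
      show "u y = 0" if "norm y > 10" for y using bump_support[OF that] by (simp add: u_def)
    qed
    have k: "gram_ker \<rho> r h z \<sigma> s = (LINT y|lborel. u y)" by (simp add: gram_ker_def u_def)
    have "(LINT p|lborel. u (fst p) * cnj (u (snd p))) = gram_ker \<rho> r h z \<sigma> s * cnj (gram_ker \<rho> r h z \<sigma> s)"
      using lborel_integral_prod_mult(2)[OF ui integrable_cnj[OF ui]] unfolding Bochner_Integration.integral_cnj k .
    moreover have "Om (z, \<sigma>, s, p) = of_real (bump z) * (u (fst p) * cnj (u (snd p)))" for p
      using Om_eq[of z \<sigma> s "fst p" "snd p"] by (simp add: u_def)
    ultimately have "(LINT p|lborel. Om (z, \<sigma>, s, p)) = of_real (bump z) * (gram_ker \<rho> r h z \<sigma> s * cnj (gram_ker \<rho> r h z \<sigma> s))" by simp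
    then show ?thesis by (simp only: complex_norm_square[symmetric] of_real_mult)
  qed
  have p0: "0 \<le> bump z * (cmod (gram_ker \<rho> r h z \<sigma> s))\<^sup>2" for z \<sigma> s using bump_bounds(1) by simp
  \<comment> \<open>The integrations over \<open>s\<close>, then \<open>\<sigma>\<close>, then
    \<open>z\<close> are removed in turn; each conclusion supplies the hypotheses of the
    next.\<close>
  note L2 = nn_integral_slice[OF I2 inner p0]
  note L1 = nn_integral_slice[OF I1 L2(1) L2(2)]
  note L0 = nn_integral_slice[OF I0 L1(1) L1(2)]
  have "(\<integral>\<^sup>+ z. ennreal (bump z) * (\<integral>\<^sup>+ \<sigma>. \<integral>\<^sup>+ s. ennreal ((cmod (gram_ker \<rho> r h z \<sigma> s))\<^sup>2) \<partial>lborel \<partial>lborel) \<partial>lborel)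
    = (\<integral>\<^sup>+ z. \<integral>\<^sup>+ \<sigma>. \<integral>\<^sup>+ s. ennreal (bump z * (cmod (gram_ker \<rho> r h z \<sigma> s))\<^sup>2) \<partial>lborel \<partial>lborel \<partial>lborel)"
  proof -
    note k3m = gram_ker_measurable[OF hm r, of \<rho>]
    have k2m: "(\<lambda>p. gram_ker \<rho> r h z (fst p) (snd p)) \<in> borel_measurable borel" for z
      using measurable_compose[OF Pm k3m, of z] by simp
    have k1m: "(\<lambda>s. gram_ker \<rho> r h z \<sigma> s) \<in> borel_measurable borel" for z \<sigma>
      using measurable_compose[OF Pm k2m, of z \<sigma>] by simp
    have m1: "(\<lambda>s. ennreal ((cmod (gram_ker \<rho> r h z \<sigma> s))\<^sup>2)) \<in> borel_measurable lborel" for z \<sigma> using k1m by simp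
    have m2: "(\<lambda>\<sigma>. \<integral>\<^sup>+ s. ennreal ((cmod (gram_ker \<rho> r h z \<sigma> s))\<^sup>2) \<partial>lborel) \<in> borel_measurable lborel" for z
    proof -
      have "(\<lambda>(\<sigma>, s). ennreal ((cmod (gram_ker \<rho> r h z \<sigma> s))\<^sup>2)) \<in> borel_measurable (lborel \<Otimes>\<^sub>M lborel)"
        using k2m unfolding lborel_prod case_prod_unfold by simp
      from lborel.borel_measurable_nn_integral[OF this] show ?thesis by simp
    qed
    show ?thesis
      unfolding ennreal_mult[OF bump_bounds(1) zero_le_power2] nn_integral_cmult[OF m1] nn_integral_cmult[OF m2] ..
  qed
  also have "\<dots> = ennreal (LINT z|lborel. LINT \<sigma>|lborel. LINT s|lborel. bump z * (cmod (gram_ker \<rho> r h z \<sigma> s))\<^sup>2)"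
    unfolding L2(3) L1(3) L0(3) ..
  also have "\<dots> = ennreal (cmod (LINT Y|lborel. Om Y))"
    unfolding L0(1) norm_of_real abs_of_nonneg[OF L0(2)] ..
  also have "(LINT Y|lborel. Om Y) = (LINT X|lborel. q X)"
  proof -
    have "(LINT X|lborel. q X) = (LINT X|distr lborel borel (\<lambda>X. (fst X + g (snd X), snd X)). q X)"
      unfolding lborel_distr_shear[OF gm] ..
    also have "\<dots> = (LINT Y|lborel. Om Y)"
      unfolding Om_def using shear_measurable[OF gm] qp(1) by (subst integral_distr) simp_all
    finally show ?thesis ..
  qed
  finally show ?thesis unfolding q_def by simp
qed

section \<open>From the four-point form back to the operator\<close>

abbreviation (input) unit_square :: "vec set" where "unit_square \<equiv> {0..1} \<times> {0..1}"

lemma emeasure_vec_box: "a \<le> b \<Longrightarrow> c \<le> d \<Longrightarrow> emeasure lborel ({a..b} \<times> {c..d} :: vec set) = ennreal ((b - a) * (d - c))"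
  using lborel.emeasure_pair_measure_Times[of "{a..b}" lborel "{c..d}"] by (simp add: lborel_prod ennreal_mult)

lemma vec_box_sets: "({a..b} \<times> {c..d} :: vec set) \<in> sets borel"
  by (intro borel_closed closed_Times) auto

definition Tdil :: "real \<Rightarrow> (vec \<Rightarrow> complex) \<Rightarrow> (vec \<Rightarrow> complex) \<Rightarrow> (vec \<Rightarrow> complex) \<Rightarrow> vec \<Rightarrow> complex" where
  "Tdil \<rho> r f h x = (LINT t|lborel. f (x + Bd \<rho> t) * h (x + P t) * r t)"

lemma Tdil_measurable:
  assumes f: "f \<in> borel_measurable borel" and h: "h \<in> borel_measurable borel" and r: "r \<in> borel_measurable borel"
  shows "Tdil \<rho> r f h \<in> borel_measurable borel"
proof -
  have c: "(\<lambda>p::vec \<times> vec. fst p + Bd \<rho> (snd p)) \<in> borel_measurable borel" "(\<lambda>p::vec \<times> vec. fst p + P (snd p)) \<in> borel_measurable borel"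
    "(\<lambda>p::vec \<times> vec. snd p) \<in> borel_measurable borel"
    unfolding P_def Bd_def by (intro borel_measurable_continuous_onI continuous_intros)+
  have "(\<lambda>(x, t). f (x + Bd \<rho> t) * h (x + P t) * r t) \<in> borel_measurable (lborel \<Otimes>\<^sub>M lborel)"
    unfolding lborel_prod case_prod_unfold measurable_lborel2
    by (intro borel_measurable_times measurable_compose[OF c(1) f] measurable_compose[OF c(2) h] measurable_compose[OF c(3) r])
  from lborel.borel_measurable_lebesgue_integral[OF this] show ?thesis unfolding Tdil_def by simp
qed

text \<open>The norm over the unit square is averaged over y, so that x = z + B y with both y and z
  varying. For fixed z, Cauchy--Schwarz in y and then \<open>box_Cauchy_Schwarz\<close> bound the
  fourth power of the average by the square of a local square norm of \<open>f\<close> times the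
  Gram square norm. The linearised inequality turns this into terms whose integrals over z are
  known. The cutoff is at least 1 on the sets of y and z concerned and may be inserted
  freely.\<close>

lemma Tdil_box_estimate:
  assumes r: "cutoff c A r" and rho: "0 \<le> \<rho>" "\<rho> \<le> 1"
    and fm: "f \<in> borel_measurable borel" and hm: "h \<in> borel_measurable borel" and N: "\<And>v. cmod (h v) \<le> N"
    and fG: "(\<integral>\<^sup>+ x. ennreal ((cmod (f x))\<^sup>2) \<partial>lborel) \<le> ennreal (G\<^sup>2)" and G: "G > 0"
    and J: "cmod (LINT X|lborel. quad \<rho> r (\<lambda>X. h (pX1 X)) (\<lambda>v. cnj (h v)) (\<lambda>v. cnj (h v)) h X) \<le> J" "J > 0"
  shows "(\<integral>\<^sup>+ x. ennreal (cmod (Tdil \<rho> r f h x)) * indicator unit_square x \<partial>lborel)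
    \<le> ennreal ((measure lborel (cball 0 10 :: vec set) / 2 + 1) * G * root 4 J)"
proof -
  let ?U = unit_square
  \<comment> \<open>Since B y lies in the unit square for y in the unit square, x = z + B y in the
    unit square forces z into this square of area 4.\<close>
  define Z :: "vec set" where "Z = {-1..1} \<times> {-1..1}"
  have U1: "emeasure lborel ?U = 1" using emeasure_vec_box[of 0 1 0 1] by simp
  have Z4: "emeasure lborel Z = 4" unfolding Z_def using emeasure_vec_box[of "-1" 1 "-1" 1] by simp
  have Us: "?U \<in> sets borel" and Zs: "Z \<in> sets borel" unfolding Z_def by (rule vec_box_sets)+
  have rm: "r \<in> borel_measurable borel" by (rule C1_measurable[OF cutoffD(1)[OF r]])
  have Tm: "Tdil \<rho> r f h \<in> borel_measurable borel" by (rule Tdil_measurable[OF fm hm rm])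
  define a where "a = (\<lambda>x. ennreal (cmod (Tdil \<rho> r f h x)))"
  have am: "a \<in> borel_measurable borel" unfolding a_def using Tm by simp
  have iU: "(indicator ?U :: vec \<Rightarrow> ennreal) \<in> borel_measurable borel" using Us by (rule borel_measurable_indicator)
  have iZ: "(indicator Z :: vec \<Rightarrow> ennreal) \<in> borel_measurable borel" using Zs by (rule borel_measurable_indicator)
  define L where "L = (\<integral>\<^sup>+ x. a x * indicator ?U x \<partial>lborel)"
  have BdU: "0 \<le> fst (Bd \<rho> y) \<and> fst (Bd \<rho> y) \<le> 1 \<and> 0 \<le> snd (Bd \<rho> y) \<and> snd (Bd \<rho> y) \<le> 1" if "y \<in> ?U" for y
  proof -
    have y: "0 \<le> fst y" "fst y \<le> 1" "0 \<le> snd y" "snd y \<le> 1" using that by (auto simp: mem_Times_iff)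
    have "\<rho> * fst y \<le> 1 * 1" "\<rho> * \<rho> * snd y \<le> 1 * 1 * 1" using rho y by (intro mult_mono; simp)+
    then show ?thesis using rho y by (simp add: Bd_def)
  qed
  have sh: "(\<lambda>p::vec \<times> vec. snd p + Bd \<rho> (fst p)) \<in> borel_measurable borel" "(\<lambda>p::vec \<times> vec. fst p) \<in> borel_measurable borel" "(\<lambda>p::vec \<times> vec. snd p) \<in> borel_measurable borel"
    unfolding Bd_def by (intro borel_measurable_continuous_onI continuous_intros)+
  define Aa where "Aa = (\<lambda>z. \<integral>\<^sup>+ y. a (z + Bd \<rho> y) * indicator ?U y \<partial>lborel)"
  have L_le: "L \<le> (\<integral>\<^sup>+ z. Aa z * indicator Z z \<partial>lborel)"
  proof -
    have "L = (\<integral>\<^sup>+ y. L * indicator ?U y \<partial>lborel)" using Us by (simp add: nn_integral_cmult_indicator U1)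
    also have "\<dots> \<le> (\<integral>\<^sup>+ y. \<integral>\<^sup>+ z. (a (z + Bd \<rho> y) * indicator ?U y) * indicator Z z \<partial>lborel \<partial>lborel)"
    proof (intro nn_integral_mono)
      fix y :: vec
      show "L * indicator ?U y \<le> (\<integral>\<^sup>+ z. (a (z + Bd \<rho> y) * indicator ?U y) * indicator Z z \<partial>lborel)"
      proof (cases "y \<in> ?U")
        case True
        have "L = (\<integral>\<^sup>+ z. a (Bd \<rho> y + z) * indicator ?U (Bd \<rho> y + z) \<partial>lborel)"
          unfolding L_def by (rule nn_integral_lborel_shift[symmetric]) (intro borel_measurable_times_ennreal am iU)
        also have "\<dots> \<le> (\<integral>\<^sup>+ z. (a (z + Bd \<rho> y) * indicator ?U y) * indicator Z z \<partial>lborel)"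
        proof (intro nn_integral_mono)
          fix z
          have "Bd \<rho> y + z \<in> ?U \<Longrightarrow> z \<in> Z" using BdU[OF True] by (auto simp: Z_def mem_Times_iff)
          then show "a (Bd \<rho> y + z) * indicator ?U (Bd \<rho> y + z) \<le> (a (z + Bd \<rho> y) * indicator ?U y) * indicator Z z"
            using True by (cases "Bd \<rho> y + z \<in> ?U") (simp_all add: add.commute)
        qed
        finally show ?thesis using True by simp
      qed simp
    qed
    also have "\<dots> = (\<integral>\<^sup>+ z. \<integral>\<^sup>+ y. (a (z + Bd \<rho> y) * indicator ?U y) * indicator Z z \<partial>lborel \<partial>lborel)"
    proof -
      have "(\<lambda>p. (a (snd p + Bd \<rho> (fst p)) * indicator ?U (fst p)) * indicator Z (snd p)) \<in> borel_measurable (lborel \<Otimes>\<^sub>M lborel)"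
        unfolding lborel_prod measurable_lborel2
        by (intro borel_measurable_times_ennreal measurable_compose[OF sh(1) am] measurable_compose[OF sh(2) iU] measurable_compose[OF sh(3) iZ])
      then show ?thesis
        using lborel_pair.Fubini'[of "\<lambda>y z. (a (z + Bd \<rho> y) * indicator ?U y) * indicator Z z"] by (simp add: case_prod_unfold)
    qed
    also have "\<dots> = (\<integral>\<^sup>+ z. Aa z * indicator Z z \<partial>lborel)"
    proof -
      have "(\<lambda>y. a (z + Bd \<rho> y) * indicator ?U y) \<in> borel_measurable lborel" for z
      proof -
        have "(\<lambda>y. z + Bd \<rho> y) \<in> borel_measurable borel" unfolding Bd_def by (intro borel_measurable_continuous_onI continuous_intros)
        from measurable_compose[OF this am] iU show ?thesis by (simp add: borel_measurable_times_ennreal)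
      qed
      then show ?thesis unfolding Aa_def by (simp add: nn_integral_multc)
    qed
    finally show ?thesis .
  qed
  \<comment> \<open>The amplitude confines s to coordinates of size at most 2, so the indicator
    changes nothing in the operator. It makes the integral over z of the square norms finite, at
    most the area \<open>q\<close> of the ball times \<open>G\<^sup>2\<close>.\<close>
  define F where "F = (\<lambda>z s. f (z + Bd \<rho> s) * indicator (cball 0 10) s)"
  define \<Phi> where "\<Phi> = (\<lambda>z. \<integral>\<^sup>+ s. ennreal ((cmod (F z s))\<^sup>2) \<partial>lborel)"
  define Box where "Box = (\<lambda>z. \<integral>\<^sup>+ \<sigma>. \<integral>\<^sup>+ s. ennreal ((cmod (gram_ker \<rho> r h z \<sigma> s))\<^sup>2) \<partial>lborel \<partial>lborel)"
  have ci: "(indicator (cball (0::vec) 10) :: vec \<Rightarrow> complex) \<in> borel_measurable borel" by (intro borel_measurable_indicator borel_closed closed_cball)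
  have Fm: "F z \<in> borel_measurable borel" for z
  proof -
    have "(\<lambda>y. z + Bd \<rho> y) \<in> borel_measurable borel" unfolding Bd_def by (intro borel_measurable_continuous_onI continuous_intros)
    then show ?thesis unfolding F_def by (intro borel_measurable_times ci measurable_compose[OF _ fm])
  qed
  have Tdil_eq: "Tdil \<rho> r f h (z + Bd \<rho> y) = (LINT s|lborel. F z s * slice_ker \<rho> r h z (y, s))" if y: "y \<in> ?U" for z y
  proof -
    have gm: "(\<lambda>t. f (z + Bd \<rho> y + Bd \<rho> t) * h (z + Bd \<rho> y + P t) * r t) \<in> borel_measurable borel"
      unfolding Bd_def P_def
      by (intro borel_measurable_times rm measurable_compose[OF _ fm] measurable_compose[OF _ hm]) (intro borel_measurable_continuous_onI continuous_intros)+
    have "Tdil \<rho> r f h (z + Bd \<rho> y) = (LINT s|lborel. f (z + Bd \<rho> y + Bd \<rho> (- y + s)) * h (z + Bd \<rho> y + P (- y + s)) * r (- y + s))"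
      unfolding Tdil_def using lborel_integral_shift[OF gm, of "- y"] by simp
    also have "\<dots> = (LINT s|lborel. F z s * slice_ker \<rho> r h z (y, s))"
    proof (rule Bochner_Integration.integral_cong[OF refl])
      fix s :: vec
      have e: "- y + s = s - y" "z + Bd \<rho> y + Bd \<rho> (s - y) = z + Bd \<rho> s" by (simp_all add: Bd_def prod_eq_iff algebra_simps)
      show "f (z + Bd \<rho> y + Bd \<rho> (- y + s)) * h (z + Bd \<rho> y + P (- y + s)) * r (- y + s) = F z s * slice_ker \<rho> r h z (y, s)"
      proof (cases "r (s - y) = 0")
        case False
        have "0 \<le> fst (s - y) \<and> fst (s - y) \<le> 1 \<and> 0 \<le> snd (s - y) \<and> snd (s - y) \<le> 1" using cutoffD(6)[OF r False] .
        moreover have "0 \<le> fst y" "fst y \<le> 1" "0 \<le> snd y" "snd y \<le> 1" using y by (auto simp: mem_Times_iff)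
        ultimately have "\<bar>fst s\<bar> \<le> 2" "\<bar>snd s\<bar> \<le> 2" unfolding fst_diff snd_diff by linarith+
        then have "norm s \<le> 10" using norm_vec_le[of s] by linarith
        then show ?thesis unfolding e F_def slice_ker_def fst_conv snd_conv by simp
      qed (simp add: e slice_ker_def)
    qed
    finally show ?thesis .
  qed
  \<comment> \<open>Finiteness of \<open>\<Phi> z\<close> is a hypothesis of
    \<open>box_Cauchy_Schwarz\<close>. Where it fails, the bound \<open>Az\<close> below holds
    because its right-hand side is infinite.\<close>
  have A4: "(Aa z) ^ 4 \<le> (\<Phi> z)\<^sup>2 * Box z" if fin: "\<Phi> z < \<infinity>" for z
  proof -
    define H where "H = (\<lambda>y. LINT s|lborel. F z s * slice_ker \<rho> r h z (y, s))"
    have Hm: "(\<lambda>y. Tdil \<rho> r f h (z + Bd \<rho> y)) \<in> borel_measurable borel"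
      by (rule measurable_compose[OF _ Tm]) (simp add: Bd_def[abs_def], intro borel_measurable_continuous_onI continuous_intros)
    have aH: "a (z + Bd \<rho> y) * indicator ?U y = indicator ?U y * (ennreal (cmod (Tdil \<rho> r f h (z + Bd \<rho> y))) * indicator ?U y)" for y
      by (simp add: a_def indicator_def)
    have "(Aa z)\<^sup>2 \<le> (\<integral>\<^sup>+ y. (indicator ?U y)\<^sup>2 \<partial>lborel) * (\<integral>\<^sup>+ y. (ennreal (cmod (Tdil \<rho> r f h (z + Bd \<rho> y))) * indicator ?U y)\<^sup>2 \<partial>lborel)"
      unfolding Aa_def aH
      by (rule Cauchy_Schwarz_nn_integral) (use iU Hm in \<open>simp_all add: borel_measurable_times_ennreal\<close>)
    also have "(\<integral>\<^sup>+ y. (indicator ?U y)\<^sup>2 \<partial>lborel) = (\<integral>\<^sup>+ y. indicator ?U y \<partial>lborel)"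
      by (rule nn_integral_cong) (simp add: indicator_def)
    also have "\<dots> = 1" using U1 Us by simp
    also have "1 * (\<integral>\<^sup>+ y. (ennreal (cmod (Tdil \<rho> r f h (z + Bd \<rho> y))) * indicator ?U y)\<^sup>2 \<partial>lborel) \<le> (\<integral>\<^sup>+ y. ennreal (bump y) * ennreal ((cmod (H y))\<^sup>2) \<partial>lborel)"
      unfolding mult_1
    proof (intro nn_integral_mono)
      fix y :: vec
      show "(ennreal (cmod (Tdil \<rho> r f h (z + Bd \<rho> y))) * indicator ?U y)\<^sup>2 \<le> ennreal (bump y) * ennreal ((cmod (H y))\<^sup>2)"
      proof (cases "y \<in> ?U")
        case True
        have "0 \<le> fst y" "fst y \<le> 1" "0 \<le> snd y" "snd y \<le> 1" using True by (auto simp: mem_Times_iff)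
        then have "1 \<le> bump y" by (intro bump_bounds(3)) linarith+
        then have "1 * (cmod (H y))\<^sup>2 \<le> bump y * (cmod (H y))\<^sup>2" by (rule mult_right_mono) simp
        then have "ennreal ((cmod (H y))\<^sup>2) \<le> ennreal (bump y * (cmod (H y))\<^sup>2)" by (intro ennreal_leI) simp
        then show ?thesis using True by (simp add: Tdil_eq[OF True] H_def ennreal_power ennreal_mult bump_bounds(1))
      qed simp
    qed
    finally have 1: "(Aa z)\<^sup>2 \<le> (\<integral>\<^sup>+ y. ennreal (bump y) * ennreal ((cmod (H y))\<^sup>2) \<partial>lborel)" .
    have "(\<integral>\<^sup>+ y. ennreal (bump y) * ennreal ((cmod (H y))\<^sup>2) \<partial>lborel)\<^sup>2 \<le> (\<Phi> z)\<^sup>2 * Box z"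
      unfolding H_def \<Phi>_def Box_def gram_ker_def
    proof (rule box_Cauchy_Schwarz[where M = 10 and B = "N * c" and C = 390625])
      show "F z s = 0" if "norm s > 10" for s using that by (simp add: F_def)
      show "(\<integral>\<^sup>+ s. ennreal ((cmod (F z s))\<^sup>2) \<partial>lborel) < \<infinity>" using fin unfolding \<Phi>_def .
    qed (rule Fm slice_ker_measurable(2)[OF hm r] slice_ker_bound[OF r N] bump_measurable bump_bounds bump_support; assumption?)+
    then have "((Aa z)\<^sup>2)\<^sup>2 \<le> (\<Phi> z)\<^sup>2 * Box z" using power_mono[OF 1, of 2] by (meson order_trans zero_le)
    then show ?thesis by (simp add: power_mult[symmetric])
  qed
  \<comment> \<open>With w the fourth root of \<open>J\<close>, these choices turn the three terms
    into q/2, 1/2 and 1/2 times G w.\<close>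
  define \<nu> where "\<nu> = sqrt J / 2"
  define \<mu> where "\<mu> = root 4 J / G"
  have pos: "\<mu> > 0" "\<nu> > 0" using J G by (simp_all add: \<mu>_def \<nu>_def)
  have Az: "Aa z \<le> ennreal (\<mu> / 2) * \<Phi> z + ennreal (\<nu> / (4 * \<mu>)) + ennreal (1 / (4 * \<mu> * \<nu>)) * Box z" for z
  proof (cases "\<Phi> z < \<infinity>")
    case True
    show ?thesis by (rule ennreal_weighted_AM_GM[OF A4[OF True] pos])
  next
    case False
    then have "\<Phi> z = \<infinity>" by (simp add: less_top[symmetric])
    then show ?thesis using pos by (simp add: ennreal_mult_top)
  qed
  define q where "q = measure lborel (cball 0 10 :: vec set)"
  have q: "emeasure lborel (cball 0 10 :: vec set) = ennreal q" "q \<ge> 0"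
    unfolding q_def by (rule emeasure_eq_ennreal_measure) (use emeasure_lborel_cball_finite[of "0::vec" 10] in \<open>simp_all add: less_top[symmetric]\<close>)
  have Fpm: "(\<lambda>p::vec \<times> vec. ennreal ((cmod (F (fst p) (snd p)))\<^sup>2)) \<in> borel_measurable borel"
  proof -
    have "(\<lambda>p::vec \<times> vec. fst p + Bd \<rho> (snd p)) \<in> borel_measurable borel" unfolding Bd_def by (intro borel_measurable_continuous_onI continuous_intros)
    then have "(\<lambda>p::vec \<times> vec. F (fst p) (snd p)) \<in> borel_measurable borel"
      unfolding F_def by (intro borel_measurable_times measurable_compose[OF _ fm] measurable_compose[OF sh(3) ci])
    then show ?thesis by simp
  qed
  have Phim: "\<Phi> \<in> borel_measurable borel"
  proof -
    have "(\<lambda>(z, s). ennreal ((cmod (F z s))\<^sup>2)) \<in> borel_measurable ((lborel :: vec measure) \<Otimes>\<^sub>M lborel)"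
      using Fpm unfolding lborel_prod case_prod_unfold by simp
    from lborel.borel_measurable_nn_integral[OF this] show ?thesis unfolding \<Phi>_def by simp
  qed
  have Phi_int: "(\<integral>\<^sup>+ z. \<Phi> z \<partial>lborel) \<le> ennreal (q * G\<^sup>2)"
  proof -
    have "(\<integral>\<^sup>+ z. \<Phi> z \<partial>lborel) = (\<integral>\<^sup>+ s. \<integral>\<^sup>+ z. ennreal ((cmod (F z s))\<^sup>2) \<partial>lborel \<partial>lborel)"
      unfolding \<Phi>_def using lborel_pair.Fubini'[of "\<lambda>s z. ennreal ((cmod (F z s))\<^sup>2)"]
      measurable_compose[OF _ Fpm, of "\<lambda>p. (snd p, fst p)" "borel :: (vec \<times> vec) measure"] 
      by (simp add: lborel_prod case_prod_unfold borel_measurable_continuous_onI continuous_intros)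
    also have "\<dots> \<le> (\<integral>\<^sup>+ s. ennreal (G\<^sup>2) * indicator (cball (0::vec) 10) s \<partial>lborel)"
    proof (intro nn_integral_mono)
      fix s :: vec
      have "(\<integral>\<^sup>+ z. ennreal ((cmod (f (z + Bd \<rho> s)))\<^sup>2) \<partial>lborel) = (\<integral>\<^sup>+ z. ennreal ((cmod (f z))\<^sup>2) \<partial>lborel)"
        using nn_integral_lborel_shift[of "\<lambda>z. ennreal ((cmod (f z))\<^sup>2)" "Bd \<rho> s"] fm by (simp add: add.commute)
      then show "(\<integral>\<^sup>+ z. ennreal ((cmod (F z s))\<^sup>2) \<partial>lborel) \<le> ennreal (G\<^sup>2) * indicator (cball (0::vec) 10) s"
        using fG by (cases "s \<in> cball 0 10") (simp_all add: F_def)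
    qed
    also have "\<dots> = ennreal (G\<^sup>2) * ennreal q" unfolding q(1)[symmetric] by (rule nn_integral_cmult_indicator) simp
    also have "\<dots> = ennreal (q * G\<^sup>2)" using q(2) by (simp add: ennreal_mult mult.commute)
    finally show ?thesis .
  qed
  have Box_int: "(\<integral>\<^sup>+ z. Box z * indicator Z z \<partial>lborel) \<le> ennreal J"
  proof -
    have "(\<integral>\<^sup>+ z. Box z * indicator Z z \<partial>lborel) \<le> (\<integral>\<^sup>+ z. ennreal (bump z) * Box z \<partial>lborel)"
    proof (intro nn_integral_mono)
      fix z :: vec
      show "Box z * indicator Z z \<le> ennreal (bump z) * Box z"
      proof (cases "z \<in> Z")
        case True
        then have "-1 \<le> fst z" "fst z \<le> 1" "-1 \<le> snd z" "snd z \<le> 1" by (auto simp: Z_def mem_Times_iff)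
        then have "1 \<le> bump z" by (intro bump_bounds(3)) linarith+
        then have "(1::ennreal) \<le> ennreal (bump z)" by simp
        from mult_right_mono[OF this, of "Box z"] show ?thesis using True by simp
      qed simp
    qed
    also have "\<dots> \<le> ennreal (cmod (LINT X|lborel. quad \<rho> r (\<lambda>X. h (pX1 X)) (\<lambda>v. cnj (h v)) (\<lambda>v. cnj (h v)) h X))"
      unfolding Box_def by (rule box_le_quad[OF r rho hm N])
    also have "\<dots> \<le> ennreal J" by (rule ennreal_leI[OF J(1)])
    finally show ?thesis .
  qed
  have Boxm: "Box \<in> borel_measurable borel" unfolding Box_def by (rule gram_ker_nn_integral_measurable[OF hm r])
  have "L \<le> (\<integral>\<^sup>+ z. (ennreal (\<mu> / 2) * \<Phi> z + ennreal (\<nu> / (4 * \<mu>)) * indicator Z z) + ennreal (1 / (4 * \<mu> * \<nu>)) * (Box z * indicator Z z) \<partial>lborel)"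
  proof (rule order_trans[OF L_le], intro nn_integral_mono)
    fix z
    show "Aa z * indicator Z z \<le> (ennreal (\<mu> / 2) * \<Phi> z + ennreal (\<nu> / (4 * \<mu>)) * indicator Z z) + ennreal (1 / (4 * \<mu> * \<nu>)) * (Box z * indicator Z z)"
      using Az[of z] by (cases "z \<in> Z") simp_all
  qed
  also have "\<dots> \<le> (\<integral>\<^sup>+ z. ennreal (\<mu> / 2) * \<Phi> z + ennreal (\<nu> / (4 * \<mu>)) * indicator Z z \<partial>lborel) + (\<integral>\<^sup>+ z. ennreal (1 / (4 * \<mu> * \<nu>)) * (Box z * indicator Z z) \<partial>lborel)"
    by (rule eq_refl, rule nn_integral_add) (use Phim Boxm iZ in \<open>simp_all add: borel_measurable_times_ennreal\<close>)
  also have "\<dots> \<le> ennreal (\<mu> / 2) * ennreal (q * G\<^sup>2) + ennreal (\<nu> / (4 * \<mu>)) * 4 + ennreal (1 / (4 * \<mu> * \<nu>)) * ennreal J"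
  proof (rule add_mono)
    have "(\<integral>\<^sup>+ z. ennreal (\<mu> / 2) * \<Phi> z + ennreal (\<nu> / (4 * \<mu>)) * indicator Z z \<partial>lborel) = ennreal (\<mu> / 2) * (\<integral>\<^sup>+ z. \<Phi> z \<partial>lborel) + ennreal (\<nu> / (4 * \<mu>)) * 4"
      using Phim iZ Zs Z4 by (simp add: nn_integral_add nn_integral_cmult nn_integral_cmult_indicator borel_measurable_times_ennreal)
    also have "\<dots> \<le> ennreal (\<mu> / 2) * ennreal (q * G\<^sup>2) + ennreal (\<nu> / (4 * \<mu>)) * 4"
      by (intro add_right_mono mult_left_mono Phi_int) simp
    finally show "(\<integral>\<^sup>+ z. ennreal (\<mu> / 2) * \<Phi> z + ennreal (\<nu> / (4 * \<mu>)) * indicator Z z \<partial>lborel) \<le> ennreal (\<mu> / 2) * ennreal (q * G\<^sup>2) + ennreal (\<nu> / (4 * \<mu>)) * 4" .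
    have "(\<integral>\<^sup>+ z. ennreal (1 / (4 * \<mu> * \<nu>)) * (Box z * indicator Z z) \<partial>lborel) = ennreal (1 / (4 * \<mu> * \<nu>)) * (\<integral>\<^sup>+ z. Box z * indicator Z z \<partial>lborel)"
      using Boxm iZ by (intro nn_integral_cmult) (simp add: borel_measurable_times_ennreal)
    also have "\<dots> \<le> ennreal (1 / (4 * \<mu> * \<nu>)) * ennreal J" by (intro mult_left_mono Box_int) simp
    finally show "(\<integral>\<^sup>+ z. ennreal (1 / (4 * \<mu> * \<nu>)) * (Box z * indicator Z z) \<partial>lborel) \<le> ennreal (1 / (4 * \<mu> * \<nu>)) * ennreal J" .
  qed
  also have "\<dots> = ennreal (\<mu> / 2 * (q * G\<^sup>2) + \<nu> / \<mu> + J / (4 * \<mu> * \<nu>))"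
  proof -
    have "ennreal (\<nu> / (4 * \<mu>)) * 4 = ennreal (\<nu> / \<mu>)"
      using ennreal_mult[of "\<nu> / (4 * \<mu>)" 4] pos by (simp add: field_simps)
    moreover have "ennreal (\<mu> / 2) * ennreal (q * G\<^sup>2) = ennreal (\<mu> / 2 * (q * G\<^sup>2))"
      using pos q(2) by (intro ennreal_mult[symmetric]) simp_all
    moreover have "ennreal (1 / (4 * \<mu> * \<nu>)) * ennreal J = ennreal (J / (4 * \<mu> * \<nu>))"
      using pos J(2) by (simp add: ennreal_mult[symmetric])
    moreover have "0 \<le> \<mu> / 2 * (q * G\<^sup>2)" "0 \<le> \<nu> / \<mu>" "0 \<le> J / (4 * \<mu> * \<nu>)" using pos q(2) J(2) by simp_all
    ultimately show ?thesis by (simp only: ennreal_plus add_nonneg_nonneg)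
  qed
  also have "\<mu> / 2 * (q * G\<^sup>2) + \<nu> / \<mu> + J / (4 * \<mu> * \<nu>) = (q / 2 + 1) * G * root 4 J"
  proof -
    define w where "w = root 4 J"
    have w0: "w > 0" unfolding w_def using J(2) by simp
    have J4: "J = w ^ 4" unfolding w_def using J(2) by simp
    have "sqrt J = w\<^sup>2" unfolding J4 by (rule real_sqrt_unique) simp_all
    then have n: "\<nu> = w\<^sup>2 / 2" and m: "\<mu> = w / G" by (simp_all add: \<nu>_def \<mu>_def w_def)
    have 1: "\<mu> / 2 * (q * G\<^sup>2) = q / 2 * G * w" unfolding m using G by (simp add: power2_eq_square)
    have 2: "\<nu> / \<mu> = G * w / 2" unfolding n m using G w0 by (simp add: power2_eq_square)
    have "4 * \<mu> * \<nu> = 2 * w ^ 3 / G" unfolding n m by (simp add: eval_nat_numeral)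
    then have 3: "J / (4 * \<mu> * \<nu>) = G * w / 2" unfolding J4 using G w0 by (simp add: eval_nat_numeral)
    show ?thesis unfolding 1 2 3 w_def[symmetric] by (simp add: algebra_simps)
  qed
  finally show ?thesis unfolding L_def a_def q_def .
qed

section \<open>The change of variables\<close>

text \<open>Outer regularity encloses \<open>E\<close> in an open set of almost the same measure,
  and a covering of \<open>E\<close> by cubes with disjoint interiors inside the open set transfers
  the bound. This avoids a change of variables formula: only cubes have to be examined.\<close>

lemma emeasure_le_of_cubes:
  fixes M :: "'a::euclidean_space measure" and K L :: real
  assumes sets: "sets M = sets borel" and K0: "K \<ge> 0"
    and K: "\<And>u v d. d > 0 \<Longrightarrow> (\<And>i. i \<in> Basis \<Longrightarrow> v \<bullet> i - u \<bullet> i = d) \<Longrightarrow> emeasure M (cbox u v) \<le> ennreal K * emeasure lborel (cbox u v)"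
    and E: "E \<in> sets borel" "E \<subseteq> cbox (- (L *\<^sub>R One)) (L *\<^sub>R One)" "L > 0"
  shows "emeasure M E \<le> ennreal K * emeasure lborel E"
proof (rule ennreal_le_epsilon)
  fix e :: real assume e: "e > 0"
  define e' where "e' = e / (K + 1)"
  have e': "e' > 0" using e K0 by (simp add: e'_def)
  obtain T where T: "open T" "E \<subseteq> T" "emeasure lborel (T - E) < ennreal e'"
    using outer_regular_lborel[OF E(1) e'] by blast
  have "\<exists>r>0. ball x r \<subseteq> T" if "x \<in> E" for x using T that by (meson open_contains_ball subsetD)
  then obtain r where r: "\<And>x. x \<in> E \<Longrightarrow> r x > 0 \<and> ball x (r x) \<subseteq> T" by metis
  define g where "g = (\<lambda>x. if x \<in> E then ball x (r x) else ball x 1)"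
  have ga: "gauge g" using r by (simp add: gauge_def g_def)
  have ne: "box (- (L *\<^sub>R One)) (L *\<^sub>R One :: 'a) \<noteq> {}" using E(3) by (simp add: box_ne_empty)
  obtain D where D: "countable D" "\<And>X. X \<in> D \<Longrightarrow> interior X \<noteq> {} \<and> (\<exists>c d. X = cbox c d)"
    "pairwise (\<lambda>A B. interior A \<inter> interior B = {}) D" "\<And>X. X \<in> D \<Longrightarrow> \<exists>x \<in> E \<inter> X. X \<subseteq> g x"
    "\<And>u v. cbox u v \<in> D \<Longrightarrow> \<exists>n. \<forall>i \<in> Basis. v \<bullet> i - u \<bullet> i = ((L *\<^sub>R One) \<bullet> i - (- (L *\<^sub>R One)) \<bullet> i) / 2^n" "E \<subseteq> \<Union>D"
    using covering_lemma[OF E(2) ne ga] by metis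
  have DT: "X \<subseteq> T" if "X \<in> D" for X using D(4)[OF that] r by (auto simp: g_def)
  have cube: "emeasure M X \<le> ennreal K * emeasure lborel (interior X)" "X \<in> sets borel" if X: "X \<in> D" for X
  proof -
    obtain u v where uv: "X = cbox u v" using D(2)[OF X] by blast
    then obtain n where n: "\<And>i. i \<in> Basis \<Longrightarrow> v \<bullet> i - u \<bullet> i = 2 * L / 2 ^ n" using D(5)[of u v] X by fastforce
    have p: "2 * L / 2 ^ n > 0" using E(3) by simp
    have le: "u \<bullet> i \<le> v \<bullet> i" if "i \<in> Basis" for i using n[OF that] p by linarith
    have "emeasure lborel (interior X) = emeasure lborel (cbox u v)" unfolding uv interior_cbox using le by simp
    then show "emeasure M X \<le> ennreal K * emeasure lborel (interior X)" using K[OF p n] unfolding uv by simp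
    show "X \<in> sets borel" unfolding uv by simp
  qed
  define F where "F = (\<lambda>n. \<Union>{X \<in> D. to_nat_on D X = n})"
  define Y where "Y = (\<lambda>n. interior (F n))"
  have F_cases: "(F n \<in> D \<and> to_nat_on D (F n) = n) \<or> F n = {}" for n
  proof (cases "\<exists>X\<in>D. to_nat_on D X = n")
    case True
    then obtain X where X: "X \<in> D" "to_nat_on D X = n" by blast
    then have "{X \<in> D. to_nat_on D X = n} = {X}" using D(1) by (auto dest: to_nat_on_inj)
    then show ?thesis using X by (simp add: F_def)
  qed (auto simp: F_def)
  have UF: "(\<Union>n. F n) = \<Union>D" by (auto simp: F_def)
  have Fs: "F n \<in> sets borel" for n using F_cases[of n] cube(2) by auto
  have disj: "disjoint_family Y"
  unfolding disjoint_family_on_def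
  proof (intro ballI impI)
    fix m n :: nat assume mn: "m \<noteq> n"
    show "Y m \<inter> Y n = {}"
    proof (cases "F m = {} \<or> F n = {}")
      case False
      then have "F m \<in> D" "F n \<in> D" "F m \<noteq> F n" using F_cases[of m] F_cases[of n] mn by auto
      then show ?thesis using D(3) unfolding Y_def pairwise_def by blast
    qed (auto simp: Y_def)
  qed
  have YT: "(\<Union>n. Y n) \<subseteq> T"
  proof (rule UN_least)
    fix n show "Y n \<subseteq> T" using F_cases[of n] DT interior_subset[of "F n"] unfolding Y_def by blast
  qed
  have "emeasure M E \<le> emeasure M (\<Union>n. F n)" using D(6) Fs sets unfolding UF[symmetric] by (intro emeasure_mono) auto
  also have "\<dots> \<le> (\<Sum>n. emeasure M (F n))" using Fs sets by (intro emeasure_subadditive_countably) auto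
  also have "\<dots> \<le> (\<Sum>n. ennreal K * emeasure lborel (Y n))"
  proof (intro suminf_le summableI)
    fix n show "emeasure M (F n) \<le> ennreal K * emeasure lborel (Y n)"
      using F_cases[of n] cube(1) unfolding Y_def by auto
  qed
  also have "\<dots> = ennreal K * (\<Sum>n. emeasure lborel (Y n))" by (rule ennreal_suminf_cmult)
  also have "(\<Sum>n. emeasure lborel (Y n)) = emeasure lborel (\<Union>n. Y n)"
    using disj by (intro suminf_emeasure) (auto simp: Y_def)
  also have "\<dots> \<le> emeasure lborel T" using YT T(1) by (intro emeasure_mono) auto
  also have "\<dots> = emeasure lborel (E \<union> (T - E))" using T(2) by (simp add: Un_absorb1)
  also have "\<dots> \<le> emeasure lborel E + emeasure lborel (T - E)" using E(1) T(1) by (intro emeasure_subadditive) auto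
  also have "\<dots> \<le> emeasure lborel E + ennreal e'" using T(3) by (intro add_left_mono less_imp_le)
  finally have "emeasure M E \<le> ennreal K * (emeasure lborel E + ennreal e')" by (simp add: mult_left_mono)
  also have "\<dots> = ennreal K * emeasure lborel E + ennreal (K * e')" using K0 e' by (simp add: distrib_left ennreal_mult)
  also have "\<dots> \<le> ennreal K * emeasure lborel E + ennreal e"
  proof (intro add_left_mono ennreal_leI)
    show "K * e' \<le> e" unfolding e'_def using K0 e by (simp add: field_simps)
  qed
  finally show "emeasure M E \<le> ennreal K * emeasure lborel E + ennreal e" .
qed

text \<open>Cramer's rule: the determinant times an unknown is a combination of the two right-hand
  sides with coefficients of size at most 3, and dividing by the determinant costs a factor
  \<open>A\<close>.\<close>

lemma linear_solve_bound:
  fixes a b c e :: real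
  assumes det: "inverse A \<le> \<bar>a * e - b * c\<bar>" and A: "A \<ge> 1" and coef: "\<bar>a\<bar> \<le> 3" "\<bar>b\<bar> \<le> 3" "\<bar>c\<bar> \<le> 3" "\<bar>e\<bar> \<le> 3"
    and p: "\<bar>a * w1 + b * w2\<bar> \<le> p" and q: "\<bar>c * w1 + e * w2\<bar> \<le> q"
  shows "\<bar>w1\<bar> \<le> 3 * A * (p + q)" "\<bar>w2\<bar> \<le> 3 * A * (p + q)"
proof -
  have gen: "\<bar>w\<bar> \<le> 3 * A * (p + q)" if e1: "(a * e - b * c) * w = x * X - y * Y" and bd: "\<bar>x\<bar> \<le> 3" "\<bar>y\<bar> \<le> 3" "\<bar>X\<bar> + \<bar>Y\<bar> \<le> p + q" for w x y X Y
  proof -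
    have "inverse A * \<bar>w\<bar> \<le> \<bar>a * e - b * c\<bar> * \<bar>w\<bar>" using det by (rule mult_right_mono) simp
    also have "\<dots> = \<bar>x * X - y * Y\<bar>" using e1 by (simp add: abs_mult[symmetric])
    also have "\<dots> \<le> \<bar>x * X\<bar> + \<bar>y * Y\<bar>" by (rule abs_triangle_ineq4)
    also have "\<dots> \<le> 3 * \<bar>X\<bar> + 3 * \<bar>Y\<bar>" unfolding abs_mult using bd by (intro add_mono mult_right_mono) auto
    also have "\<dots> = 3 * (\<bar>X\<bar> + \<bar>Y\<bar>)" by (rule distrib_left[symmetric])
    also have "\<dots> \<le> 3 * (p + q)" using bd(3) by (rule mult_left_mono) (rule zero_le_numeral)
    finally have "A * (inverse A * \<bar>w\<bar>) \<le> A * (3 * (p + q))" using A by (intro mult_left_mono) auto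
    moreover have "A * (inverse A * \<bar>w\<bar>) = \<bar>w\<bar>" using A by simp
    moreover have "A * (3 * (p + q)) = 3 * A * (p + q)" by (simp only: mult_ac)
    ultimately show ?thesis by (simp only:)
  qed
  show "\<bar>w1\<bar> \<le> 3 * A * (p + q)"
    by (rule gen[of _ e "a * w1 + b * w2" b "c * w1 + e * w2"], simp only: left_diff_distrib right_diff_distrib distrib_left, simp add: mult_ac) (use coef add_mono[OF p q] in simp_all)
  show "\<bar>w2\<bar> \<le> 3 * A * (p + q)"
    by (rule gen[of _ a "c * w1 + e * w2" c "a * w1 + b * w2"], simp only: left_diff_distrib right_diff_distrib distrib_left, simp add: mult_ac) (use coef add_mono[OF p q] in \<open>simp_all add: add.commute\<close>)
qed

definition phi :: "real \<Rightarrow> vec \<Rightarrow> vec" where "phi \<rho> t = P t - Bd \<rho> t"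

definition jacobian :: "real \<Rightarrow> vec \<Rightarrow> real" where
  "jacobian \<rho> t = (2 * fst t - \<rho>) * (3 * snd t ^ 2 - \<rho> * \<rho>) - (2 * snd t) * (3 * fst t ^ 2)"

text \<open>Taylor expansion at \<open>t\<close> is exact because \<open>phi\<close> is polynomial;
  with M the larger coordinate difference, the remainders are at most 2M^2 and 6M^2. Solving the
  linear part gives M \<le> 6Ad + 24AM^2. The restriction \<open>60 * A * m \<le> 1\<close> makes
  the quadratic term at most (2/5)M, which is absorbed on the left.\<close>

lemma phi_separation:
  fixes t t' :: vec
  assumes rho: "0 \<le> \<rho>" "\<rho> \<le> 1" and A: "A \<ge> 1"
    and t: "t \<in> unit_square" "t' \<in> unit_square" and J: "inverse A \<le> \<bar>jacobian \<rho> t\<bar>"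
    and m: "\<bar>fst t' - fst t\<bar> \<le> m" "\<bar>snd t' - snd t\<bar> \<le> m" "60 * A * m \<le> 1"
    and d: "\<bar>fst (phi \<rho> t') - fst (phi \<rho> t)\<bar> \<le> d" "\<bar>snd (phi \<rho> t') - snd (phi \<rho> t)\<bar> \<le> d"
  shows "\<bar>fst t' - fst t\<bar> \<le> 12 * A * d \<and> \<bar>snd t' - snd t\<bar> \<le> 12 * A * d"
proof -
  define a b w1 w2 where "a = fst t" and "b = snd t" and "w1 = fst t' - fst t" and "w2 = snd t' - snd t"
  define M where "M = max \<bar>w1\<bar> \<bar>w2\<bar>"
  have ab: "0 \<le> a" "a \<le> 1" "0 \<le> b" "b \<le> 1" and ab': "0 \<le> a + w1" "a + w1 \<le> 1" "0 \<le> b + w2" "b + w2 \<le> 1"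
    using t unfolding a_def b_def w1_def w2_def mem_Times_iff by simp_all
  have w: "\<bar>w1\<bar> \<le> M" "\<bar>w2\<bar> \<le> M" "0 \<le> M" "M \<le> m" "M \<le> 1" using m(1,2) ab ab' by (auto simp: M_def w1_def w2_def)
  have Mm: "60 * A * M \<le> 1" using order_trans[OF mult_left_mono[OF w(4)] m(3)] A by simp
  have sq: "w1\<^sup>2 \<le> M\<^sup>2" "w2\<^sup>2 \<le> M\<^sup>2" using power_mono[OF w(1) abs_ge_zero, of 2] power_mono[OF w(2) abs_ge_zero, of 2] by simp_all
  have e1: "fst (phi \<rho> t') - fst (phi \<rho> t) = ((2 * a - \<rho>) * w1 + 2 * b * w2) + (w1\<^sup>2 + w2\<^sup>2)"
    unfolding phi_def P_def Bd_def a_def b_def w1_def w2_def by (simp add: algebra_simps power2_eq_square)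
  have e2: "snd (phi \<rho> t') - snd (phi \<rho> t) = (3 * a\<^sup>2 * w1 + (3 * b\<^sup>2 - \<rho> * \<rho>) * w2) + ((3 * a + w1) * w1\<^sup>2 + (3 * b + w2) * w2\<^sup>2)"
    unfolding phi_def P_def Bd_def a_def b_def w1_def w2_def by (simp add: algebra_simps power2_eq_square power3_eq_cube)
  have p: "\<bar>(2 * a - \<rho>) * w1 + 2 * b * w2\<bar> \<le> d + 2 * M\<^sup>2" using d(1) sq zero_le_power2[of w1] zero_le_power2[of w2] unfolding e1 by linarith
  have z: "0 \<le> (3 * a + w1) * w1\<^sup>2 \<and> (3 * a + w1) * w1\<^sup>2 \<le> 3 * M\<^sup>2" if "0 \<le> a" "a \<le> 1" "0 \<le> a + w1" "a + w1 \<le> 1" "w1\<^sup>2 \<le> M\<^sup>2" for a w1 :: real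
  proof
    show "0 \<le> (3 * a + w1) * w1\<^sup>2" using that by (intro mult_nonneg_nonneg) auto
    show "(3 * a + w1) * w1\<^sup>2 \<le> 3 * M\<^sup>2" using that by (intro mult_mono) auto
  qed
  have q: "\<bar>3 * a\<^sup>2 * w1 + (3 * b\<^sup>2 - \<rho> * \<rho>) * w2\<bar> \<le> d + 6 * M\<^sup>2"
    using d(2) z[OF ab(1,2) ab'(1,2) sq(1)] z[OF ab(3,4) ab'(3,4) sq(2)] unfolding e2 by linarith
  have s: "0 \<le> a\<^sup>2" "a\<^sup>2 \<le> 1" "0 \<le> b\<^sup>2" "b\<^sup>2 \<le> 1" "0 \<le> \<rho> * \<rho>" "\<rho> * \<rho> \<le> 1" using ab rho by (auto intro: power_le_one mult_le_one)
  have c: "\<bar>2 * a - \<rho>\<bar> \<le> 3" "\<bar>2 * b\<bar> \<le> 3" "\<bar>3 * a\<^sup>2\<bar> \<le> 3" "\<bar>3 * b\<^sup>2 - \<rho> * \<rho>\<bar> \<le> 3" using ab rho s by linarith+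
  have det: "inverse A \<le> \<bar>(2 * a - \<rho>) * (3 * b\<^sup>2 - \<rho> * \<rho>) - 2 * b * (3 * a\<^sup>2)\<bar>" using J by (simp add: jacobian_def a_def b_def)
  have "M \<le> 3 * A * ((d + 2 * M\<^sup>2) + (d + 6 * M\<^sup>2))"
    by (subst (1) M_def, rule max.boundedI) (rule linear_solve_bound[OF det A c p q])+
  also have "\<dots> = 6 * A * d + 24 * A * M * M" by (simp add: power2_eq_square algebra_simps)
  finally have 1: "M \<le> 6 * (A * d) + 24 * (A * M * M)" by (simp only: mult.assoc)
  have 2: "60 * (A * M * M) \<le> M" using mult_right_mono[OF Mm w(3)] by (simp only: mult.assoc mult_1)
  have gen: "M \<le> 12 * y" if "M \<le> 6 * y + 24 * x" "60 * x \<le> M" "0 \<le> M" for x y :: real using that by linarith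
  have "M \<le> 12 * A * d" using gen[OF 1 2 w(3)] by (simp only: mult.assoc)
  then have "\<bar>w1\<bar> \<le> 12 * A * d" "\<bar>w2\<bar> \<le> 12 * A * d" using w(1,2) by (blast intro: order_trans)+
  then show ?thesis unfolding w1_def w2_def by (rule conjI)
qed

text \<open>On a square of side \<open>m \<le> 1 / (60 A)\<close> the map \<open>phi\<close> is injective on \<open>S\<close>, with an inverse of
  Lipschitz constant \<open>12 A\<close> in the maximum norm.\<close>

lemma phi_fibre_cell:
  fixes u p q :: vec
  assumes rho: "0 \<le> \<rho>" "\<rho> \<le> 1" and A: "A \<ge> 1" and m: "60 * A * m \<le> 1" and d: "d > 0" and pq: "\<And>i. i \<in> Basis \<Longrightarrow> q \<bullet> i - p \<bullet> i = d"
    and S: "S \<in> sets borel" "\<And>t. t \<in> S \<Longrightarrow> t \<in> unit_square \<and> inverse A \<le> \<bar>jacobian \<rho> t\<bar>"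
  shows "emeasure lborel {t \<in> S. u + phi \<rho> t \<in> cbox p q \<and> a \<le> fst t \<and> fst t \<le> a + m \<and> b \<le> snd t \<and> snd t \<le> b + m}
    \<le> ennreal (576 * A\<^sup>2) * emeasure lborel (cbox p q)"
proof (cases "{t \<in> S. u + phi \<rho> t \<in> cbox p q \<and> a \<le> fst t \<and> fst t \<le> a + m \<and> b \<le> snd t \<and> snd t \<le> b + m} = {}")
  case False
  define X where "X = {t \<in> S. u + phi \<rho> t \<in> cbox p q \<and> a \<le> fst t \<and> fst t \<le> a + m \<and> b \<le> snd t \<and> snd t \<le> b + m}"
  \<comment> \<open>Relative to one point of the fibre all others lie within
    \<open>12 * A * d\<close> in each coordinate, that is, in a square of side 24Ad. This is the
    origin of 576 = 24^2.\<close>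
  obtain t where t: "t \<in> X" using False unfolding X_def[symmetric] by blast
  have pq': "fst q - fst p = d" "snd q - snd p = d" using pq[of "(1, 0)"] pq[of "(0, 1)"] by (auto simp: Basis_prod_def inner_prod_def)
  have cb: "x \<in> cbox p q \<longleftrightarrow> fst p \<le> fst x \<and> fst x \<le> fst q \<and> snd p \<le> snd x \<and> snd x \<le> snd q" for x
    using cbox_Pair_iff[of "fst x" "snd x" "fst p" "snd p" "fst q" "snd q"] by simp
  have "X \<subseteq> {fst t - 12 * A * d .. fst t + 12 * A * d} \<times> {snd t - 12 * A * d .. snd t + 12 * A * d}"
  proof
    fix t' assume t': "t' \<in> X"
    have ph: "\<bar>fst (phi \<rho> t') - fst (phi \<rho> t)\<bar> \<le> d" "\<bar>snd (phi \<rho> t') - snd (phi \<rho> t)\<bar> \<le> d"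
      using t t' pq' unfolding X_def cb by auto
    have di: "\<bar>fst t' - fst t\<bar> \<le> m" "\<bar>snd t' - snd t\<bar> \<le> m" using t t' unfolding X_def by auto
    have S': "t \<in> S" "t' \<in> S" using t t' unfolding X_def by auto
    have "\<bar>fst t' - fst t\<bar> \<le> 12 * A * d \<and> \<bar>snd t' - snd t\<bar> \<le> 12 * A * d"
      using S(2)[OF S'(1)] S(2)[OF S'(2)] by (intro phi_separation[OF rho A _ _ _ di m ph]) auto
    then show "t' \<in> {fst t - 12 * A * d .. fst t + 12 * A * d} \<times> {snd t - 12 * A * d .. snd t + 12 * A * d}"
      by (auto simp: mem_Times_iff)
  qed
  then have "emeasure lborel X \<le> emeasure lborel ({fst t - 12 * A * d .. fst t + 12 * A * d} \<times> {snd t - 12 * A * d .. snd t + 12 * A * d})"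
    by (rule emeasure_mono) (use vec_box_sets in simp)
  also have "\<dots> = ennreal ((24 * A * d) * (24 * A * d))"
    using A d by (subst emeasure_vec_box) (simp_all add: algebra_simps)
  also have "(24 * A * d) * (24 * A * d) = (576 * A\<^sup>2) * (d * d)" by (simp add: power2_eq_square)
  also have "ennreal \<dots> = ennreal (576 * A\<^sup>2) * ennreal (d * d)" using d by (simp add: ennreal_mult)
  also have "ennreal (d * d) = emeasure lborel (cbox p q)"
  proof -
    have "cbox p q = {fst p..fst q} \<times> {snd p..snd q}" by (auto simp: cb mem_Times_iff)
    then show ?thesis using emeasure_vec_box[of "fst p" "fst q" "snd p" "snd q"] pq' d by simp
  qed
  finally show ?thesis unfolding X_def .
next
  case True
  show ?thesis unfolding True by simp
qed

text \<open>The image under \<open>phi\<close> of Lebesgue measure on \<open>S\<close> is compared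
  with Lebesgue measure on cubes, and \<open>emeasure_le_of_cubes\<close> extends the comparison to
  Borel sets. As \<open>phi\<close> is injective only locally, the unit square is cut into cells,
  and the number of cells bounds the number of preimages. About (61A)^2 cells with 576A^2 each give
  the power A^4.\<close>

lemma phi_pushforward:
  fixes u :: vec and e :: "vec \<Rightarrow> ennreal"
  assumes rho: "0 \<le> \<rho>" "\<rho> \<le> 1" and A: "A \<ge> 1"
    and S: "S \<in> sets borel" "\<And>t. t \<in> S \<Longrightarrow> t \<in> unit_square \<and> inverse A \<le> \<bar>jacobian \<rho> t\<bar>"
    and e: "e \<in> borel_measurable borel"
  shows "(\<integral>\<^sup>+ t. e (u + phi \<rho> t) * indicator S t \<partial>lborel) \<le> ennreal (576 * 61\<^sup>2 * A ^ 4) * (\<integral>\<^sup>+ x. e x \<partial>lborel)"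
proof -
  define g where "g = (\<lambda>t. u + phi \<rho> t)"
  have gm: "g \<in> borel_measurable borel"
    unfolding g_def phi_def P_def Bd_def by (intro borel_measurable_continuous_onI continuous_intros)
  define n where "n = nat \<lceil>60 * A\<rceil>"
  have n: "60 * A \<le> real n" "real n \<le> 61 * A" "n > 0" using A by (auto simp: n_def) linarith+
  define m where "m = 1 / real n"
  have m: "60 * A * m \<le> 1" "m > 0" using n by (simp_all add: m_def)
  define M where "M = distr (density lborel (indicator S)) borel g"
  have M_em: "emeasure M E = emeasure lborel {t \<in> S. g t \<in> E}" if E: "E \<in> sets borel" for E
  proof -
    have v: "g -` E \<in> sets borel" using measurable_sets[OF gm E] by simp
    have "emeasure M E = emeasure (density lborel (indicator S)) (g -` E)"
      unfolding M_def using gm E by (subst emeasure_distr) simp_all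
    also have "\<dots> = (\<integral>\<^sup>+ t. indicator S t * indicator (g -` E) t \<partial>lborel)"
      using S(1) v by (subst emeasure_density) simp_all
    also have "\<dots> = (\<integral>\<^sup>+ t. indicator (S \<inter> g -` E) t \<partial>lborel)"
      by (rule nn_integral_cong) (simp add: indicator_def)
    also have "\<dots> = emeasure lborel (S \<inter> g -` E)" using S(1) v by simp
    also have "S \<inter> g -` E = {t \<in> S. g t \<in> E}" by auto
    finally show ?thesis .
  qed
  have cube: "emeasure M (cbox p q) \<le> ennreal (576 * 61\<^sup>2 * A ^ 4) * emeasure lborel (cbox p q)"
    if d: "d > 0" and pq: "\<And>i. i \<in> Basis \<Longrightarrow> q \<bullet> i - p \<bullet> i = d" for p q d
  proof -
    define C where "C = (\<lambda>k::nat \<times> nat. {t \<in> S. u + phi \<rho> t \<in> cbox p q \<and> real (fst k) * m \<le> fst t \<and> fst t \<le> real (fst k) * m + m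
      \<and> real (snd k) * m \<le> snd t \<and> snd t \<le> real (snd k) * m + m})"
    have Cs: "C k \<in> sets borel" for k
    proof -
      have "C k = S \<inter> g -` cbox p q \<inter> ({real (fst k) * m .. real (fst k) * m + m} \<times> {real (snd k) * m .. real (snd k) * m + m})"
        by (auto simp: C_def g_def mem_Times_iff)
      moreover have "g -` cbox p q \<in> sets borel" using measurable_sets[OF gm, of "cbox p q"] by simp
      ultimately show ?thesis using S(1) vec_box_sets by (metis sets.Int)
    qed
    have cell: "\<exists>k<n. real k * m \<le> x \<and> x \<le> real k * m + m" if x: "0 \<le> x" "x \<le> 1" for x
    proof (cases "x = 1")
      case True
      then show ?thesis using n(3) by (intro exI[of _ "n - 1"]) (auto simp: m_def field_simps of_nat_diff)
    next
      case False
      define k where "k = nat \<lfloor>x * real n\<rfloor>"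
      have k: "real k \<le> x * real n" "x * real n < real k + 1" using x by (auto simp: k_def)
      have "x * real n < 1 * real n" using x False n(3) by (intro mult_strict_right_mono) auto
      then have "k < n" using k by linarith
      moreover have "real k * m \<le> x" "x \<le> real k * m + m" using k n(3) by (simp_all add: m_def field_simps)
      ultimately show ?thesis by blast
    qed
    have "{t \<in> S. g t \<in> cbox p q} \<subseteq> (\<Union>k\<in>{..<n} \<times> {..<n}. C k)"
    proof
      fix t assume t: "t \<in> {t \<in> S. g t \<in> cbox p q}"
      then have "0 \<le> fst t" "fst t \<le> 1" "0 \<le> snd t" "snd t \<le> 1" using S(2)[of t] by (auto simp: mem_Times_iff)
      then obtain k l where "k < n" "l < n" "real k * m \<le> fst t" "fst t \<le> real k * m + m" "real l * m \<le> snd t" "snd t \<le> real l * m + m"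
        using cell[of "fst t"] cell[of "snd t"] by blast
      then have "t \<in> C (k, l)" "(k, l) \<in> {..<n} \<times> {..<n}" using t by (auto simp: C_def g_def)
      then show "t \<in> (\<Union>k\<in>{..<n} \<times> {..<n}. C k)" by blast
    qed
    then have "emeasure lborel {t \<in> S. g t \<in> cbox p q} \<le> emeasure lborel (\<Union>k\<in>{..<n} \<times> {..<n}. C k)"
      by (rule emeasure_mono) (use Cs in auto)
    also have "\<dots> \<le> (\<Sum>k\<in>{..<n} \<times> {..<n}. emeasure lborel (C k))"
      using Cs by (intro emeasure_subadditive_finite) auto
    also have "\<dots> \<le> (\<Sum>k\<in>{..<n} \<times> {..<n}. ennreal (576 * A\<^sup>2) * emeasure lborel (cbox p q))"
      unfolding C_def by (intro sum_mono phi_fibre_cell[OF rho A m(1) d pq S])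
    also have "\<dots> = ennreal (real n * real n) * (ennreal (576 * A\<^sup>2) * emeasure lborel (cbox p q))"
      by (simp add: ennreal_of_nat_eq_real_of_nat[symmetric] ennreal_mult)
    also have "\<dots> = ennreal (real n * real n * (576 * A\<^sup>2)) * emeasure lborel (cbox p q)"
      by (simp add: ennreal_mult mult.assoc)
    also have "\<dots> \<le> ennreal (576 * 61\<^sup>2 * A ^ 4) * emeasure lborel (cbox p q)"
    proof (intro mult_right_mono ennreal_leI)
      have "real n * real n * (576 * A\<^sup>2) \<le> (61 * A) * (61 * A) * (576 * A\<^sup>2)"
        using n(2) A by (intro mult_mono) auto
      also have "\<dots> = 576 * 61\<^sup>2 * A ^ 4" by (simp add: eval_nat_numeral)
      finally show "real n * real n * (576 * A\<^sup>2) \<le> 576 * 61\<^sup>2 * A ^ 4" .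
    qed simp
    finally show ?thesis using M_em[of "cbox p q"] by simp
  qed
  define K where "K = 576 * 61\<^sup>2 * A ^ 4"
  have K0: "K \<ge> 0" using A by (simp add: K_def)
  have sM: "sets M = sets borel" by (simp add: M_def)
  \<comment> \<open>On the unit square the coordinates of \<open>P\<close> are at most 2 and those
    of the dilation at most 1, so the image lies in this box.\<close>
  define L where "L = 3 + \<bar>fst u\<bar> + \<bar>snd u\<bar>"
  define B where "B = cbox (- (L *\<^sub>R One)) (L *\<^sub>R One :: vec)"
  have gB: "g t \<in> B" if "t \<in> S" for t
  proof -
    have t: "0 \<le> fst t" "fst t \<le> 1" "0 \<le> snd t" "snd t \<le> 1" using S(2)[OF that] by (auto simp: mem_Times_iff)
    have pw: "0 \<le> x ^ k" "x ^ k \<le> 1" if "0 \<le> x" "x \<le> 1" for x :: real and k using that by (auto intro: power_le_one)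
    have b1: "0 \<le> \<rho> * fst t" "0 \<le> \<rho> * \<rho> * snd t" using rho t by simp_all
    have b2: "\<rho> * fst t \<le> 1 * 1" "\<rho> * \<rho> * snd t \<le> 1 * 1 * 1" using mult_mono[OF rho(2) t(2)] mult_mono[OF mult_mono[OF rho(2) rho(2)] t(4)] rho t by simp_all
    then have "\<bar>fst (g t)\<bar> \<le> L" "\<bar>snd (g t)\<bar> \<le> L"
      using b1 pw[OF t(1,2), of 2] pw[OF t(1,2), of 3] pw[OF t(3,4), of 2] pw[OF t(3,4), of 3]
      unfolding g_def phi_def P_def Bd_def L_def fst_add snd_add fst_diff snd_diff fst_conv snd_conv by linarith+
    moreover have "L *\<^sub>R One = (L, L)"
    proof -
      have c: "fst x = x \<bullet> (1, 0)" "snd x = x \<bullet> (0, 1)" for x :: vec by (simp_all add: inner_prod_def)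
      have o: "(One :: vec) \<bullet> b = 1" if "b \<in> Basis" for b using that by (rule inner_sum_Basis)
      have bas: "(1, 0) \<in> (Basis :: vec set)" "(0, 1) \<in> (Basis :: vec set)" by (simp_all add: Basis_prod_def)
      have "fst (One :: vec) = 1" "snd (One :: vec) = 1" unfolding c by (rule o[OF bas(1)], rule o[OF bas(2)])
      then show ?thesis by (simp only: prod_eq_iff fst_scaleR snd_scaleR fst_conv snd_conv real_scaleR_def mult_1_right simp_thms)
    qed
    ultimately show ?thesis
      unfolding B_def using cbox_Pair_iff[of "fst (g t)" "snd (g t)" "- L" "- L" L L] by (auto simp: abs_le_iff)
  qed
  have le: "M \<le> scale_measure (ennreal K) lborel"
  proof (subst le_measure)
    show "sets M = sets (scale_measure (ennreal K) lborel)" using sM by simp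
    show "\<forall>E\<in>sets M. emeasure M E \<le> emeasure (scale_measure (ennreal K) lborel) E"
    proof
      fix E assume "E \<in> sets M"
      then have E: "E \<in> sets borel" using sM by simp
      have EB: "E \<inter> B \<in> sets borel" using E by (simp add: B_def)
      have "{t \<in> S. g t \<in> E} = {t \<in> S. g t \<in> E \<inter> B}" using gB by auto
      then have "emeasure M E = emeasure M (E \<inter> B)" unfolding M_em[OF E] M_em[OF EB] by simp
      also have "\<dots> \<le> ennreal K * emeasure lborel (E \<inter> B)"
        by (rule emeasure_le_of_cubes[OF sM K0 cube[folded K_def] EB, of _ L]) (auto simp: B_def L_def)
      also have "\<dots> \<le> ennreal K * emeasure lborel E" using E by (intro mult_left_mono emeasure_mono) auto
      finally show "emeasure M E \<le> emeasure (scale_measure (ennreal K) lborel) E" by simp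
    qed
  qed
  have "(\<integral>\<^sup>+ t. e (u + phi \<rho> t) * indicator S t \<partial>lborel) = (\<integral>\<^sup>+ x. e x \<partial>M)"
    unfolding M_def g_def[symmetric]
    using gm e S(1) by (subst nn_integral_distr, simp, simp, subst nn_integral_density) (simp_all add: g_def mult.commute measurable_compose[OF gm e, unfolded g_def])
  also have "\<dots> \<le> (\<integral>\<^sup>+ x. e x \<partial>scale_measure (ennreal K) lborel)"
    by (rule nn_integral_mono_measure[OF _ le]) (simp add: sM)
  also have "\<dots> = ennreal K * (\<integral>\<^sup>+ x. e x \<partial>lborel)" using e by (intro nn_integral_scale_measure) simp
  finally show ?thesis unfolding K_def .
qed

text \<open>The substitution u = x + B t frees the argument of \<open>f\<close> from t and turns
  that of \<open>g\<close> into u + \<phi>(t). The integral over t is then at most \<open>B\<close>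
  uniformly in u, and u ranges over a square of area 4, where Cauchy--Schwarz bounds the integral of
  |f| by 2G.\<close>

lemma bilinear_L1_bound:
  fixes f r :: "vec \<Rightarrow> complex" and g :: "vec \<Rightarrow> ennreal"
  assumes rho: "0 \<le> \<rho>" "\<rho> \<le> 1"
    and f: "f \<in> borel_measurable borel" "(\<integral>\<^sup>+ x. ennreal ((cmod (f x))\<^sup>2) \<partial>lborel) \<le> ennreal (G\<^sup>2)" "G \<ge> 0"
    and g: "g \<in> borel_measurable borel" and S: "S \<in> sets borel" "S \<subseteq> unit_square"
    and r: "r \<in> borel_measurable borel" "\<And>t. cmod (r t) \<le> c" "\<And>t. t \<notin> S \<Longrightarrow> r t = 0"
    and B: "\<And>u. (\<integral>\<^sup>+ t. g (u + phi \<rho> t) * indicator S t \<partial>lborel) \<le> B"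
  shows "(\<integral>\<^sup>+ x. (\<integral>\<^sup>+ t. ennreal (cmod (f (x + Bd \<rho> t))) * g (x + P t) * ennreal (cmod (r t)) \<partial>lborel) * indicator unit_square x \<partial>lborel)
    \<le> ennreal (2 * c * G) * B"
proof -
  define V :: "vec set" where "V = {0..2} \<times> {0..2}"
  have V4: "emeasure lborel V = 4" unfolding V_def using emeasure_vec_box[of 0 2 0 2] by simp
  have Us: "unit_square \<in> sets borel" and Vs: "V \<in> sets borel" unfolding V_def by (rule vec_box_sets)+
  have iU: "(indicator unit_square :: vec \<Rightarrow> ennreal) \<in> borel_measurable borel" using Us by (rule borel_measurable_indicator)
  have iV: "(indicator V :: vec \<Rightarrow> ennreal) \<in> borel_measurable borel" using Vs by (rule borel_measurable_indicator)
  have iS: "(indicator S :: vec \<Rightarrow> ennreal) \<in> borel_measurable borel" using S(1) by (rule borel_measurable_indicator)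
  have c0: "c \<ge> 0" using order_trans[OF norm_ge_zero r(2)] .
  have fm: "(\<lambda>x. ennreal (cmod (f x))) \<in> borel_measurable borel" using f(1) by simp
  have rm: "(\<lambda>x. ennreal (cmod (r x))) \<in> borel_measurable borel" using r(1) by simp
  have co: "(\<lambda>p::vec \<times> vec. fst p + Bd \<rho> (snd p)) \<in> borel_measurable borel" "(\<lambda>p::vec \<times> vec. fst p + P (snd p)) \<in> borel_measurable borel"
    "(\<lambda>p::vec \<times> vec. fst p) \<in> borel_measurable borel" "(\<lambda>p::vec \<times> vec. snd p) \<in> borel_measurable borel"
    "(\<lambda>p::vec \<times> vec. fst p + phi \<rho> (snd p)) \<in> borel_measurable borel"
    unfolding phi_def P_def Bd_def by (intro borel_measurable_continuous_onI continuous_intros)+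
  have co1: "(\<lambda>t. x + Bd \<rho> t) \<in> borel_measurable borel" "(\<lambda>t. x + P t) \<in> borel_measurable borel" "(\<lambda>t. x + phi \<rho> t) \<in> borel_measurable borel" for x
    unfolding phi_def P_def Bd_def by (intro borel_measurable_continuous_onI continuous_intros)+
  have co2: "(\<lambda>x::vec. x + y) \<in> borel_measurable borel" for y
    by (intro borel_measurable_continuous_onI continuous_intros)
  define h where "h = (\<lambda>x t. ennreal (cmod (f (x + Bd \<rho> t))) * g (x + P t) * indicator unit_square x)"
  define k where "k = (\<lambda>u t. ennreal (cmod (f u)) * indicator V u * (g (u + phi \<rho> t) * indicator S t))"
  have hm: "(\<lambda>p. h (fst p) (snd p) * ennreal (cmod (r (snd p)))) \<in> borel_measurable borel"
    unfolding h_def by (intro borel_measurable_times_ennreal measurable_compose[OF co(1) fm] measurable_compose[OF co(2) g] measurable_compose[OF co(3) iU] measurable_compose[OF co(4) rm])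
  have km: "(\<lambda>p. k (fst p) (snd p)) \<in> borel_measurable borel"
    unfolding k_def by (intro borel_measurable_times_ennreal measurable_compose[OF co(3) fm] measurable_compose[OF co(3) iV] measurable_compose[OF co(5) g] measurable_compose[OF co(4) iS])
  have hm1: "(\<lambda>x. h x t) \<in> borel_measurable borel" for t
    unfolding h_def by (intro borel_measurable_times_ennreal measurable_compose[OF co2 fm] measurable_compose[OF co2 g] iU)
  have "(\<integral>\<^sup>+ x. (\<integral>\<^sup>+ t. ennreal (cmod (f (x + Bd \<rho> t))) * g (x + P t) * ennreal (cmod (r t)) \<partial>lborel) * indicator unit_square x \<partial>lborel)
    = (\<integral>\<^sup>+ x. \<integral>\<^sup>+ t. h x t * ennreal (cmod (r t)) \<partial>lborel \<partial>lborel)"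
  proof (rule nn_integral_cong)
    fix x
    have "(\<lambda>t. ennreal (cmod (f (x + Bd \<rho> t))) * g (x + P t) * ennreal (cmod (r t))) \<in> borel_measurable lborel"
      unfolding measurable_lborel2
      by (intro borel_measurable_times_ennreal measurable_compose[OF co1(1) fm] measurable_compose[OF co1(2) g] rm)
    then show "(\<integral>\<^sup>+ t. ennreal (cmod (f (x + Bd \<rho> t))) * g (x + P t) * ennreal (cmod (r t)) \<partial>lborel) * indicator unit_square x
      = (\<integral>\<^sup>+ t. h x t * ennreal (cmod (r t)) \<partial>lborel)"
      unfolding h_def by (subst nn_integral_multc[symmetric]) (simp_all add: mult_ac)
  qed
  also have "\<dots> = (\<integral>\<^sup>+ t. \<integral>\<^sup>+ x. h x t * ennreal (cmod (r t)) \<partial>lborel \<partial>lborel)"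
    using lborel_pair.Fubini'[of "\<lambda>x t. h x t * ennreal (cmod (r t))"] hm
    by (simp add: lborel_prod case_prod_unfold)
  also have "\<dots> \<le> (\<integral>\<^sup>+ t. \<integral>\<^sup>+ u. ennreal c * k u t \<partial>lborel \<partial>lborel)"
  proof (rule nn_integral_mono)
    fix t :: vec
    show "(\<integral>\<^sup>+ x. h x t * ennreal (cmod (r t)) \<partial>lborel) \<le> (\<integral>\<^sup>+ u. ennreal c * k u t \<partial>lborel)"
    proof (cases "t \<in> S")
      case False
      then show ?thesis using r(3) by simp
    next
      case True
      then have t: "0 \<le> fst t" "fst t \<le> 1" "0 \<le> snd t" "snd t \<le> 1" using S(2) by (auto simp: mem_Times_iff)
      have b1: "0 \<le> \<rho> * fst t" "0 \<le> \<rho> * \<rho> * snd t" using rho t by simp_all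
      have b2: "\<rho> * fst t \<le> 1 * 1" "\<rho> * \<rho> * snd t \<le> 1 * 1 * 1" using mult_mono[OF rho(2) t(2)] mult_mono[OF mult_mono[OF rho(2) rho(2)] t(4)] rho t by simp_all
      note b = b1 b2
      have "(\<integral>\<^sup>+ x. h x t * ennreal (cmod (r t)) \<partial>lborel) = (\<integral>\<^sup>+ u. h (- Bd \<rho> t + u) t * ennreal (cmod (r t)) \<partial>lborel)"
        by (rule nn_integral_lborel_shift[symmetric]) (intro borel_measurable_times_ennreal hm1 measurable_const, simp)
      also have "\<dots> \<le> (\<integral>\<^sup>+ u. ennreal c * k u t \<partial>lborel)"
      proof (rule nn_integral_mono)
        fix u :: vec
        have e: "- Bd \<rho> t + u + Bd \<rho> t = u" "- Bd \<rho> t + u + P t = u + phi \<rho> t" by (simp_all add: phi_def)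
        have i: "- Bd \<rho> t + u \<in> unit_square \<Longrightarrow> u \<in> V" using b by (auto simp: V_def Bd_def mem_Times_iff)
        have "h (- Bd \<rho> t + u) t \<le> k u t" unfolding h_def k_def e using True i
          by (cases "- Bd \<rho> t + u \<in> unit_square") simp_all
        then have "h (- Bd \<rho> t + u) t * ennreal (cmod (r t)) \<le> k u t * ennreal c"
          by (intro mult_mono ennreal_leI r(2)) simp_all
        then show "h (- Bd \<rho> t + u) t * ennreal (cmod (r t)) \<le> ennreal c * k u t" by (simp only: mult.commute)
      qed
      finally show ?thesis .
    qed
  qed
  also have "\<dots> = (\<integral>\<^sup>+ u. \<integral>\<^sup>+ t. ennreal c * k u t \<partial>lborel \<partial>lborel)"
    using lborel_pair.Fubini'[of "\<lambda>u t. ennreal c * k u t"] borel_measurable_times_ennreal[OF measurable_const km]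
    by (simp add: lborel_prod case_prod_unfold)
  also have "\<dots> \<le> (\<integral>\<^sup>+ u. ennreal c * B * (ennreal (cmod (f u)) * indicator V u) \<partial>lborel)"
  proof (rule nn_integral_mono)
    fix u
    have m1: "(\<lambda>t. g (u + phi \<rho> t) * indicator S t) \<in> borel_measurable lborel"
      unfolding measurable_lborel2 by (intro borel_measurable_times_ennreal measurable_compose[OF co1(3) g] iS)
    have "(\<integral>\<^sup>+ t. ennreal c * k u t \<partial>lborel) = ennreal c * (ennreal (cmod (f u)) * indicator V u * (\<integral>\<^sup>+ t. g (u + phi \<rho> t) * indicator S t \<partial>lborel))"
      unfolding k_def using m1 by (simp add: nn_integral_cmult mult.assoc)
    also have "\<dots> \<le> ennreal c * (ennreal (cmod (f u)) * indicator V u * B)" by (intro mult_left_mono B) simp_all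
    finally show "(\<integral>\<^sup>+ t. ennreal c * k u t \<partial>lborel) \<le> ennreal c * B * (ennreal (cmod (f u)) * indicator V u)" by (simp add: mult_ac)
  qed
  also have "\<dots> = ennreal c * B * (\<integral>\<^sup>+ u. ennreal (cmod (f u)) * indicator V u \<partial>lborel)"
    using fm iV by (intro nn_integral_cmult) (simp add: borel_measurable_times_ennreal)
  also have "\<dots> \<le> ennreal c * B * ennreal (G * 2)"
  proof (rule mult_left_mono, rule nn_integral_Cauchy_Schwarz_bound)
    have "(\<integral>\<^sup>+ x. (indicator V x)\<^sup>2 \<partial>lborel) = (\<integral>\<^sup>+ x. indicator V x \<partial>lborel)" by (rule nn_integral_cong) (simp add: indicator_def)
    then show "(\<integral>\<^sup>+ x. (indicator V x)\<^sup>2 \<partial>lborel) \<le> ennreal (2\<^sup>2)" using V4 Vs by simp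
    show "(\<integral>\<^sup>+ x. (ennreal (cmod (f x)))\<^sup>2 \<partial>lborel) \<le> ennreal (G\<^sup>2)" using f(2) by (simp add: ennreal_power)
  qed (use fm iV f(3) in simp_all)
  also have "\<dots> = ennreal (2 * c * G) * B" using c0 f(3) by (simp add: ennreal_mult mult_ac)
  finally show ?thesis .
qed

section \<open>The estimate\<close>

text \<open>No convergence is assumed: if the integrand on the left is not integrable, the left-hand
  side is 0 by convention; if the majorant is infinite, nothing is to be shown. In the remaining
  case the integrand with \<open>h\<close> is a difference of integrable functions.\<close>

lemma Tdil_split:
  assumes m: "f \<in> borel_measurable borel" "f' \<in> borel_measurable borel" "h \<in> borel_measurable borel" "r \<in> borel_measurable borel"
    and g: "\<And>v. ennreal (cmod (f' v - h v)) \<le> g v"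
  shows "ennreal (cmod (Tdil \<rho> r f f' x)) \<le> ennreal (cmod (Tdil \<rho> r f h x))
    + (\<integral>\<^sup>+ t. ennreal (cmod (f (x + Bd \<rho> t))) * g (x + P t) * ennreal (cmod (r t)) \<partial>lborel)"
proof -
  define a b where "a = (\<lambda>t. f (x + Bd \<rho> t) * f' (x + P t) * r t)" and "b = (\<lambda>t. f (x + Bd \<rho> t) * h (x + P t) * r t)"
  define I where "I = (\<integral>\<^sup>+ t. ennreal (cmod (f (x + Bd \<rho> t))) * g (x + P t) * ennreal (cmod (r t)) \<partial>lborel)"
  have co: "(\<lambda>t. x + Bd \<rho> t) \<in> borel_measurable borel" "(\<lambda>t. x + P t) \<in> borel_measurable borel"
    unfolding P_def Bd_def by (intro borel_measurable_continuous_onI continuous_intros)+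
  have am: "a \<in> borel_measurable borel" "b \<in> borel_measurable borel" unfolding a_def b_def
    by (intro borel_measurable_times measurable_compose[OF co(1) m(1)] measurable_compose[OF co(2) m(2)] measurable_compose[OF co(2) m(3)] m(4))+
  have le: "(\<integral>\<^sup>+ t. ennreal (cmod (a t - b t)) \<partial>lborel) \<le> I" unfolding I_def
  proof (rule nn_integral_mono)
    fix t
    have "a t - b t = f (x + Bd \<rho> t) * (f' (x + P t) - h (x + P t)) * r t" by (simp add: a_def b_def algebra_simps)
    then have "ennreal (cmod (a t - b t)) = ennreal (cmod (f (x + Bd \<rho> t))) * ennreal (cmod (f' (x + P t) - h (x + P t))) * ennreal (cmod (r t))"
      by (simp add: norm_mult ennreal_mult)
    also have "\<dots> \<le> ennreal (cmod (f (x + Bd \<rho> t))) * g (x + P t) * ennreal (cmod (r t))"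
      by (intro mult_right_mono mult_left_mono g) simp_all
    finally show "ennreal (cmod (a t - b t)) \<le> ennreal (cmod (f (x + Bd \<rho> t))) * g (x + P t) * ennreal (cmod (r t))" .
  qed
  have "ennreal (cmod (integral\<^sup>L lborel a)) \<le> ennreal (cmod (integral\<^sup>L lborel b)) + I"
  proof (cases "integrable lborel a \<and> I < \<infinity>")
    case True
    have d: "integrable lborel (\<lambda>t. a t - b t)"
      unfolding integrable_iff_bounded using am le True by (auto intro: le_less_trans)
    have "integrable lborel (\<lambda>t. a t - (a t - b t))" by (rule Bochner_Integration.integrable_diff[OF conjunct1[OF True] d])
    moreover have "(\<lambda>t. a t - (a t - b t)) = b" by (rule ext) (simp add: algebra_simps)
    ultimately have bi: "integrable lborel b" by simp
    have "integral\<^sup>L lborel a = integral\<^sup>L lborel b + (LINT t|lborel. a t - b t)"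
      using True bi by (simp add: Bochner_Integration.integral_diff)
    then have "cmod (integral\<^sup>L lborel a) \<le> cmod (integral\<^sup>L lborel b) + cmod (LINT t|lborel. a t - b t)"
      by (simp only: norm_triangle_ineq)
    then have "ennreal (cmod (integral\<^sup>L lborel a)) \<le> ennreal (cmod (integral\<^sup>L lborel b)) + ennreal (cmod (LINT t|lborel. a t - b t))"
      by (simp add: ennreal_plus[symmetric] ennreal_leI del: ennreal_plus)
    also have "ennreal (cmod (LINT t|lborel. a t - b t)) \<le> I" by (rule order_trans[OF norm_integral_le_nn_integral le])
    finally show ?thesis by (simp add: add_left_mono)
  next
    case False
    show ?thesis
    proof (cases "integrable lborel a")
      case True
      then have "I = \<infinity>" using False by (simp add: less_top[symmetric])
      then show ?thesis by simp
    qed (simp add: not_integrable_integral_eq)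
  qed
  then show ?thesis unfolding Tdil_def a_def b_def I_def .
qed

text \<open>Where the large part is nonzero, |f| > N, so that |f| \<le> |f|^2 / N; this converts the
  \<open>L\<^sup>2\<close> norm into an \<open>L\<^sup>1\<close> bound. The Gaussian mean is a
  contraction in \<open>L\<^sup>1\<close>, whence the factor 2. The identity regroups
  \<open>f = u + w\<close> around the mean of \<open>f\<close> itself.\<close>

lemma gconv_truncation:
  fixes f :: "vec \<Rightarrow> complex"
  assumes f: "in_L2 f" and N: "N > 0" and s: "s > 0"
    and u_def: "u = (\<lambda>v. if cmod (f v) \<le> N then f v else 0)" and w_def: "w = (\<lambda>v. if cmod (f v) \<le> N then 0 else f v)"
  shows "u \<in> borel_measurable borel" "w \<in> borel_measurable borel" "cmod (u v) \<le> N"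
    "f v - (u v - gconv s u v) = (w v - gconv s w v) + gconv s f v"
    "(\<integral>\<^sup>+ v. ennreal (cmod (w v - gconv s w v)) \<partial>lborel) \<le> ennreal (2 * (norm_L2 f)\<^sup>2 / N)"
proof -
  have fm: "f \<in> borel_measurable borel" using f by (simp add: in_L2_def)
  have mset: "{v \<in> space borel. cmod (f v) \<le> N} \<in> sets borel" using fm by measurable
  show um: "u \<in> borel_measurable borel" and wm: "w \<in> borel_measurable borel" unfolding u_def w_def
    using fm mset by (intro measurable_If; simp)+
  show "cmod (u v) \<le> N" using N by (simp add: u_def)
  have uN: "cmod (u v) \<le> N" for v using N by (simp add: u_def)
  have fuw: "f v = u v + w v" for v by (simp add: u_def w_def)
  note iu = gker_times_bounded_integrable[OF um s uN] and jf = gker_times_L2_integrable[OF f s]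
  have iw: "integrable lborel (\<lambda>y. of_real (gker s (v - y)) * w y)"
  proof -
    have "(\<lambda>y. of_real (gker s (v - y)) * w y) = (\<lambda>y. of_real (gker s (v - y)) * f y - of_real (gker s (v - y)) * u y)"
      by (simp add: fuw algebra_simps)
    then show ?thesis using Bochner_Integration.integrable_diff[OF jf[of v] iu[of v]] by simp
  qed
  have "gconv s f v = gconv s u v + gconv s w v"
    unfolding gconv_def using Bochner_Integration.integral_add[OF iu[of v] iw] by (simp add: fuw distrib_left)
  then show "f v - (u v - gconv s u v) = (w v - gconv s w v) + gconv s f v" by (simp add: fuw)
  have gm: "gconv s w \<in> borel_measurable borel" by (rule gconv_measurable[OF wm])
  have "(\<integral>\<^sup>+ v. ennreal (cmod (w v - gconv s w v)) \<partial>lborel) \<le> (\<integral>\<^sup>+ v. ennreal (cmod (w v)) + ennreal (cmod (gconv s w v)) \<partial>lborel)"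
  proof (rule nn_integral_mono)
    fix v show "ennreal (cmod (w v - gconv s w v)) \<le> ennreal (cmod (w v)) + ennreal (cmod (gconv s w v))"
      using norm_triangle_ineq4[of "w v" "gconv s w v"] by (simp add: ennreal_plus[symmetric] ennreal_leI del: ennreal_plus)
  qed
  also have "\<dots> = (\<integral>\<^sup>+ v. ennreal (cmod (w v)) \<partial>lborel) + (\<integral>\<^sup>+ v. ennreal (cmod (gconv s w v)) \<partial>lborel)"
    using wm gm by (intro nn_integral_add) simp_all
  also have "\<dots> \<le> (\<integral>\<^sup>+ v. ennreal (cmod (w v)) \<partial>lborel) + (\<integral>\<^sup>+ v. ennreal (cmod (w v)) \<partial>lborel)"
    by (intro add_left_mono gconv_L1[OF wm s])
  also have "(\<integral>\<^sup>+ v. ennreal (cmod (w v)) \<partial>lborel) \<le> ennreal ((norm_L2 f)\<^sup>2 / N)"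
  proof -
    have "(\<integral>\<^sup>+ v. ennreal (cmod (w v)) \<partial>lborel) \<le> (\<integral>\<^sup>+ v. ennreal (1 / N) * ennreal ((cmod (f v))\<^sup>2) \<partial>lborel)"
    proof (rule nn_integral_mono)
      fix v
      have "cmod (w v) \<le> 1 / N * (cmod (f v))\<^sup>2"
      proof (cases "cmod (f v) \<le> N")
        case False
        then have "N * cmod (f v) \<le> cmod (f v) * cmod (f v)" by (intro mult_right_mono) auto
        then show ?thesis using False N by (simp add: w_def field_simps power2_eq_square)
      qed (use N in \<open>simp add: w_def\<close>)
      then have "ennreal (cmod (w v)) \<le> ennreal (1 / N * (cmod (f v))\<^sup>2)" by (rule ennreal_leI)
      also have "\<dots> = ennreal (1 / N) * ennreal ((cmod (f v))\<^sup>2)" using N by (intro ennreal_mult) simp_all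
      finally show "ennreal (cmod (w v)) \<le> ennreal (1 / N) * ennreal ((cmod (f v))\<^sup>2)" .
    qed
    also have "\<dots> = ennreal (1 / N) * ennreal ((norm_L2 f)\<^sup>2)"
      using fm by (simp add: nn_integral_cmult nn_integral_norm_L2[OF f])
    also have "\<dots> = ennreal ((norm_L2 f)\<^sup>2 / N)" using N by (simp add: ennreal_mult[symmetric])
    finally show ?thesis .
  qed
  finally have "(\<integral>\<^sup>+ v. ennreal (cmod (w v - gconv s w v)) \<partial>lborel) \<le> ennreal ((norm_L2 f)\<^sup>2 / N) + ennreal ((norm_L2 f)\<^sup>2 / N)"
    by (meson add_mono order_refl order_trans)
  also have "\<dots> = ennreal (2 * (norm_L2 f)\<^sup>2 / N)" using N by (simp add: ennreal_plus[symmetric] del: ennreal_plus)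
  finally show "(\<integral>\<^sup>+ v. ennreal (cmod (w v - gconv s w v)) \<partial>lborel) \<le> ennreal (2 * (norm_L2 f)\<^sup>2 / N)" .
qed

text \<open>The left-hand side is the factor of \<open>gconv_high_frequency\<close> at s = 1/lam and
  decays exponentially. It is weakened to the rate of the other two terms.\<close>

lemma gaussian_tail_le:
  assumes lam: "lam \<ge> (1::real)"
  shows "exp (- pi * (1 / lam) * lam\<^sup>2 / 2) / sqrt (1 / lam) \<le> lam powr (- (1/1920))"
proof -
  have e: "- pi * (1 / lam) * lam\<^sup>2 / 2 = - (pi * lam / 2)" using lam by (simp add: power2_eq_square field_simps)
  have "exp (- (pi * lam / 2)) \<le> 1 / lam"
  proof -
    have "2 * lam \<le> pi * lam" using pi_ge_two lam by (intro mult_right_mono) auto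
    then have "lam \<le> exp (pi * lam / 2)" using exp_ge_add_one_self[of "pi * lam / 2"] by linarith
    then show ?thesis using lam by (simp add: exp_minus inverse_eq_divide frac_le)
  qed
  then have "exp (- pi * (1 / lam) * lam\<^sup>2 / 2) / sqrt (1 / lam) \<le> (1 / lam) / sqrt (1 / lam)"
    unfolding e using lam by (intro divide_right_mono) auto
  also have "\<dots> = sqrt (1 / lam)" by (rule real_div_sqrt) (use lam in simp)
  also have "\<dots> = lam powr (- (1/2))" using lam by (simp add: powr_minus powr_half_sqrt real_sqrt_divide inverse_eq_divide)
  also have "\<dots> \<le> lam powr (- (1/1920))" using lam by (intro powr_mono) auto
  finally show ?thesis .
qed

text \<open>With eps = lam^(-1/8) the first term is lam^(-1/4) and the second is lam^(-1/240), which
  dominates. It is written as an eighth power because a fourth root will be taken, leaving a square,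
  and one of the two remaining factors pays for the truncation height.\<close>

lemma scale_choice:
  assumes lam: "lam \<ge> (1::real)"
  shows "sqrt (1 / lam) / (lam powr (- (1/8)))\<^sup>2 + root 30 (lam powr (- (1/8))) \<le> 2 * (lam powr (- (1/1920))) ^ 8"
proof -
  have w8: "(lam powr (- (1/1920))) ^ 8 = lam powr (- (1/240))" using lam by (simp add: powr_power)
  have "root 30 (lam powr (- (1/8))) = lam powr (- (1/240))"
    using lam by (simp add: root_powr_inverse powr_powr)
  moreover have "sqrt (1 / lam) / (lam powr (- (1/8)))\<^sup>2 \<le> lam powr (- (1/240))"
  proof -
    have "sqrt (1 / lam) = lam powr (- (1/2))" using lam by (simp add: powr_minus powr_half_sqrt real_sqrt_divide inverse_eq_divide)
    moreover have "(lam powr (- (1/8)))\<^sup>2 = lam powr (- (1/4))" using lam by (simp add: powr_power)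
    ultimately have "sqrt (1 / lam) / (lam powr (- (1/8)))\<^sup>2 = lam powr (- (1/4))" using lam by (simp add: powr_diff[symmetric])
    then show ?thesis using lam by (simp add: powr_mono)
  qed
  ultimately show ?thesis unfolding w8 by linarith
qed

text \<open>\<open>G\<close> and \<open>F\<close> are positive upper bounds in place of the norms
  themselves, because the weights in \<open>Tdil_box_estimate\<close> divide by \<open>G\<close> and
  the truncation height must be positive.\<close>

lemma Tdil_estimate:
  "\<exists>D>0. \<forall>lam \<rho> A c r f\<^sub>1 f\<^sub>2 g\<^sub>2 G F. lam \<ge> 1 \<and> 0 \<le> \<rho> \<and> \<rho> \<le> 1 \<and> cutoff c A r \<and> (\<forall>t. r t \<noteq> 0 \<longrightarrow> inverse A \<le> \<bar>jacobian \<rho> t\<bar>) \<and>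
     in_L2 f\<^sub>1 \<and> f\<^sub>2 has_fourier_transform g\<^sub>2 \<and> ess_support g\<^sub>2 \<inter> ball 0 lam = {} \<and>
     norm_L2 f\<^sub>1 \<le> G \<and> norm_L2 f\<^sub>2 \<le> F \<and> 0 < G \<and> 0 < F \<longrightarrow>
     (\<integral>\<^sup>+ x \<in> unit_square. ennreal (cmod (Tdil \<rho> r f\<^sub>1 f\<^sub>2 x)) \<partial>lborel) \<le> ennreal (D * c * A ^ 4 * lam powr (- (1/1920)) * G * F)"
proof -
  obtain K where K1: "K \<ge> 1" and K': "\<forall>\<rho> c A r N eps s f. cutoff c A r \<and> 0 \<le> \<rho> \<and> \<rho> \<le> 1 \<and> 0 < eps \<and> eps \<le> 1 \<and> 0 < N \<and> 0 < s \<and>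
     f \<in> borel_measurable borel \<and> (\<forall>v. cmod (f v) \<le> N) \<longrightarrow>
     cmod (LINT X|lborel. quad \<rho> r (\<lambda>X. f (pX1 X) - gconv s f (pX1 X)) (\<lambda>v. cnj (f v - gconv s f v)) (\<lambda>v. cnj (f v - gconv s f v)) (\<lambda>v. f v - gconv s f v) X)
       \<le> K * c ^ 4 * A * N ^ 4 * (sqrt s / eps\<^sup>2 + root 30 eps)"
    using box_bound by (elim exE conjE) (rule that)
  define q where "q = measure lborel (cball 0 10 :: vec set)"
  define K2 :: real where "K2 = 576 * 61\<^sup>2"
  define D where "D = (q + 2) * K + 2 * (2 * K2 + 1)"
  have q0: "q \<ge> 0" by (simp add: q_def)
  have D0: "D > 0" using q0 K1 by (simp add: D_def K2_def add_nonneg_pos)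
  show ?thesis
  proof (intro exI[of _ D] conjI D0 allI impI, elim conjE)
    fix lam \<rho> A c G F :: real and r f\<^sub>1 f\<^sub>2 g\<^sub>2 :: "vec \<Rightarrow> complex"
    assume lam: "lam \<ge> 1" and rho: "0 \<le> \<rho>" "\<rho> \<le> 1" and r: "cutoff c A r" and jac: "\<forall>t. r t \<noteq> 0 \<longrightarrow> inverse A \<le> \<bar>jacobian \<rho> t\<bar>"
      and f1: "in_L2 f\<^sub>1" and f2: "f\<^sub>2 has_fourier_transform g\<^sub>2" and supp: "ess_support g\<^sub>2 \<inter> ball 0 lam = {}"
      and G: "norm_L2 f\<^sub>1 \<le> G" "0 < G" and F: "norm_L2 f\<^sub>2 \<le> F" "0 < F"
    have f2L: "in_L2 f\<^sub>2" using f2 by (simp add: has_fourier_transform_def)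
    have fm: "f\<^sub>1 \<in> borel_measurable borel" "f\<^sub>2 \<in> borel_measurable borel" using f1 f2L by (simp_all add: in_L2_def)
    have rm: "r \<in> borel_measurable borel" by (rule C1_measurable[OF cutoffD(1)[OF r]])
    have cA: "c \<ge> 1" "A \<ge> 1" by (rule cutoffD[OF r])+
    have nn: "0 \<le> norm_L2 f\<^sub>1" "0 \<le> norm_L2 f\<^sub>2" by (simp_all add: norm_L2_def)
    define w where "w = lam powr (- (1/1920))"
    define s where "s = 1 / lam"
    define eps where "eps = lam powr (- (1/8))"
    \<comment> \<open>The bounded part contributes N w^2 and the large part has
      \<open>L\<^sup>1\<close> norm at most 2F^2 / N; this choice makes both of order w F.\<close>
    define N where "N = F / w"
    have w: "0 < w" using lam by (simp add: w_def)
    have s: "0 < s" using lam by (simp add: s_def)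
    have "lam powr (- (1/8)) \<le> lam powr 0" using lam by (intro powr_mono) auto
    then have eps: "0 < eps" "eps \<le> 1" using lam by (simp_all add: eps_def)
    have N: "0 < N" using F w by (simp add: N_def)
    define u where "u = (\<lambda>v. if cmod (f\<^sub>2 v) \<le> N then f\<^sub>2 v else 0)"
    define z where "z = (\<lambda>v. if cmod (f\<^sub>2 v) \<le> N then 0 else f\<^sub>2 v)"
    note tr = gconv_truncation[OF f2L N s u_def z_def]
    define h where "h = (\<lambda>v. u v - gconv s u v)"
    define e where "e = (\<lambda>v. z v - gconv s z v)"
    have hm: "h \<in> borel_measurable borel" unfolding h_def by (intro borel_measurable_diff tr gconv_measurable)
    have em: "e \<in> borel_measurable borel" unfolding e_def by (intro borel_measurable_diff tr gconv_measurable)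
    have hb: "cmod (h v) \<le> N + N" for v
      unfolding h_def by (rule order_trans[OF norm_triangle_ineq4]) (intro add_mono tr(3) gconv_bound[OF tr(1) s])
    have fG: "(\<integral>\<^sup>+ x. ennreal ((cmod (f\<^sub>1 x))\<^sup>2) \<partial>lborel) \<le> ennreal (G\<^sup>2)"
      unfolding nn_integral_norm_L2[OF f1] by (intro ennreal_leI power_mono G nn)
    \<comment> \<open>An upper bound for the fourth root of the form. The factors
      \<open>2 * K\<close> and \<open>A\<close>, which occur there to the first power, are enlarged
      to fourth powers so that the root is explicit.\<close>
    define j where "j = 2 * K * c * A * N * w\<^sup>2"
    have j: "0 < j" unfolding j_def using K1 cA N w by (intro mult_pos_pos) auto
    have J: "cmod (LINT X|lborel. quad \<rho> r (\<lambda>X. h (pX1 X)) (\<lambda>v. cnj (h v)) (\<lambda>v. cnj (h v)) h X) \<le> j ^ 4"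
    proof -
      have "cmod (LINT X|lborel. quad \<rho> r (\<lambda>X. h (pX1 X)) (\<lambda>v. cnj (h v)) (\<lambda>v. cnj (h v)) h X)
        \<le> K * c ^ 4 * A * N ^ 4 * (sqrt s / eps\<^sup>2 + root 30 eps)"
        unfolding h_def by (rule K'[rule_format]) (intro conjI allI r rho eps N s tr(1) tr(3))
      also have "\<dots> \<le> K * c ^ 4 * A * N ^ 4 * (2 * w ^ 8)"
        unfolding s_def eps_def w_def using K1 cA N by (intro mult_left_mono scale_choice[OF lam]) auto
      also have "\<dots> = (2 * K) * A * (c ^ 4 * N ^ 4 * w ^ 8)" by (simp only: mult_ac)
      also have "\<dots> \<le> (2 * K) ^ 4 * A ^ 4 * (c ^ 4 * N ^ 4 * w ^ 8)"
      proof (intro mult_right_mono mult_mono)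
        show "2 * K \<le> (2 * K) ^ 4" "A \<le> A ^ 4" using self_le_power[of "2 * K" 4] self_le_power[of A 4] K1 cA by simp_all
      qed (use K1 cA N w in auto)
      also have "\<dots> = j ^ 4" by (simp add: j_def power_mult_distrib power_mult[symmetric] mult_ac)
      finally show ?thesis .
    qed
    have T1: "(\<integral>\<^sup>+ x. ennreal (cmod (Tdil \<rho> r f\<^sub>1 h x)) * indicator unit_square x \<partial>lborel) \<le> ennreal ((q / 2 + 1) * G * j)"
      using Tdil_box_estimate[OF r rho fm(1) hm hb fG G(2) J] j unfolding q_def by (simp add: real_root_power_cancel)
    \<comment> \<open>Majorant of the difference between \<open>f\<^sub>2\<close> and
      \<open>h\<close>: the part from large values, small in \<open>L\<^sup>1\<close>, plus a
      constant bounding the Gaussian mean of \<open>f\<^sub>2\<close>.\<close>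
    define g where "g = (\<lambda>v. ennreal (cmod (e v)) + ennreal (w * F))"
    have gm: "g \<in> borel_measurable borel" unfolding g_def using em by simp
    have gc: "cmod (gconv s f\<^sub>2 v) \<le> w * F" for v
    proof -
      have "cmod (gconv s f\<^sub>2 v) \<le> exp (- pi * s * lam\<^sup>2 / 2) / sqrt s * norm_L2 f\<^sub>2"
        using lam by (intro gconv_high_frequency[OF f2 supp s]) simp
      also have "\<dots> \<le> w * F" unfolding s_def w_def using gaussian_tail_le[OF lam] F nn by (intro mult_mono) auto
      finally show ?thesis .
    qed
    have gb: "ennreal (cmod (f\<^sub>2 v - h v)) \<le> g v" for v
    proof -
      have "cmod (f\<^sub>2 v - h v) \<le> cmod (e v) + w * F"
        unfolding h_def tr(4) e_def[symmetric]
        using norm_triangle_ineq[of "z v - gconv s z v" "gconv s f\<^sub>2 v"] gc[of v] by (simp add: e_def)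
      then have "ennreal (cmod (f\<^sub>2 v - h v)) \<le> ennreal (cmod (e v) + w * F)" by (rule ennreal_leI)
      then show ?thesis using w F by (simp add: g_def)
    qed
    define S where "S = {t. r t \<noteq> 0}"
    have Sm: "S \<in> sets borel" using measurable_sets[OF rm, of "- {0}"] unfolding S_def by (simp add: vimage_def)
    have SU: "t \<in> unit_square \<and> inverse A \<le> \<bar>jacobian \<rho> t\<bar>" if "t \<in> S" for t
      using cutoffD(6)[OF r, of t] jac[rule_format, of t] that by (simp add: S_def mem_Times_iff)
    define B where "B = (2 * K2 * A ^ 4 + 1) * (w * F)"
    have Bb: "(\<integral>\<^sup>+ t. g (v + phi \<rho> t) * indicator S t \<partial>lborel) \<le> ennreal B" for v
    proof -
      have co: "(\<lambda>t. v + phi \<rho> t) \<in> borel_measurable borel"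
        unfolding phi_def P_def Bd_def by (intro borel_measurable_continuous_onI continuous_intros)
      have em': "(\<lambda>x. ennreal (cmod (e x))) \<in> borel_measurable borel" using em by simp
      have iS: "(indicator S :: vec \<Rightarrow> ennreal) \<in> borel_measurable borel" using Sm by (rule borel_measurable_indicator)
      have "(\<integral>\<^sup>+ t. g (v + phi \<rho> t) * indicator S t \<partial>lborel)
        = (\<integral>\<^sup>+ t. ennreal (cmod (e (v + phi \<rho> t))) * indicator S t \<partial>lborel) + (\<integral>\<^sup>+ t. ennreal (w * F) * indicator S t \<partial>lborel)"
        unfolding g_def distrib_right using measurable_compose[OF co em'] iS
        by (intro nn_integral_add) (simp_all add: borel_measurable_times_ennreal)
      also have "\<dots> \<le> ennreal (K2 * A ^ 4) * (\<integral>\<^sup>+ x. ennreal (cmod (e x)) \<partial>lborel) + ennreal (w * F) * emeasure lborel unit_square"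
      proof (rule add_mono)
        show "(\<integral>\<^sup>+ t. ennreal (cmod (e (v + phi \<rho> t))) * indicator S t \<partial>lborel) \<le> ennreal (K2 * A ^ 4) * (\<integral>\<^sup>+ x. ennreal (cmod (e x)) \<partial>lborel)"
          unfolding K2_def by (rule phi_pushforward[OF rho cA(2) Sm SU em'])
        have "(\<integral>\<^sup>+ t. ennreal (w * F) * indicator S t \<partial>lborel) = ennreal (w * F) * emeasure lborel S" using Sm by (simp add: nn_integral_cmult_indicator)
        also have "\<dots> \<le> ennreal (w * F) * emeasure lborel unit_square"
          by (intro mult_left_mono emeasure_mono) (use SU vec_box_sets in auto)
        finally show "(\<integral>\<^sup>+ t. ennreal (w * F) * indicator S t \<partial>lborel) \<le> ennreal (w * F) * emeasure lborel unit_square" .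
      qed
      also have "\<dots> \<le> ennreal (K2 * A ^ 4) * ennreal (2 * w * F) + ennreal (w * F)"
      proof (rule add_mono)
        have "(\<integral>\<^sup>+ x. ennreal (cmod (e x)) \<partial>lborel) \<le> ennreal (2 * (norm_L2 f\<^sub>2)\<^sup>2 / N)" unfolding e_def by (rule tr(5))
        also have "\<dots> \<le> ennreal (2 * w * F)"
        proof (rule ennreal_leI)
          have "2 * (norm_L2 f\<^sub>2)\<^sup>2 / N \<le> 2 * F\<^sup>2 / N" using F nn N by (intro divide_right_mono mult_left_mono power_mono) auto
          also have "\<dots> = 2 * w * F" using F w by (simp add: N_def power2_eq_square)
          finally show "2 * (norm_L2 f\<^sub>2)\<^sup>2 / N \<le> 2 * w * F" .
        qed
        finally show "ennreal (K2 * A ^ 4) * (\<integral>\<^sup>+ x. ennreal (cmod (e x)) \<partial>lborel) \<le> ennreal (K2 * A ^ 4) * ennreal (2 * w * F)"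
          by (rule mult_left_mono) simp
        show "ennreal (w * F) * emeasure lborel unit_square \<le> ennreal (w * F)" using emeasure_vec_box[of 0 1 0 1] by simp
      qed
      also have "\<dots> = ennreal (K2 * A ^ 4 * (2 * w * F) + w * F)"
        using w F cA by (simp add: ennreal_mult[symmetric] K2_def)
      also have "K2 * A ^ 4 * (2 * w * F) + w * F = B" by (simp add: B_def algebra_simps)
      finally show ?thesis .
    qed
    have SU2: "S \<subseteq> unit_square" using SU by blast
    have r0: "r t = 0" if "t \<notin> S" for t using that by (simp add: S_def)
    define Q where "Q = (\<lambda>x. \<integral>\<^sup>+ t. ennreal (cmod (f\<^sub>1 (x + Bd \<rho> t))) * g (x + P t) * ennreal (cmod (r t)) \<partial>lborel)"
    have T2: "(\<integral>\<^sup>+ x. Q x * indicator unit_square x \<partial>lborel) \<le> ennreal (2 * c * G) * ennreal B"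
      unfolding Q_def by (rule bilinear_L1_bound[OF rho fm(1) fG less_imp_le[OF G(2)] gm Sm SU2 rm cutoffD(4)[OF r] r0 Bb])
    have Tm: "(\<lambda>x. ennreal (cmod (Tdil \<rho> r f\<^sub>1 h x)) * indicator unit_square x) \<in> borel_measurable lborel"
    proof -
      have "(\<lambda>x. ennreal (cmod (Tdil \<rho> r f\<^sub>1 h x))) \<in> borel_measurable borel" using Tdil_measurable[OF fm(1) hm rm] by simp
      then show ?thesis unfolding measurable_lborel2 by (intro borel_measurable_times_ennreal borel_measurable_indicator vec_box_sets)
    qed
    have Qm: "(\<lambda>x. Q x * indicator unit_square x) \<in> borel_measurable lborel"
    proof -
      have co: "(\<lambda>p::vec \<times> vec. fst p + Bd \<rho> (snd p)) \<in> borel_measurable borel" "(\<lambda>p::vec \<times> vec. fst p + P (snd p)) \<in> borel_measurable borel"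
        "(\<lambda>p::vec \<times> vec. snd p) \<in> borel_measurable borel"
        unfolding P_def Bd_def by (intro borel_measurable_continuous_onI continuous_intros)+
      have m: "(\<lambda>x. ennreal (cmod (f\<^sub>1 x))) \<in> borel_measurable borel" "(\<lambda>x. ennreal (cmod (r x))) \<in> borel_measurable borel" using fm rm by simp_all
      have "(\<lambda>(x, t). ennreal (cmod (f\<^sub>1 (x + Bd \<rho> t))) * g (x + P t) * ennreal (cmod (r t))) \<in> borel_measurable ((lborel :: vec measure) \<Otimes>\<^sub>M lborel)"
        unfolding lborel_prod case_prod_unfold measurable_lborel2
        by (intro borel_measurable_times_ennreal measurable_compose[OF co(1) m(1)] measurable_compose[OF co(2) gm] measurable_compose[OF co(3) m(2)])
      from lborel.borel_measurable_nn_integral[OF this] have "Q \<in> borel_measurable borel" unfolding Q_def by simp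
      then show ?thesis unfolding measurable_lborel2 by (intro borel_measurable_times_ennreal borel_measurable_indicator vec_box_sets)
    qed
    have "(\<integral>\<^sup>+ x \<in> unit_square. ennreal (cmod (Tdil \<rho> r f\<^sub>1 f\<^sub>2 x)) \<partial>lborel)
      \<le> (\<integral>\<^sup>+ x. ennreal (cmod (Tdil \<rho> r f\<^sub>1 h x)) * indicator unit_square x + Q x * indicator unit_square x \<partial>lborel)"
    proof (rule nn_integral_mono)
      fix x
      show "ennreal (cmod (Tdil \<rho> r f\<^sub>1 f\<^sub>2 x)) * indicator unit_square x \<le> ennreal (cmod (Tdil \<rho> r f\<^sub>1 h x)) * indicator unit_square x + Q x * indicator unit_square x"
        unfolding distrib_right[symmetric] Q_def by (rule mult_right_mono[OF Tdil_split[OF fm hm rm gb]]) simp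
    qed
    also have "\<dots> = (\<integral>\<^sup>+ x. ennreal (cmod (Tdil \<rho> r f\<^sub>1 h x)) * indicator unit_square x \<partial>lborel) + (\<integral>\<^sup>+ x. Q x * indicator unit_square x \<partial>lborel)"
      by (rule nn_integral_add[OF Tm Qm])
    also have "\<dots> \<le> ennreal ((q / 2 + 1) * G * j) + ennreal (2 * c * G) * ennreal B" by (rule add_mono[OF T1 T2])
    also have "\<dots> = ennreal ((q / 2 + 1) * G * j + 2 * c * G * B)"
    proof -
      have "0 \<le> (q / 2 + 1) * G * j" using q0 G(2) j by (intro mult_nonneg_nonneg) auto
      moreover have "0 \<le> B" unfolding B_def K2_def using w F cA by (intro mult_nonneg_nonneg add_nonneg_nonneg) auto
      moreover have "0 \<le> 2 * c * G" using cA G by simp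
      ultimately show ?thesis by (simp add: ennreal_mult)
    qed
    also have "\<dots> \<le> ennreal (D * c * A ^ 4 * w * G * F)"
    proof (rule ennreal_leI)
      have A4: "A \<le> A ^ 4" "1 \<le> A ^ 4" using self_le_power[of A 4] cA by auto
      have p: "0 \<le> c * w * G * F" using cA w G F by simp
      have "(q / 2 + 1) * G * j = (q + 2) * K * A * (c * w * G * F)"
        unfolding j_def N_def using w by (simp add: power2_eq_square field_simps)
      also have "\<dots> \<le> (q + 2) * K * A ^ 4 * (c * w * G * F)"
        using q0 K1 A4 by (intro mult_right_mono[OF _ p] mult_left_mono mult_nonneg_nonneg) auto
      finally have 1: "(q / 2 + 1) * G * j \<le> (q + 2) * K * A ^ 4 * (c * w * G * F)" .
      have "2 * c * G * B = 2 * (2 * K2 * A ^ 4 + 1) * (c * w * G * F)" by (simp add: B_def)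
      also have "\<dots> \<le> 2 * (2 * K2 * A ^ 4 + A ^ 4) * (c * w * G * F)"
        using A4 p by (intro mult_right_mono mult_left_mono add_left_mono) auto
      finally have 2: "2 * c * G * B \<le> 2 * (2 * K2 * A ^ 4 + A ^ 4) * (c * w * G * F)" .
      have "(q + 2) * K * A ^ 4 * (c * w * G * F) + 2 * (2 * K2 * A ^ 4 + A ^ 4) * (c * w * G * F) = D * c * A ^ 4 * w * G * F"
        by (simp add: D_def algebra_simps)
      then show "(q / 2 + 1) * G * j + 2 * c * G * B \<le> D * c * A ^ 4 * w * G * F" using 1 2 by linarith
    qed
    finally show "(\<integral>\<^sup>+ x \<in> unit_square. ennreal (cmod (Tdil \<rho> r f\<^sub>1 f\<^sub>2 x)) \<partial>lborel) \<le> ennreal (D * c * A ^ 4 * lam powr (- (1/1920)) * G * F)"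
      unfolding w_def .
  qed
qed

text \<open>The derivative in a general direction is the combination of the two partial derivatives,
  with coefficients at most \<open>norm v\<close>. Absolute values are taken in the constant because
  the family \<open>C\<close> consists of arbitrary reals, while \<open>cutoff\<close> asks for a
  constant of at least 1.\<close>

lemma smooth_cutoff:
  fixes r :: "vec \<Rightarrow> complex"
  assumes sm: "smooth r" and A: "A \<ge> 1" and supp: "support r \<subseteq> unit_square"
    and b: "\<And>\<alpha> t. cmod (multideriv \<alpha> r t) \<le> C \<alpha> * A ^ (fst \<alpha> + snd \<alpha>)"
  shows "cutoff (1 + \<bar>C (0, 0)\<bar> + \<bar>C (1, 0)\<bar> + \<bar>C (0, 1)\<bar>) A r"
proof -
  define c where "c = 1 + \<bar>C (0, 0)\<bar> + \<bar>C (1, 0)\<bar> + \<bar>C (0, 1)\<bar>"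
  have k: "(\<forall>x. r differentiable at x) \<and> (\<forall>b\<in>Basis. continuous_on UNIV (dirderiv b r))"
    using sm[unfolded smooth_def, rule_format, of 1] by simp
  have df: "r differentiable at x" for x by (rule spec[OF conjunct1[OF k]])
  have bas: "(1, 0) \<in> (Basis :: vec set)" "(0, 1) \<in> (Basis :: vec set)" by (simp_all add: Basis_prod_def)
  have ct: "continuous_on UNIV (\<lambda>t. fd r t (1, 0))" "continuous_on UNIV (\<lambda>t. fd r t (0, 1))"
    using bspec[OF conjunct2[OF k] bas(1)] bspec[OF conjunct2[OF k] bas(2)] unfolding dirderiv_def .
  have ex: "fd r t v = fst v *\<^sub>R fd r t (1, 0) + snd v *\<^sub>R fd r t (0, 1)" for t v
  proof -
    have l: "linear (fd r t)" using df by (rule linear_frechet_derivative)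
    have "v = fst v *\<^sub>R (1, 0) + snd v *\<^sub>R (0, 1)" by (simp add: prod_eq_iff)
    then have "fd r t v = fd r t (fst v *\<^sub>R (1, 0) + snd v *\<^sub>R (0, 1))" by simp
    then show ?thesis by (simp only: linear_add[OF l] linear_scale[OF l])
  qed
  have C1: "C1 r" unfolding C1_def
  proof (intro conjI allI df)
    fix v show "continuous_on UNIV (\<lambda>t. fd r t v)" unfolding ex[of _ v] by (intro continuous_intros ct)
  qed
  have r0: "cmod (r t) \<le> c" for t using b[of "(0, 0)" t] by (simp add: multideriv_def c_def)
  have Cc: "C (1, 0) * A + C (0, 1) * A \<le> c * A" unfolding c_def distrib_right[symmetric] using A by (intro mult_right_mono) auto
  have fb: "cmod (fd r t v) \<le> c * A * norm v" for t v
  proof -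
    have 1: "cmod (fd r t (1, 0)) \<le> C (1, 0) * A" using b[of "(1, 0)" t] by (simp add: multideriv_def dirderiv_def)
    have 2: "cmod (fd r t (0, 1)) \<le> C (0, 1) * A" using b[of "(0, 1)" t] by (simp add: multideriv_def dirderiv_def)
    have "cmod (fd r t v) \<le> \<bar>fst v\<bar> * cmod (fd r t (1, 0)) + \<bar>snd v\<bar> * cmod (fd r t (0, 1))"
      unfolding ex[of t v] by (rule order_trans[OF norm_triangle_ineq]) simp
    also have "\<dots> \<le> norm v * (C (1, 0) * A) + norm v * (C (0, 1) * A)"
      using 1 2 norm_fst_le_norm[of v] norm_snd_le_norm[of v] by (intro add_mono mult_mono) auto
    also have "\<dots> = norm v * (C (1, 0) * A + C (0, 1) * A)" by (simp add: distrib_left)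
    also have "\<dots> \<le> norm v * (c * A)" by (intro mult_left_mono Cc) simp
    finally show ?thesis by (simp add: mult_ac)
  qed
  have st: "0 \<le> fst t \<and> fst t \<le> 1 \<and> 0 \<le> snd t \<and> snd t \<le> 1" if "r t \<noteq> 0" for t
  proof -
    have "t \<in> support r" unfolding support_def by (rule subsetD[OF closure_subset]) (simp add: that)
    then have "t \<in> unit_square" by (rule subsetD[OF supp])
    then show ?thesis by (simp add: mem_Times_iff)
  qed
  show ?thesis unfolding c_def[symmetric] cutoff_def
    using C1 A r0 fb st by (simp add: c_def)
qed

text \<open>Removes the positivity assumed in \<open>Tdil_estimate\<close>: the norms enlarged by
  \<delta> are positive, and letting \<delta> tend to 0 covers functions of norm 0 as well.\<close>

lemma le_ennreal_limit:
  assumes "\<And>\<delta>. \<delta> > 0 \<Longrightarrow> X \<le> ennreal (a * (G + \<delta>) * (F + \<delta>))"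
  shows "X \<le> ennreal (a * G * F)"
proof (rule tendsto_lowerbound)
  have "((\<lambda>\<delta>. ennreal (a * (G + \<delta>) * (F + \<delta>))) \<longlongrightarrow> ennreal (a * (G + 0) * (F + 0))) (at_right 0)"
    by (intro tendsto_ennrealI tendsto_intros tendsto_ident_at)
  then show "((\<lambda>\<delta>. ennreal (a * (G + \<delta>) * (F + \<delta>))) \<longlongrightarrow> ennreal (a * G * F)) (at_right 0)" by simp
  show "\<forall>\<^sub>F \<delta> in at_right 0. X \<le> ennreal (a * (G + \<delta>) * (F + \<delta>))"
    using assms by (auto simp: eventually_at_filter)
qed simp

theorem theorem5:
  "\<exists>\<gamma>>0. \<exists>K>0. \<forall>C\<^sub>\<alpha> :: nat \<times> nat \<Rightarrow> real. \<exists>C>0.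
     \<forall>(lam::real) (R::real) (A::real) (r :: real \<times> real \<Rightarrow> complex).
       lam \<ge> 1 \<and> R \<ge> 1 \<and> A \<ge> 1 \<and> smooth r \<and> support r \<subseteq> {0..1} \<times> {0..1} \<and>
       (\<forall>(t\<^sub>1, t\<^sub>2) \<in> support r.
          \<bar>t\<^sub>1\<bar> > inverse A \<and> \<bar>t\<^sub>2\<bar> > inverse A \<and> \<bar>t\<^sub>1 - t\<^sub>2\<bar> > inverse A \<and>
          \<bar>jac R (t\<^sub>1, t\<^sub>2)\<bar> \<ge> inverse A) \<and>
       (\<forall>\<alpha> t. cmod (multideriv \<alpha> r t) \<le> C\<^sub>\<alpha> \<alpha> * A ^ (fst \<alpha> + snd \<alpha>)) \<longrightarrow>
       (\<forall>f\<^sub>1 f\<^sub>2 g\<^sub>2.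
          in_L2 f\<^sub>1 \<and> in_L2 f\<^sub>2 \<and> f\<^sub>2 has_fourier_transform g\<^sub>2 \<and>
          ess_support g\<^sub>2 \<subseteq> ball 0 (2 * lam) - ball 0 lam \<longrightarrow>
          (\<integral>\<^sup>+ x \<in> {0..1} \<times> {0..1}. ennreal (cmod (T R r f\<^sub>1 f\<^sub>2 x)) \<partial>lborel)
            \<le> ennreal (C * A powr K * lam powr (- \<gamma>) * norm_L2 f\<^sub>1 * norm_L2 f\<^sub>2))"
proof -
  obtain D where D: "D > 0" and D': "\<forall>lam \<rho> A c r f\<^sub>1 f\<^sub>2 g\<^sub>2 G F. lam \<ge> 1 \<and> 0 \<le> \<rho> \<and> \<rho> \<le> 1 \<and> cutoff c A r \<and> (\<forall>t. r t \<noteq> 0 \<longrightarrow> inverse A \<le> \<bar>jacobian \<rho> t\<bar>) \<and>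
     in_L2 f\<^sub>1 \<and> f\<^sub>2 has_fourier_transform g\<^sub>2 \<and> ess_support g\<^sub>2 \<inter> ball 0 lam = {} \<and>
     norm_L2 f\<^sub>1 \<le> G \<and> norm_L2 f\<^sub>2 \<le> F \<and> 0 < G \<and> 0 < F \<longrightarrow>
     (\<integral>\<^sup>+ x \<in> unit_square. ennreal (cmod (Tdil \<rho> r f\<^sub>1 f\<^sub>2 x)) \<partial>lborel) \<le> ennreal (D * c * A ^ 4 * lam powr (- (1/1920)) * G * F)"
    using Tdil_estimate by (elim exE conjE) (rule that)
  show ?thesis
  proof (rule exI[of _ "1/1920"], rule conjI, simp, rule exI[of _ 4], rule conjI, simp, rule allI)
    fix C\<^sub>\<alpha> :: "nat \<times> nat \<Rightarrow> real"
    define c where "c = 1 + \<bar>C\<^sub>\<alpha> (0, 0)\<bar> + \<bar>C\<^sub>\<alpha> (1, 0)\<bar> + \<bar>C\<^sub>\<alpha> (0, 1)\<bar>"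
    show "\<exists>C>0. \<forall>(lam::real) (R::real) (A::real) (r :: real \<times> real \<Rightarrow> complex).
       lam \<ge> 1 \<and> R \<ge> 1 \<and> A \<ge> 1 \<and> smooth r \<and> support r \<subseteq> {0..1} \<times> {0..1} \<and>
       (\<forall>(t\<^sub>1, t\<^sub>2) \<in> support r.
          \<bar>t\<^sub>1\<bar> > inverse A \<and> \<bar>t\<^sub>2\<bar> > inverse A \<and> \<bar>t\<^sub>1 - t\<^sub>2\<bar> > inverse A \<and>
          \<bar>jac R (t\<^sub>1, t\<^sub>2)\<bar> \<ge> inverse A) \<and>
       (\<forall>\<alpha> t. cmod (multideriv \<alpha> r t) \<le> C\<^sub>\<alpha> \<alpha> * A ^ (fst \<alpha> + snd \<alpha>)) \<longrightarrow>
       (\<forall>f\<^sub>1 f\<^sub>2 g\<^sub>2.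
          in_L2 f\<^sub>1 \<and> in_L2 f\<^sub>2 \<and> f\<^sub>2 has_fourier_transform g\<^sub>2 \<and>
          ess_support g\<^sub>2 \<subseteq> ball 0 (2 * lam) - ball 0 lam \<longrightarrow>
          (\<integral>\<^sup>+ x \<in> {0..1} \<times> {0..1}. ennreal (cmod (T R r f\<^sub>1 f\<^sub>2 x)) \<partial>lborel)
            \<le> ennreal (C * A powr 4 * lam powr (- (1/1920)) * norm_L2 f\<^sub>1 * norm_L2 f\<^sub>2))"
    \<comment> \<open>\<open>D\<close> is an absolute constant and \<open>c\<close> is built from
      the given family alone, so the product involves neither \<open>R\<close> nor \<open>A\<close>,
      \<open>lam\<close> or \<open>r\<close>.\<close>
    proof (intro exI[of _ "D * c"] conjI allI impI, goal_cases)
      case 1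
      show ?case using D by (simp add: c_def add_pos_nonneg)
    next
      case (2 lam R A r f\<^sub>1 f\<^sub>2 g\<^sub>2)
      have lam: "lam \<ge> 1" using 2(1) by (elim conjE)
      have R: "R \<ge> 1" using 2(1) by (elim conjE)
      have A: "A \<ge> 1" using 2(1) by (elim conjE)
      have sm: "smooth r" using 2(1) by (elim conjE)
      have supp: "support r \<subseteq> unit_square" using 2(1) by (elim conjE)
      have tr: "\<forall>(t\<^sub>1, t\<^sub>2) \<in> support r. \<bar>t\<^sub>1\<bar> > inverse A \<and> \<bar>t\<^sub>2\<bar> > inverse A \<and> \<bar>t\<^sub>1 - t\<^sub>2\<bar> > inverse A \<and> \<bar>jac R (t\<^sub>1, t\<^sub>2)\<bar> \<ge> inverse A"
        using 2(1) by (elim conjE)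
      have b: "\<forall>\<alpha> t. cmod (multideriv \<alpha> r t) \<le> C\<^sub>\<alpha> \<alpha> * A ^ (fst \<alpha> + snd \<alpha>)" using 2(1) by (elim conjE)
      have f1: "in_L2 f\<^sub>1" using 2(2) by (elim conjE)
      have f2: "f\<^sub>2 has_fourier_transform g\<^sub>2" using 2(2) by (elim conjE)
      have g2: "ess_support g\<^sub>2 \<subseteq> ball 0 (2 * lam) - ball 0 lam" using 2(2) by (elim conjE)
      have r: "cutoff c A r" unfolding c_def by (rule smooth_cutoff[OF sm A supp b[rule_format]])
      have rho: "0 \<le> 1 / R" "1 / R \<le> 1" using R by simp_all
      have jacobian_eq: "jacobian (1 / R) t = jac R t" for t
        by (simp add: jac_def jacobian_def det_2 power2_eq_square)
      have jac: "\<forall>t. r t \<noteq> 0 \<longrightarrow> inverse A \<le> \<bar>jacobian (1 / R) t\<bar>"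
      proof (intro allI impI)
        fix t assume "r t \<noteq> 0"
        then have t: "t \<in> support r" unfolding support_def by (intro subsetD[OF closure_subset]) simp
        show "inverse A \<le> \<bar>jacobian (1 / R) t\<bar>" unfolding jacobian_eq using bspec[OF tr t] by (cases t) simp
      qed
      have em: "ess_support g\<^sub>2 \<inter> ball 0 lam = {}" by (rule equals0I, elim IntE, drule subsetD[OF g2]) simp
      have "T R r f\<^sub>1 f\<^sub>2 = Tdil (1 / R) r f\<^sub>1 f\<^sub>2" by (rule ext) (simp add: T_def Tdil_def dil_eq_Bd)
      moreover have "(\<integral>\<^sup>+ x \<in> unit_square. ennreal (cmod (Tdil (1 / R) r f\<^sub>1 f\<^sub>2 x)) \<partial>lborel)
        \<le> ennreal (D * c * A ^ 4 * lam powr (- (1/1920)) * norm_L2 f\<^sub>1 * norm_L2 f\<^sub>2)"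
      proof (rule le_ennreal_limit)
        fix \<delta> :: real assume d: "\<delta> > 0"
        have nn: "0 \<le> norm_L2 f\<^sub>1" "0 \<le> norm_L2 f\<^sub>2" by (simp_all add: norm_L2_def)
        have d': "norm_L2 f\<^sub>1 \<le> norm_L2 f\<^sub>1 + \<delta>" "norm_L2 f\<^sub>2 \<le> norm_L2 f\<^sub>2 + \<delta>" "0 < norm_L2 f\<^sub>1 + \<delta>" "0 < norm_L2 f\<^sub>2 + \<delta>"
          using nn d by linarith+
        show "(\<integral>\<^sup>+ x \<in> unit_square. ennreal (cmod (Tdil (1 / R) r f\<^sub>1 f\<^sub>2 x)) \<partial>lborel)
          \<le> ennreal (D * c * A ^ 4 * lam powr (- (1/1920)) * (norm_L2 f\<^sub>1 + \<delta>) * (norm_L2 f\<^sub>2 + \<delta>))"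
          by (rule D'[rule_format, where g\<^sub>2 = g\<^sub>2]) (intro conjI lam rho r jac f1 f2 em d')
      qed
      ultimately show ?case using A by (simp add: powr_realpow)
    qed
  qed
qed

end
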